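(* Let $W\in C_b^{1,(2,2)}([0,T)\times M(\mathbb{R}))\cap C^0([0,T]\times M(\mathbb{R}))$. (i) Suppose that $$\frac{\partial W}{\partial t}(u,\lambda)+\int_{\mathbb{R}}\inf_{a\in A}\Big[L\tfrac{\delta W}{\delta\mu}(u,\lambda,\cdot)(x,\lambda,a)+\tfrac12\gamma(x,\lambda,a)\tfrac{\delta^2W}{\delta\mu^2}(u,\lambda,x,x)+f(x,\lambda,a)\Big]\lambda(dx)\ge0$$ for $(u,\lambda)\in[0,T)\times M(\mathbb{R})$, and $W(T,\lambda)\le g(\lambda)$ for $\lambda\in M(\mathbb{R})$. Then $W\le V$ on $[0,T]\times M(\mathbb{R})$. (ii) Suppose further that $W(T,\lambda)=g(\lambda)$ and that there exists a measurable function $\alpha^*:[0,T]\times M(\mathbb{R})\times\mathbb{R}\to A$ such that $$\begin{aligned}&L\tfrac{\delta W}{\delta\mu}(u,\lambda,\cdot)(x,\lambda,\alpha^*(u,\lambda,x))+\tfrac12\gamma(x,\lambda,\alpha^*(u,\lambda,x))\tfrac{\delta^2W}{\delta\mu^2}(u,\lambda,x,x)+f(x,\lambda,\alpha^*(u,\lambda,x))\\&=\inf_{a\in A}\Big[L\tfrac{\delta W}{\delta\mu}(u,\lambda,\cdot)(x,\lambda,a)+\tfrac12\gamma(x,\lambda,a)\tfrac{\delta^2W}{\delta\mu^2}(u,\lambda,x,x)+f(x,\lambda,a)\Big],\end{aligned}$$ and that for any $(t,\lambda)$ there exists some $\mathbb{P}\in\mathscr{P}_{t,\lambda}$ such that $$\mathbb{P}\big(m(du,dx,da)=du\,\mu_u(dx)\,\delta_{\alpha^*(u,\mu_u,x)}(da)\big)=1.$$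 Then $W=V$ and $\alpha^*$ is an optimal Markovian control.
   Context: **Measures.** $M(E)$ is the set of finite Borel measures on a Polish space $E$ with the weak topology; $\langle f,\mu\rangle=\int f\,d\mu$. The weak topology of $M(\mathbb{R})$ is induced by the distance $d(\mu,\lambda)=\big(\sum_{k\ge0}\frac{1}{2^kq_k}\langle\varphi_k,\mu-\lambda\rangle^2\big)^{1/2}$, $q_k=\max\{1,\|D\varphi_k\|_\infty^2,\|D^2\varphi_k\|_\infty^2\}$, where $(\varphi_k)_{k\ge0}\subset C_b^2(\mathbb{R})$ is a fixed sequence with $\varphi_0=1$, $\|\varphi_k\|_\infty\le1$, dense in $\{f\in C_b(\mathbb{R}):\|f\|_\infty\le1\}$. **Linear derivatives.** The linear derivative of $F:M(\mathbb{R})\to\mathbb{R}$ is a function $\frac{\delta F}{\delta\mu}:M(\mathbb{R})\times\mathbb{R}\to\mathbb{R}$ with $F(\mu)-F(\lambda)=\int_0^1\int_{\mathbb{R}}\frac{\delta F}{\delta\mu}(\lambda+t(\mu-\lambda),x)(\mu-\lambda)(dx)\,dt$ for all $\mu,\lambda$. $\frac{\delta^2F}{\delta\mu^2}(\mu,x,y)$ is the linear derivative, evaluated at $y$, of $\mu\mapsto\frac{\delta F}{\delta\mu}(\mu,x)$. $C_b^{m,n}(M(\mathbb{R}))$ is the set of functions with linear derivatives up to order $m$, bounded and continuous for the product topology, each $n$ times continuously differentiable in the spatial variables, with all these spatial derivatives bounded. $C_b^{1,(2,2)}$ is the time-dependent version: functions of $(t,\mu)$ that are $C^1$ in $t$ and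 $C_b^{2,2}$ in $\mu$, with derivatives continuous and bounded. **Coefficients.** $A\subset\mathbb{R}$ is compact; $(b,\sigma,\gamma):\mathbb{R}\times M(\mathbb{R})\times A\to\mathbb{R}\times\mathbb{R}\times\mathbb{R}^+$ are bounded, continuous, and Lipschitz in $(x,\lambda)$ uniformly in $a$. For $F,\varphi\in C_b^2(\mathbb{R})$: $F_\varphi(\lambda)=F(\langle\varphi,\lambda\rangle)$, $L\varphi(x,\lambda,a)=b(x,\lambda,a)\varphi'(x)+\frac12\sigma^2(x,\lambda,a)\varphi''(x)$, and $\mathscr{L}F_\varphi(x,\lambda,a)=F'(\langle\varphi,\lambda\rangle)L\varphi(x,\lambda,a)+\frac12F''(\langle\varphi,\lambda\rangle)\gamma(x,\lambda,a)\varphi^2(x)$. **Canonical space.** $D([0,T];M(\mathbb{R}))$ is the space of càdlàg paths. $\mathbb{M}\subset M([0,T]\times\mathbb{R}\times A)$ consists of measures whose projection on $[0,T]$ is Lebesgue measure. $\Omega=D([0,T];M(\mathbb{R}))\times\mathbb{M}$ with coordinate projections $(\mu,m)$; $\mathscr{F}_t$ is generated by $\mu_s$, $s\le t$, and $m([0,s]\times B_1\times A_1)$, $s\le t$, $B_1\in\mathscr{B}(\mathbb{R})$, $A_1\in\mathscr{B}(A)$. $\mathscr{P}(\Omega)$ is the set of probability measures on $\Omega$. **Weak control rules.** For $(t,\lambda)\in[0,T]\times D([0,T];M(\mathbb{R}))$, $\mathscr{P}_{t,\lambda}$ is the set of $\mathbb{P}\in\mathscr{P}(\Omega)$ such that (1)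 $\mathbb{P}(\mu_s=\lambda_s,\ 0\le s\le t)=1$; (2) $\mathbb{P}$-a.s. there is a Borel $\alpha:[0,T]\times\mathbb{R}\to A$ (possibly depending on $\omega$) with $m(ds,dx,da)=ds\,\mu_s(dx)\,\delta_{\alpha(s,x)}(da)$; (3) for all $F,\varphi\in C_b^2(\mathbb{R})$, $F_\varphi(\mu_s)-\int_t^s\int_{\mathbb{R}\times A}\mathscr{L}F_\varphi(x,\mu_u,a)\,m(du,dx,da)$, $t\le s\le T$, is a $(\mathbb{P},(\mathscr{F}_s))$-martingale. **Control problem.** $f:\mathbb{R}\times M(\mathbb{R})\times A\to\mathbb{R}$ and $g:M(\mathbb{R})\to\mathbb{R}$ are continuous with $|f(x,\lambda,a)|\le C(1+d(\lambda,0)^p)$ and $|g(\lambda)|\le C(1+d(\lambda,0)^p)$ for some $C,p>0$. $J(t,\lambda,\mathbb{P})=E^{\mathbb{P}}\big[\int_t^T\int_{\mathbb{R}\times A}f(x,\mu_u,a)\,m(du,dx,da)+g(\mu_T)\big]$ and $V(t,\lambda)=\inf_{\mathbb{P}\in\mathscr{P}_{t,\lambda}}J(t,\lambda,\mathbb{P})$. $V(t,\lambda)$ depends on the path $\lambda$ only through $\lambda_t$, so $V$ is regarded as a function on $[0,T]\times M(\mathbb{R})$ by $V(t,\lambda_t):=V(t,\lambda)$; for a measure $\lambda\in M(\mathbb{R})$, $\mathscr{P}_{t,\lambda}$ refers to a path with value $\lambda$ at time $t$. "Optimal Markovian control" means that a control rule $\mathbb{P}$ as in (ii), whose action at time $u$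 and position $x$ is $\alpha^*(u,\mu_u,x)$, attains $V(t,\lambda)$.
   Formalization: The Lebesgue projection of m forces unit mass, making (ii) vacuous; the theorem covers that space and the one without this constraint. For the latter, (ii) assumes the HJB relation with "= 0": with "≥ 0" it fails (zero coefficients and costs, W = t−T, V = 0). *)

theory Defs
  imports "HOL-Probability.Probability"
begin

section \<open>Finite Borel measures with the weak topology\<close>

typedef (overloaded) 'a finmeas =
    "{M :: 'a::topological_space measure. sets M = sets borel \<and> finite_measure M}"
  morphisms meas Abs_finmeas
proof
  show "null_measure borel \<in> {M :: 'a measure. sets M = sets borel \<and> finite_measure M}"
    by (auto intro!: finite_measureI)
qed

definition pairing :: "('a::topological_space \<Rightarrow> real) \<Rightarrow> 'a finmeas \<Rightarrow> real" where
  "pairing f \<mu> = (\<integral>x. f x \<partial>meas \<mu>)"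

text \<open>The coarsest topology making all pairings with bounded continuous functions continuous.\<close>

instantiation finmeas :: (topological_space) topological_space
begin

definition open_finmeas :: "'a finmeas set \<Rightarrow> bool" where
  "open_finmeas = generate_topology
     {{\<mu>. pairing f \<mu> \<in> V} | f V. continuous_on UNIV f \<and> bounded (range f) \<and> open V}"

instance
proof (standard, goal_cases)
  case 1 show ?case unfolding open_finmeas_def by (rule generate_topology.UNIV)
next
  case (2 S T) then show ?case unfolding open_finmeas_def by (rule generate_topology.Int)
next
  case (3 K) then show ?case unfolding open_finmeas_def by (auto intro: generate_topology.UN)
qed

end

instantiation finmeas :: (topological_space) zero
begin
definition zero_finmeas :: "'a finmeas" where "zero_finmeas = Abs_finmeas (null_measure borel)"
instance ..
end

text \<open>\<open>segment t \<nu> \<mu>\<close> is \<open>\<nu> + t(\<mu> - \<nu>)\<close>, which is a (nonnegative) measure for \<open>0 \<le> t \<le> 1\<close>.\<close>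

definition segment :: "real \<Rightarrow> 'a::topological_space finmeas \<Rightarrow> 'a finmeas \<Rightarrow> 'a finmeas" where
  "segment t \<nu> \<mu> = Abs_finmeas (measure_of UNIV (sets borel)
     (\<lambda>B. ennreal (1 - t) * emeasure (meas \<nu>) B + ennreal t * emeasure (meas \<mu>) B))"

lemma sets_meas [simp, measurable_cong]: "sets (meas \<mu>) = sets borel"
  using meas[of \<mu>] by auto

lemma space_meas [simp]: "space (meas \<mu>) = UNIV"
  using sets_eq_imp_space_eq[OF sets_meas, of \<mu>] by simp

lemma finite_measure_meas: "finite_measure (meas \<mu>)"
  using meas[of \<mu>] by auto

lemma meas_0 [simp]: "meas 0 = null_measure borel"
  unfolding zero_finmeas_def
  by (rule Abs_finmeas_inverse) (auto intro!: finite_measureI)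

lemma emeasure_segment:
  assumes t: "0 \<le> t" "t \<le> 1" and B: "B \<in> sets borel"
  shows "emeasure (meas (segment t \<nu> \<mu>)) B =
    ennreal (1 - t) * emeasure (meas \<nu>) B + ennreal t * emeasure (meas \<mu>) B"
proof -
  let ?e = "\<lambda>B. ennreal (1 - t) * emeasure (meas \<nu>) B + ennreal t * emeasure (meas \<mu>) B"
  let ?M = "measure_of UNIV (sets (borel :: 'a measure)) ?e"
  have sa: "sigma_algebra UNIV (sets (borel :: 'a measure))"
    using sets.sigma_algebra_axioms[of "borel :: 'a measure"] by simp
  have sM: "sets ?M = sets borel"
    using sigma_algebra.sets_measure_of_eq[OF sa] by simp
  have ca: "countably_additive (sets ?M) ?e"
    unfolding sM countably_additive_def
    by (auto simp: suminf_add[symmetric] suminf_emeasure ennreal_suminf_cmult)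
  have eM: "emeasure ?M B = ?e B" if "B \<in> sets borel" for B
    by (rule emeasure_measure_of[OF refl _ _ ca])
      (use sets.space_closed[of "borel :: 'a measure"] that sM in \<open>auto simp: positive_def\<close>)
  have "finite_measure ?M"
  proof (rule finite_measureI)
    have "space ?M = UNIV" using sets_eq_imp_space_eq[OF sM] by simp
    moreover have "?e UNIV \<noteq> \<infinity>"
      using finite_measure.emeasure_finite[OF finite_measure_meas, of \<nu> UNIV]
        finite_measure.emeasure_finite[OF finite_measure_meas, of \<mu> UNIV]
      by (simp add: ennreal_mult_eq_top_iff)
    ultimately show "emeasure ?M (space ?M) \<noteq> \<infinity>" using eM[of UNIV] by simp
  qed
  then have "meas (segment t \<nu> \<mu>) = ?M"
    unfolding segment_def by (intro Abs_finmeas_inverse) (use sM in auto)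
  then show ?thesis using eM[OF B] by simp
qed

lemma continuous_pairing:
  assumes "continuous_on UNIV f" "bounded (range f)"
  shows "continuous_on UNIV (pairing f)"
  unfolding continuous_on_open_vimage[OF open_UNIV]
  using assms by (auto simp: open_finmeas_def vimage_def intro!: generate_topology.Basis)

section \<open>Test functions and the distance on finite measures\<close>

definition bcont_on :: "'a::topological_space set \<Rightarrow> ('a \<Rightarrow> real) \<Rightarrow> bool" where
  "bcont_on S h \<longleftrightarrow> continuous_on S h \<and> bounded (h ` S)"

definition Cb2 :: "(real \<Rightarrow> real) \<Rightarrow> bool" where
  "Cb2 h \<longleftrightarrow> (\<forall>x. h field_differentiable at x) \<and> (\<forall>x. deriv h field_differentiable at x) \<and>
     bcont_on UNIV h \<and> bcont_on UNIV (deriv h) \<and> bcont_on UNIV (deriv (deriv h))"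

definition sup_norm :: "(real \<Rightarrow> real) \<Rightarrow> real" where
  "sup_norm h = (SUP x. \<bar>h x\<bar>)"

definition dist_weight :: "(real \<Rightarrow> real) \<Rightarrow> real" where
  "dist_weight h = max 1 (max ((sup_norm (deriv h))\<^sup>2) ((sup_norm (deriv (deriv h)))\<^sup>2))"

definition weak_dist :: "(nat \<Rightarrow> real \<Rightarrow> real) \<Rightarrow> real finmeas \<Rightarrow> real finmeas \<Rightarrow> real" where
  "weak_dist \<phi> \<mu> \<nu> =
     sqrt (\<Sum>k. 1 / (2 ^ k * dist_weight (\<phi> k)) * (pairing (\<phi> k) \<mu> - pairing (\<phi> k) \<nu>)\<^sup>2)"

text \<open>The bounded continuous functions on the real line are not separable for the supremum norm, so
  the density of the sequence is meant for uniform convergence on compact sets. This alone does not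
  make \<open>weak_dist \<phi>\<close> a metric for the weak topology, hence the last clause.\<close>

definition test_sequence :: "(nat \<Rightarrow> real \<Rightarrow> real) \<Rightarrow> bool" where
  "test_sequence \<phi> \<longleftrightarrow>
     (\<forall>k. Cb2 (\<phi> k)) \<and> \<phi> 0 = (\<lambda>_. 1) \<and> (\<forall>k x. \<bar>\<phi> k x\<bar> \<le> 1) \<and>
     (\<forall>h. continuous_on UNIV h \<and> (\<forall>x. \<bar>h x\<bar> \<le> 1) \<longrightarrow>
        (\<forall>K e. compact K \<and> e > 0 \<longrightarrow> (\<exists>k. \<forall>x\<in>K. \<bar>\<phi> k x - h x\<bar> < e))) \<and>
     (\<forall>U. open U \<longleftrightarrow> (\<forall>\<mu>\<in>U. \<exists>e>0. \<forall>\<nu>. weak_dist \<phi> \<mu> \<nu> < e \<longrightarrow> \<nu> \<in> U))"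

section \<open>Linear derivatives\<close>

text \<open>The integral against the signed measure \<open>\<mu> - \<nu>\<close> is the difference of the two integrals. The
  notion is only used with bounded continuous \<open>D\<close>, for which all integrals exist.\<close>

definition has_linear_derivative ::
    "(real finmeas \<Rightarrow> real) \<Rightarrow> (real finmeas \<Rightarrow> real \<Rightarrow> real) \<Rightarrow> bool" where
  "has_linear_derivative F D \<longleftrightarrow> (\<forall>\<mu> \<nu>. F \<mu> - F \<nu> =
     (LINT t:{0..1}|lborel. pairing (D (segment t \<nu> \<mu>)) \<mu> - pairing (D (segment t \<nu> \<mu>)) \<nu>))"

definition pd :: "(real \<Rightarrow> real finmeas \<Rightarrow> real \<Rightarrow> real) \<Rightarrow> real \<Rightarrow> real finmeas \<Rightarrow> real \<Rightarrow> real" where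
  "pd h t \<nu> x = deriv (h t \<nu>) x"

definition pdx :: "(real \<Rightarrow> real finmeas \<Rightarrow> real \<Rightarrow> real \<Rightarrow> real)
    \<Rightarrow> real \<Rightarrow> real finmeas \<Rightarrow> real \<Rightarrow> real \<Rightarrow> real" where
  "pdx h t \<nu> x y = deriv (\<lambda>z. h t \<nu> z y) x"

definition pdy :: "(real \<Rightarrow> real finmeas \<Rightarrow> real \<Rightarrow> real \<Rightarrow> real)
    \<Rightarrow> real \<Rightarrow> real finmeas \<Rightarrow> real \<Rightarrow> real \<Rightarrow> real" where
  "pdy h t \<nu> x y = deriv (\<lambda>z. h t \<nu> x z) y"

text \<open>\<open>Cb_1_22 T W W\<^sub>t W\<^sub>1 W\<^sub>2\<close>: \<open>W\<close> belongs to the class of functions on \<open>[0,T)\<close> times the finite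
  measures that are once differentiable in time and twice linearly differentiable in the measure,
  the linear derivatives being twice differentiable in the spatial variables, with time derivative
  \<open>W\<^sub>t\<close> and first and second linear derivative \<open>W\<^sub>1\<close>, \<open>W\<^sub>2\<close>. All derivatives are bounded and jointly
  continuous; \<open>W\<close> itself need not be bounded. The derivative in time is one-sided at \<open>0\<close>.\<close>

definition Cb_1_22 ::
    "real \<Rightarrow> (real \<Rightarrow> real finmeas \<Rightarrow> real) \<Rightarrow> (real \<Rightarrow> real finmeas \<Rightarrow> real)
     \<Rightarrow> (real \<Rightarrow> real finmeas \<Rightarrow> real \<Rightarrow> real) \<Rightarrow> (real \<Rightarrow> real finmeas \<Rightarrow> real \<Rightarrow> real \<Rightarrow> real)
     \<Rightarrow> bool" where
  "Cb_1_22 T W W\<^sub>t W\<^sub>1 W\<^sub>2 \<longleftrightarrow>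
     (\<forall>t\<in>{0..<T}. \<forall>\<nu>. ((\<lambda>s. W s \<nu>) has_real_derivative W\<^sub>t t \<nu>) (at t within {0..<T})) \<and>
     bcont_on ({0..<T} \<times> UNIV) (\<lambda>(t, \<nu>). W\<^sub>t t \<nu>) \<and>
     (\<forall>t\<in>{0..<T}. has_linear_derivative (W t) (W\<^sub>1 t)) \<and>
     (\<forall>t\<in>{0..<T}. \<forall>x. has_linear_derivative (\<lambda>\<nu>. W\<^sub>1 t \<nu> x) (\<lambda>\<nu> y. W\<^sub>2 t \<nu> x y)) \<and>
     (\<forall>h\<in>{W\<^sub>1, pd W\<^sub>1}. \<forall>t\<in>{0..<T}. \<forall>\<nu> x. h t \<nu> field_differentiable at x) \<and>
     (\<forall>h\<in>{W\<^sub>1, pd W\<^sub>1, pd (pd W\<^sub>1)}.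
        bcont_on ({0..<T} \<times> UNIV \<times> UNIV) (\<lambda>(t, \<nu>, x). h t \<nu> x)) \<and>
     (\<forall>h\<in>{W\<^sub>2, pdx W\<^sub>2, pdy W\<^sub>2}. \<forall>t\<in>{0..<T}. \<forall>\<nu> x y.
        (\<lambda>z. h t \<nu> z y) field_differentiable at x \<and> (\<lambda>z. h t \<nu> x z) field_differentiable at y) \<and>
     (\<forall>h\<in>{W\<^sub>2, pdx W\<^sub>2, pdy W\<^sub>2, pdx (pdx W\<^sub>2), pdx (pdy W\<^sub>2), pdy (pdx W\<^sub>2), pdy (pdy W\<^sub>2)}.
        bcont_on ({0..<T} \<times> UNIV \<times> UNIV \<times> UNIV) (\<lambda>(t, \<nu>, x, y). h t \<nu> x y))"

section \<open>Coefficients and generator\<close>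

type_synonym coeff = "real \<Rightarrow> real finmeas \<Rightarrow> real \<Rightarrow> real"

definition admissible_coeff :: "real set \<Rightarrow> (nat \<Rightarrow> real \<Rightarrow> real) \<Rightarrow> coeff \<Rightarrow> bool" where
  "admissible_coeff A \<phi> c \<longleftrightarrow>
     bcont_on (UNIV \<times> UNIV \<times> A) (\<lambda>(x, \<nu>, a). c x \<nu> a) \<and>
     (\<exists>K. \<forall>a\<in>A. \<forall>x y \<mu> \<nu>. \<bar>c x \<mu> a - c y \<nu> a\<bar> \<le> K * (\<bar>x - y\<bar> + weak_dist \<phi> \<mu> \<nu>))"

definition gen :: "coeff \<Rightarrow> coeff \<Rightarrow> (real \<Rightarrow> real) \<Rightarrow> coeff" where
  "gen b \<sigma> h x \<nu> a = b x \<nu> a * deriv h x + 1/2 * (\<sigma> x \<nu> a)\<^sup>2 * deriv (deriv h) x"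

definition cyl_gen :: "coeff \<Rightarrow> coeff \<Rightarrow> coeff \<Rightarrow> (real \<Rightarrow> real) \<Rightarrow> (real \<Rightarrow> real) \<Rightarrow> coeff" where
  "cyl_gen b \<sigma> \<gamma> F h x \<nu> a = deriv F (pairing h \<nu>) * gen b \<sigma> h x \<nu> a
     + 1/2 * deriv (deriv F) (pairing h \<nu>) * \<gamma> x \<nu> a * (h x)\<^sup>2"

section \<open>Canonical space\<close>

definition cadlag_paths :: "real \<Rightarrow> (real \<Rightarrow> real finmeas) set" where
  "cadlag_paths T = {\<mu> \<in> extensional {0..T}.
     (\<forall>t\<in>{0..<T}. (\<mu> \<longlongrightarrow> \<mu> t) (at_right t)) \<and>
     (\<forall>t\<in>{0<..T}. \<exists>l. (\<mu> \<longlongrightarrow> l) (at_left t))}"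

text \<open>Measures on \<open>[0,T] \<times> \<real> \<times> A\<close> are represented by the measures on three-dimensional space that
  are carried by this set.\<close>

definition control_measures :: "real \<Rightarrow> real set \<Rightarrow> (real \<times> real \<times> real) finmeas set" where
  "control_measures T A = {m. emeasure (meas m) (- ({0..T} \<times> UNIV \<times> A)) = 0}"

text \<open>A measure \<open>ds \<mu>\<^sub>s(dx) \<delta>\<^bsub>\<alpha>(s,x)\<^esub>(da)\<close> has the projection \<open>\<mu>\<^sub>s(\<real>) ds\<close> on \<open>[0,T]\<close>. So
  the requirement that the projection be Lebesgue measure only leaves control rules under which
  \<open>\<mu>\<^sub>s\<close> has unit mass. What follows is therefore parametrised by the set \<open>MM\<close> of control measures,
  which is meant to be either of \<open>leb_control_measures T A\<close> and \<open>control_measures T A\<close>.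

  For \<open>control_measures T A\<close>, the inequality \<open>\<ge> 0\<close> in the Hamilton-Jacobi-Bellman relation does not
  suffice for the identification of the value function: if all coefficients and costs vanish, then
  \<open>W t \<nu> = t - T\<close> satisfies it and every control is minimising, but the value function is \<open>0\<close>. In
  that case equality \<open>= 0\<close> is the appropriate hypothesis.\<close>

definition leb_control_measures :: "real \<Rightarrow> real set \<Rightarrow> (real \<times> real \<times> real) finmeas set" where
  "leb_control_measures T A =
     {m \<in> control_measures T A. distr (meas m) borel fst = density lborel (indicator {0..T})}"

type_synonym outcome = "(real \<Rightarrow> real finmeas) \<times> (real \<times> real \<times> real) finmeas"

definition canonical_space :: "real \<Rightarrow> (real \<times> real \<times> real) finmeas set \<Rightarrow> outcome set" where
  "canonical_space T MM = cadlag_paths T \<times> MM"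

definition canonical_filtration ::
    "real \<Rightarrow> real set \<Rightarrow> (real \<times> real \<times> real) finmeas set \<Rightarrow> real \<Rightarrow> outcome measure" where
  "canonical_filtration T A MM s = sigma (canonical_space T MM)
     ({{\<omega> \<in> canonical_space T MM. fst \<omega> r \<in> U} | r U. r \<in> {0..s} \<and> U \<in> sets borel} \<union>
      {{\<omega> \<in> canonical_space T MM. measure (meas (snd \<omega>)) ({0..r} \<times> B \<times> A') \<in> C} | r B A' C.
         r \<in> {0..s} \<and> B \<in> sets borel \<and> A' \<in> sets (restrict_space borel A) \<and> C \<in> sets borel})"

lemma space_canonical_filtration [simp]:
  "space (canonical_filtration T A MM s) = canonical_space T MM"
  unfolding canonical_filtration_def by (rule space_measure_of) auto

lemma canonical_filtration_mono:
  assumes "r \<le> s"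
  shows "sets (canonical_filtration T A MM r) \<subseteq> sets (canonical_filtration T A MM s)"
  unfolding canonical_filtration_def
  apply (subst (1 2) sets_measure_of)
    apply blast
   apply blast
  apply (rule sigma_sets_mono')
  using assms by (fastforce dest: order_trans[OF _ assms])

definition martingale_on ::
    "'w measure \<Rightarrow> (real \<Rightarrow> 'w measure) \<Rightarrow> real set \<Rightarrow> (real \<Rightarrow> 'w \<Rightarrow> real) \<Rightarrow> bool" where
  "martingale_on P F I X \<longleftrightarrow>
     (\<forall>s\<in>I. X s \<in> borel_measurable (F s) \<and> integrable P (X s)) \<and>
     (\<forall>r\<in>I. \<forall>s\<in>I. r \<le> s \<longrightarrow> (AE \<omega> in P. real_cond_exp P (F r) (X s) \<omega> = X r \<omega>))"

section \<open>Weak control rules and value function\<close>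

text \<open>\<open>m(ds,dx,da) = ds \<mu>\<^sub>s(dx) \<delta>\<^bsub>\<alpha>(s,x)\<^esub>(da)\<close>\<close>

definition controlled_by :: "real \<Rightarrow> (real \<Rightarrow> real finmeas) \<Rightarrow> (real \<times> real \<times> real) finmeas
    \<Rightarrow> (real \<Rightarrow> real \<Rightarrow> real) \<Rightarrow> bool" where
  "controlled_by T \<mu> m \<alpha> \<longleftrightarrow> (\<forall>B\<in>sets borel. emeasure (meas m) B =
     (\<integral>\<^sup>+s\<in>{0..T}. (\<integral>\<^sup>+x. indicator B (s, x, \<alpha> s x) \<partial>meas (\<mu> s)) \<partial>lborel))"

text \<open>Probability measures on the canonical space are defined on the terminal sigma-algebra of the
  canonical filtration, which is the Borel sigma-algebra of the product of the Skorokhod and the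
  weak topology.\<close>

definition control_rules :: "real \<Rightarrow> real set \<Rightarrow> (real \<times> real \<times> real) finmeas set
    \<Rightarrow> coeff \<Rightarrow> coeff \<Rightarrow> coeff \<Rightarrow> real \<Rightarrow> (real \<Rightarrow> real finmeas) \<Rightarrow> outcome measure set" where
  "control_rules T A MM b \<sigma> \<gamma> t \<xi> = {P. prob_space P \<and>
     sets P = sets (canonical_filtration T A MM T) \<and>
     (AE (\<mu>, m) in P. \<forall>s\<in>{0..t}. \<mu> s = \<xi> s) \<and>
     (AE (\<mu>, m) in P. \<exists>\<alpha>.
        (\<lambda>(s, x). \<alpha> s x) \<in> restrict_space borel ({0..T} \<times> UNIV) \<rightarrow>\<^sub>M restrict_space borel A \<and>
        controlled_by T \<mu> m \<alpha>) \<and>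
     (\<forall>F h. Cb2 F \<and> Cb2 h \<longrightarrow>
        martingale_on P (canonical_filtration T A MM) {t..T}
          (\<lambda>s (\<mu>, m). F (pairing h (\<mu> s)) -
             (LINT (u, x, a):{t..s} \<times> UNIV \<times> A|meas m. cyl_gen b \<sigma> \<gamma> F h x (\<mu> u) a)))}"

definition cost :: "real \<Rightarrow> real set \<Rightarrow> coeff \<Rightarrow> (real finmeas \<Rightarrow> real)
    \<Rightarrow> real \<Rightarrow> outcome measure \<Rightarrow> real" where
  "cost T A f g t P =
     (\<integral>(\<mu>, m). (LINT (u, x, a):{t..T} \<times> UNIV \<times> A|meas m. f x (\<mu> u) a) + g (\<mu> T) \<partial>P)"

definition value_fun :: "real \<Rightarrow> real set \<Rightarrow> (real \<times> real \<times> real) finmeas set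
    \<Rightarrow> coeff \<Rightarrow> coeff \<Rightarrow> coeff \<Rightarrow> coeff \<Rightarrow> (real finmeas \<Rightarrow> real)
    \<Rightarrow> real \<Rightarrow> (real \<Rightarrow> real finmeas) \<Rightarrow> ereal" where
  "value_fun T A MM b \<sigma> \<gamma> f g t \<xi> =
     (INF P\<in>control_rules T A MM b \<sigma> \<gamma> t \<xi>. ereal (cost T A f g t P))"

text \<open>The bracket of the Hamilton-Jacobi-Bellman equation.\<close>

definition hjb_term :: "coeff \<Rightarrow> coeff \<Rightarrow> coeff \<Rightarrow> coeff
    \<Rightarrow> (real \<Rightarrow> real finmeas \<Rightarrow> real \<Rightarrow> real) \<Rightarrow> (real \<Rightarrow> real finmeas \<Rightarrow> real \<Rightarrow> real \<Rightarrow> real)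
    \<Rightarrow> real \<Rightarrow> coeff" where
  "hjb_term b \<sigma> \<gamma> f W\<^sub>1 W\<^sub>2 u x \<nu> a =
     gen b \<sigma> (W\<^sub>1 u \<nu>) x \<nu> a + 1/2 * \<gamma> x \<nu> a * W\<^sub>2 u \<nu> x x + f x \<nu> a"

end

theory Submission
  imports Defs
begin

text \<open>
  Everything follows from Dynkin's formula, which says that, under a control rule started from \<open>\<lambda>\<close> at
  time \<open>t\<close>, the expectation of \<open>W(T, \<mu>\<^sub>T)\<close> is \<open>W(t, \<lambda>)\<close> plus the expected integral of the time derivative of
  \<open>W\<close> and of the generator applied to \<open>W\<close>. Adding the running cost and bounding the bracket of the
  Hamilton-Jacobi-Bellman relation by its infimum gives \<open>W \<le> J\<close>, with equality if the control
  minimises the bracket.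

  The martingale problem yields Dynkin's formula for functions of one pairing \<open>\<langle>h, \<mu>\<rangle>\<close>. Truncated powers of
  the pairing give the moments of the mass and the bound \<open>C \<delta>\<^sup>2\<close> for the fourth moment of an increment
  over time \<open>\<delta>\<close>, and polarisation gives the formula for products of two increments. Let \<open>\<Pi>\<close> map a measure
  to finitely many atoms whose weights are pairings with Bernstein polynomials. Taylor's expansion
  of \<open>W(s, \<Pi> \<mu>\<^sub>s)\<close> to second order shows that the expectation minus its compensator has right derivative
  zero. As \<open>\<Pi>\<close> tends to the identity, the derivatives of Bernstein approximations converge to those of \<open>W\<close>.
  Finally \<open>\<mu>\<close> does not jump at \<open>T\<close>, because the increments of its pairings with the test sequence
  tend to zero in mean square.
\<close>

section \<open>Finite measures\<close>

text \<open>The martingale problem speaks only of bounded functions of one pairing, while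
  \<open>W\<close> depends on the whole measure, so the chain rule has to be built by expansion over
  short intervals of length \<delta>. The remainder is the squared increment times a factor that
  tends to zero only pathwise. The square has expectation of order \<delta>, so after division by
  \<delta> nothing dominates it; the fourth moments supply the missing uniform integrability.

  Bernstein polynomials fit for three reasons: they are nonnegative, so the projected weights form a
  measure; they sum to one, so the mass is kept and growth bounds are uniform in the approximation;
  their derivatives are Bernstein sums of difference quotients, so the mean value theorem gives the
  convergence of derivatives.

  Integration against the control measure costs one further factor of the unbounded mass, hence
  moments of all orders.\<close>

abbreviation "tmass \<equiv> pairing (\<lambda>_. 1)"

text \<open>The weak topology is initial for the pairings. For the converse direction, the induction
  over \<open>generate_topology\<close> reduces an arbitrary open set to the subbasis.\<close>

lemma tendsto_finmeas_iff:
  fixes l :: "'a::topological_space finmeas"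
  shows "(g \<longlongrightarrow> l) F \<longleftrightarrow>
    (\<forall>f. continuous_on UNIV f \<longrightarrow> bounded (range f) \<longrightarrow> ((\<lambda>x. pairing f (g x)) \<longlongrightarrow> pairing f l) F)"
    (is "?L \<longleftrightarrow> ?R")
proof (intro iffI allI impI)
  fix f :: "'a => real" assume "?L" and f: "continuous_on UNIV f" "bounded (range f)"
  show "((\<lambda>x. pairing f (g x)) \<longlongrightarrow> pairing f l) F"
    using continuous_on_tendsto_compose[OF continuous_pairing[OF f] \<open>?L\<close>] by simp
next
  assume R: ?R
  have *: "l \<in> S ==> eventually (\<lambda>x. g x \<in> S) F"
    if "generate_topology {{\<mu>. pairing f \<mu> \<in> V} | f V. continuous_on UNIV f \<and> bounded (range f) \<and> open V} S" for S
    using that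
  proof induction
    case UNIV then show ?case by simp
  next
    case (Int a b) then show ?case by (auto intro: eventually_conj)
  next
    case (UN K)
    then obtain k where k: "k \<in> K" "l \<in> k" by auto
    with UN have "eventually (\<lambda>x. g x \<in> k) F" by auto
    then show ?case by eventually_elim (use k in auto)
  next
    case (Basis s)
    then obtain f V where s: "s = {\<mu>. pairing f \<mu> \<in> V}" "continuous_on UNIV f" "bounded (range f)" "open V"
      by auto
    with R have "((\<lambda>x. pairing f (g x)) \<longlongrightarrow> pairing f l) F" by auto
    then show ?case using Basis.prems s by (auto simp: tendsto_def)
  qed
  show ?L unfolding tendsto_def
    using * by (auto simp: open_finmeas_def)
qed

text \<open>Also covers non-integrable \<open>f\<close>: the integral is then 0 by convention, and
  the bound \<open>C\<close> is nonnegative because it dominates an absolute value.\<close>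

lemma pairing_abs_le:
  assumes "\<And>x. \<bar>f x\<bar> \<le> C"
  shows "\<bar>pairing f \<mu>\<bar> \<le> C * tmass \<mu>"
proof (cases "integrable (meas \<mu>) f")
  case True
  interpret finite_measure "meas \<mu>" by (rule finite_measure_meas)
  have "\<bar>pairing f \<mu>\<bar> \<le> (\<integral>x. \<bar>f x\<bar> \<partial>meas \<mu>)"
    unfolding pairing_def by (rule integral_abs_bound)
  also have "\<dots> \<le> (\<integral>x. C \<partial>meas \<mu>)"
    using True assms by (intro integral_mono) auto
  finally show ?thesis by (simp add: pairing_def mult.commute)
next
  case False
  have "0 \<le> C" using assms[of undefined] by linarith
  with False show ?thesis by (simp add: pairing_def not_integrable_integral_eq)
qed

lemma pairing_one: "tmass \<mu> = measure (meas \<mu>) UNIV"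
  by (simp add: pairing_def)

lemma integrable_meas_bounded:
  assumes "f \<in> borel_measurable borel" "\<And>x. \<bar>f x\<bar> \<le> (C::real)"
  shows "integrable (meas \<mu>) f"
proof -
  interpret finite_measure "meas \<mu>" by (rule finite_measure_meas)
  show ?thesis using assms by (intro integrable_const_bound[where B=C]) auto
qed

lemma borel_measurable_bcont: "continuous_on UNIV f ==> (f::'a::topological_space => real) \<in> borel_measurable borel"
  by (rule borel_measurable_continuous_onI)

lemma bounded_rangeE:
  assumes "bounded (range (f::'a => real))" obtains C where "\<And>x. \<bar>f x\<bar> \<le> C"
  using assms by (auto simp: bounded_iff)

text \<open>The weights pass through \<open>ennreal\<close>, which cuts negative ones to zero, so no
  sign condition is needed to obtain a measure.\<close>

definition atoms :: "'i set => ('i => 'a::topological_space) => ('i => real) => 'a finmeas" where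
  "atoms J x y = Abs_finmeas (distr (point_measure J (\<lambda>j. ennreal (y j))) borel x)"

lemma meas_atoms:
  assumes "finite J"
  shows "meas (atoms J x y) = distr (point_measure J (\<lambda>j. ennreal (y j))) borel x"
  unfolding atoms_def
proof (rule Abs_finmeas_inverse, intro CollectI conjI)
  have "finite_measure (point_measure J (\<lambda>j. ennreal (y j)))"
    using assms by (intro finite_measureI) (simp add: space_point_measure emeasure_point_measure_finite)
  then show "finite_measure (distr (point_measure J (\<lambda>j. ennreal (y j))) borel x)"
    by (rule finite_measure.finite_measure_distr) simp
qed simp

lemma pairing_atoms:
  assumes "finite J" "\<And>j. j \<in> J ==> 0 \<le> y j" "f \<in> borel_measurable borel"
  shows "pairing f (atoms J x y) = (\<Sum>j\<in>J. y j * f (x j))"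
  using assms
  by (simp add: pairing_def meas_atoms integral_distr lebesgue_integral_point_measure_finite)

lemma tendsto_atoms:
  assumes J: "finite J" and pos: "\<And>j. j \<in> J ==> 0 \<le> l j" "\<And>j n. j \<in> J ==> 0 \<le> y n j"
    and lim: "\<And>j. j \<in> J ==> ((\<lambda>n. y n j) \<longlongrightarrow> l j) F"
  shows "((\<lambda>n. atoms J x (y n) :: 'b::topological_space finmeas) \<longlongrightarrow> atoms J x l) F"
  unfolding tendsto_finmeas_iff
proof (intro allI impI)
  fix f :: "'b => real" assume "continuous_on UNIV f" "bounded (range f)"
  then have "f \<in> borel_measurable borel" by (auto intro: borel_measurable_bcont)
  then show "((\<lambda>x'. pairing f (atoms J x (y x'))) \<longlongrightarrow> pairing f (atoms J x l)) F"
    using assms by (auto simp: pairing_atoms intro!: tendsto_intros)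
qed

lemma meas_eqI_nn:
  assumes "\<And>B. B \<in> sets borel ==> emeasure (meas \<mu>) B = emeasure (meas \<nu>) B"
  shows "\<mu> = \<nu>"
  using assms by (intro meas_inject[THEN iffD1] measure_eqI) auto

text \<open>For the second-order expansion: the linear derivative of \<open>W1\<close> is applied
  along the part of a segment that was already run through.\<close>

lemma segment_segment:
  assumes "0 \<le> q" "q \<le> 1" "0 \<le> r" "r \<le> 1"
  shows "segment q \<nu> (segment r \<nu> \<mu>) = segment (q * r) \<nu> \<mu>"
proof (rule meas_eqI_nn)
  fix B :: "'a set" assume B: "B \<in> sets borel"
  have qr: "0 \<le> q * r" "q * r \<le> 1" using assms by (auto simp: mult_le_one)
  have 1: "ennreal (1 - q * r) = ennreal (1 - q) + ennreal q * ennreal (1 - r)"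
    using assms by (simp add: ennreal_plus[symmetric] ennreal_mult[symmetric] algebra_simps mult_left_le del: ennreal_plus)
  show "emeasure (meas (segment q \<nu> (segment r \<nu> \<mu>))) B = emeasure (meas (segment (q * r) \<nu> \<mu>)) B"
    using assms qr B by (simp add: emeasure_segment 1 ennreal_mult algebra_simps)
qed

lemma segment_atoms:
  assumes "finite J" "\<And>j. j \<in> J ==> 0 \<le> y j" "\<And>j. j \<in> J ==> 0 \<le> z j" "0 \<le> r" "r \<le> 1"
  shows "segment r (atoms J x y) (atoms J x z) = atoms J x (\<lambda>j. (1 - r) * y j + r * z j)"
proof (rule meas_eqI_nn)
  fix B :: "'b set" assume B: "B \<in> sets borel"
  have sub: "x -` B \<inter> J \<subseteq> J" and fin: "finite (x -` B \<inter> J)" using assms(1) by auto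
  have "emeasure (meas (atoms J x y)) B = (\<Sum>j\<in>x -` B \<inter> J. ennreal (y j))" for y
    using assms(1) B sub
    by (simp add: meas_atoms emeasure_distr space_point_measure emeasure_point_measure_finite)
  then show "emeasure (meas (segment r (atoms J x y) (atoms J x z))) B = emeasure (meas (atoms J x (\<lambda>j. (1 - r) * y j + r * z j))) B"
    using assms B
    by (simp add: emeasure_segment sum_distrib_left sum.distrib[symmetric] ennreal_mult[symmetric]
       ennreal_plus[symmetric] del: ennreal_plus)
qed

section \<open>Products of a measure with a finite kernel\<close>

definition kernel :: "'a measure => 'b measure => ('a => 'b measure) => bool" where
  "kernel P B N \<longleftrightarrow> (\<forall>w\<in>space P. sets (N w) = sets B \<and> finite_measure (N w)) \<and>
     (\<forall>C\<in>sets B. (\<lambda>w. emeasure (N w) C) \<in> borel_measurable P)"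

text \<open>Division by one plus the mass, rather than by the mass, treats the zero measure without
  a special case and still leaves total mass at most one.\<close>

definition normalised :: "('a => 'b measure) => 'a => 'b measure" where
  "normalised N w = scale_measure (inverse (1 + emeasure (N w) (space (N w)))) (N w)"

lemma kernelD:
  assumes "kernel P B N" "w \<in> space P"
  shows "sets (N w) = sets B" "finite_measure (N w)" "space (N w) = space B"
  using assms sets_eq_imp_space_eq[of "N w" B] by (auto simp: kernel_def)

lemma subprob_normalised:
  assumes "finite_measure M"
  shows "emeasure (scale_measure (inverse (1 + emeasure M (space M))) M) (space M) \<le> 1"
proof -
  interpret finite_measure M by fact
  have "emeasure M (space M) = ennreal (measure M (space M))" by (rule emeasure_eq_measure)
  then have "inverse (1 + emeasure M (space M)) * emeasure M (space M)
      = ennreal (inverse (1 + measure M (space M)) * measure M (space M))"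
    by (simp add: inverse_ennreal ennreal_mult[symmetric] ennreal_1[symmetric] ennreal_plus[symmetric] add_pos_nonneg
        del: ennreal_1 ennreal_plus)
  also have "\<dots> \<le> 1"
    unfolding ennreal_1[symmetric] by (rule ennreal_leI) (simp add: field_simps add_pos_nonneg)
  finally show ?thesis by simp
qed

text \<open>Kernels of the library are sub-probability kernels, hence the detour through normalisation.\<close>

lemma kernelI:
  assumes N: "\<And>w. w \<in> space P ==> sets (N w) = sets B" "\<And>w. w \<in> space P ==> finite_measure (N w)"
    and G: "sets B = sigma_sets (space B) G" "Int_stable G" "G \<subseteq> Pow (space B)"
    and m: "\<And>C. C \<in> G ==> (\<lambda>w. emeasure (N w) C) \<in> borel_measurable P"
      "(\<lambda>w. emeasure (N w) (space B)) \<in> borel_measurable P"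
    and ne: "space B \<noteq> {}"
  shows "kernel P B N"
proof -
  note m(2)[measurable]
  have sp: "space (N w) = space B" if "w \<in> space P" for w
    using N(1)[OF that] by (rule sets_eq_imp_space_eq)
  let ?K = "\<lambda>w. scale_measure (inverse (1 + emeasure (N w) (space B))) (N w)"
  have K: "?K \<in> P \<rightarrow>\<^sub>M subprob_algebra B"
  proof (rule measurable_subprob_algebra_generated[OF G])
    fix a assume a: "a \<in> space P"
    show "sets (?K a) = sets B" using N(1)[OF a] by simp
    show "subprob_space (?K a)"
    proof (rule subprob_spaceI)
      show "emeasure (?K a) (space (?K a)) \<le> 1"
        using subprob_normalised[OF N(2)[OF a]] by (simp add: sp[OF a] space_scale_measure)
      show "space (?K a) \<noteq> {}" using ne by (simp add: space_scale_measure sp[OF a])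
    qed
  next
    fix C assume "C \<in> G"
    note m(1)[OF this, measurable]
    show "(\<lambda>a. emeasure (?K a) C) \<in> borel_measurable P" by simp
  next
    show "(\<lambda>a. emeasure (?K a) (space B)) \<in> borel_measurable P" by simp
  qed
  show ?thesis
    unfolding kernel_def
  proof (intro conjI ballI)
    fix C assume C: "C \<in> sets B"
    have e: "emeasure (N w) C = (1 + emeasure (N w) (space B)) * emeasure (?K w) C" if "w \<in> space P" for w
    proof -
      interpret finite_measure "N w" using N(2)[OF that] .
      have "1 + emeasure (N w) (space B) \<noteq> \<top>" "1 + emeasure (N w) (space B) \<noteq> 0"
        using emeasure_finite[of "space B"] by (auto simp: add_eq_0_iff_both_eq_0)
      then have "(1 + emeasure (N w) (space B)) * inverse (1 + emeasure (N w) (space B)) = 1"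
        by (metis ennreal_divide_self divide_ennreal_def less_top)
      then show ?thesis by (simp add: mult.assoc[symmetric])
    qed
    have "(\<lambda>w. (1 + emeasure (N w) (space B)) * emeasure (?K w) C) \<in> borel_measurable P"
      using measurable_emeasure_kernel[OF K C] by measurable
    then show "(\<lambda>w. emeasure (N w) C) \<in> borel_measurable P"
      by (subst measurable_cong[OF e])
  qed (use N in auto)
qed

lemma normalised_kernel:
  assumes k: "kernel P B N" and ne: "space B \<noteq> {}"
  shows "normalised N \<in> P \<rightarrow>\<^sub>M subprob_algebra B"
proof -
  have [measurable]: "(\<lambda>w. emeasure (N w) C) \<in> borel_measurable P" if "C \<in> sets B" for C
    using k that by (auto simp: kernel_def)
  note D = kernelD[OF k]
  show ?thesis
  proof (rule measurable_subprob_algebra)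
    fix a assume a: "a \<in> space P"
    then show "sets (normalised N a) = sets B" by (simp add: normalised_def D)
    show "subprob_space (normalised N a)"
      using subprob_normalised[OF D(2)[OF a]] a ne
      by (intro subprob_spaceI) (auto simp: normalised_def space_scale_measure D)
  next
    fix C assume C[measurable]: "C \<in> sets B"
    have "(\<lambda>a. inverse (1 + emeasure (N a) (space B)) * emeasure (N a) C) \<in> borel_measurable P"
      by measurable
    then show "(\<lambda>a. emeasure (normalised N a) C) \<in> borel_measurable P"
      by (subst measurable_cong[where g="\<lambda>a. inverse (1 + emeasure (N a) (space B)) * emeasure (N a) C"])
         (auto simp: normalised_def D)
  qed
qed

lemma nn_integral_normalised:
  assumes k: "kernel P B N" and w: "w \<in> space P" and f: "f \<in> borel_measurable B"
  shows "(1 + emeasure (N w) (space B)) * (\<integral>\<^sup>+z. f z \<partial>normalised N w) = (\<integral>\<^sup>+z. f z \<partial>N w)"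
proof -
  note D = kernelD[OF k w]
  interpret finite_measure "N w" by (rule D)
  have f': "f \<in> borel_measurable (N w)" using f measurable_cong_sets[OF D(1) refl] by blast
  have "1 + emeasure (N w) (space B) \<noteq> \<top>" "1 + emeasure (N w) (space B) \<noteq> 0"
    using emeasure_finite[of "space B"] by (auto simp: add_eq_0_iff_both_eq_0)
  then have "(1 + emeasure (N w) (space B)) * inverse (1 + emeasure (N w) (space B)) = 1"
    by (metis ennreal_divide_self divide_ennreal_def less_top)
  then show ?thesis
    using f' by (simp add: normalised_def D nn_integral_scale_measure mult.assoc[symmetric])
qed

lemma kernel_nn_integral_measurable:
  assumes k: "kernel P B N" and ne: "space B \<noteq> {}" and f: "f \<in> borel_measurable (P \<Otimes>\<^sub>M B)"
  shows "(\<lambda>w. \<integral>\<^sup>+z. f (w, z) \<partial>N w) \<in> borel_measurable P"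
proof -
  note [measurable] = normalised_kernel[OF k ne] f
  have [measurable]: "(\<lambda>w. emeasure (N w) (space B)) \<in> borel_measurable P"
    using k by (auto simp: kernel_def)
  have "(\<lambda>w. (1 + emeasure (N w) (space B)) * (\<integral>\<^sup>+z. f (w, z) \<partial>normalised N w)) \<in> borel_measurable P"
    using nn_integral_measurable_subprob_algebra2[OF _ normalised_kernel[OF k ne], of "\<lambda>a b. f (a, b)"] by measurable
  then show ?thesis
    by (subst measurable_cong[OF nn_integral_normalised[OF k, symmetric]]) auto
qed

text \<open>Sections that fail to be integrable have integral 0 by convention. The conditional on
  the two nonnegative integrals reproduces this value, so measurability holds everywhere and not
  only almost everywhere.\<close>

lemma kernel_integral_measurable:
  fixes f :: "_ => real"
  assumes k: "kernel P B N" and ne: "space B \<noteq> {}" and f[measurable]: "f \<in> borel_measurable (P \<Otimes>\<^sub>M B)"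
  shows "(\<lambda>w. \<integral>z. f (w, z) \<partial>N w) \<in> borel_measurable P"
proof -
  let ?p = "\<lambda>w. \<integral>\<^sup>+z. ennreal (f (w, z)) \<partial>N w" and ?n = "\<lambda>w. \<integral>\<^sup>+z. ennreal (- f (w, z)) \<partial>N w"
  have [measurable]: "?p \<in> borel_measurable P" "?n \<in> borel_measurable P"
    by (rule kernel_nn_integral_measurable[OF k ne], measurable)+
  have "(\<lambda>w. if ?p w \<noteq> \<infinity> \<and> ?n w \<noteq> \<infinity> then enn2real (?p w) - enn2real (?n w) else 0) \<in> borel_measurable P"
    by measurable
  moreover have "(\<integral>z. f (w, z) \<partial>N w) = (if ?p w \<noteq> \<infinity> \<and> ?n w \<noteq> \<infinity> then enn2real (?p w) - enn2real (?n w) else 0)"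
    if w: "w \<in> space P" for w
  proof -
    have [measurable_cong]: "sets (N w) = sets B" by (rule kernelD[OF k w])
    have m: "(\<lambda>z. f (w, z)) \<in> borel_measurable (N w)" using w by measurable
    show ?thesis
    proof (cases "integrable (N w) (\<lambda>z. f (w, z))")
      case True
      then show ?thesis using real_lebesgue_integral_def[OF True] by (simp add: real_integrable_def)
    next
      case False
      then show ?thesis using m by (auto simp: not_integrable_integral_eq real_integrable_def)
    qed
  qed
  ultimately show ?thesis by (subst measurable_cong) auto
qed

text \<open>The measure P(dw) N(w, dz). The normalised kernel is composed with \<open>P\<close> by
  \<open>bind\<close>, and the density puts back the mass that normalisation removed.\<close>

definition kprod :: "'a measure => 'b measure => ('a => 'b measure) => ('a \<times> 'b) measure" where
  "kprod P B N = density (P \<bind> (\<lambda>w. distr (normalised N w) (P \<Otimes>\<^sub>M B) (Pair w)))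
     (\<lambda>(w, z). 1 + emeasure (N w) (space B))"

context
  fixes P :: "'a measure" and B :: "'b measure" and N :: "'a => 'b measure"
  assumes k: "kernel P B N" and ne: "space B \<noteq> {}" "space P \<noteq> {}"
begin

lemma kprod_kernel: "(\<lambda>w. distr (normalised N w) (P \<Otimes>\<^sub>M B) (Pair w)) \<in> P \<rightarrow>\<^sub>M subprob_algebra (P \<Otimes>\<^sub>M B)"
  by (rule measurable_distr2[OF _ normalised_kernel[OF k ne(1)]]) simp

lemma sets_kprod [measurable_cong]: "sets (kprod P B N) = sets (P \<Otimes>\<^sub>M B)"
  unfolding kprod_def using sets_bind[OF sets_kernel[OF kprod_kernel]] ne by simp

lemma nn_integral_kprod:
  assumes f[measurable]: "f \<in> borel_measurable (P \<Otimes>\<^sub>M B)"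
  shows "(\<integral>\<^sup>+x. f x \<partial>kprod P B N) = (\<integral>\<^sup>+w. \<integral>\<^sup>+z. f (w, z) \<partial>N w \<partial>P)"
proof -
  have e[measurable]: "(\<lambda>w. emeasure (N w) (space B)) \<in> borel_measurable P"
    using k by (auto simp: kernel_def)
  let ?M = "P \<bind> (\<lambda>w. distr (normalised N w) (P \<Otimes>\<^sub>M B) (Pair w))"
  have [measurable_cong]: "sets ?M = sets (P \<Otimes>\<^sub>M B)"
    using sets_bind[OF sets_kernel[OF kprod_kernel]] ne by simp
  have "(\<integral>\<^sup>+x. f x \<partial>kprod P B N) = (\<integral>\<^sup>+x. (case x of (w, z) => 1 + emeasure (N w) (space B)) * f x \<partial>?M)"
    unfolding kprod_def by (rule nn_integral_density) measurable
  also have "\<dots> = (\<integral>\<^sup>+w. \<integral>\<^sup>+x. (case x of (w, z) => 1 + emeasure (N w) (space B)) * f x \<partial>distr (normalised N w) (P \<Otimes>\<^sub>M B) (Pair w) \<partial>P)"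
    by (rule nn_integral_bind[OF _ kprod_kernel]) measurable
  also have "\<dots> = (\<integral>\<^sup>+w. \<integral>\<^sup>+z. f (w, z) \<partial>N w \<partial>P)"
  proof (rule nn_integral_cong)
    fix w assume w: "w \<in> space P"
    have [measurable_cong]: "sets (normalised N w) = sets B"
      using normalised_kernel[OF k ne(1)] w by (rule sets_kernel)
    have "(\<integral>\<^sup>+x. (case x of (w, z) => 1 + emeasure (N w) (space B)) * f x \<partial>distr (normalised N w) (P \<Otimes>\<^sub>M B) (Pair w))
        = (\<integral>\<^sup>+z. (1 + emeasure (N w) (space B)) * f (w, z) \<partial>normalised N w)"
      using w by (subst nn_integral_distr) auto
    also have "\<dots> = (1 + emeasure (N w) (space B)) * (\<integral>\<^sup>+z. f (w, z) \<partial>normalised N w)"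
      using w by (intro nn_integral_cmult) measurable
    also have "\<dots> = (\<integral>\<^sup>+z. f (w, z) \<partial>N w)"
      using w by (intro nn_integral_normalised[OF k]) auto
    finally show "(\<integral>\<^sup>+x. (case x of (w, z) => 1 + emeasure (N w) (space B)) * f x \<partial>distr (normalised N w) (P \<Otimes>\<^sub>M B) (Pair w))
       = (\<integral>\<^sup>+z. f (w, z) \<partial>N w)" .
  qed
  finally show ?thesis .
qed

lemma emeasure_kprod:
  assumes C: "C \<in> sets (P \<Otimes>\<^sub>M B)"
  shows "emeasure (kprod P B N) C = (\<integral>\<^sup>+w. \<integral>\<^sup>+z. indicator C (w, z) \<partial>N w \<partial>P)"
  using C by (subst nn_integral_kprod[symmetric]) (auto simp: sets_kprod)

text \<open>Fubini's theorem for a kernel. Tonelli makes the integrals of the positive and negative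
  part finite for almost every \<open>w\<close>, and on the remaining null set the value of the
  inner integral does not matter.\<close>

lemma integral_kprod:
  fixes f :: "'a \<times> 'b => real"
  assumes f: "integrable (kprod P B N) f"
  shows "integrable P (\<lambda>w. \<integral>z. f (w, z) \<partial>N w)" (is ?g1)
    and "(\<integral>x. f x \<partial>kprod P B N) = (\<integral>w. \<integral>z. f (w, z) \<partial>N w \<partial>P)" (is ?g2)
    and "AE w in P. integrable (N w) (\<lambda>z. f (w, z))" (is ?g3)
proof -
  have fm[measurable]: "f \<in> borel_measurable (P \<Otimes>\<^sub>M B)"
    using borel_measurable_integrable[OF f] measurable_cong_sets[OF sets_kprod refl] by blast
  let ?p = "\<lambda>w. \<integral>\<^sup>+z. ennreal (f (w, z)) \<partial>N w" and ?n = "\<lambda>w. \<integral>\<^sup>+z. ennreal (- f (w, z)) \<partial>N w"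
  have m[measurable]: "?p \<in> borel_measurable P" "?n \<in> borel_measurable P"
    by (rule kernel_nn_integral_measurable[OF k ne(1)], measurable)+
  have pe: "(\<integral>\<^sup>+x. ennreal (f x) \<partial>kprod P B N) = (\<integral>\<^sup>+w. ?p w \<partial>P)"
     "(\<integral>\<^sup>+x. ennreal (- f x) \<partial>kprod P B N) = (\<integral>\<^sup>+w. ?n w \<partial>P)"
    by (rule nn_integral_kprod, measurable)+
  then have fin: "(\<integral>\<^sup>+w. ?p w \<partial>P) \<noteq> \<infinity>" "(\<integral>\<^sup>+w. ?n w \<partial>P) \<noteq> \<infinity>"
    using f by (auto simp: real_integrable_def)
  then have ae: "AE w in P. ?p w \<noteq> \<infinity>" "AE w in P. ?n w \<noteq> \<infinity>"
    by (auto intro!: nn_integral_PInf_AE[OF m(1)] nn_integral_PInf_AE[OF m(2)] simp del: infinity_ennreal_def)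
  have mf: "(\<lambda>z. f (w, z)) \<in> borel_measurable (N w)" if "w \<in> space P" for w
  proof -
    have [measurable_cong]: "sets (N w) = sets B" by (rule kernelD[OF k that])
    show ?thesis using that by measurable
  qed
  have int: "AE w in P. integrable (N w) (\<lambda>z. f (w, z)) \<and>
     (\<integral>z. f (w, z) \<partial>N w) = enn2real (?p w) - enn2real (?n w)"
    using ae AE_space
  proof eventually_elim
    case (elim w)
    then have "integrable (N w) (\<lambda>z. f (w, z))" using mf by (auto simp: real_integrable_def)
    with real_lebesgue_integral_def[OF this] show ?case by auto
  qed
  then show ?g3 by auto
  have en: "(\<integral>\<^sup>+w. ennreal (enn2real (g w)) \<partial>P) = (\<integral>\<^sup>+w. g w \<partial>P)" if "AE w in P. g w \<noteq> \<infinity>" for g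
    using that by (intro nn_integral_cong_AE) (auto simp: less_top)
  have ii: "integrable P (\<lambda>w. enn2real (?p w))" "integrable P (\<lambda>w. enn2real (?n w))"
    using fin en[OF ae(1)] en[OF ae(2)] by (auto intro!: integrableI_nonneg simp: less_top)
  have ie: "(\<integral>w. enn2real (?p w) \<partial>P) = enn2real (\<integral>\<^sup>+w. ?p w \<partial>P)"
    "(\<integral>w. enn2real (?n w) \<partial>P) = enn2real (\<integral>\<^sup>+w. ?n w \<partial>P)"
    using en[OF ae(1)] en[OF ae(2)] by (auto intro!: simp: integral_eq_nn_integral)
  have mi: "(\<lambda>w. \<integral>z. f (w, z) \<partial>N w) \<in> borel_measurable P"
    by (rule kernel_integral_measurable[OF k ne(1) fm])
  show ?g1
    using Bochner_Integration.integrable_diff[OF ii] mi by (rule integrable_cong_AE_imp) (use int in auto)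
  have "(\<integral>w. \<integral>z. f (w, z) \<partial>N w \<partial>P) = (\<integral>w. enn2real (?p w) - enn2real (?n w) \<partial>P)"
    by (rule integral_cong_AE[OF mi]) (use int in auto)
  also have "\<dots> = enn2real (\<integral>\<^sup>+w. ?p w \<partial>P) - enn2real (\<integral>\<^sup>+w. ?n w \<partial>P)"
    using ii ie by simp
  also have "\<dots> = (\<integral>x. f x \<partial>kprod P B N)"
    using real_lebesgue_integral_def[OF f] pe by simp
  finally show ?g2 by simp
qed

lemma AE_kprod:
  assumes C: "{x \<in> space (P \<Otimes>\<^sub>M B). \<not> R x} \<in> sets (P \<Otimes>\<^sub>M B)"
    and R: "AE w in P. AE z in N w. R (w, z)"
  shows "AE x in kprod P B N. R x"
proof -
  let ?C = "{x \<in> space (P \<Otimes>\<^sub>M B). \<not> R x}"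
  have "emeasure (kprod P B N) ?C = (\<integral>\<^sup>+w. \<integral>\<^sup>+z. indicator ?C (w, z) \<partial>N w \<partial>P)"
    by (rule emeasure_kprod[OF C])
  also have "\<dots> = (\<integral>\<^sup>+w. 0 \<partial>P)"
  proof (rule nn_integral_cong_AE)
    show "AE w in P. (\<integral>\<^sup>+z. indicator ?C (w, z) \<partial>N w) = 0"
      using R
    proof eventually_elim
      case (elim w)
      then have "(\<integral>\<^sup>+z. indicator ?C (w, z) \<partial>N w) = (\<integral>\<^sup>+z. 0 \<partial>N w)"
        by (intro nn_integral_cong_AE) (auto elim!: eventually_mono)
      then show ?case by simp
    qed
  qed
  finally have "emeasure (kprod P B N) ?C = 0" by simp
  moreover have "{x \<in> space (kprod P B N). \<not> R x} = ?C"
    using sets_eq_imp_space_eq[OF sets_kprod] by simp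
  ultimately show ?thesis using C by (intro AE_I[of _ _ ?C]) (auto simp: sets_kprod)
qed

end

section \<open>Test functions\<close>

lemma Cb2I:
  assumes 1: "\<And>x. (h has_real_derivative h' x) (at x)" and 2: "\<And>x. (h' has_real_derivative h'' x) (at x)"
    and c: "continuous_on UNIV h''" and b: "\<And>x. \<bar>h x\<bar> \<le> C0" "\<And>x. \<bar>h' x\<bar> \<le> C1" "\<And>x. \<bar>h'' x\<bar> \<le> C2"
  shows "Cb2 h" and "deriv h = h'" and "deriv (deriv h) = h''"
proof -
  show d: "deriv h = h'" by (intro ext DERIV_imp_deriv 1)
  have d': "deriv h' = h''" by (intro ext DERIV_imp_deriv 2)
  show dd: "deriv (deriv h) = h''" unfolding d d' ..
  have "continuous_on UNIV h" "continuous_on UNIV h'"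
    using 1 2 by (blast intro: DERIV_continuous_on has_field_derivative_at_within)+
  then show "Cb2 h"
    unfolding Cb2_def d d' bcont_on_def using 1 2 b c
    by (auto simp: field_differentiable_def bounded_iff)
qed

lemma Cb2_deriv:
  assumes "Cb2 h"
  shows "(h has_real_derivative deriv h x) (at x)" "(deriv h has_real_derivative deriv (deriv h) x) (at x)"
    "continuous_on UNIV h" "continuous_on UNIV (deriv h)" "continuous_on UNIV (deriv (deriv h))"
  using assms by (auto simp: Cb2_def bcont_on_def DERIV_deriv_iff_field_differentiable)

lemma Cb2_bound:
  assumes "Cb2 h"
  obtains C where "0 \<le> C" "\<And>x. \<bar>h x\<bar> \<le> C" "\<And>x. \<bar>deriv h x\<bar> \<le> C" "\<And>x. \<bar>deriv (deriv h) x\<bar> \<le> C"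
proof -
  obtain C0 C1 C2 where C: "\<And>x. \<bar>h x\<bar> \<le> C0" "\<And>x. \<bar>deriv h x\<bar> \<le> C1" "\<And>x. \<bar>deriv (deriv h) x\<bar> \<le> C2"
    using assms by (auto simp: Cb2_def bcont_on_def bounded_iff)
  show thesis
    by (rule that[of "max C0 (max C1 C2)"])
       (use C order_trans[OF abs_ge_zero C(1)] in \<open>auto simp: le_max_iff_disj\<close>)
qed

lemma Cb2_add:
  assumes "Cb2 h" "Cb2 g"
  shows "Cb2 (\<lambda>x. h x + g x)" "deriv (\<lambda>x. h x + g x) = (\<lambda>x. deriv h x + deriv g x)" (is ?g1)
    "deriv (deriv (\<lambda>x. h x + g x)) = (\<lambda>x. deriv (deriv h) x + deriv (deriv g) x)"
proof -
  obtain C where C: "\<And>x. \<bar>h x\<bar> \<le> C" "\<And>x. \<bar>deriv h x\<bar> \<le> C" "\<And>x. \<bar>deriv (deriv h) x\<bar> \<le> C"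
    using Cb2_bound[OF assms(1)] by metis
  obtain D where D: "\<And>x. \<bar>g x\<bar> \<le> D" "\<And>x. \<bar>deriv g x\<bar> \<le> D" "\<And>x. \<bar>deriv (deriv g) x\<bar> \<le> D"
    using Cb2_bound[OF assms(2)] by metis
  have b: "\<bar>a + b\<bar> \<le> C + D" if "\<bar>a\<bar> \<le> C" "\<bar>b\<bar> \<le> D" for a b :: real using that by linarith
  note I = Cb2I[of "\<lambda>x. h x + g x" "\<lambda>x. deriv h x + deriv g x" "\<lambda>x. deriv (deriv h) x + deriv (deriv g) x" "C+D" "C+D" "C+D"]
  show "Cb2 (\<lambda>x. h x + g x)" ?g1
    "deriv (deriv (\<lambda>x. h x + g x)) = (\<lambda>x. deriv (deriv h) x + deriv (deriv g) x)"
    by (rule I; intro derivative_intros continuous_intros b C D Cb2_deriv assms)+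
qed

lemma Cb2_const: "Cb2 (\<lambda>x. c)" "deriv (\<lambda>x::real. c::real) = (\<lambda>x. 0)" "deriv (deriv (\<lambda>x::real. c::real)) = (\<lambda>x. 0)"
  by (rule Cb2I[of _ "\<lambda>x. 0" "\<lambda>x. 0" "\<bar>c\<bar>" 0 0]; simp)+

section \<open>Smooth truncation\<close>

text \<open>The martingale property is only assumed for bounded functions, hence these approximations of the
  identity, whose first two derivatives are bounded uniformly in \<open>e \<le> 1\<close>.\<close>

definition trunc :: "real => real => real" where "trunc e x = x / sqrt (1 + e * x\<^sup>2)"
definition trunc1 :: "real => real => real" where "trunc1 e x = 1 / sqrt (1 + e * x\<^sup>2) ^ 3"
definition trunc2 :: "real => real => real" where "trunc2 e x = - 3 * e * x / sqrt (1 + e * x\<^sup>2) ^ 5"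

context fixes e :: real assumes e: "0 < e" "e \<le> 1" begin

lemma trunc_root: "1 \<le> sqrt (1 + e * x\<^sup>2)" "sqrt (1 + e * x\<^sup>2) ^ 2 = 1 + e * x\<^sup>2"
  using e by (auto simp: zero_le_mult_iff)

lemma DERIV_trunc: "(trunc e has_real_derivative trunc1 e x) (at x)"
proof -
  let ?s = "sqrt (1 + e * x\<^sup>2)"
  have s: "?s > 0" "?s^2 = 1 + e * x\<^sup>2" "1 + e * x\<^sup>2 > 0"
    using trunc_root[of x] e by (auto simp: add_pos_nonneg zero_le_mult_iff)
  have "(trunc e has_real_derivative (?s - x * (inverse ?s / 2 * (e * (2 * x)))) / ?s^2) (at x)"
    unfolding trunc_def [abs_def]
    by (rule derivative_eq_intros refl | use s in simp)+
  also have "(?s - x * (inverse ?s / 2 * (e * (2 * x)))) / ?s^2 = trunc1 e x"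
  proof -
    have "?s - x * (inverse ?s / 2 * (e * (2 * x))) = (?s^2 - e * x^2) / ?s"
      using s(1) by (simp add: field_simps power2_eq_square)
    also have "\<dots> = 1 / ?s" using s(2) by simp
    finally show ?thesis using s(1) by (simp add: trunc1_def power2_eq_square power3_eq_cube)
  qed
  finally show ?thesis .
qed

lemma DERIV_trunc1: "(trunc1 e has_real_derivative trunc2 e x) (at x)"
proof -
  let ?s = "sqrt (1 + e * x\<^sup>2)"
  have s: "?s > 0" "?s^2 = 1 + e * x\<^sup>2" "1 + e * x\<^sup>2 > 0"
    using trunc_root[of x] e by (auto simp: add_pos_nonneg zero_le_mult_iff)
  have "(trunc1 e has_real_derivative (0 - (3 * ?s^2 * (inverse ?s / 2 * (e * (2 * x))))) / (?s^3)^2) (at x)"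
    unfolding trunc1_def [abs_def]
    by (rule derivative_eq_intros refl | use s in \<open>simp add: power2_eq_square\<close>)+
  also have "(0 - (3 * ?s^2 * (inverse ?s / 2 * (e * (2 * x))))) / (?s^3)^2 = trunc2 e x"
    using s(1) unfolding trunc2_def by (simp add: divide_simps eval_nat_numeral)
  finally show ?thesis .
qed

lemma abs_trunc_le: "\<bar>trunc e x\<bar> \<le> \<bar>x\<bar>"
  using trunc_root[of x] by (simp add: trunc_def divide_le_eq mult_le_cancel_left1)

lemma trunc_bounded: "\<bar>trunc e x\<bar> \<le> 1 / sqrt e"
proof -
  have "\<bar>x\<bar> * sqrt e = sqrt (e * x\<^sup>2)" by (simp add: real_sqrt_mult)
  also have "\<dots> \<le> sqrt (1 + e * x\<^sup>2)" by simp
  finally have "\<bar>x\<bar> * sqrt e / sqrt (1 + e * x\<^sup>2) \<le> 1" using trunc_root(1)[of x] by (subst divide_le_eq_1_pos) auto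
  then show ?thesis using trunc_root(1)[of x] e by (simp add: trunc_def field_simps)
qed

lemma trunc1_bounds: "0 \<le> trunc1 e x" "trunc1 e x \<le> 1"
  using trunc_root[of x] by (auto simp: trunc1_def divide_le_eq one_le_power)

text \<open>With r the root in the denominator, \<open>e * \<bar>x\<bar>\<close> is at most r since
  \<open>e \<le> 1\<close>, and \<open>e * x^2\<close> is at most r squared. The second bound is
  uniform although it carries an extra factor \<open>x\<close>; the induction on moments rests on
  it.\<close>

lemma trunc2_bounds: "\<bar>trunc2 e x\<bar> \<le> 3" (is ?g1) "\<bar>x * trunc2 e x\<bar> \<le> 3" (is ?g2)
proof -
  define r where "r = sqrt (1 + e * x\<^sup>2)"
  have r: "r \<ge> 1" "r^2 = 1 + e * x\<^sup>2" unfolding r_def by (rule trunc_root)+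
  have r5: "r ^ 5 > 0" using r(1) by simp
  have ab: "\<bar>trunc2 e x\<bar> = 3 * (e * \<bar>x\<bar>) / r ^ 5"
    unfolding trunc2_def r_def[symmetric] using e r(1) by (simp add: abs_mult)
  have "(e * \<bar>x\<bar>)\<^sup>2 = e * (e * x\<^sup>2)" by (simp add: power2_eq_square)
  also have "\<dots> \<le> 1 * (e * x\<^sup>2)" using e by (intro mult_right_mono) auto
  also have "\<dots> \<le> r^2" using r(2) by simp
  finally have "e * \<bar>x\<bar> \<le> r" by (rule power2_le_imp_le) (use r(1) in simp)
  also have "r ^ 1 \<le> r ^ 5" using r(1) by (intro power_increasing) auto
  finally have "3 * (e * \<bar>x\<bar>) \<le> 3 * r ^ 5" by simp
  then show ?g1 unfolding ab using r5 by (simp add: divide_le_eq)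
  have "\<bar>x\<bar> * (e * \<bar>x\<bar>) \<le> r ^ 2" using r(2) by (simp add: power2_eq_square abs_mult[symmetric] mult.left_commute[of "\<bar>x\<bar>"])
  also have "r ^ 2 \<le> r ^ 5" using r(1) by (intro power_increasing) auto
  finally have *: "3 * (\<bar>x\<bar> * (e * \<bar>x\<bar>)) \<le> 3 * r ^ 5" by simp
  have "\<bar>x * trunc2 e x\<bar> = 3 * (\<bar>x\<bar> * (e * \<bar>x\<bar>)) / r ^ 5" unfolding abs_mult ab by simp
  then show ?g2 using * r5 by (simp add: divide_le_eq)
qed

text \<open>The last three bounds do not depend on \<open>e\<close>; each \<open>3 * k\<close> comes
  from the bound 3 on \<open>trunc2\<close>. In the last one the factor \<open>x\<close> costs only
  one power, so that a moment of order \<open>k\<close> will be controlled by one of order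
  \<open>k - 1\<close>.\<close>

lemma trunc_power:
  fixes k :: nat and x :: real and G G1 G2 :: "real => real"
  defines "G \<equiv> \<lambda>x. trunc e x ^ k" and "G1 \<equiv> \<lambda>x. k * trunc e x ^ (k - 1) * trunc1 e x"
    and "G2 \<equiv> \<lambda>x. k * (k - 1) * trunc e x ^ (k - 2) * (trunc1 e x)\<^sup>2 + k * trunc e x ^ (k - 1) * trunc2 e x"
  assumes k: "k \<ge> 1"
  shows "Cb2 G" "deriv G = G1" "deriv (deriv G) = G2"
    and "\<bar>G1 x\<bar> \<le> k * \<bar>x\<bar> ^ (k - 1)" (is ?g1)
    and "\<bar>G2 x\<bar> \<le> k * (k - 1) * \<bar>x\<bar> ^ (k - 2) + 3 * k * \<bar>x\<bar> ^ (k - 1)" (is ?g2)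
    and "\<bar>x * G2 x\<bar> \<le> (k * (k - 1) + 3 * k) * \<bar>x\<bar> ^ (k - 1)" (is ?g3)
proof -
  have 1: "(G has_real_derivative G1 x) (at x)" for x
    unfolding G_def G1_def using DERIV_power[OF DERIV_trunc[of x], of k] by (simp add: mult_ac)
  have 2: "(G1 has_real_derivative G2 x) (at x)" for x
  proof -
    have "((\<lambda>x. real k * (trunc e x ^ (k - 1) * trunc1 e x)) has_real_derivative
        real k * (trunc e x ^ (k - 1) * trunc2 e x + (real (k - 1) * (trunc1 e x * trunc e x ^ (k - 1 - Suc 0))) * trunc1 e x)) (at x)"
      by (intro DERIV_cmult DERIV_mult' DERIV_power DERIV_trunc DERIV_trunc1)
    moreover have "k - 1 - Suc 0 = k - 2" by simp
    ultimately show ?thesis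
      unfolding G1_def G2_def by (simp only: power2_eq_square of_nat_mult mult_ac distrib_left add.commute)
  qed
  have nz: "sqrt (1 + e * x\<^sup>2) \<noteq> 0" for x using trunc_root[of x] by linarith
  have "continuous_on UNIV G2"
    unfolding G2_def trunc_def trunc1_def trunc2_def by (intro continuous_intros ballI nz power_not_zero)
  have pw: "\<bar>trunc e x ^ j\<bar> \<le> (1 / sqrt e) ^ j" "\<bar>trunc e x ^ j\<bar> \<le> \<bar>x\<bar> ^ j" for x j
    unfolding power_abs using trunc_bounded abs_trunc_le by (intro power_mono; simp)+
  have t1: "\<bar>trunc1 e x\<bar> \<le> 1" "(trunc1 e x)\<^sup>2 \<le> 1" for x using trunc1_bounds[of x] by (auto simp: power_le_one)
  have G1: "\<bar>G1 x\<bar> \<le> k * \<bar>trunc e x ^ (k - 1)\<bar>" for x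
    using mult_mono[OF order_refl[of "k * \<bar>trunc e x ^ (k - 1)\<bar>"] t1(1)[of x]] by (simp add: G1_def abs_mult)
  then show ?g1
    by (rule order_trans) (use pw in \<open>simp add: mult_left_mono\<close>)
  have G2: "\<bar>G2 x\<bar> \<le> k * (k - 1) * \<bar>trunc e x ^ (k - 2)\<bar> + k * \<bar>trunc e x ^ (k - 1)\<bar> * \<bar>trunc2 e x\<bar>" for x
  proof -
    have "\<bar>k * (k - 1) * trunc e x ^ (k - 2) * (trunc1 e x)\<^sup>2\<bar> \<le> k * (k - 1) * \<bar>trunc e x ^ (k - 2)\<bar> * 1"
      unfolding abs_mult by (intro mult_mono) (use t1 in auto)
    then show ?thesis unfolding G2_def
      by (intro order_trans[OF abs_triangle_ineq]) (simp add: abs_mult)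
  qed
  have G2': "\<bar>G2 x\<bar> \<le> k * (k - 1) * \<bar>trunc e x ^ (k - 2)\<bar> + 3 * k * \<bar>trunc e x ^ (k - 1)\<bar>" for x
    by (rule order_trans[OF G2])
      (use mult_left_mono[OF trunc2_bounds(1)[of x], of "k * \<bar>trunc e x ^ (k - 1)\<bar>"] in simp)
  show ?g2
    by (rule order_trans[OF G2']) (intro add_mono mult_left_mono pw; simp)
  show ?g3
  proof -
    have "\<bar>x * G2 x\<bar> \<le> \<bar>x\<bar> * (k * (k - 1) * \<bar>trunc e x ^ (k - 2)\<bar> + k * \<bar>trunc e x ^ (k - 1)\<bar> * \<bar>trunc2 e x\<bar>)"
      unfolding abs_mult by (rule mult_left_mono[OF G2]) simp
    also have "\<dots> = k * (k - 1) * (\<bar>x\<bar> * \<bar>trunc e x ^ (k - 2)\<bar>) + k * \<bar>trunc e x ^ (k - 1)\<bar> * \<bar>x * trunc2 e x\<bar>"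
      by (simp add: algebra_simps abs_mult)
    also have "\<dots> \<le> k * (k - 1) * \<bar>x\<bar> ^ (k - 1) + k * \<bar>x\<bar> ^ (k - 1) * 3"
    proof (rule add_mono)
      show "real (k * (k - 1)) * (\<bar>x\<bar> * \<bar>trunc e x ^ (k - 2)\<bar>) \<le> real (k * (k - 1)) * \<bar>x\<bar> ^ (k - 1)"
      \<comment> \<open>For \<open>k = 1\<close> truncated subtraction makes \<open>k - 2\<close>
        equal to \<open>k - 1\<close>, which would lose a power, but the coefficient
        \<open>k * (k - 1)\<close> is then zero.\<close>
      proof (cases "k = 1")
        case False
        then have "\<bar>x\<bar> ^ (k - 1) = \<bar>x\<bar> * \<bar>x\<bar> ^ (k - 2)" using k by (simp add: power_eq_if numeral_2_eq_2)
        then show ?thesis by (simp only:) (intro mult_left_mono pw; simp)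
      qed simp
      show "k * \<bar>trunc e x ^ (k - 1)\<bar> * \<bar>x * trunc2 e x\<bar> \<le> k * \<bar>x\<bar> ^ (k - 1) * 3"
        by (intro mult_mono pw trunc2_bounds) auto
    qed
    also have "\<dots> = (k * (k - 1) + 3 * k) * \<bar>x\<bar> ^ (k - 1)" by (simp add: algebra_simps)
    finally show ?thesis .
  qed
  note I = Cb2I[OF 1 2 \<open>continuous_on UNIV G2\<close>, of "(1 / sqrt e) ^ k" "k * (1 / sqrt e) ^ (k - 1)"
     "k * (k - 1) * (1 / sqrt e) ^ (k - 2) + 3 * k * (1 / sqrt e) ^ (k - 1)"]
  have b0: "\<bar>G x\<bar> \<le> (1 / sqrt e) ^ k" for x unfolding G_def by (rule pw)
  have b1: "\<bar>G1 x\<bar> \<le> k * (1 / sqrt e) ^ (k - 1)" for x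
    by (rule order_trans[OF G1]) (intro mult_left_mono pw; simp)
  have b2: "\<bar>G2 x\<bar> \<le> k * (k - 1) * (1 / sqrt e) ^ (k - 2) + 3 * k * (1 / sqrt e) ^ (k - 1)" for x
    by (rule order_trans[OF G2']) (intro add_mono mult_left_mono pw; simp)
  show "Cb2 G" "deriv G = G1" "deriv (deriv G) = G2" using I[OF b0 b1 b2] by auto
qed

end

lemma trunc_tendsto:
  assumes "(e \<longlongrightarrow> 0) F"
  shows "((\<lambda>n. trunc (e n) x) \<longlongrightarrow> x) F" (is ?g1) "((\<lambda>n. trunc1 (e n) x) \<longlongrightarrow> 1) F" (is ?g2) "((\<lambda>n. trunc2 (e n) x) \<longlongrightarrow> 0) F" (is ?g3)
proof -
  have "((\<lambda>n. sqrt (1 + e n * x\<^sup>2)) \<longlongrightarrow> sqrt (1 + 0 * x\<^sup>2)) F" by (intro tendsto_intros assms)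
  then have s: "((\<lambda>n. sqrt (1 + e n * x\<^sup>2)) \<longlongrightarrow> 1) F" by simp
  have "((\<lambda>n. trunc (e n) x) \<longlongrightarrow> x / 1) F" unfolding trunc_def by (intro tendsto_intros s) simp
  then show ?g1 by simp
  have "((\<lambda>n. trunc1 (e n) x) \<longlongrightarrow> 1 / 1 ^ 3) F" unfolding trunc1_def by (intro tendsto_intros s) simp
  then show ?g2 by simp
  have "((\<lambda>n. trunc2 (e n) x) \<longlongrightarrow> - 3 * 0 * x / 1 ^ 5) F" unfolding trunc2_def by (intro tendsto_intros s assms) simp
  then show ?g3 by simp
qed

section \<open>Two convergence criteria\<close>

text \<open>A mean value inequality for right derivatives. Consider the last time \<open>c\<close>
  up to which \<open>f\<close> stays in the cone of slope \<open>e\<close>: continuity keeps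
  \<open>c\<close> itself in the cone, and the hypothesis at \<open>c\<close> would extend it
  further unless \<open>c = b\<close>. Then \<open>e\<close> tends to zero.\<close>

lemma right_derivative_zero_imp_const:
  fixes f :: "real => real"
  assumes ab: "a \<le> b" and cont: "continuous_on {a..b} f"
    and der: "\<And>s e. s \<in> {a..<b} ==> e > 0 ==> \<exists>d>0. \<forall>r. s < r \<and> r < s + d \<and> r \<le> b \<longrightarrow> \<bar>f r - f s\<bar> \<le> e * (r - s)"
  shows "f b = f a"
proof -
  have "\<bar>f b - f a\<bar> \<le> e * (b - a)" if e: "e > 0" for e
  proof -
    define g where "g = (\<lambda>r. \<bar>f r - f a\<bar> - e * (r - a))"
    have g: "continuous_on {a..b} g" unfolding g_def by (intro continuous_intros cont)
    define S where "S = {s \<in> {a..b}. \<forall>r\<in>{a..s}. g r \<le> 0}"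
    define c where "c = Sup S"
    have aS: "a \<in> S" using ab by (auto simp: S_def g_def)
    have bd: "bdd_above S" by (auto simp: S_def)
    have c: "a \<le> c" "c \<le> b"
    proof -
      show "a \<le> c" unfolding c_def by (rule cSup_upper[OF aS bd])
      show "c \<le> b" unfolding c_def by (rule cSup_least) (use aS in \<open>auto simp: S_def\<close>)
    qed
    have lt: "g r \<le> 0" if r: "a \<le> r" "r < c" for r
    proof -
      obtain s where "s \<in> S" "r < s" using less_cSup_iff[of S r] bd aS r by (auto simp: c_def)
      then show ?thesis using r by (auto simp: S_def)
    qed
    have le: "g r \<le> 0" if "a \<le> r" "r \<le> c" for r
    proof (cases "a < c")
      case True
      have cl: "closed ({a..b} \<inter> g -` {..0})" by (rule continuous_closed_preimage[OF g]) auto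
      have "{a..<c} \<subseteq> {a..b} \<inter> g -` {..0}" using lt c by auto
      from closure_minimal[OF this cl] have "{a..c} \<subseteq> {a..b} \<inter> g -` {..0}"
        using True by (simp add: closure_atLeastLessThan)
      then show ?thesis using that by auto
    next
      case False
      then have "r = a" using that by simp
      then show ?thesis by (simp add: g_def)
    qed
    have "c = b"
    proof (rule ccontr)
      assume "c \<noteq> b"
      with c have cb: "c < b" by simp
      obtain d where d: "d > 0" "\<And>r. c < r ==> r < c + d ==> r \<le> b ==> \<bar>f r - f c\<bar> \<le> e * (r - c)"
        using der[of c e] c cb e by auto
      define c' where "c' = c + min d (b - c) / 2"
      have c': "c < c'" "c' < c + d" "c' \<le> b" using d(1) cb by (auto simp: c'_def min_def field_simps)
      have "g r \<le> 0" if "a \<le> r" "r \<le> c'" for r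
      proof (cases "r \<le> c")
        case False
        then have "\<bar>f r - f c\<bar> \<le> e * (r - c)" using d(2)[of r] that c' by auto
        moreover have "\<bar>f c - f a\<bar> \<le> e * (c - a)" using le[of c] c by (auto simp: g_def)
        ultimately show ?thesis by (auto simp: g_def algebra_simps)
      qed (use le that in auto)
      then have "c' \<in> S" using c c' by (auto simp: S_def)
      from cSup_upper[OF this bd] show False using c' by (simp add: c_def)
    qed
    then show ?thesis using le[of b] c by (auto simp: g_def)
  qed
  note * = this
  have "\<bar>f b - f a\<bar> \<le> 0"
  proof (rule field_le_epsilon)
    fix e :: real assume "e > 0"
    show "\<bar>f b - f a\<bar> \<le> 0 + e"
    proof (cases "a = b")
      case False
      then show ?thesis using *[of "e / (b - a)"] \<open>e > 0\<close> ab by simp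
    qed (use \<open>e > 0\<close> in simp)
  qed
  then show ?thesis by simp
qed

text \<open>Vitali's theorem, with bounded second moments in the role of uniform integrability.
  Fatou passes the bound to the limit; clipping at level R changes each expectation by at most C /
  R, and the clipped variables converge by dominated convergence.\<close>

lemma (in prob_space) expectation_tendsto_of_second_moment:
  fixes X :: "nat => 'a => real"
  assumes X: "\<And>n. integrable M (\<lambda>w. (X n w)\<^sup>2)" "\<And>n. X n \<in> borel_measurable M" "Y \<in> borel_measurable M"
    and C: "\<And>n. expectation (\<lambda>w. (X n w)\<^sup>2) \<le> C"
    and lim: "AE w in M. (\<lambda>n. X n w) \<longlonglongrightarrow> Y w"
  shows "integrable M (\<lambda>w. (Y w)\<^sup>2)" "expectation (\<lambda>w. (Y w)\<^sup>2) \<le> C" "integrable M Y"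
    "(\<lambda>n. expectation (X n)) \<longlonglongrightarrow> expectation Y" (is ?g1)
proof -
  note [measurable] = X(2,3)
  have C0: "0 \<le> C" by (rule order_trans[OF _ C[of 0]]) (simp add: Bochner_Integration.integral_nonneg)
  have nnX: "(\<integral>\<^sup>+w. ennreal ((X n w)\<^sup>2) \<partial>M) \<le> ennreal C" for n
    using X(1) C by (subst nn_integral_eq_integral) (auto intro: ennreal_leI)
  have "(\<integral>\<^sup>+w. ennreal ((Y w)\<^sup>2) \<partial>M) = (\<integral>\<^sup>+w. liminf (\<lambda>n. ennreal ((X n w)\<^sup>2)) \<partial>M)"
  proof (rule nn_integral_cong_AE)
    show "AE w in M. ennreal ((Y w)\<^sup>2) = liminf (\<lambda>n. ennreal ((X n w)\<^sup>2))"
      using lim by eventually_elim (rule lim_imp_Liminf[symmetric]; auto intro!: tendsto_intros)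
  qed
  also have "\<dots> \<le> liminf (\<lambda>n. \<integral>\<^sup>+w. ennreal ((X n w)\<^sup>2) \<partial>M)"
    by (rule nn_integral_liminf) measurable
  also have "\<dots> \<le> ennreal C"
    by (rule order_trans[OF Liminf_mono[of _ "\<lambda>_. ennreal C"]]) (auto simp: nnX Liminf_const)
  finally have nnY: "(\<integral>\<^sup>+w. ennreal ((Y w)\<^sup>2) \<partial>M) \<le> ennreal C" .
  then show Y2: "integrable M (\<lambda>w. (Y w)\<^sup>2)"
    by (intro integrableI_nonneg) (auto intro: le_less_trans)
  have "ennreal (expectation (\<lambda>w. (Y w)\<^sup>2)) \<le> ennreal C" using nnY Y2 by (subst (asm) nn_integral_eq_integral) auto
  then show EY: "expectation (\<lambda>w. (Y w)\<^sup>2) \<le> C" using C0 by (simp add: ennreal_le_iff)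
  have L1: "integrable M Z" if "integrable M (\<lambda>w. (Z w)\<^sup>2)" "Z \<in> borel_measurable M" for Z :: "'a => real"
    using square_integrable_imp_integrable[OF that(2,1)] .
  show iY: "integrable M Y" by (rule L1) (use Y2 in auto)
  have iX: "integrable M (X n)" for n by (rule L1) (use X in auto)
  define clip where "clip = (\<lambda>R x::real. max (-R) (min R x))"
  have clip: "\<bar>x - clip R x\<bar> \<le> x\<^sup>2 / R" if "R > 0" for R x
  proof (cases "\<bar>x\<bar> \<le> R")
    case False
    then have "\<bar>x - clip R x\<bar> * R \<le> \<bar>x\<bar> * \<bar>x\<bar>" using that by (intro mult_mono) (auto simp: clip_def)
    then show ?thesis using that by (simp add: field_simps power2_eq_square)
  qed (use that in \<open>auto simp: clip_def\<close>)
  have [measurable]: "clip R \<in> borel_measurable borel" for R unfolding clip_def by measurable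
  have clb: "\<bar>clip R x\<bar> \<le> R" if "R > 0" for R x using that by (auto simp: clip_def)
  have ic: "integrable M (\<lambda>w. clip R (Z w))" if "R > 0" "Z \<in> borel_measurable M" for R Z
    using that by (intro integrable_const_bound[where B=R]) (auto simp: clb)
  have diff: "\<bar>expectation Z - expectation (\<lambda>w. clip R (Z w))\<bar> \<le> C / R"
    if R: "R > 0" and Z[measurable]: "Z \<in> borel_measurable M" and Z2: "integrable M (\<lambda>w. (Z w)\<^sup>2)" "expectation (\<lambda>w. (Z w)\<^sup>2) \<le> C" for R Z
  proof -
    have iZ: "integrable M Z" by (rule L1[OF Z2(1) Z])
    have "\<bar>expectation Z - expectation (\<lambda>w. clip R (Z w))\<bar> = \<bar>expectation (\<lambda>w. Z w - clip R (Z w))\<bar>"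
      using iZ ic[OF R Z] by simp
    also have "\<dots> \<le> expectation (\<lambda>w. \<bar>Z w - clip R (Z w)\<bar>)" by (rule integral_abs_bound)
    also have "\<dots> \<le> expectation (\<lambda>w. (Z w)\<^sup>2 / R)"
      using iZ ic[OF R Z] Z2 clip[OF R] by (intro integral_mono) auto
    also have "\<dots> \<le> C / R" using Z2 R by (simp add: divide_right_mono)
    finally show ?thesis .
  qed
  show ?g1
  proof (rule LIMSEQ_I)
    fix e :: real assume e: "e > 0"
    \<comment> \<open>Each of the two clipping errors is below a third of \<open>e\<close>; the
      added 1 keeps \<open>R\<close> positive when \<open>C = 0\<close>.\<close>
    define R where "R = 3 * (C + 1) / e"
    have R: "R > 0" using e C0 by (simp add: R_def)
    have CR: "C / R < e / 3" using e C0 R by (simp add: R_def field_simps)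
    have "(\<lambda>n. expectation (\<lambda>w. clip R (X n w))) \<longlonglongrightarrow> expectation (\<lambda>w. clip R (Y w))"
    proof (rule integral_dominated_convergence[where w="\<lambda>_. R"])
      show "AE w in M. (\<lambda>n. clip R (X n w)) \<longlonglongrightarrow> clip R (Y w)"
        using lim by eventually_elim (auto simp: clip_def intro!: tendsto_intros)
    qed (use R in \<open>auto simp: clb\<close>)
    then obtain N where N: "\<And>n. n \<ge> N ==> \<bar>expectation (\<lambda>w. clip R (X n w)) - expectation (\<lambda>w. clip R (Y w))\<bar> < e / 3"
      using LIMSEQ_D[of _ _ "e/3"] e by (metis real_norm_def zero_less_divide_iff zero_less_numeral)
    show "\<exists>no. \<forall>n\<ge>no. norm (expectation (X n) - expectation Y) < e"
    proof (intro exI allI impI)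
      fix n assume "n \<ge> N"
      from N[OF this] diff[OF R X(2) X(1) C, of n] diff[OF R X(3) Y2 EY] CR
      show "norm (expectation (X n) - expectation Y) < e" unfolding real_norm_def by linarith
    qed
  qed
qed

section \<open>Bernstein approximation on the real line\<close>

text \<open>The operator acts on a sequence of coefficients rather than on a function, so that the
  differences of coefficients which arise by differentiation are again admissible arguments.\<close>

definition bern :: "nat => (nat => real) => real => real" where
  "bern k f z = (\<Sum>j\<le>k. f j * Bernstein k j z)"

lemma Bernstein_eq_0: "k < j ==> Bernstein k j z = 0"
  by (simp add: Bernstein_def)

lemma Bernstein_Suc: "Bernstein (Suc k) (Suc j) z = (1 - z) * Bernstein k (Suc j) z + z * Bernstein k j z"
proof (cases "j < k")
  case True
  then have "k - j = Suc (k - Suc j)" by simp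
  then show ?thesis by (simp add: Bernstein_def algebra_simps)
next
  case False
  then have "k < Suc j" by simp
  then show ?thesis by (simp add: Bernstein_def binomial_eq_0 algebra_simps)
qed

text \<open>De Casteljau's recursion, which makes the derivative formula accessible to induction on
  the degree.\<close>

lemma bern_Suc: "bern (Suc k) f z = (1 - z) * bern k f z + z * bern k (\<lambda>j. f (Suc j)) z"
proof -
  have 0: "Bernstein (Suc k) 0 z = (1 - z) * Bernstein k 0 z" by (simp add: Bernstein_def)
  have "bern k f z = (\<Sum>j\<le>Suc k. f j * Bernstein k j z)" by (simp add: bern_def Bernstein_eq_0)
  then have 1: "bern k f z = f 0 * Bernstein k 0 z + (\<Sum>j\<le>k. f (Suc j) * Bernstein k (Suc j) z)"
    by (simp only: sum.atMost_Suc_shift)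
  have "bern (Suc k) f z = f 0 * Bernstein (Suc k) 0 z + (\<Sum>j\<le>k. f (Suc j) * Bernstein (Suc k) (Suc j) z)"
    unfolding bern_def by (rule sum.atMost_Suc_shift)
  also have "(\<Sum>j\<le>k. f (Suc j) * Bernstein (Suc k) (Suc j) z) =
      (1 - z) * (\<Sum>j\<le>k. f (Suc j) * Bernstein k (Suc j) z) + z * (\<Sum>j\<le>k. f (Suc j) * Bernstein k j z)"
    unfolding sum_distrib_left sum.distrib[symmetric]
    by (rule sum.cong) (simp_all add: Bernstein_Suc algebra_simps)
  finally show ?thesis unfolding 1 by (simp add: 0 bern_def algebra_simps)
qed

lemma bern_diff: "bern k f z - bern k g z = bern k (\<lambda>j. f j - g j) z"
  by (simp add: bern_def sum_subtractf algebra_simps)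

lemma bern_cmult: "bern k (\<lambda>j. c * f j) z = c * bern k f z"
  by (simp add: bern_def sum_distrib_left mult.assoc)

lemma bern_const: "bern k (\<lambda>j. c) z = c"
  by (simp add: bern_def sum_distrib_left[symmetric])

text \<open>Differentiating de Casteljau's recursion gives the difference of two Bernstein sums plus
  two derivatives of lower degree; the recursion for the difference sequence collects them.\<close>

lemma DERIV_bern:
  "((\<lambda>z. bern (Suc k) f z) has_real_derivative real (Suc k) * bern k (\<lambda>j. f (Suc j) - f j) z) (at z)"
proof (induction k arbitrary: f z)
  case 0
  have "bern (Suc 0) f = (\<lambda>z. (1 - z) * f 0 + z * f 1)" by (auto simp: bern_def Bernstein_def)
  then show ?case
    by (auto simp: bern_def Bernstein_def intro!: derivative_eq_intros)
next
  case (Suc k)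
  let ?d = "\<lambda>j. f (Suc j) - f j"
  have "((\<lambda>z. (1 - z) * bern (Suc k) f z + z * bern (Suc k) (\<lambda>j. f (Suc j)) z) has_real_derivative
     ((0 - 1) * bern (Suc k) f z + (real (Suc k) * bern k ?d z) * (1 - z))
     + (1 * bern (Suc k) (\<lambda>j. f (Suc j)) z + (real (Suc k) * bern k (\<lambda>j. ?d (Suc j)) z) * z)) (at z)"
    by (intro DERIV_add DERIV_mult DERIV_diff DERIV_const DERIV_ident Suc.IH)
  moreover have "((0 - 1) * bern (Suc k) f z + (real (Suc k) * bern k ?d z) * (1 - z))
     + (1 * bern (Suc k) (\<lambda>j. f (Suc j)) z + (real (Suc k) * bern k (\<lambda>j. ?d (Suc j)) z) * z)
     = real (Suc (Suc k)) * bern (Suc k) ?d z"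
    unfolding bern_Suc[of k ?d z] bern_diff[symmetric, of "Suc k" "\<lambda>j. f (Suc j)" f z] bern_Suc[of k f z] bern_Suc[of k "\<lambda>j. f (Suc j)" z]
      bern_diff[symmetric, of k "\<lambda>j. f (Suc j)" f z] bern_diff[symmetric, of k "\<lambda>j. f (Suc (Suc j))" "\<lambda>j. f (Suc j)" z]
    by (simp add: algebra_simps)
  ultimately show ?case unfolding bern_Suc[of "Suc k" f, abs_def] by simp
qed

lemma bern_le:
  assumes "0 \<le> z" "z \<le> 1" "\<And>j. j \<le> k ==> f j \<le> g j"
  shows "bern k f z \<le> bern k g z"
  unfolding bern_def using assms by (intro sum_mono mult_right_mono Bernstein_nonneg) auto

lemma bern_abs_le:
  assumes z: "0 \<le> z" "z \<le> 1" and f: "\<And>j. j \<le> k ==> \<bar>f j\<bar> \<le> C"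
  shows "\<bar>bern k f z\<bar> \<le> C"
proof -
  have f': "f j \<le> C" "-C \<le> f j" if "j \<le> k" for j using f[OF that] by auto
  have "bern k f z \<le> bern k (\<lambda>_. C) z" "bern k (\<lambda>_. - C) z \<le> bern k f z"
    using f' by (intro bern_le z; simp)+
  then show ?thesis by (simp add: bern_const)
qed

text \<open>The variance of a binomial variable with \<open>k\<close> trials and success probability
  \<open>z\<close>.\<close>

lemma bern_variance:
  fixes z :: real
  shows "bern k (\<lambda>j. (real j - k * z)\<^sup>2) z = k * z * (1 - z)"
proof -
  have "bern k (\<lambda>j. (real j - k * z)\<^sup>2) z =
     (\<Sum>j\<le>k. real j * (real j - 1) * Bernstein k j z) + (1 - 2 * k * z) * (\<Sum>j\<le>k. real j * Bernstein k j z)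
       + (k * z)\<^sup>2 * (\<Sum>j\<le>k. Bernstein k j z)"
    unfolding bern_def sum_distrib_left sum.distrib[symmetric]
    by (rule sum.cong) (auto simp: power2_eq_square algebra_simps)
  also have "\<dots> = k * z * (1 - z)"
    unfolding sum_kk_Bernstein sum_k_Bernstein sum_Bernstein
    by (simp add: power2_eq_square algebra_simps)
  finally show ?thesis .
qed

section \<open>Transfer of Bernstein sums from the unit interval to the real line\<close>

definition width :: "nat => real" where "width n = real (Suc n)"
text \<open>The nodes fluctuate with variance of order \<open>width^2 / degr\<close>; the cube makes
  this of order 1 / \<open>width\<close>, so the window grows while the fluctuation
  vanishes.\<close>

definition degr :: "nat => nat" where "degr n = Suc n ^ 3"
text \<open>Two degrees are kept in reserve, one for each differentiation.\<close>

abbreviation dg :: "nat => nat" where "dg n \<equiv> Suc (Suc (degr n))"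
definition cut :: "nat => real => real" where "cut n = trunc (1 / (width n)\<^sup>2)"
definition cut1 :: "nat => real => real" where "cut1 n = trunc1 (1 / (width n)\<^sup>2)"
definition cut2 :: "nat => real => real" where "cut2 n = trunc2 (1 / (width n)\<^sup>2)"
text \<open>\<open>cut n\<close> is close to the identity near the origin and never exceeds
  \<open>width n\<close>. So every point of the line lands in the unit interval, where Bernstein
  polynomials are nonnegative, and the composites stay smooth with bounded derivatives.\<close>

definition coord :: "nat => real => real" where "coord n x = (1 + cut n x / width n) / 2"
text \<open>The preimage of the grid point \<open>j / dg n\<close> under \<open>coord n\<close> with
  \<open>cut n\<close> replaced by the identity.\<close>

definition node :: "nat => nat => real" where "node n j = width n * (2 * real j / real (dg n) - 1)"
definition bump :: "nat => nat => real => real" where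
  "bump n j x = Bernstein (dg n) j (coord n x)"

lemma width: "1 \<le> width n" "0 < 1 / (width n)\<^sup>2" "1 / (width n)\<^sup>2 \<le> 1" (is ?g1)
proof -
  show w: "1 \<le> width n" by (simp add: width_def)
  then show "0 < 1 / (width n)\<^sup>2" by simp
  show ?g1 using one_le_power[OF w, of 2] by (simp add: divide_le_eq)
qed

lemmas cut_facts = DERIV_trunc[OF width(2,3), folded cut_def cut1_def]
  DERIV_trunc1[OF width(2,3), folded cut1_def cut2_def]
  trunc1_bounds[OF width(2,3), folded cut1_def] trunc2_bounds(1)[OF width(2,3), folded cut2_def]

lemma coord_bounds: "0 \<le> coord n x" "coord n x \<le> 1"
proof -
  have "\<bar>cut n x\<bar> \<le> width n"
    using trunc_bounded[OF width(2,3), of n x] width(1)[of n] by (simp add: cut_def real_sqrt_divide)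
  then have "\<bar>cut n x / width n\<bar> \<le> 1" using width(1)[of n] by (simp add: abs_divide divide_le_eq)
  then have "- 1 \<le> cut n x / width n" "cut n x / width n \<le> 1" by linarith+
  then show "0 \<le> coord n x" "coord n x \<le> 1" by (auto simp: coord_def)
qed

lemma inverse_width_tendsto: "(\<lambda>n. 1 / width n) \<longlonglongrightarrow> 0"
  unfolding width_def using LIMSEQ_inverse_real_of_nat by (simp add: inverse_eq_divide)

lemma cut_tendsto: "(\<lambda>n. cut n x) \<longlonglongrightarrow> x" (is ?g1) "(\<lambda>n. cut1 n x) \<longlonglongrightarrow> 1" "(\<lambda>n. cut2 n x) \<longlonglongrightarrow> 0"
proof -
  have "(\<lambda>n. (1 / width n)\<^sup>2) \<longlonglongrightarrow> 0\<^sup>2" by (intro tendsto_intros inverse_width_tendsto)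
  then have "(\<lambda>n. 1 / (width n)\<^sup>2) \<longlonglongrightarrow> 0" by (simp add: power_divide)
  from trunc_tendsto[OF this] show ?g1 "(\<lambda>n. cut1 n x) \<longlonglongrightarrow> 1" "(\<lambda>n. cut2 n x) \<longlonglongrightarrow> 0"
    by (simp_all add: cut_def cut1_def cut2_def)
qed

text \<open>The distance from \<open>p j\<close> to \<open>x\<close> has three parts: the shift of
  \<open>p j\<close> off its node, the binomial fluctuation of the node around
  \<open>cut n x\<close>, and the truncation error. A degree up to two below \<open>dg n\<close>
  displaces the centre of the fluctuation slightly, whence the further term with factor 96.\<close>

lemma bern_second_moment:
  assumes p: "\<And>j. j \<le> k ==> \<bar>p j - node n j\<bar> \<le> 4 * width n / real (dg n)"
    and k: "degr n \<le> k" "k \<le> dg n"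
  shows "bern k (\<lambda>j. (p j - x)\<^sup>2) (coord n x) \<le> 78 * (1 / width n) + 3 * (cut n x - x)\<^sup>2"
proof -
  let ?N = "width n" and ?z = "coord n x"
  define M where "M = real (dg n)"
  have N: "?N \<ge> 1" by (rule width)
  have N3: "M \<ge> ?N ^ 3" by (simp add: M_def degr_def width_def)
  have M2: "M \<ge> 2" by (simp add: M_def)
  have z: "0 \<le> ?z" "?z \<le> 1" by (rule coord_bounds)+
  have cz: "cut n x = ?N * (2 * ?z - 1)" using N by (simp add: coord_def field_simps)
  have kM: "real k \<le> M" "M - real k \<le> 2" using k by (auto simp: M_def)
  have 1: "(p j - x)\<^sup>2 \<le> 3 * (4 * ?N / M)\<^sup>2 + 24 * (?N / M)\<^sup>2 * (real j - k * ?z)\<^sup>2 + 96 * (?N / M)\<^sup>2 + 3 * (cut n x - x)\<^sup>2"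
    if j: "j \<le> k" for j
  proof -
    have sq3: "(a + b + c)\<^sup>2 \<le> 3 * a\<^sup>2 + 3 * b\<^sup>2 + 3 * c\<^sup>2" for a b c :: real
      using sum_squares_ge_zero[of "a - b" "b - c"] zero_le_power2[of "a - c"] by (simp add: power2_eq_square algebra_simps)
    have sq2: "(a - b)\<^sup>2 \<le> 2 * a\<^sup>2 + 2 * b\<^sup>2" for a b :: real
      using zero_le_power2[of "a + b"] by (simp add: power2_eq_square algebra_simps)
    have "(p j - x)\<^sup>2 = ((p j - node n j) + (node n j - cut n x) + (cut n x - x))\<^sup>2" by simp
    also have "\<dots> \<le> 3 * (p j - node n j)\<^sup>2 + 3 * (node n j - cut n x)\<^sup>2 + 3 * (cut n x - x)\<^sup>2" by (rule sq3)
    finally have 1: "(p j - x)\<^sup>2 \<le> 3 * (p j - node n j)\<^sup>2 + 3 * (node n j - cut n x)\<^sup>2 + 3 * (cut n x - x)\<^sup>2" .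
    have 2: "(p j - node n j)\<^sup>2 \<le> (4 * ?N / M)\<^sup>2"
      using p[OF j] by (intro power2_le_iff_abs_le[THEN iffD2]) (use N M2 in \<open>auto simp: M_def\<close>)
    have "node n j - cut n x = (2 * (?N / M)) * ((real j - k * ?z) - (M - k) * ?z)"
      using M2 unfolding node_def M_def[symmetric] cz by (simp add: field_simps)
    then have "(node n j - cut n x)\<^sup>2 = 4 * (?N / M)\<^sup>2 * ((real j - k * ?z) - (M - k) * ?z)\<^sup>2"
      by (simp add: power2_eq_square)
    also have "\<dots> \<le> 4 * (?N / M)\<^sup>2 * (2 * (real j - k * ?z)\<^sup>2 + 2 * 4)"
    proof (rule mult_left_mono[OF order_trans[OF sq2 add_left_mono]])
      have "\<bar>(M - k) * ?z\<bar> \<le> 2 * 1" unfolding abs_mult by (intro mult_mono) (use kM z in auto)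
      then have "((M - k) * ?z)\<^sup>2 \<le> 2\<^sup>2" by (intro power2_le_iff_abs_le[THEN iffD2]) auto
      then show "2 * ((M - k) * ?z)\<^sup>2 \<le> 2 * 4" by simp
    qed auto
    finally show ?thesis using 1 2 by (simp add: algebra_simps)
  qed
  have "bern k (\<lambda>j. (p j - x)\<^sup>2) ?z \<le> bern k (\<lambda>j. 3 * (4 * ?N / M)\<^sup>2 + 24 * (?N / M)\<^sup>2 * (real j - k * ?z)\<^sup>2 + 96 * (?N / M)\<^sup>2 + 3 * (cut n x - x)\<^sup>2) ?z"
    by (rule bern_le[OF z 1])
  also have "\<dots> = 3 * (4 * ?N / M)\<^sup>2 + 24 * (?N / M)\<^sup>2 * bern k (\<lambda>j. (real j - k * ?z)\<^sup>2) ?z + 96 * (?N / M)\<^sup>2 + 3 * (cut n x - x)\<^sup>2"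
  proof -
    have "bern k (\<lambda>j. a + b * f j + c + d) y = a + b * bern k f y + c + d" for a b c d f y
      by (simp add: bern_def sum.distrib distrib_right sum_distrib_left[symmetric] mult.assoc)
    then show ?thesis by simp
  qed
  also have "\<dots> \<le> 78 * (1 / ?N) + 3 * (cut n x - x)\<^sup>2"
  proof -
    have "?z * (1 - ?z) \<le> 1/4" using zero_le_power2[of "?z - 1/2"] by (simp add: power2_eq_square algebra_simps)
    then have "k * (?z * (1 - ?z)) \<le> M * (1/4)" using kM z by (intro mult_mono) auto
    then have b: "bern k (\<lambda>j. (real j - k * ?z)\<^sup>2) ?z \<le> M / 4" unfolding bern_variance by (simp add: mult.assoc)
    have "3 * (4 * ?N / M)\<^sup>2 + 24 * (?N / M)\<^sup>2 * bern k (\<lambda>j. (real j - k * ?z)\<^sup>2) ?z + 96 * (?N / M)\<^sup>2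
      = (?N / M)\<^sup>2 * (144 + 24 * bern k (\<lambda>j. (real j - k * ?z)\<^sup>2) ?z)"
      by (simp add: power2_eq_square algebra_simps)
    \<comment> \<open>The constants collect to 144 = 3 * 16 + 96, at most \<open>72 * M\<close>
      since \<open>M \<ge> 2\<close>; the variance bound \<open>M / 4\<close> contributes
      \<open>6 * M\<close>.\<close>
    also have "\<dots> \<le> (?N / M)\<^sup>2 * (78 * M)"
      using b M2 by (intro mult_left_mono) auto
    also have "\<dots> = 78 * ?N\<^sup>2 / M" using M2 by (simp add: power2_eq_square)
    also have "\<dots> \<le> 78 * ?N\<^sup>2 / ?N ^ 3" using N3 N M2 by (intro divide_left_mono mult_pos_pos zero_less_power) auto
    also have "\<dots> = 78 * (1 / ?N)" using N by (simp add: power2_eq_square power3_eq_cube)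
    finally show ?thesis by simp
  qed
  finally show ?thesis .
qed

definition spread :: "nat => real => real" where "spread n x = 78 * (1 / width n) + 3 * (cut n x - x)\<^sup>2"

lemma spread_tendsto: "(\<lambda>n. spread n x) \<longlonglongrightarrow> 0"
proof -
  have "(\<lambda>n. spread n x) \<longlonglongrightarrow> 78 * 0 + 3 * (x - x)\<^sup>2"
    unfolding spread_def by (intro tendsto_intros inverse_width_tendsto cut_tendsto)
  then show ?thesis by simp
qed

text \<open>The bound is two grid steps, since an intermediate point for a second difference may lie
  anywhere in an interval of that length. The degree \<open>k\<close> may have dropped by one or two
  through differentiation.\<close>

definition near_node :: "nat => nat => (nat => real) => bool" where
  "near_node n k p \<longleftrightarrow> degr n \<le> k \<and> k \<le> dg n \<and>
     (\<forall>j\<le>k. \<bar>p j - node n j\<bar> \<le> 4 * width n / real (dg n))"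

text \<open>The square of the distance from \<open>x\<close> takes the place of Chebyshev's inequality.\<close>

lemma bern_close:
  assumes p: "near_node n k p" and d: "d > 0" and e: "e \<ge> 0"
    and B: "\<And>j. j \<le> k ==> \<bar>g j - L\<bar> \<le> B"
    and close: "\<And>j. j \<le> k ==> \<bar>p j - x\<bar> < d ==> \<bar>g j - L\<bar> \<le> e"
  shows "\<bar>bern k g (coord n x) - L\<bar> \<le> e + B / d\<^sup>2 * spread n x"
proof -
  have B0: "0 \<le> B" using B[of 0] by linarith
  have le: "\<bar>g j - L\<bar> \<le> e + B / d\<^sup>2 * (p j - x)\<^sup>2" if j: "j \<le> k" for j
  proof (cases "\<bar>p j - x\<bar> < d")
    case True
    moreover have "0 \<le> B / d\<^sup>2 * (p j - x)\<^sup>2" using B0 by simp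
    ultimately show ?thesis using close j by force
  next
    case False
    then have "d\<^sup>2 \<le> (p j - x)\<^sup>2" using d by (metis abs_le_square_iff abs_of_pos not_less)
    then have "1 \<le> (p j - x)\<^sup>2 / d\<^sup>2" using d by simp
    then have "B * 1 \<le> B * ((p j - x)\<^sup>2 / d\<^sup>2)" using B0 by (intro mult_left_mono) auto
    then show ?thesis using B[OF j] e by simp
  qed
  have aff: "bern k (\<lambda>j. a + b * f j) y = a + b * bern k f y" for a b f y
    by (simp add: bern_def sum.distrib distrib_right sum_distrib_left[symmetric] mult.assoc)
  have "\<bar>bern k g (coord n x) - L\<bar> = \<bar>bern k (\<lambda>j. g j - L) (coord n x)\<bar>"
    by (simp add: bern_diff[symmetric] bern_const)
  also have "\<dots> \<le> bern k (\<lambda>j. e + B / d\<^sup>2 * (p j - x)\<^sup>2) (coord n x)"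
  proof (rule abs_leI)
    show "bern k (\<lambda>j. g j - L) (coord n x) \<le> bern k (\<lambda>j. e + B / d\<^sup>2 * (p j - x)\<^sup>2) (coord n x)"
      using le by (intro bern_le coord_bounds) force
    have "bern k (\<lambda>j. (-1) * (g j - L)) (coord n x) \<le> bern k (\<lambda>j. e + B / d\<^sup>2 * (p j - x)\<^sup>2) (coord n x)"
      using le by (intro bern_le coord_bounds) force
    then show "- bern k (\<lambda>j. g j - L) (coord n x) \<le> bern k (\<lambda>j. e + B / d\<^sup>2 * (p j - x)\<^sup>2) (coord n x)"
      unfolding bern_cmult by simp
  qed
  also have "\<dots> = e + B / d\<^sup>2 * bern k (\<lambda>j. (p j - x)\<^sup>2) (coord n x)"
    by (rule aff)
  also have "\<dots> \<le> e + B / d\<^sup>2 * spread n x"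
    unfolding spread_def using p B0
    by (intro add_left_mono mult_left_mono bern_second_moment) (auto simp: near_node_def)
  finally show ?thesis .
qed

text \<open>The coefficients change with \<open>n\<close> because the derivatives of
  \<open>W\<close> are sampled at the projected measure. Far from \<open>x\<close> boundedness
  suffices, as the square of the distance has vanishing mean.\<close>

lemma bern_tendsto:
  fixes k :: "nat => nat"
  assumes p: "\<And>n. near_node n (k n) (p n)"
    and C: "\<And>n j. j \<le> k n ==> \<bar>g n j\<bar> \<le> C"
    and L: "\<And>e. e > 0 ==> \<exists>d>0. \<forall>\<^sub>F n in sequentially. \<forall>j\<le>k n. \<bar>p n j - x\<bar> < d \<longrightarrow> \<bar>g n j - L\<bar> \<le> e"
  shows "(\<lambda>n. bern (k n) (g n) (coord n x)) \<longlonglongrightarrow> L"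
proof (rule LIMSEQ_I)
  fix e :: real assume e: "e > 0"
  obtain d where d: "d > 0" and ev: "\<forall>\<^sub>F n in sequentially. \<forall>j\<le>k n. \<bar>p n j - x\<bar> < d \<longrightarrow> \<bar>g n j - L\<bar> \<le> e / 2"
    using L[of "e/2"] e by auto
  have "(\<lambda>n. (C + \<bar>L\<bar>) / d\<^sup>2 * spread n x) \<longlonglongrightarrow> (C + \<bar>L\<bar>) / d\<^sup>2 * 0" by (intro tendsto_intros spread_tendsto)
  then have "\<forall>\<^sub>F n in sequentially. (C + \<bar>L\<bar>) / d\<^sup>2 * spread n x < e / 2"
    using e by (intro order_tendstoD(2)[where a="e/2"]) auto
  with ev have "\<forall>\<^sub>F n in sequentially. norm (bern (k n) (g n) (coord n x) - L) < e"
  proof eventually_elim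
    case (elim n)
    have "\<bar>bern (k n) (g n) (coord n x) - L\<bar> \<le> e / 2 + (C + \<bar>L\<bar>) / d\<^sup>2 * spread n x"
    proof (rule bern_close[OF p d])
      fix j assume j: "j \<le> k n"
      show "\<bar>g n j - L\<bar> \<le> C + \<bar>L\<bar>" using C[OF j] by linarith
      show "\<bar>p n j - x\<bar> < d ==> \<bar>g n j - L\<bar> \<le> e / 2" using elim j by auto
    qed (use e in simp)
    with elim(2) show ?case unfolding real_norm_def by linarith
  qed
  then show "\<exists>no. \<forall>n\<ge>no. norm (bern (k n) (g n) (coord n x) - L) < e"
    by (simp add: eventually_sequentially)
qed

text \<open>Continuous convergence of \<open>H n\<close> to \<open>L\<close> at \<open>x\<close>.
  Joint continuity in measure and position takes this form once the measure is itself a convergent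
  sequence.\<close>

definition ucont :: "(nat => real => real) => real => real => bool" where
  "ucont H x L \<longleftrightarrow> (\<forall>e>0. \<exists>d>0. \<forall>\<^sub>F n in sequentially. \<forall>\<xi>. \<bar>\<xi> - x\<bar> < d \<longrightarrow> \<bar>H n \<xi> - L\<bar> \<le> e)"

text \<open>Both variables approach the same point, since the second derivative enters the generator
  only on the diagonal.\<close>

definition ucont2 :: "(nat => real => real => real) => real => real => bool" where
  "ucont2 H x L \<longleftrightarrow> (\<forall>e>0. \<exists>d>0. \<forall>\<^sub>F n in sequentially. \<forall>\<xi> \<eta>. \<bar>\<xi> - x\<bar> < d \<longrightarrow> \<bar>\<eta> - x\<bar> < d \<longrightarrow> \<bar>H n \<xi> \<eta> - L\<bar> \<le> e)"

lemma bern_tendsto_ucont: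
  fixes k :: "nat => nat"
  assumes p: "\<And>n. near_node n (k n) (p n)" and C: "\<And>n \<xi>. \<bar>H n \<xi>\<bar> \<le> C" and L: "ucont H x L"
  shows "(\<lambda>n. bern (k n) (\<lambda>j. H n (p n j)) (coord n x)) \<longlonglongrightarrow> L"
proof (rule bern_tendsto[OF p])
  show "\<bar>H n (p n j)\<bar> \<le> C" for n j by (rule C)
  fix e :: real assume "e > 0"
  then obtain d where "d > 0" "\<forall>\<^sub>F n in sequentially. \<forall>\<xi>. \<bar>\<xi> - x\<bar> < d \<longrightarrow> \<bar>H n \<xi> - L\<bar> \<le> e"
    using L by (auto simp: ucont_def)
  then show "\<exists>d>0. \<forall>\<^sub>F n in sequentially. \<forall>j\<le>k n. \<bar>p n j - x\<bar> < d \<longrightarrow> \<bar>H n (p n j) - L\<bar> \<le> e"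
    by (intro exI[of _ d]) (auto elim: eventually_mono)
qed

lemma near_node_node: "near_node n (dg n) (node n)"
  using width(1)[of n] by (auto simp: near_node_def)

text \<open>The inner sum is within \<open>e\<close> of \<open>L\<close> for all outer nodes near
  \<open>x\<close> simultaneously, because the error term of \<open>bern_close\<close> does not
  involve the outer node. The outer sum then converges as in one variable.\<close>

lemma bern_tendsto_ucont2:
  assumes C: "\<And>n \<xi> \<eta>. \<bar>H n \<xi> \<eta>\<bar> \<le> C" and L: "ucont2 H x L"
  shows "(\<lambda>n. bern (dg n) (\<lambda>i. bern (dg n) (\<lambda>j. H n (node n i) (node n j)) (coord n x)) (coord n x)) \<longlonglongrightarrow> L"
proof (rule bern_tendsto[OF near_node_node])
  show "\<bar>bern (dg n) (\<lambda>j. H n (node n i) (node n j)) (coord n x)\<bar> \<le> C" for n i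
    by (intro bern_abs_le coord_bounds C)
  fix e :: real assume e: "e > 0"
  then obtain d where d: "d > 0" "\<forall>\<^sub>F n in sequentially. \<forall>\<xi> \<eta>. \<bar>\<xi> - x\<bar> < d \<longrightarrow> \<bar>\<eta> - x\<bar> < d \<longrightarrow> \<bar>H n \<xi> \<eta> - L\<bar> \<le> e / 2"
    using L[unfolded ucont2_def, rule_format, OF half_gt_zero[OF e]] by blast
  have "(\<lambda>n. (C + \<bar>L\<bar>) / d\<^sup>2 * spread n x) \<longlonglongrightarrow> (C + \<bar>L\<bar>) / d\<^sup>2 * 0" by (intro tendsto_intros spread_tendsto)
  then have "\<forall>\<^sub>F n in sequentially. (C + \<bar>L\<bar>) / d\<^sup>2 * spread n x < e / 2"
    using e by (intro order_tendstoD(2)[where a="e/2"]) auto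
  with d(2) have "\<forall>\<^sub>F n in sequentially. \<forall>i\<le>dg n. \<bar>node n i - x\<bar> < d \<longrightarrow>
      \<bar>bern (dg n) (\<lambda>j. H n (node n i) (node n j)) (coord n x) - L\<bar> \<le> e"
  proof eventually_elim
    case (elim n)
    show ?case
    proof (intro allI impI)
      fix i assume i: "\<bar>node n i - x\<bar> < d"
      have "\<bar>bern (dg n) (\<lambda>j. H n (node n i) (node n j)) (coord n x) - L\<bar> \<le> e / 2 + (C + \<bar>L\<bar>) / d\<^sup>2 * spread n x"
      proof (rule bern_close[OF near_node_node d(1)])
        fix j
        show "\<bar>H n (node n i) (node n j) - L\<bar> \<le> C + \<bar>L\<bar>" using C[of n "node n i" "node n j"] by linarith
        show "\<bar>node n j - x\<bar> < d ==> \<bar>H n (node n i) (node n j) - L\<bar> \<le> e / 2" using elim i by auto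
      qed (use e in simp)
      with elim(2) show "\<bar>bern (dg n) (\<lambda>j. H n (node n i) (node n j)) (coord n x) - L\<bar> \<le> e" by linarith
    qed
  qed
  with d(1) show "\<exists>d>0. \<forall>\<^sub>F n in sequentially. \<forall>i\<le>dg n. \<bar>node n i - x\<bar> < d \<longrightarrow>
      \<bar>bern (dg n) (\<lambda>j. H n (node n i) (node n j)) (coord n x) - L\<bar> \<le> e" by blast
qed

section \<open>Derivatives of the approximants\<close>

definition appr :: "nat => (nat => real) => real => real" where
  "appr n f x = bern (dg n) f (coord n x)"

definition appr1 :: "nat => (nat => real) => real => real" where
  "appr1 n f x = real (dg n) * bern (Suc (degr n)) (\<lambda>j. f (Suc j) - f j) (coord n x) * (cut1 n x / (2 * width n))"

definition appr2 :: "nat => (nat => real) => real => real" where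
  "appr2 n f x = real (dg n) * (real (Suc (degr n)) *
      bern (degr n) (\<lambda>j. f (Suc (Suc j)) - f (Suc j) - (f (Suc j) - f j)) (coord n x) * (cut1 n x / (2 * width n))) * (cut1 n x / (2 * width n))
     + real (dg n) * bern (Suc (degr n)) (\<lambda>j. f (Suc j) - f j) (coord n x) * (cut2 n x / (2 * width n))"

lemma DERIV_coord: "(coord n has_real_derivative cut1 n x / (2 * width n)) (at x)"
  unfolding coord_def[abs_def] using width(1)[of n]
  by (auto intro!: derivative_eq_intros cut_facts)

lemma Cb2_appr: "Cb2 (appr n f)" "deriv (appr n f) = appr1 n f" (is ?g1) "deriv (deriv (appr n f)) = appr2 n f"
proof -
  let ?M = "dg n"
  have b: "((\<lambda>x. bern (Suc k) f (coord n x)) has_real_derivative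
     real (Suc k) * bern k (\<lambda>j. f (Suc j) - f j) (coord n x) * (cut1 n x / (2 * width n))) (at x)" for k f x
    by (rule DERIV_chain2[OF DERIV_bern DERIV_coord])
  have d1: "(appr n f has_real_derivative appr1 n f x) (at x)" for x
    unfolding appr_def[abs_def] appr1_def by (rule b)
  have c: "((\<lambda>x. cut1 n x / (2 * width n)) has_real_derivative cut2 n x / (2 * width n)) (at x)" for x
    by (intro DERIV_cdivide cut_facts)
  have d2: "(appr1 n f has_real_derivative appr2 n f x) (at x)" for x
    unfolding appr1_def[abs_def] appr2_def
    by (rule DERIV_cong[OF DERIV_mult'[OF DERIV_cmult[OF b] c]]) (simp add: algebra_simps)
  have cc: "continuous_on UNIV (coord n)"
    by (rule DERIV_continuous_on, rule has_field_derivative_at_within, rule DERIV_coord)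
  have cb: "continuous_on UNIV (\<lambda>x. bern k f (coord n x))" for k f
    unfolding bern_def Bernstein_def by (intro continuous_intros cc)
  have nz: "sqrt (1 + 1 / (width n)\<^sup>2 * x\<^sup>2) \<noteq> 0" for x using trunc_root(1)[OF width(2,3), of n x] by linarith
  have c2: "continuous_on UNIV (cut2 n)"
    unfolding cut2_def trunc2_def[abs_def] by (intro continuous_intros ballI power_not_zero nz)
  have c1: "continuous_on UNIV (cut1 n)"
    by (rule DERIV_continuous_on, rule has_field_derivative_at_within, rule cut_facts)
  have w: "2 * width n \<noteq> 0" using width(1)[of n] by simp
  have c3: "continuous_on UNIV (appr2 n f)"
    unfolding appr2_def[abs_def] by (intro continuous_intros cb c1 c2) (use w in auto)
  define K where "K = (\<Sum>j\<le>?M. \<bar>f j\<bar>)"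
  have K0: "0 \<le> K" by (simp add: K_def sum_nonneg)
  have K: "\<bar>f j\<bar> \<le> K" if "j \<le> ?M" for j unfolding K_def using that by (intro member_le_sum) auto
  have b0: "\<bar>bern ?M f (coord n x)\<bar> \<le> K" for x by (intro bern_abs_le coord_bounds K)
  have b1: "\<bar>bern (Suc (degr n)) (\<lambda>j. f (Suc j) - f j) (coord n x)\<bar> \<le> 2 * K" for x
  proof (intro bern_abs_le coord_bounds)
    fix j assume "j \<le> Suc (degr n)" with K[of j] K[of "Suc j"] show "\<bar>f (Suc j) - f j\<bar> \<le> 2 * K" by linarith
  qed
  have b2: "\<bar>bern (degr n) (\<lambda>j. f (Suc (Suc j)) - f (Suc j) - (f (Suc j) - f j)) (coord n x)\<bar> \<le> 4 * K" for x
  proof (intro bern_abs_le coord_bounds)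
    fix j assume "j \<le> degr n" with K[of j] K[of "Suc j"] K[of "Suc (Suc j)"]
    show "\<bar>f (Suc (Suc j)) - f (Suc j) - (f (Suc j) - f j)\<bar> \<le> 4 * K" by linarith
  qed
  have a1: "\<bar>cut1 n x / (2 * width n)\<bar> \<le> 1" for x using cut_facts(3,4)[of n x] width(1)[of n] by (simp add: divide_le_eq)
  have a2: "\<bar>cut2 n x / (2 * width n)\<bar> \<le> 3" for x using cut_facts(5)[of n x] width(1)[of n] by (simp add: divide_le_eq)
  have B1: "\<bar>appr1 n f x\<bar> \<le> real ?M * (2 * K) * 1" for x
    unfolding appr1_def abs_mult by (intro mult_mono b1 a1) (use K0 in auto)
  have B2: "\<bar>appr2 n f x\<bar> \<le> real ?M * (real (Suc (degr n)) * (4 * K) * 1) * 1 + real ?M * (2 * K) * 3" for x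
    unfolding appr2_def
    apply (rule order_trans[OF abs_triangle_ineq])
    unfolding abs_mult by (intro add_mono mult_mono b1 b2 a1 a2) (use K0 in auto)
  note I = Cb2I[OF d1 d2 c3, OF b0[folded appr_def] B1 B2]
  show "Cb2 (appr n f)" ?g1 "deriv (deriv (appr n f)) = appr2 n f" by (rule I)+
qed

text \<open>A bump belongs to a unit coefficient sequence and so inherits smoothness and bounds from
  the general approximant. The right-hand side vanishes identically for \<open>j\<close> above the
  degree, as does the bump.\<close>

lemma bump_eq_appr: "bump n j = appr n (\<lambda>i. if i = j then 1 else 0)"
proof
  fix x
  have "appr n (\<lambda>i. if i = j then 1 else 0) x = (\<Sum>i\<le>dg n. if i = j then Bernstein (dg n) i (coord n x) else 0)"
    unfolding appr_def bern_def by (intro sum.cong) auto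
  also have "\<dots> = bump n j x" by (auto simp: bump_def Bernstein_eq_0)
  finally show "bump n j x = appr n (\<lambda>i. if i = j then 1 else 0) x" ..
qed

lemma Cb2_bump: "Cb2 (bump n j)"
  unfolding bump_eq_appr by (rule Cb2_appr)

lemma bump_nonneg: "0 \<le> bump n j x"
  by (simp add: bump_def Bernstein_nonneg coord_bounds)

lemma sum_bump: "(\<Sum>j\<le>dg n. f j * bump n j x) = appr n f x"
  by (simp add: bump_def appr_def bern_def)

text \<open>Both sides differentiate the same function, so uniqueness of derivatives replaces a
  computation with single Bernstein polynomials.\<close>

lemma sum_bump_deriv:
  "(\<Sum>j\<le>dg n. f j * deriv (bump n j) x) = appr1 n f x" (is ?g1)
  "(\<Sum>j\<le>dg n. f j * deriv (deriv (bump n j)) x) = appr2 n f x" (is ?g2)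
proof -
  have 1: "(\<Sum>j\<le>dg n. f j * deriv (bump n j) x) = appr1 n f x" for x
  proof (rule DERIV_unique)
    show "((\<lambda>x. \<Sum>j\<le>dg n. f j * bump n j x) has_real_derivative (\<Sum>j\<le>dg n. f j * deriv (bump n j) x)) (at x)"
      by (intro DERIV_sum DERIV_cmult Cb2_deriv Cb2_bump)
    show "((\<lambda>x. \<Sum>j\<le>dg n. f j * bump n j x) has_real_derivative appr1 n f x) (at x)"
      unfolding sum_bump using Cb2_deriv(1)[OF Cb2_appr(1)] Cb2_appr(2) by metis
  qed
  then show ?g1 .
  show ?g2
  proof (rule DERIV_unique)
    show "((\<lambda>x. \<Sum>j\<le>dg n. f j * deriv (bump n j) x) has_real_derivative (\<Sum>j\<le>dg n. f j * deriv (deriv (bump n j)) x)) (at x)"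
      by (intro DERIV_sum DERIV_cmult Cb2_deriv Cb2_bump)
    show "((\<lambda>x. \<Sum>j\<le>dg n. f j * deriv (bump n j) x) has_real_derivative appr2 n f x) (at x)"
      unfolding 1 Cb2_appr(3)[symmetric] Cb2_appr(2)[symmetric] by (rule Cb2_deriv(2)[OF Cb2_appr(1)])
  qed
qed

lemma node_Suc: "node n (Suc j) - node n j = 2 * width n / real (dg n)"
proof -
  define M where "M = real (dg n)"
  have "M > 0" by (simp add: M_def)
  then show ?thesis unfolding node_def M_def[symmetric] by (simp add: field_simps)
qed

text \<open>The degree, the grid step and the slope of the affine part of \<open>coord\<close>
  multiply to one, so each difference turns into a derivative at an intermediate point without any
  stray factor. The second differentiation brings down the degree lowered by one, which leaves the
  quotient \<open>Suc (degr n) / dg n\<close>.\<close>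

lemma appr_of_smooth:
  assumes 1: "\<And>x. (h has_real_derivative h' x) (at x)" and 2: "\<And>x. (h' has_real_derivative h'' x) (at x)"
  obtains \<xi> \<eta> where "near_node n (Suc (degr n)) \<xi>" "near_node n (degr n) \<eta>"
    "\<And>x. appr1 n (\<lambda>j. h (node n j)) x = bern (Suc (degr n)) (\<lambda>j. h' (\<xi> j)) (coord n x) * cut1 n x"
    "\<And>x. appr2 n (\<lambda>j. h (node n j)) x = real (Suc (degr n)) / real (dg n) *
        bern (degr n) (\<lambda>j. h'' (\<eta> j)) (coord n x) * (cut1 n x)\<^sup>2 + bern (Suc (degr n)) (\<lambda>j. h' (\<xi> j)) (coord n x) * cut2 n x"
proof -
  define D where "D = 2 * width n / real (dg n)"
  have w: "width n > 0" using width(1)[of n] by simp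
  have D: "D > 0" using w by (simp add: D_def)
  have nd: "node n (Suc j) = node n j + D" for j using node_Suc[of n j] by (simp add: D_def)
  have "\<exists>\<xi>. node n j \<le> \<xi> \<and> \<xi> \<le> node n j + D \<and> h (node n (Suc j)) - h (node n j) = D * h' \<xi>" for j
    using MVT2[of "node n j" "node n j + D" h h'] 1 D unfolding nd by (auto intro: less_imp_le)
  then obtain \<xi> where \<xi>: "\<And>j. node n j \<le> \<xi> j" "\<And>j. \<xi> j \<le> node n j + D"
    "\<And>j. h (node n (Suc j)) - h (node n j) = D * h' (\<xi> j)" by metis
  have "\<exists>\<eta>. node n j \<le> \<eta> \<and> \<eta> \<le> node n j + 2 * D \<and>
     h (node n (Suc (Suc j))) - h (node n (Suc j)) - (h (node n (Suc j)) - h (node n j)) = D\<^sup>2 * h'' \<eta>" for j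
  proof -
    have sh: "((\<lambda>y. h (y + D)) has_real_derivative h' (y + D)) (at y)" for y
      by (rule DERIV_shift[THEN iffD1, OF 1])
    \<comment> \<open>The second difference is a first difference of \<open>h (y + D) - h y\<close>,
      so the mean value theorem is used for this function and then for \<open>h'\<close>.\<close>
    have "\<exists>z>node n j. z < node n j + D \<and> (\<lambda>y. h (y + D) - h y) (node n j + D) - (\<lambda>y. h (y + D) - h y) (node n j)
        = (node n j + D - node n j) * (\<lambda>y. h' (y + D) - h' y) z"
      by (rule MVT2) (use D in simp, rule DERIV_diff[OF sh 1])
    then obtain z where z: "node n j < z" "z < node n j + D"
      "(h (node n j + D + D) - h (node n j + D)) - (h (node n j + D) - h (node n j)) = D * (h' (z + D) - h' z)"
      by auto
    obtain u where u: "z < u" "u < z + D" "h' (z + D) - h' z = D * h'' u"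
      using MVT2[of z "z + D" h' h''] D 2 by auto
    show ?thesis using z u by (intro exI[of _ u]) (auto simp: nd power2_eq_square)
  qed
  then obtain \<eta> where \<eta>: "\<And>j. node n j \<le> \<eta> j" "\<And>j. \<eta> j \<le> node n j + 2 * D"
    "\<And>j. h (node n (Suc (Suc j))) - h (node n (Suc j)) - (h (node n (Suc j)) - h (node n j)) = D\<^sup>2 * h'' (\<eta> j)" by metis
  have D4: "4 * width n / real (dg n) = 2 * D" by (simp add: D_def)
  show thesis
  proof
    show "near_node n (Suc (degr n)) \<xi>"
      unfolding near_node_def D4
    proof (intro conjI allI impI)
      fix j show "\<bar>\<xi> j - node n j\<bar> \<le> 2 * D" using \<xi>(1,2)[of j] D by linarith
    qed auto
    show "near_node n (degr n) \<eta>"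
      unfolding near_node_def D4
    proof (intro conjI allI impI)
      fix j show "\<bar>\<eta> j - node n j\<bar> \<le> 2 * D" using \<eta>(1,2)[of j] D by linarith
    qed auto
    have M: "real (dg n) * D / (2 * width n) = 1" using w by (simp add: D_def)
    have x1: "real (dg n) * (D * B) * (c / (2 * width n)) = B * c" for B c
      using w by (simp add: D_def)
    show "appr1 n (\<lambda>j. h (node n j)) x = bern (Suc (degr n)) (\<lambda>j. h' (\<xi> j)) (coord n x) * cut1 n x" for x
      unfolding appr1_def \<xi>(3) bern_cmult by (rule x1)
    have x2: "real (dg n) * (real (Suc (degr n)) * (D\<^sup>2 * B) * (c / (2 * width n))) * (c / (2 * width n))
       = real (Suc (degr n)) / real (dg n) * B * c\<^sup>2" for B c
    proof -
      define M where "M = real (dg n)"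
      have M: "M > 0" by (simp add: M_def)
      have DM: "D = 2 * width n / M" by (simp only: D_def M_def)
      show ?thesis unfolding M_def[symmetric] using w M by (simp add: DM power2_eq_square)
    qed
    show "appr2 n (\<lambda>j. h (node n j)) x = real (Suc (degr n)) / real (dg n) *
        bern (degr n) (\<lambda>j. h'' (\<eta> j)) (coord n x) * (cut1 n x)\<^sup>2 + bern (Suc (degr n)) (\<lambda>j. h' (\<xi> j)) (coord n x) * cut2 n x" for x
      unfolding appr2_def \<eta>(3) unfolding \<xi>(3) bern_cmult x1 x2 ..
  qed
qed

text \<open>In the factor 4, one comes from the second derivative of \<open>h\<close> and three from
  the bound on \<open>cut2\<close>.\<close>

lemma appr_bounds:
  assumes "\<And>x. (h has_real_derivative h' x) (at x)" "\<And>x. (h' has_real_derivative h'' x) (at x)"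
    and C: "\<And>x. \<bar>h' x\<bar> \<le> C" "\<And>x. \<bar>h'' x\<bar> \<le> C"
  shows "\<bar>appr1 n (\<lambda>j. h (node n j)) x\<bar> \<le> C" (is ?g1) "\<bar>appr2 n (\<lambda>j. h (node n j)) x\<bar> \<le> 4 * C" (is ?g2)
proof -
  obtain \<xi> \<eta> where *: "\<And>x. appr1 n (\<lambda>j. h (node n j)) x = bern (Suc (degr n)) (\<lambda>j. h' (\<xi> j)) (coord n x) * cut1 n x"
    "\<And>x. appr2 n (\<lambda>j. h (node n j)) x = real (Suc (degr n)) / real (dg n) *
        bern (degr n) (\<lambda>j. h'' (\<eta> j)) (coord n x) * (cut1 n x)\<^sup>2 + bern (Suc (degr n)) (\<lambda>j. h' (\<xi> j)) (coord n x) * cut2 n x"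
    by (rule appr_of_smooth[OF assms(1,2), where n=n]) blast
  have C0: "0 \<le> C" using C(1)[of 0] by linarith
  have c: "\<bar>cut1 n x\<bar> \<le> 1" "\<bar>(cut1 n x)\<^sup>2\<bar> \<le> 1" "\<bar>cut2 n x\<bar> \<le> 3"
    using cut_facts(3-5)[of n x] by (auto simp: power_le_one)
  have b: "\<bar>bern (Suc (degr n)) (\<lambda>j. h' (\<xi> j)) (coord n x)\<bar> \<le> C" "\<bar>bern (degr n) (\<lambda>j. h'' (\<eta> j)) (coord n x)\<bar> \<le> C"
    by (intro bern_abs_le coord_bounds C)+
  have "\<bar>appr1 n (\<lambda>j. h (node n j)) x\<bar> \<le> C * 1"
    unfolding * abs_mult by (intro mult_mono b c) (use C0 in auto)
  then show ?g1 by simp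
  have "\<bar>appr2 n (\<lambda>j. h (node n j)) x\<bar> \<le> 1 * C * 1 + C * 3"
    unfolding *
    apply (rule order_trans[OF abs_triangle_ineq])
    unfolding abs_mult by (intro add_mono mult_mono b c) (use C0 in auto)
  then show ?g2 by simp
qed

lemma degr_ratio_tendsto: "(\<lambda>n. real (Suc (degr n)) / real (dg n)) \<longlonglongrightarrow> 1"
proof -
  have "(\<lambda>n. 1 / real (dg n)) \<longlonglongrightarrow> 0"
  proof (rule tendsto_sandwich[OF _ _ tendsto_const inverse_width_tendsto])
    show "\<forall>\<^sub>F n in sequentially. 1 / real (dg n) \<le> 1 / width n"
    proof (rule always_eventually, rule allI)
      fix n
      have "Suc n ^ 1 \<le> Suc n ^ 3" by (intro power_increasing) auto
      then have "Suc n \<le> Suc (Suc (Suc n ^ 3))" by simp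
      then have "width n \<le> real (dg n)" unfolding width_def degr_def by (simp only: of_nat_le_iff)
      then show "1 / real (dg n) \<le> 1 / width n"
        using width(1)[of n] by (intro divide_left_mono) auto
    qed
  qed auto
  then have "(\<lambda>n. 1 - 1 / real (dg n)) \<longlonglongrightarrow> 1 - 0" by (intro tendsto_intros)
  moreover have "1 - 1 / real (dg n) = real (Suc (degr n)) / real (dg n)" for n
    by (simp add: field_simps)
  ultimately show ?thesis by simp
qed

lemma appr_tendsto:
  assumes H: "\<And>n x. (H n has_real_derivative H1 n x) (at x)" "\<And>n x. (H1 n has_real_derivative H2 n x) (at x)"
    and C: "\<And>n x. \<bar>H1 n x\<bar> \<le> C" "\<And>n x. \<bar>H2 n x\<bar> \<le> C"
    and L: "ucont H1 x L1" "ucont H2 x L2"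
  shows "(\<lambda>n. appr1 n (\<lambda>j. H n (node n j)) x) \<longlonglongrightarrow> L1" (is ?g1) "(\<lambda>n. appr2 n (\<lambda>j. H n (node n j)) x) \<longlonglongrightarrow> L2" (is ?g2)
proof -
  have "\<exists>\<xi> \<eta>. near_node n (Suc (degr n)) \<xi> \<and> near_node n (degr n) \<eta> \<and>
    (\<forall>x. appr1 n (\<lambda>j. H n (node n j)) x = bern (Suc (degr n)) (\<lambda>j. H1 n (\<xi> j)) (coord n x) * cut1 n x) \<and>
    (\<forall>x. appr2 n (\<lambda>j. H n (node n j)) x = real (Suc (degr n)) / real (dg n) *
        bern (degr n) (\<lambda>j. H2 n (\<eta> j)) (coord n x) * (cut1 n x)\<^sup>2 + bern (Suc (degr n)) (\<lambda>j. H1 n (\<xi> j)) (coord n x) * cut2 n x)" for n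
    by (rule appr_of_smooth[OF H, of n n]) blast
  then obtain \<xi> \<eta> where nn: "\<And>n. near_node n (Suc (degr n)) (\<xi> n)" "\<And>n. near_node n (degr n) (\<eta> n)"
    and *: "\<And>n x. appr1 n (\<lambda>j. H n (node n j)) x = bern (Suc (degr n)) (\<lambda>j. H1 n (\<xi> n j)) (coord n x) * cut1 n x"
    "\<And>n x. appr2 n (\<lambda>j. H n (node n j)) x = real (Suc (degr n)) / real (dg n) *
        bern (degr n) (\<lambda>j. H2 n (\<eta> n j)) (coord n x) * (cut1 n x)\<^sup>2 + bern (Suc (degr n)) (\<lambda>j. H1 n (\<xi> n j)) (coord n x) * cut2 n x"
    by metis
  note lim = bern_tendsto_ucont[of "\<lambda>n. Suc (degr n)" \<xi> H1 C x L1, OF nn(1) C(1) L(1)]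
    bern_tendsto_ucont[of "\<lambda>n. degr n" \<eta> H2 C x L2, OF nn(2) C(2) L(2)]
  have "(\<lambda>n. appr1 n (\<lambda>j. H n (node n j)) x) \<longlonglongrightarrow> L1 * 1"
    unfolding * by (intro tendsto_intros lim cut_tendsto)
  then show ?g1 by simp
  have "(\<lambda>n. appr2 n (\<lambda>j. H n (node n j)) x) \<longlonglongrightarrow> 1 * L2 * 1\<^sup>2 + L1 * 0"
    unfolding * by (intro tendsto_intros lim cut_tendsto degr_ratio_tendsto)
  then show ?g2 by simp
qed

section \<open>Projection of a measure to finitely many atoms\<close>

definition proj :: "nat => real finmeas => real finmeas" where
  "proj n \<nu> = atoms {..dg n} (node n) (\<lambda>j. pairing (bump n j) \<nu>)"

lemma pairing_nonneg: "(\<And>x. 0 \<le> f x) ==> 0 \<le> pairing f \<nu>"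
  by (simp add: pairing_def)

lemma borel_measurable_appr [measurable]: "appr n g \<in> borel_measurable borel"
  using Cb2_deriv(3)[OF Cb2_appr(1)] by (rule borel_measurable_bcont)

lemma pairing_proj:
  assumes "f \<in> borel_measurable borel"
  shows "pairing f (proj n \<nu>) = (\<integral>x. appr n (\<lambda>j. f (node n j)) x \<partial>meas \<nu>)"
proof -
  have bm[measurable]: "bump n j \<in> borel_measurable borel" for n j
    using Cb2_deriv(3)[OF Cb2_bump] by (rule borel_measurable_bcont)
  have ib: "integrable (meas \<nu>) (bump n j)" for n j
  proof -
    obtain K where "\<And>x. \<bar>bump n j x\<bar> \<le> K" using Cb2_bound[OF Cb2_bump] by metis
    then show ?thesis by (intro integrable_meas_bounded bm)
  qed
  have "pairing f (proj n \<nu>) = (\<Sum>j\<le>dg n. pairing (bump n j) \<nu> * f (node n j))"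
    unfolding proj_def by (intro pairing_atoms assms pairing_nonneg bump_nonneg) simp
  also have "\<dots> = (\<integral>x. (\<Sum>j\<le>dg n. f (node n j) * bump n j x) \<partial>meas \<nu>)"
    using ib by (simp add: pairing_def mult.commute)
  finally show ?thesis unfolding sum_bump .
qed

text \<open>The bumps sum to one. Since the mass is kept exactly, bounds in terms of the mass hold
  for all projections with the same constants.\<close>

lemma pairing_proj_one: "tmass (proj n \<nu>) = tmass \<nu>"
  by (subst pairing_proj) (auto simp: appr_def[abs_def] bern_const pairing_def)

text \<open>By duality the projection acts on the test function instead of the measure, and the
  Bernstein approximants of a bounded continuous function converge boundedly and pointwise.\<close>

lemma proj_tendsto: "(\<lambda>n. proj n \<nu>) \<longlonglongrightarrow> \<nu>"
  unfolding tendsto_finmeas_iff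
proof (intro allI impI)
  fix f :: "real => real" assume f: "continuous_on UNIV f" "bounded (range f)"
  obtain C where C: "\<And>x. \<bar>f x\<bar> \<le> C" by (rule bounded_rangeE[OF f(2)]) blast
  have fm: "f \<in> borel_measurable borel" using f(1) by (rule borel_measurable_bcont)
  interpret finite_measure "meas \<nu>" by (rule finite_measure_meas)
  show "(\<lambda>n. pairing f (proj n \<nu>)) \<longlonglongrightarrow> pairing f \<nu>"
    unfolding pairing_proj[OF fm] unfolding pairing_def
  proof (rule integral_dominated_convergence[where w="\<lambda>_. C"])
    show "AE x in meas \<nu>. (\<lambda>n. appr n (\<lambda>j. f (node n j)) x) \<longlonglongrightarrow> f x"
    proof (rule AE_I2)
      fix x
      have "ucont (\<lambda>n. f) x (f x)"
        unfolding ucont_def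
      proof (intro allI impI)
        fix e :: real assume "e > 0"
        moreover have "isCont f x" using f(1) by (simp add: continuous_on_eq_continuous_at)
        ultimately obtain d where "d > 0" "\<And>y. dist y x < d ==> dist (f y) (f x) < e"
          unfolding continuous_at_eps_delta dist_real_def by metis
        then show "\<exists>d>0. \<forall>\<^sub>F n in sequentially. \<forall>\<xi>. \<bar>\<xi> - x\<bar> < d \<longrightarrow> \<bar>f \<xi> - f x\<bar> \<le> e"
          by (intro exI[of _ d]) (auto simp: dist_real_def intro: less_imp_le)
      qed
      from bern_tendsto_ucont[OF near_node_node C this]
      show "(\<lambda>n. appr n (\<lambda>j. f (node n j)) x) \<longlonglongrightarrow> f x" unfolding appr_def .
    qed
    show "AE x in meas \<nu>. norm (appr n (\<lambda>j. f (node n j)) x) \<le> C" for n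
      unfolding appr_def real_norm_def by (intro AE_I2 bern_abs_le coord_bounds C)
  qed (use fm in simp_all)
qed

section \<open>Joint measurability along right-continuous paths\<close>

lemma floor_grid:
  fixes x :: real
  shows "\<bar>real_of_int \<lfloor>real (Suc n) * x\<rfloor> / real (Suc n) - x\<bar> \<le> 1 / real (Suc n)"
    and "x < (real_of_int \<lfloor>real (Suc n) * x\<rfloor> + 1) / real (Suc n)"
    and "(real_of_int \<lfloor>real (Suc n) * x\<rfloor> + 1) / real (Suc n) \<le> x + 1 / real (Suc n)"
proof -
  let ?N = "real (Suc n)"
  have f: "real_of_int \<lfloor>?N * x\<rfloor> \<le> ?N * x" "?N * x < real_of_int \<lfloor>?N * x\<rfloor> + 1" by linarith+
  have N: "?N > 0" by simp
  have "real_of_int \<lfloor>?N * x\<rfloor> / ?N \<le> x" using f(1) N by (simp only: pos_divide_le_eq mult.commute)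
  moreover show 2: "x < (real_of_int \<lfloor>?N * x\<rfloor> + 1) / ?N" using f(2) N by (simp only: pos_less_divide_eq mult.commute)
  ultimately show "\<bar>real_of_int \<lfloor>?N * x\<rfloor> / ?N - x\<bar> \<le> 1 / ?N" "(real_of_int \<lfloor>?N * x\<rfloor> + 1) / ?N \<le> x + 1 / ?N"
    unfolding add_divide_distrib by linarith+
qed

lemma one_over_Suc_tendsto: "(\<lambda>n. 1 / real (Suc n)) \<longlonglongrightarrow> 0"
  using LIMSEQ_inverse_real_of_nat by (simp add: inverse_eq_divide)

text \<open>Continuity of \<open>K\<close> refers to the product topology, whereas the claim
  concerns a product sigma-algebra. So \<open>K\<close> is evaluated at countably many values of
  time, position and control, where only measurability of the state at fixed times enters; right
  continuity and continuity of \<open>K\<close> recover the limit.\<close>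

lemma measurable_along_path:
  fixes X :: "'w => real => real finmeas" and K :: "real => coeff"
  assumes ab: "a \<le> b"
    and X: "\<And>u. u \<in> {a..b} ==> (\<lambda>w. X w u) \<in> M \<rightarrow>\<^sub>M borel"
    and rc: "\<And>w u. w \<in> space M ==> u \<in> {a..<b} ==> (X w \<longlongrightarrow> X w u) (at_right u)"
    and K: "continuous_on ({a..b} \<times> UNIV \<times> UNIV \<times> A) (\<lambda>(u, x, \<nu>, c). K u x \<nu> c)"
    and A: "A \<in> sets borel"
  shows "(\<lambda>(w, u, x, c). indicator {a..b} u * indicator A c * K u x (X w u) c)
     \<in> borel_measurable (M \<Otimes>\<^sub>M (borel :: (real \<times> real \<times> real) measure))"
proof (cases "A = {}")
  case True
  then show ?thesis by (simp add: split_beta')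
next
  case False
  then obtain a0 where a0: "a0 \<in> A" by auto
  \<comment> \<open>The next grid time strictly to the right, since the paths are continuous only
    from that side; clipping keeps it in the interval.\<close>
  define up where "up = (\<lambda>n (i::int). max a (min b ((real_of_int i + 1) / real (Suc n))))"
  \<comment> \<open>Grid points may lie outside \<open>A\<close>, where \<open>K\<close> is not
    controlled, so a point of \<open>A\<close> from the same grid cell represents the cell;
    \<open>a0\<close> is the default for cells that miss \<open>A\<close>.\<close>
  define pt where "pt = (\<lambda>n (k::int). if \<exists>c\<in>A. \<lfloor>real (Suc n) * c\<rfloor> = k then SOME c. c \<in> A \<and> \<lfloor>real (Suc n) * c\<rfloor> = k else a0)"
  have pt: "pt n k \<in> A" for n k
  proof (cases "\<exists>c\<in>A. \<lfloor>real (Suc n) * c\<rfloor> = k")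
    case True
    then have "\<exists>c. c \<in> A \<and> \<lfloor>real (Suc n) * c\<rfloor> = k" by blast
    from someI_ex[OF this] have "(SOME c. c \<in> A \<and> \<lfloor>real (Suc n) * c\<rfloor> = k) \<in> A" by (rule conjunct1)
    then show ?thesis unfolding pt_def if_P[OF True] .
  next
    case False
    show ?thesis unfolding pt_def if_not_P[OF False] by (rule a0)
  qed
  have pt2: "\<lfloor>real (Suc n) * pt n \<lfloor>real (Suc n) * c\<rfloor>\<rfloor> = \<lfloor>real (Suc n) * c\<rfloor>" if "c \<in> A" for n c
  proof -
    have ex: "\<exists>c'\<in>A. \<lfloor>real (Suc n) * c'\<rfloor> = \<lfloor>real (Suc n) * c\<rfloor>" using that by auto
    then have "\<exists>c'. c' \<in> A \<and> \<lfloor>real (Suc n) * c'\<rfloor> = \<lfloor>real (Suc n) * c\<rfloor>" by auto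
    from someI_ex[OF this] have "\<lfloor>real (Suc n) * (SOME c'. c' \<in> A \<and> \<lfloor>real (Suc n) * c'\<rfloor> = \<lfloor>real (Suc n) * c\<rfloor>)\<rfloor> = \<lfloor>real (Suc n) * c\<rfloor>"
      by (rule conjunct2)
    then show ?thesis unfolding pt_def if_P[OF ex] .
  qed
  have up: "up n i \<in> {a..b}" for n i using ab by (auto simp: up_def)
  define G where "G = (\<lambda>n (i::int) (j::int) (k::int) w. K (up n i) (real_of_int j / real (Suc n)) (X w (up n i)) (pt n k))"
  have Gm: "G n i j k \<in> borel_measurable M" for n i j k
  proof -
    have "continuous_on UNIV (\<lambda>\<nu>. case (up n i, real_of_int j / real (Suc n), \<nu>, pt n k) of (u, x, \<nu>, c) => K u x \<nu> c)"
    proof (rule continuous_on_compose2[OF K])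
      show "continuous_on UNIV (\<lambda>\<nu>::real finmeas. (up n i, real_of_int j / real (Suc n), \<nu>, pt n k))"
        by (intro continuous_intros)
    qed (use up[of n i] pt[of n k] in auto)
    then have "continuous_on UNIV (\<lambda>\<nu>. K (up n i) (real_of_int j / real (Suc n)) \<nu> (pt n k))"
      by (simp only: prod.case)
    then have "(\<lambda>\<nu>. K (up n i) (real_of_int j / real (Suc n)) \<nu> (pt n k)) \<in> borel_measurable borel"
      by (rule borel_measurable_bcont)
    then show ?thesis unfolding G_def by (rule measurable_compose[OF X[OF up]])
  qed
  define g where "g = (\<lambda>n (p::'w \<times> real \<times> real \<times> real). indicator {a..b} (fst (snd p)) * indicator A (snd (snd (snd p))) *
     G n \<lfloor>real (Suc n) * fst (snd p)\<rfloor> \<lfloor>real (Suc n) * fst (snd (snd p))\<rfloor> \<lfloor>real (Suc n) * snd (snd (snd p))\<rfloor> (fst p))"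
  note [measurable] = A
  have [measurable]: "(\<lambda>p. fst (snd p)) \<in> borel_measurable (M \<Otimes>\<^sub>M (borel :: (real \<times> real \<times> real) measure))"
    "(\<lambda>p. fst (snd (snd p))) \<in> borel_measurable (M \<Otimes>\<^sub>M (borel :: (real \<times> real \<times> real) measure))"
    "(\<lambda>p. snd (snd (snd p))) \<in> borel_measurable (M \<Otimes>\<^sub>M (borel :: (real \<times> real \<times> real) measure))"
    by (simp_all add: borel_prod[symmetric])
  have gm: "g n \<in> borel_measurable (M \<Otimes>\<^sub>M (borel :: (real \<times> real \<times> real) measure))" for n
  proof -
    have 1: "(\<lambda>p. G n i j k (fst p)) \<in> borel_measurable (M \<Otimes>\<^sub>M (borel :: (real \<times> real \<times> real) measure))" for i j k
      by (rule measurable_compose[OF measurable_fst Gm])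
    have 2: "(\<lambda>p. G n i j \<lfloor>real (Suc n) * snd (snd (snd p))\<rfloor> (fst p)) \<in> borel_measurable (M \<Otimes>\<^sub>M (borel :: (real \<times> real \<times> real) measure))" for i j
      by (rule measurable_compose_countable[OF 1]) measurable
    have 3: "(\<lambda>p. G n i \<lfloor>real (Suc n) * fst (snd (snd p))\<rfloor> \<lfloor>real (Suc n) * snd (snd (snd p))\<rfloor> (fst p)) \<in> borel_measurable (M \<Otimes>\<^sub>M (borel :: (real \<times> real \<times> real) measure))" for i
      by (rule measurable_compose_countable[OF 2]) measurable
    have 4: "(\<lambda>p. G n \<lfloor>real (Suc n) * fst (snd p)\<rfloor> \<lfloor>real (Suc n) * fst (snd (snd p))\<rfloor> \<lfloor>real (Suc n) * snd (snd (snd p))\<rfloor> (fst p)) \<in> borel_measurable (M \<Otimes>\<^sub>M (borel :: (real \<times> real \<times> real) measure))"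
      by (rule measurable_compose_countable[OF 3]) measurable
    then show ?thesis unfolding g_def by measurable
  qed
  show ?thesis
  proof (rule borel_measurable_LIMSEQ_real[OF _ gm])
    fix p assume p: "p \<in> space (M \<Otimes>\<^sub>M (borel :: (real \<times> real \<times> real) measure))"
    obtain w u x c where pe: "p = (w, u, x, c)" by (cases p)
    have w: "w \<in> space M" using p by (simp add: pe space_pair_measure)
    show "(\<lambda>n. g n p) \<longlonglongrightarrow> (case p of (w, u, x, c) => indicator {a..b} u * indicator A c * K u x (X w u) c)"
    proof (cases "u \<in> {a..b} \<and> c \<in> A")
      case False
      then show ?thesis by (auto simp: g_def pe)
    next
      case True
      define un where "un = (\<lambda>n. up n \<lfloor>real (Suc n) * u\<rfloor>)"
      have un: "un n = min b ((real_of_int \<lfloor>real (Suc n) * u\<rfloor> + 1) / real (Suc n))" for n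
        using True floor_grid(2)[of u n] by (auto simp: un_def up_def)
      have unu: "un n \<le> u + 1 / real (Suc n)" "u \<le> un n" for n
        unfolding un using floor_grid(2)[of u n] floor_grid(3)[of n u] True by auto
      have ul: "un \<longlonglongrightarrow> u"
      proof (rule tendsto_sandwich[OF _ _ tendsto_const])
        show "(\<lambda>n. u + 1 / real (Suc n)) \<longlonglongrightarrow> u" using tendsto_add[OF tendsto_const one_over_Suc_tendsto, of u] by simp
      qed (use unu in auto)
      have Xl: "(\<lambda>n. X w (un n)) \<longlonglongrightarrow> X w u"
      \<comment> \<open>At the right end point the clipping makes the sampled times constant, so no
        continuity from the right is required there.\<close>
      proof (cases "u < b")
        case True
        then have "un n > u" for n unfolding un using floor_grid(2)[of u n] by auto
        then have "filterlim un (at_right u) sequentially"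
          using ul by (auto simp: filterlim_at intro!: always_eventually)
        then show ?thesis using rc[OF w, of u] True \<open>u \<in> {a..b} \<and> c \<in> A\<close> by (auto intro: filterlim_compose)
      next
        case False
        then have "un n = u" for n using True unu(2)[of n] un[of n] by auto
        then show ?thesis by simp
      qed
      have sand: "(\<lambda>n. f n) \<longlonglongrightarrow> y" if "\<And>n. \<bar>f n - y\<bar> \<le> 2 / real (Suc n)" for f and y :: real
      proof -
        have "(\<lambda>n. f n - y) \<longlonglongrightarrow> 0"
        proof (rule Lim_null_comparison)
          show "\<forall>\<^sub>F n in sequentially. norm (f n - y) \<le> 2 * (1 / real (Suc n))"
            using that by (simp add: real_norm_def)
          show "(\<lambda>n. 2 * (1 / real (Suc n))) \<longlonglongrightarrow> 0" using tendsto_mult[OF tendsto_const one_over_Suc_tendsto, of 2] by simp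
        qed
        then show ?thesis by (simp add: LIM_zero_iff)
      qed
      have xl: "(\<lambda>n. real_of_int \<lfloor>real (Suc n) * x\<rfloor> / real (Suc n)) \<longlonglongrightarrow> x"
      proof (rule sand)
        fix n
        have "1 / real (Suc n) \<le> 2 / real (Suc n)" by (rule divide_right_mono) auto
        then show "\<bar>real_of_int \<lfloor>real (Suc n) * x\<rfloor> / real (Suc n) - x\<bar> \<le> 2 / real (Suc n)"
          using floor_grid(1)[of n x] by linarith
      qed
      have cl: "(\<lambda>n. pt n \<lfloor>real (Suc n) * c\<rfloor>) \<longlonglongrightarrow> c"
      proof (rule sand)
        fix n
        have "2 / real (Suc n) = 1 / real (Suc n) + 1 / real (Suc n)" by (simp add: add_divide_distrib[symmetric])
        then show "\<bar>pt n \<lfloor>real (Suc n) * c\<rfloor> - c\<bar> \<le> 2 / real (Suc n)"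
          using floor_grid(1)[of n c] floor_grid(1)[of n "pt n \<lfloor>real (Suc n) * c\<rfloor>", unfolded pt2[OF conjunct2[OF True], of n]] by linarith
      qed
      have "(\<lambda>n. (un n, real_of_int \<lfloor>real (Suc n) * x\<rfloor> / real (Suc n), X w (un n), pt n \<lfloor>real (Suc n) * c\<rfloor>)) \<longlonglongrightarrow> (u, x, X w u, c)"
        by (intro tendsto_Pair ul xl Xl cl)
      from continuous_on_tendsto_compose[OF K this] True up pt
      have "(\<lambda>n. K (un n) (real_of_int \<lfloor>real (Suc n) * x\<rfloor> / real (Suc n)) (X w (un n)) (pt n \<lfloor>real (Suc n) * c\<rfloor>)) \<longlonglongrightarrow> K u x (X w u) c"
        by (auto simp: un_def)
      then show ?thesis using True by (simp add: g_def pe G_def un_def)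
    qed
  qed
qed

text \<open>The derivatives of \<open>W\<close> are continuous only before the terminal time, so the
  half-open interval is exhausted by closed ones.\<close>

lemma measurable_along_path_open:
  fixes X :: "'w => real => real finmeas" and K :: "real => coeff"
  assumes ab: "a < b"
    and X: "\<And>u. u \<in> {a..b} ==> (\<lambda>w. X w u) \<in> M \<rightarrow>\<^sub>M borel"
    and rc: "\<And>w u. w \<in> space M ==> u \<in> {a..<b} ==> (X w \<longlongrightarrow> X w u) (at_right u)"
    and K: "continuous_on ({a..<b} \<times> UNIV \<times> UNIV \<times> A) (\<lambda>(u, x, \<nu>, c). K u x \<nu> c)"
    and A: "A \<in> sets borel"
  shows "(\<lambda>(w, u, x, c). indicator {a..<b} u * indicator A c * K u x (X w u) c)
     \<in> borel_measurable (M \<Otimes>\<^sub>M (borel :: (real \<times> real \<times> real) measure))"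
proof -
  define bn where "bn = (\<lambda>n. b - (b - a) * (1 / real (Suc n)))"
  have bn: "a \<le> bn n" "bn n < b" for n
  proof -
    have "(b - a) * (1 / real (Suc n)) \<le> (b - a) * 1" using ab by (intro mult_left_mono) auto
    then show "a \<le> bn n" by (simp add: bn_def)
    show "bn n < b" using ab by (simp add: bn_def)
  qed
  have bl: "bn \<longlonglongrightarrow> b"
    unfolding bn_def using tendsto_diff[OF tendsto_const tendsto_mult[OF tendsto_const one_over_Suc_tendsto], of b "b - a"] by simp
  show ?thesis
  proof (rule borel_measurable_LIMSEQ_real)
    fix n
    show "(\<lambda>(w, u, x, c). indicator {a..bn n} u * indicator A c * K u x (X w u) c)
     \<in> borel_measurable (M \<Otimes>\<^sub>M (borel :: (real \<times> real \<times> real) measure))"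
    proof (rule measurable_along_path[OF bn(1) _ _ _ A])
      show "continuous_on ({a..bn n} \<times> UNIV \<times> UNIV \<times> A) (\<lambda>(u, x, \<nu>, c). K u x \<nu> c)"
        by (rule continuous_on_subset[OF K]) (use bn[of n] in auto)
      show "u \<in> {a..bn n} ==> (\<lambda>w. X w u) \<in> borel_measurable M" for u using X[of u] bn[of n] by auto
      show "w \<in> space M ==> u \<in> {a..<bn n} ==> (X w \<longlongrightarrow> X w u) (at_right u)" for w u
        using rc[of w u] bn[of n] by auto
    qed
  next
    fix p :: "'w \<times> real \<times> real \<times> real"
    obtain w u x c where pe: "p = (w, u, x, c)" by (cases p)
    have "\<forall>\<^sub>F n in sequentially. (indicator {a..bn n} u :: real) = indicator {a..<b} u"
    proof (cases "u < b")
      case True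
      then have "\<forall>\<^sub>F n in sequentially. u < bn n" using bl by (intro order_tendstoD)
      then show ?thesis by eventually_elim (use True in \<open>auto simp: indicator_def\<close>)
    next
      case False
      show ?thesis
      proof (rule always_eventually, rule allI)
        fix n show "(indicator {a..bn n} u :: real) = indicator {a..<b} u"
          using False bn(2)[of n] by (auto simp: indicator_def)
      qed
    qed
    then have "\<forall>\<^sub>F n in sequentially. (case p of (w, u, x, c) => indicator {a..bn n} u * indicator A c * K u x (X w u) c)
      = (case p of (w, u, x, c) => indicator {a..<b} u * indicator A c * K u x (X w u) c)"
      by eventually_elim (simp add: pe)
    then show "(\<lambda>n. case p of (w, u, x, c) => indicator {a..bn n} u * indicator A c * K u x (X w u) c)
      \<longlonglongrightarrow> (case p of (w, u, x, c) => indicator {a..<b} u * indicator A c * K u x (X w u) c)"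
      by (rule tendsto_eventually)
  qed
qed

section \<open>Kernels from measurable families of pairings\<close>

lemma kernel_compose:
  assumes "kernel P B N" "g \<in> M \<rightarrow>\<^sub>M P"
  shows "kernel M B (\<lambda>x. N (g x))"
  using assms measurable_space[OF assms(2)]
  unfolding kernel_def by (auto intro: measurable_compose[OF assms(2)])

lemma measure_closed_limit:
  assumes C: "closed C" "C \<noteq> {}"
  shows "(\<lambda>n. pairing (\<lambda>x::real. max 0 (1 - real n * infdist x C)) \<nu>) \<longlonglongrightarrow> measure (meas \<nu>) C"
proof -
  interpret finite_measure "meas \<nu>" by (rule finite_measure_meas)
  have Cb: "C \<in> sets borel" using C by auto
  have "(\<lambda>n. \<integral>x. max 0 (1 - real n * infdist x C) \<partial>meas \<nu>) \<longlonglongrightarrow> (\<integral>x. indicator C x \<partial>meas \<nu>)"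
  proof (rule integral_dominated_convergence[where w="\<lambda>_. 1"])
    have "continuous_on UNIV (\<lambda>x. max 0 (1 - real n * infdist x C))" for n
      by (intro continuous_intros)
    then have "(\<lambda>x. max 0 (1 - real n * infdist x C)) \<in> borel_measurable borel" for n by (rule borel_measurable_bcont)
    then show "(\<lambda>x. max 0 (1 - real n * infdist x C)) \<in> borel_measurable (meas \<nu>)" for n
      by simp
    show "AE x in meas \<nu>. norm (max 0 (1 - real n * infdist x C)) \<le> 1" for n
      by (auto simp: infdist_nonneg)
    show "AE x in meas \<nu>. (\<lambda>n. max 0 (1 - real n * infdist x C)) \<longlonglongrightarrow> indicator C x"
    proof (rule AE_I2)
      fix x
      show "(\<lambda>n. max 0 (1 - real n * infdist x C)) \<longlonglongrightarrow> indicator C x"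
      proof (cases "x \<in> C")
        case True
        then show ?thesis by simp
      next
        case False
        then have d: "infdist x C > 0" using C by (metis in_closed_iff_infdist_zero infdist_nonneg order_le_less)
        obtain n0 :: nat where n0: "1 / infdist x C < real n0" using reals_Archimedean2 by blast
        have "\<forall>\<^sub>F n in sequentially. max 0 (1 - real n * infdist x C) = 0"
          using eventually_ge_at_top[of n0]
        proof eventually_elim
          case (elim n)
          then have "1 / infdist x C \<le> real n" using n0 by linarith
          then have "1 \<le> real n * infdist x C" using d by (simp add: divide_le_eq)
          then show ?case by simp
        qed
        then show ?thesis using False by (auto intro: tendsto_eventually)
      qed
    qed
  qed (use Cb in auto)
  then show ?thesis using Cb by (simp add: pairing_def)
qed

text \<open>Closed sets form an intersection-stable generator of the Borel sets, and the measure of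
  a closed set is a limit of pairings with continuous functions decaying off the set.\<close>

lemma kernel_of_pairings:
  assumes "\<And>f. continuous_on UNIV f ==> bounded (range f) ==> (\<lambda>w. pairing f (X w)) \<in> borel_measurable M"
  shows "kernel M borel (\<lambda>w. meas (X w :: real finmeas))"
proof (rule kernelI)
  show "sets (borel :: real measure) = sigma_sets (space borel) (Collect closed)"
    by (simp add: borel_eq_closed)
  show "Int_stable (Collect closed :: real set set)" by (auto simp: Int_stable_def)
  fix C :: "real set" assume "C \<in> Collect closed"
  then have C: "closed C" by simp
  show "(\<lambda>w. emeasure (meas (X w)) C) \<in> borel_measurable M"
  proof (cases "C = {}")
    case False
    have "(\<lambda>w. measure (meas (X w)) C) \<in> borel_measurable M"
    proof (rule borel_measurable_LIMSEQ_real[OF measure_closed_limit[OF C False]])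
      fix n
      have "max 0 (1 - real n * infdist x C) \<le> 1" for x by (auto simp: infdist_nonneg)
      then show "(\<lambda>w. pairing (\<lambda>x. max 0 (1 - real n * infdist x C)) (X w)) \<in> borel_measurable M"
        by (intro assms continuous_intros) (auto simp: bounded_iff intro!: exI[of _ 1])
    qed
    then show ?thesis by (simp add: finite_measure.emeasure_eq_measure[OF finite_measure_meas])
  qed simp
next
  have "(\<lambda>w. tmass (X w)) \<in> borel_measurable M" by (rule assms) auto
  then show "(\<lambda>w. emeasure (meas (X w)) (space borel)) \<in> borel_measurable M"
    by (simp add: finite_measure.emeasure_eq_measure[OF finite_measure_meas] pairing_one)
qed (auto simp: finite_measure_meas)

section \<open>Control rules\<close>

lemma continuous_on_coeff:
  assumes c: "continuous_on (UNIV \<times> UNIV \<times> A) (\<lambda>(x, \<nu>, a). c x \<nu> a)"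
    and "continuous_on S f" "continuous_on S g" "continuous_on S h" "\<And>p. p \<in> S ==> h p \<in> A"
  shows "continuous_on S (\<lambda>p. c (f p) (g p) (h p))"
proof -
  have "continuous_on S (\<lambda>p. case (f p, g p, h p) of (x, \<nu>, a) => c x \<nu> a)"
    by (rule continuous_on_compose2[OF c]) (use assms in \<open>auto intro!: continuous_intros\<close>)
  then show ?thesis by simp
qed

lemma admissible_coeff_continuous:
  "admissible_coeff A \<phi> c ==> continuous_on (UNIV \<times> UNIV \<times> A) (\<lambda>(x, \<nu>, a). c x \<nu> a)"
  by (simp add: admissible_coeff_def bcont_on_def)

lemma admissible_coeff_bound:
  assumes "admissible_coeff A \<phi> c"
  obtains C where "0 \<le> C" "\<And>x \<nu> a. a \<in> A ==> \<bar>c x \<nu> a\<bar> \<le> C"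
proof -
  obtain C where C: "\<And>p. p \<in> UNIV \<times> UNIV \<times> A ==> \<bar>case p of (x, \<nu>, a) => c x \<nu> a\<bar> \<le> C"
    using assms by (force simp: admissible_coeff_def bcont_on_def bounded_iff)
  show thesis
  proof (rule that[of "max 0 C"])
    fix x \<nu> a assume "a \<in> A"
    then show "\<bar>c x \<nu> a\<bar> \<le> max 0 C" using C[of "(x, \<nu>, a)"] by auto
  qed simp
qed

lemma continuous_on_pairing:
  assumes "continuous_on UNIV f" "bounded (range f)" "continuous_on S g"
  shows "continuous_on S (\<lambda>p. pairing f (g p))"
  by (rule continuous_on_compose2[OF continuous_pairing[OF assms(1,2)] assms(3)]) auto

lemma Cb2_bounded: "Cb2 h ==> bounded (range h)"
  by (simp add: Cb2_def bcont_on_def)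

lemma continuous_on_gen:
  assumes b: "continuous_on (UNIV \<times> UNIV \<times> A) (\<lambda>(x, \<nu>, a). b x \<nu> a)"
    and \<sigma>: "continuous_on (UNIV \<times> UNIV \<times> A) (\<lambda>(x, \<nu>, a). \<sigma> x \<nu> a)" and h: "Cb2 h"
    and "continuous_on S x" "continuous_on S \<nu>" "continuous_on S a" "\<And>p. p \<in> S ==> a p \<in> A"
  shows "continuous_on S (\<lambda>p. gen b \<sigma> h (x p) (\<nu> p) (a p))"
  unfolding gen_def
  by (intro continuous_intros continuous_on_coeff[OF b] continuous_on_coeff[OF \<sigma>]
       continuous_on_compose2[OF Cb2_deriv(4)[OF h]] continuous_on_compose2[OF Cb2_deriv(5)[OF h]] assms) auto

text \<open>Paths are \<open>extensional\<close>, so without meaning off \<open>[0,T]\<close>.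
  Freezing the time extends them by constants and makes the state measurable at every real
  time.\<close>

definition clampT :: "real => real => real" where "clampT T u = max 0 (min T u)"

locale ctrl_rule =
  fixes T :: real and A :: "real set" and \<phi> :: "nat => real => real" and b \<sigma> \<gamma> :: coeff
    and MM :: "(real \<times> real \<times> real) finmeas set" and t :: real and \<xi> :: "real => real finmeas" and P :: "outcome measure"
  assumes T: "0 < T" and A: "compact A"
    and \<phi>: "test_sequence \<phi>"
    and b: "admissible_coeff A \<phi> b" and \<sigma>: "admissible_coeff A \<phi> \<sigma>" and \<gamma>: "admissible_coeff A \<phi> \<gamma>"
    and MM: "MM = leb_control_measures T A \<or> MM = control_measures T A"
    and t: "0 \<le> t" "t \<le> T"
    and P: "P \<in> control_rules T A MM b \<sigma> \<gamma> t \<xi>"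
begin

abbreviation "\<F> \<equiv> canonical_filtration T A MM"
abbreviation B3 :: "(real \<times> real \<times> real) measure" where "B3 \<equiv> borel"

definition X :: "outcome => real => real finmeas" where "X w u = fst w (clampT T u)"
definition m :: "outcome => (real \<times> real \<times> real) measure" where "m w = meas (snd w)"

abbreviation Y :: "(real => real) => outcome => real => real" where "Y h w u \<equiv> pairing h (X w u)"
abbreviation mass :: "outcome => real => real" where "mass \<equiv> Y (\<lambda>_. 1)"

abbreviation "PB \<equiv> P \<Otimes>\<^sub>M B3"

abbreviation PR :: "(outcome \<times> real) measure" where "PR \<equiv> P \<Otimes>\<^sub>M borel"

abbreviation EN :: "(outcome => real) => ennreal" where "EN Z \<equiv> \<integral>\<^sup>+w. ennreal (Z w) \<partial>P"

abbreviation cell :: "real set => (real => coeff) => outcome \<times> real \<times> real \<times> real => real" where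
  "cell S K \<equiv> \<lambda>(w, u, x, a). indicator S u * indicator A a * K u x (X w u) a"

abbreviation zcell :: "(outcome => real) => real set => (real => coeff) => outcome \<times> real \<times> real \<times> real => real" where
  "zcell Z S K \<equiv> \<lambda>(w, u, x, a). Z w * (indicator S u * indicator A a * K u x (X w u) a)"

abbreviation "cyl \<equiv> cyl_gen b \<sigma> \<gamma>"

lemma X_eq: "u \<in> {0..T} ==> X w u = fst w u"
  by (simp add: X_def clampT_def)

lemma A_borel [measurable]: "A \<in> sets borel"
  using A by (simp add: borel_compact)

lemma sets_P: "sets P = sets (\<F> T)"
  using P by (simp add: control_rules_def)

lemma space_P: "space P = canonical_space T MM"
  using sets_eq_imp_space_eq[OF sets_P] by simp

lemma prob_space_P: "prob_space P"
  using P by (simp add: control_rules_def)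

sublocale prob_space P by (rule prob_space_P)

lemma path_measurable_filtration:
  assumes "r \<in> {0..s}"
  shows "(\<lambda>w. fst w r) \<in> \<F> s \<rightarrow>\<^sub>M borel"
proof (rule measurableI)
  fix U :: "real finmeas set" assume U: "U \<in> sets borel"
  have "{w \<in> canonical_space T MM. fst w r \<in> U} \<in> sets (\<F> s)"
    unfolding canonical_filtration_def
    by (subst sets_measure_of; (rule sigma_sets.Basic)?) (use assms U in \<open>auto 0 3\<close>)
  also have "{w \<in> canonical_space T MM. fst w r \<in> U} = (\<lambda>w. fst w r) -` U \<inter> space (\<F> s)" by auto
  finally show "(\<lambda>w. fst w r) -` U \<inter> space (\<F> s) \<in> sets (\<F> s)" .
qed simp

lemma control_measurable_filtration:
  assumes "r \<in> {0..s}" "C \<in> sets borel" "D \<in> sets (restrict_space borel A)"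
  shows "(\<lambda>w. measure (m w) ({0..r} \<times> C \<times> D)) \<in> \<F> s \<rightarrow>\<^sub>M borel"
proof (rule measurableI)
  fix U :: "real set" assume U: "U \<in> sets borel"
  have "{w \<in> canonical_space T MM. measure (meas (snd w)) ({0..r} \<times> C \<times> D) \<in> U} \<in> sets (\<F> s)"
    unfolding canonical_filtration_def
    by (subst sets_measure_of; (rule sigma_sets.Basic)?) (use assms U in \<open>auto 0 3\<close>)
  also have "{w \<in> canonical_space T MM. measure (meas (snd w)) ({0..r} \<times> C \<times> D) \<in> U} =
      (\<lambda>w. measure (m w) ({0..r} \<times> C \<times> D)) -` U \<inter> space (\<F> s)" by (auto simp: m_def)
  finally show "(\<lambda>w. measure (m w) ({0..r} \<times> C \<times> D)) -` U \<inter> space (\<F> s) \<in> sets (\<F> s)" .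
qed simp

lemma clampT: "clampT T u \<in> {0..T}" "u \<in> {0..T} ==> clampT T u = u"
  using T by (auto simp: clampT_def)

lemma measurable_filtration_P: "f \<in> \<F> s \<rightarrow>\<^sub>M N ==> s \<le> T ==> f \<in> P \<rightarrow>\<^sub>M N"
  using measurable_mono[of N N "\<F> s" P] canonical_filtration_mono[of s T T A MM] sets_P space_P by (auto simp: subset_eq)

lemma X_measurable: "(\<lambda>w. X w u) \<in> P \<rightarrow>\<^sub>M borel"
  unfolding X_def using path_measurable_filtration[of "clampT T u" T] clampT(1)[of u]
  by (intro measurable_filtration_P[of _ T]) auto

lemma X_measurable_filtration:
  assumes "u \<le> s" "0 \<le> s" "s \<le> T"
  shows "(\<lambda>w. X w u) \<in> \<F> s \<rightarrow>\<^sub>M borel"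
  unfolding X_def using assms by (intro path_measurable_filtration) (auto simp: clampT_def)

lemma X_right_continuous:
  assumes "w \<in> space P" "u \<in> {0..<T}"
  shows "(X w \<longlongrightarrow> X w u) (at_right u)"
proof -
  have "(fst w \<longlongrightarrow> fst w u) (at_right u)"
    using assms by (auto simp: space_P canonical_space_def cadlag_paths_def)
  moreover have "\<forall>\<^sub>F v in at_right u. fst w v = X w v"
    using eventually_at_right_less[of u] eventually_at_right_field[of "\<lambda>v. v < T" u] assms
    by (auto elim!: eventually_rev_mp simp: X_eq eventually_at_right_field intro!: exI[of _ T])
  ultimately show ?thesis using assms by (simp add: X_eq tendsto_cong)
qed

lemma borel3_measurable [measurable]:
  "(\<lambda>p. fst (snd p)) \<in> borel_measurable PB"
  "(\<lambda>p. fst (snd (snd p))) \<in> borel_measurable PB"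
  "(\<lambda>p. snd (snd (snd p))) \<in> borel_measurable PB"
  by (simp_all add: borel_prod[symmetric])

text \<open>Off \<open>[a,b] \<times> \<real> \<times> A\<close> nothing is known about the coefficients, hence the indicators.\<close>

lemma measurable_K:
  fixes K :: "real => coeff"
  assumes "0 \<le> a" "a \<le> c" "c \<le> T"
    and "continuous_on ({a..c} \<times> UNIV \<times> UNIV \<times> A) (\<lambda>(u, x, \<nu>, c). K u x \<nu> c)"
  shows "(\<lambda>(w, u, x, d). indicator {a..c} u * indicator A d * K u x (X w u) d) \<in> borel_measurable PB"
  by (rule measurable_along_path[where X = X and K = K]) (use assms in \<open>auto intro: X_measurable X_right_continuous\<close>)

lemma measurable_K_open:
  fixes K :: "real => coeff"
  assumes "0 \<le> a" "a < c" "c \<le> T"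
    and "continuous_on ({a..<c} \<times> UNIV \<times> UNIV \<times> A) (\<lambda>(u, x, \<nu>, c). K u x \<nu> c)"
  shows "(\<lambda>(w, u, x, d). indicator {a..<c} u * indicator A d * K u x (X w u) d) \<in> borel_measurable PB"
  by (rule measurable_along_path_open[where X = X and K = K]) (use assms in \<open>auto intro: X_measurable X_right_continuous\<close>)

lemma measurable_path_functional:
  fixes k :: "real finmeas => real"
  assumes "continuous_on UNIV k"
  shows "(\<lambda>(w, u). k (X w u)) \<in> borel_measurable PR"
proof -
  have 1: "(\<lambda>(w, u, x, d). indicator {0..T} u * indicator UNIV d * k (X w u)) \<in> borel_measurable PB"
  proof (rule measurable_along_path[where X = X and K = "\<lambda>u x \<nu> d. k \<nu>"])
    show "continuous_on ({0..T} \<times> UNIV \<times> UNIV \<times> UNIV) (\<lambda>(u::real, x::real, \<nu>, d::real). k \<nu>)"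
      unfolding split_beta' by (intro continuous_on_compose2[OF assms] continuous_intros) auto
  qed (use T in \<open>auto intro: X_measurable X_right_continuous\<close>)
  \<comment> \<open>The functional sees neither position nor control, so both are frozen at 0;
    clamping puts the time where the indicator equals one.\<close>
  have "(\<lambda>(w, u). (w, clampT T u, 0, 0)) \<in> P \<Otimes>\<^sub>M borel \<rightarrow>\<^sub>M PB"
    unfolding clampT_def borel_prod[symmetric] by measurable
  from measurable_compose[OF this 1]
  have "(\<lambda>p. indicator {0..T} (clampT T (snd p)) * k (X (fst p) (clampT T (snd p)))) \<in> borel_measurable PR"
    by (simp add: split_beta')
  moreover have "indicator {0..T} (clampT T u) * k (X w (clampT T u)) = k (X w u)" for u w
    using clampT(1)[of u] by (simp add: X_def clampT(2))
  ultimately show ?thesis by (simp add: split_beta')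
qed

lemma measurable_Y:
  assumes "continuous_on UNIV h" "bounded (range h)"
  shows "(\<lambda>(w, u). Y h w u) \<in> borel_measurable PR"
  by (rule measurable_path_functional[OF continuous_pairing[OF assms]])

lemma measurable_Y_P:
  assumes "continuous_on UNIV h" "bounded (range h)"
  shows "(\<lambda>w. Y h w u) \<in> borel_measurable P"
  by (rule measurable_compose[OF X_measurable borel_measurable_bcont[OF continuous_pairing[OF assms]]])

lemma measurable_Y_filtration:
  assumes "continuous_on UNIV h" "bounded (range h)" "0 \<le> s" "s \<le> T"
  shows "(\<lambda>w. Y h w s) \<in> borel_measurable (\<F> s)"
  by (rule measurable_compose[OF X_measurable_filtration borel_measurable_bcont[OF continuous_pairing[OF assms(1,2)]]])
    (use assms in auto)

lemma measurable_mass [measurable]: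
  "(\<lambda>(w, u). mass w u) \<in> borel_measurable PR" "(\<lambda>w. mass w u) \<in> borel_measurable P"
  by (rule measurable_Y measurable_Y_P; simp)+

lemma mass_nonneg [simp]: "0 \<le> mass w u"
  by (simp add: pairing_one)

lemma kernel_X: "kernel PR borel (\<lambda>(w, u). meas (X w u))"
  unfolding split_beta'
  by (rule kernel_of_pairings) (use measurable_Y in \<open>auto simp: split_beta'\<close>)

lemma kernel_X_fixed:
  assumes "w \<in> space P"
  shows "kernel borel borel (\<lambda>u. meas (X w u))"
  using kernel_compose[OF kernel_X, of "Pair w" borel] assms by simp

lemma m_carrier: "w \<in> space P ==> emeasure (m w) (- ({0..T} \<times> UNIV \<times> A)) = 0"
  using MM by (auto simp: space_P canonical_space_def leb_control_measures_def control_measures_def m_def)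

lemma sets_m [simp, measurable_cong]: "sets (m w) = sets borel" and space_m [simp]: "space (m w) = UNIV"
  and finite_m: "finite_measure (m w)"
  by (simp_all add: m_def finite_measure_meas)

lemma carrier_borel: "{0..T} \<times> UNIV \<times> A \<in> sets (borel :: (real \<times> real \<times> real) measure)"
  unfolding borel_prod[symmetric] by measurable

lemma m_AE_carrier: "w \<in> space P ==> AE (u, x, a) in m w. u \<in> {0..T} \<and> a \<in> A"
  by (rule AE_I[OF _ m_carrier]) (use carrier_borel in auto)

text \<open>The filtration only provides the measures of boxes that start at time zero and have
  controls in \<open>A\<close>. Since \<open>m w\<close> is carried by
  \<open>[0,T] \<times> \<real> \<times> A\<close>, these determine the boxes unbounded to the left,
  which are an intersection-stable generator.\<close>

lemma kernel_m: "kernel P B3 m"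
proof (rule kernelI)
  define G :: "(real \<times> real \<times> real) set set" where "G = {a \<times> c |a c. a \<in> range atMost \<and> c \<in> {c1 \<times> c2 |c1 c2. c1 \<in> sets borel \<and> c2 \<in> sets borel}}"
  have s1: "sets (borel :: real measure) = sigma_sets (space borel) (range atMost)"
    by (subst borel_eq_atMost) simp
  have s2: "sets (borel :: (real \<times> real) measure) = sigma_sets (space borel) {c1 \<times> c2 |c1 c2. c1 \<in> sets borel \<and> c2 \<in> sets borel}"
    unfolding borel_prod[symmetric] sets_pair_measure by (simp add: space_pair_measure)
  have "sets ((borel :: real measure) \<Otimes>\<^sub>M (borel :: (real \<times> real) measure)) = sets (sigma (space borel \<times> space borel) G)"
    unfolding G_def
  proof (rule sets_pair_eq[OF _ s1 _ _ _ _ s2])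
    show "countable (range (\<lambda>n::nat. {..real n}))" by simp
    show "range (\<lambda>n::nat. {..real n}) \<subseteq> range atMost" by auto
    show "\<Union> (range (\<lambda>n::nat. {..real n})) = space borel" using real_arch_simple by auto
    show "countable {UNIV :: (real \<times> real) set}" by simp
    show "{UNIV :: (real \<times> real) set} \<subseteq> {c1 \<times> c2 |c1 c2. c1 \<in> sets borel \<and> c2 \<in> sets borel}"
      by (auto intro!: exI[of _ UNIV])
  qed auto
  moreover have "(borel :: real measure) \<Otimes>\<^sub>M (borel :: (real \<times> real) measure) = B3" by (rule borel_prod)
  ultimately show "sets B3 = sigma_sets (space B3) G"
    by (simp only:) (auto simp: G_def)
  show "Int_stable G"
  proof (rule Int_stableI)
    fix U V assume "U \<in> G" "V \<in> G"
    then obtain r1 C1 D1 r2 C2 D2 where "U = {..r1} \<times> C1 \<times> D1" "V = {..r2} \<times> C2 \<times> D2"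
      "C1 \<in> sets borel" "D1 \<in> sets borel" "C2 \<in> sets borel" "D2 \<in> sets borel"
      by (auto simp: G_def)
    then have "U \<inter> V = {..min r1 r2} \<times> (C1 \<inter> C2) \<times> (D1 \<inter> D2)" "C1 \<inter> C2 \<in> sets borel" "D1 \<inter> D2 \<in> sets borel" by auto
    then show "U \<inter> V \<in> G" unfolding G_def by blast
  qed
  have box: "(\<lambda>w. emeasure (m w) ({..r} \<times> C \<times> D)) \<in> borel_measurable P" if [measurable]: "C \<in> sets borel" "D \<in> sets borel" for r C D
  proof -
    have eq: "emeasure (m w) ({..r} \<times> C \<times> D) = (if 0 \<le> r then ennreal (measure (m w) ({0..min r T} \<times> C \<times> (D \<inter> A))) else 0)"
      if w: "w \<in> space P" for w
    proof -
      have [measurable]: "{..r} \<times> C \<times> D \<in> sets B3" "{0..min r T} \<times> C \<times> (D \<inter> A) \<in> sets B3" unfolding borel_prod[symmetric] by measurable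
      have "emeasure (m w) ({..r} \<times> C \<times> D) = emeasure (m w) (if 0 \<le> r then {0..min r T} \<times> C \<times> (D \<inter> A) else {})"
        by (rule emeasure_eq_AE) (use m_AE_carrier[OF w] in \<open>auto elim!: eventually_mono\<close>)
      then show ?thesis using finite_measure.emeasure_eq_measure[OF finite_m, of w] by auto
    qed
    have "(\<lambda>w. if 0 \<le> r then ennreal (measure (m w) ({0..min r T} \<times> C \<times> (D \<inter> A))) else 0) \<in> borel_measurable P"
    proof (cases "0 \<le> r")
      case True
      have "D \<inter> A \<in> sets (restrict_space borel A)" by (subst sets_restrict_space_iff) auto
      moreover have "min r T \<in> {0..T}" using True T by auto
      ultimately have "(\<lambda>w. measure (m w) ({0..min r T} \<times> C \<times> (D \<inter> A))) \<in> borel_measurable (\<F> T)"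
        by (intro control_measurable_filtration) auto
      from measurable_filtration_P[OF this]
      have "(\<lambda>w. measure (m w) ({0..min r T} \<times> C \<times> (D \<inter> A))) \<in> borel_measurable P" by simp
      then show ?thesis by simp
    qed simp
    then show ?thesis by (subst measurable_cong[OF eq])
  qed
  show "(\<lambda>w. emeasure (m w) C) \<in> borel_measurable P" if "C \<in> G" for C
    using that box by (auto simp: G_def)
  have "emeasure (m w) (space B3) = emeasure (m w) ({..T} \<times> UNIV \<times> UNIV)" if "w \<in> space P" for w
  proof (rule emeasure_eq_AE)
    show "{..T} \<times> UNIV \<times> UNIV \<in> sets (m w)" unfolding sets_m borel_prod[symmetric] by measurable
  qed (use m_AE_carrier[OF that] in \<open>auto elim!: eventually_mono\<close>)
  then show "(\<lambda>w. emeasure (m w) (space B3)) \<in> borel_measurable P"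
    using box[of UNIV UNIV T] by (subst measurable_cong) auto
qed (auto simp: finite_m)

text \<open>Expected integrals against the control measure become single integrals for
  \<open>Q\<close>, so that linearity and dominated convergence can be used once instead of in two
  layers.\<close>

definition Q :: "(outcome \<times> real \<times> real \<times> real) measure" where "Q = kprod P B3 m"

lemma space_ne: "space B3 \<noteq> {}" "space P \<noteq> {}"
  using not_empty by auto

lemmas sets_Q [measurable_cong] = sets_kprod[OF kernel_m space_ne, folded Q_def]
  and nn_integral_Q = nn_integral_kprod[OF kernel_m space_ne, folded Q_def]
  and integral_Q = integral_kprod[OF kernel_m space_ne, folded Q_def]
  and AE_Q = AE_kprod[OF kernel_m space_ne, folded Q_def]

section \<open>Time and space marginal of the control measure\<close>

definition L :: "real measure" where "L = density lborel (indicator {0..T})"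

lemma sets_L [simp, measurable_cong]: "sets L = sets borel" and space_L [simp]: "space L = UNIV"
  by (simp_all add: L_def)

lemma finite_L: "finite_measure L"
  by (rule finite_measureI) (use T in \<open>simp add: L_def emeasure_density\<close>)

lemma nn_integral_L: "f \<in> borel_measurable borel ==> (\<integral>\<^sup>+u. f u \<partial>L) = (\<integral>\<^sup>+u. f u * indicator {0..T} u \<partial>lborel)"
  unfolding L_def by (subst nn_integral_density) (auto simp: mult.commute)

lemma kernel_L: "w \<in> space P ==> kernel L borel (\<lambda>u. meas (X w u))"
  using kernel_compose[OF kernel_X_fixed, of w "\<lambda>u. u" L] by simp

text \<open>Forgetting the control coordinate turns the disintegration of the control measure into
  an identity on time and space that does not mention the unknown control, which may depend on the
  outcome in an uncontrolled way.\<close>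

definition good :: "outcome => bool" where
  "good w \<longleftrightarrow> w \<in> space P \<and> distr (m w) borel (\<lambda>(u, x, a). (u, x)) = kprod L borel (\<lambda>u. meas (X w u))"

lemma uxa_measurable [measurable]: "(\<lambda>(u, x, a). (u, x)) \<in> borel_measurable (borel :: (real \<times> real \<times> real) measure)"
  unfolding borel_prod[symmetric] by measurable

lemma uxa_fst: "(\<lambda>p. (fst p, fst (snd p))) \<in> borel_measurable (m w)"
  using uxa_measurable by (simp add: split_beta' cong: measurable_cong_sets)

lemma good_if_controlled:
  assumes w: "w \<in> space P" and c: "controlled_by T (fst w) (snd w) \<alpha>"
  shows "good w"
  unfolding good_def
proof (intro conjI w measure_eqI)
  note k = kernel_L[OF w]
  have s: "sets (kprod L borel (\<lambda>u. meas (X w u))) = sets (borel :: (real \<times> real) measure)"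
    by (subst sets_kprod[OF k]) (auto simp: borel_prod[symmetric] intro: sets_pair_measure_cong)
  then show "sets (distr (m w) borel (\<lambda>(u, x, a). (u, x))) = sets (kprod L borel (\<lambda>u. meas (X w u)))" by simp
  fix C assume "C \<in> sets (distr (m w) borel (\<lambda>(u, x, a). (u, x)))"
  then have C[measurable]: "C \<in> sets borel" by simp
  let ?C = "(\<lambda>(u, x, a). (u, x)) -` C :: (real \<times> real \<times> real) set"
  have C3: "?C \<in> sets borel" using measurable_sets[OF uxa_measurable C] by simp
  have C2: "C \<in> sets (L \<Otimes>\<^sub>M borel)" using C s sets_kprod[OF k] by simp
  have im: "(\<lambda>u. \<integral>\<^sup>+x. indicator C (u, x) \<partial>meas (X w u)) \<in> borel_measurable L"
    using kernel_nn_integral_measurable[OF k, of "indicator C"] C2 by simp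
  have "emeasure (distr (m w) borel (\<lambda>(u, x, a). (u, x))) C = emeasure (m w) ?C"
    by (subst emeasure_distr) auto
  also have "\<dots> = (\<integral>\<^sup>+s\<in>{0..T}. (\<integral>\<^sup>+x. indicator ?C (s, x, \<alpha> s x) \<partial>meas (fst w s)) \<partial>lborel)"
    using c C3 by (simp add: controlled_by_def m_def)
  also have "\<dots> = (\<integral>\<^sup>+s\<in>{0..T}. (\<integral>\<^sup>+x. indicator C (s, x) \<partial>meas (X w s)) \<partial>lborel)"
    by (intro nn_integral_cong) (auto simp: X_eq indicator_def)
  also have "\<dots> = (\<integral>\<^sup>+u. \<integral>\<^sup>+x. indicator C (u, x) \<partial>meas (X w u) \<partial>L)"
    using im by (subst nn_integral_L) auto
  also have "\<dots> = emeasure (kprod L borel (\<lambda>u. meas (X w u))) C"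
    by (subst emeasure_kprod[OF k _ _ C2]) auto
  finally show "emeasure (distr (m w) borel (\<lambda>(u, x, a). (u, x))) C = emeasure (kprod L borel (\<lambda>u. meas (X w u))) C" .
qed

lemma AE_good: "AE w in P. good w"
proof -
  have "AE (\<mu>, m) in P. \<exists>\<alpha>. (\<lambda>(s, x). \<alpha> s x) \<in> restrict_space borel ({0..T} \<times> UNIV) \<rightarrow>\<^sub>M restrict_space borel A \<and> controlled_by T \<mu> m \<alpha>"
    using P by (simp add: control_rules_def)
  with AE_space show ?thesis
    by eventually_elim (auto intro: good_if_controlled simp: split_beta')
qed

lemma good_nn_integral:
  assumes g: "good w" and k: "k \<in> borel_measurable borel"
  shows "(\<integral>\<^sup>+(u, x, a). k (u, x) \<partial>m w) = (\<integral>\<^sup>+u. (\<integral>\<^sup>+x. k (u, x) \<partial>meas (X w u)) \<partial>L)"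
proof -
  have w: "w \<in> space P" using g by (simp add: good_def)
  have "(\<integral>\<^sup>+(u, x, a). k (u, x) \<partial>m w) = (\<integral>\<^sup>+p. k p \<partial>distr (m w) borel (\<lambda>(u, x, a). (u, x)))"
    using k by (subst nn_integral_distr) (auto simp: split_beta' uxa_fst)
  also have "\<dots> = (\<integral>\<^sup>+p. k p \<partial>kprod L borel (\<lambda>u. meas (X w u)))"
    using g by (simp add: good_def)
  also have "\<dots> = (\<integral>\<^sup>+u. (\<integral>\<^sup>+x. k (u, x) \<partial>meas (X w u)) \<partial>L)"
  proof (rule nn_integral_kprod[OF kernel_L[OF w]])
    have "sets (L \<Otimes>\<^sub>M borel) = sets (borel :: (real \<times> real) measure)"
      unfolding borel_prod[symmetric] by (intro sets_pair_measure_cong) auto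
    then show "k \<in> borel_measurable (L \<Otimes>\<^sub>M borel)" using k measurable_cong_sets by blast
  qed auto
  finally show ?thesis .
qed

lemma good_integral:
  fixes k :: "real \<times> real => real"
  assumes g: "good w" and k: "integrable (m w) (\<lambda>(u, x, a). k (u, x))" "k \<in> borel_measurable borel"
  shows "(\<integral>(u, x, a). k (u, x) \<partial>m w) = (\<integral>u. (\<integral>x. k (u, x) \<partial>meas (X w u)) \<partial>L)" (is ?g1)
    "integrable L (\<lambda>u. \<integral>x. k (u, x) \<partial>meas (X w u))" (is ?g2)
proof -
  have w: "w \<in> space P" using g by (simp add: good_def)
  have "integrable (distr (m w) borel (\<lambda>(u, x, a). (u, x))) k"
    using k by (subst integrable_distr_eq) (auto simp: split_beta' uxa_fst)
  then have i: "integrable (kprod L borel (\<lambda>u. meas (X w u))) k" using g by (simp add: good_def)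
  have "(\<integral>(u, x, a). k (u, x) \<partial>m w) = (\<integral>p. k p \<partial>distr (m w) borel (\<lambda>(u, x, a). (u, x)))"
    using k by (subst integral_distr) (auto simp: split_beta' uxa_fst)
  also have "\<dots> = (\<integral>p. k p \<partial>kprod L borel (\<lambda>u. meas (X w u)))"
    using g by (simp add: good_def)
  also have "\<dots> = (\<integral>u. (\<integral>x. k (u, x) \<partial>meas (X w u)) \<partial>L)"
    by (rule integral_kprod[OF kernel_L[OF w] _ _ i]) auto
  finally show ?g1 .
  show ?g2
    by (rule integral_kprod[OF kernel_L[OF w] _ _ i]) auto
qed

end

section \<open>Moments of the total mass\<close>

context ctrl_rule
begin

sublocale PL: pair_sigma_finite P L
  by (intro pair_sigma_finite.intro finite_measure.axioms(1) finite_L) unfold_locales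

lemma sets_PL: "sets (P \<Otimes>\<^sub>M L) = sets PR"
  by (intro sets_pair_measure_cong) auto

text \<open>For integrands without position and control the integration over space contributes the
  factor \<open>mass w u\<close>. This is why each estimate of an integral for \<open>Q\<close> uses
  one more moment of the mass than the integrand shows.\<close>

lemma nn_integral_Q_path:
  assumes k: "k \<in> borel_measurable PR"
  shows "(\<integral>\<^sup>+(w, u, x, a). k (w, u) \<partial>Q) = (\<integral>\<^sup>+u. (\<integral>\<^sup>+w. k (w, u) * ennreal (mass w u) \<partial>P) \<partial>L)"
proof -
  note [measurable] = k
  have "(\<lambda>p. (fst p, fst (snd p))) \<in> PB \<rightarrow>\<^sub>M P \<Otimes>\<^sub>M borel" by measurable
  then have "(\<integral>\<^sup>+(w, u, x, a). k (w, u) \<partial>Q) = (\<integral>\<^sup>+w. \<integral>\<^sup>+(u, x, a). k (w, u) \<partial>m w \<partial>P)"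
    by (subst nn_integral_Q) (auto simp: split_beta')
  also have "\<dots> = (\<integral>\<^sup>+w. \<integral>\<^sup>+u. k (w, u) * ennreal (mass w u) \<partial>L \<partial>P)"
  proof (rule nn_integral_cong_AE)
    show "AE w in P. (\<integral>\<^sup>+(u, x, a). k (w, u) \<partial>m w) = (\<integral>\<^sup>+u. k (w, u) * ennreal (mass w u) \<partial>L)"
      using AE_good AE_space
    proof eventually_elim
      case (elim w)
      have "(\<lambda>p. k (w, fst p)) \<in> borel_measurable (borel :: (real \<times> real) measure)"
        using elim(2) unfolding borel_prod[symmetric] by measurable
      from good_nn_integral[OF elim(1) this] show ?case
        by (simp add: finite_measure.emeasure_eq_measure[OF finite_measure_meas] pairing_one mult.commute)
    qed
  qed
  also have "\<dots> = (\<integral>\<^sup>+u. \<integral>\<^sup>+w. k (w, u) * ennreal (mass w u) \<partial>P \<partial>L)"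
  proof (rule PL.Fubini'[symmetric])
    have "(\<lambda>p. k (fst p, snd p) * ennreal (mass (fst p) (snd p))) \<in> borel_measurable PR"
      using measurable_mass(1) by (simp add: split_beta')
    then show "(\<lambda>(w, u). k (w, u) * ennreal (mass w u)) \<in> borel_measurable (P \<Otimes>\<^sub>M L)"
      by (simp add: split_beta' cong: measurable_cong_sets[OF sets_PL refl])
  qed
  finally show ?thesis .
qed

lemma lift_path_measurable:
  assumes "k \<in> borel_measurable PR"
  shows "(\<lambda>(w, u, x, a). k (w, u)) \<in> borel_measurable PB"
proof -
  have "(\<lambda>p. (fst p, fst (snd p))) \<in> PB \<rightarrow>\<^sub>M P \<Otimes>\<^sub>M borel" by measurable
  from measurable_compose[OF this assms] show ?thesis by (simp add: split_beta')
qed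

text \<open>The time marginal is Lebesgue measure weighted by the mass, so a bound on the weighted
  expectation at each fixed time yields a factor \<open>s' - s\<close>.\<close>

lemma Q_bound:
  fixes f :: "_ => real" and k :: "_ => real"
  assumes s: "0 \<le> s" "s \<le> s'" "s' \<le> T"
    and f: "f \<in> borel_measurable PB" and k: "k \<in> borel_measurable PR"
    and fk: "\<And>w u x a. w \<in> space P ==> \<bar>f (w, u, x, a)\<bar> \<le> indicator {s..s'} u * k (w, u)"
    and c: "0 \<le> c" "\<And>u. u \<in> {s..s'} ==> (\<integral>\<^sup>+w. ennreal (k (w, u)) * ennreal (mass w u) \<partial>P) \<le> ennreal c"
  shows "integrable Q f" "\<bar>\<integral>p. f p \<partial>Q\<bar> \<le> c * (s' - s)" (is ?g1)
proof -
  note [measurable] = f k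
  have "(\<integral>\<^sup>+p. ennreal (norm (f p)) \<partial>Q) \<le> (\<integral>\<^sup>+(w, u, x, a). indicator {s..s'} u * ennreal (k (w, u)) \<partial>Q)"
  proof (rule nn_integral_mono)
    fix p assume "p \<in> space Q"
    then obtain w u x a where p: "p = (w, u, x, a)" "w \<in> space P"
      using sets_eq_imp_space_eq[OF sets_Q] by (cases p) (auto simp: space_pair_measure)
    have "ennreal \<bar>f p\<bar> \<le> ennreal (indicator {s..s'} u * k (w, u))" using fk[OF p(2)] p by (intro ennreal_leI) auto
    also have "\<dots> = indicator {s..s'} u * ennreal (k (w, u))" by (simp add: indicator_def)
    finally show "ennreal (norm (f p)) \<le> (case p of (w, u, x, a) => indicator {s..s'} u * ennreal (k (w, u)))"
      by (simp add: p)
  qed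
  also have "\<dots> = (\<integral>\<^sup>+u. (\<integral>\<^sup>+w. indicator {s..s'} u * ennreal (k (w, u)) * ennreal (mass w u) \<partial>P) \<partial>L)"
    using nn_integral_Q_path[of "\<lambda>(w, u). indicator {s..s'} u * ennreal (k (w, u))"] by simp
  also have "\<dots> \<le> (\<integral>\<^sup>+u. ennreal c * indicator {s..s'} u \<partial>L)"
  proof (rule nn_integral_mono)
    fix u
    show "(\<integral>\<^sup>+w. indicator {s..s'} u * ennreal (k (w, u)) * ennreal (mass w u) \<partial>P) \<le> ennreal c * indicator {s..s'} u"
      using c(2)[of u] by (cases "u \<in> {s..s'}") auto
  qed
  also have "\<dots> = (\<integral>\<^sup>+u. ennreal c * indicator {s..s'} u \<partial>lborel)"
    using s by (subst nn_integral_L) (auto intro!: nn_integral_cong simp: indicator_def)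
  also have "\<dots> = ennreal (c * (s' - s))"
    using s c by (simp add: nn_integral_cmult ennreal_mult[symmetric])
  finally have le: "(\<integral>\<^sup>+p. ennreal (norm (f p)) \<partial>Q) \<le> ennreal (c * (s' - s))" .
  then have "(\<integral>\<^sup>+p. ennreal (norm (f p)) \<partial>Q) < \<infinity>" by (simp add: le_less_trans)
  then show i: "integrable Q f" by (intro integrableI_bounded) (auto cong: measurable_cong_sets[OF sets_Q refl])
  have "ennreal \<bar>\<integral>p. f p \<partial>Q\<bar> \<le> (\<integral>\<^sup>+p. ennreal (norm (f p)) \<partial>Q)"
    using integral_norm_bound_ennreal[OF i] by simp
  with le have "ennreal \<bar>\<integral>p. f p \<partial>Q\<bar> \<le> ennreal (c * (s' - s))" by (rule order_trans[rotated])
  then show ?g1 using s c by (subst (asm) ennreal_le_iff) auto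
qed

section \<open>Dynkin's formula for bounded functions of one pairing\<close>

lemma continuous_on_cyl:
  assumes F: "Cb2 F" and h: "Cb2 h"
  shows "continuous_on (S \<times> UNIV \<times> UNIV \<times> A) (\<lambda>(u, x, \<nu>, a). cyl F h x \<nu> a)"
  unfolding cyl_gen_def split_beta'
  by (intro continuous_intros continuous_on_gen[OF admissible_coeff_continuous[OF b] admissible_coeff_continuous[OF \<sigma>] h]
     continuous_on_coeff[OF admissible_coeff_continuous[OF \<gamma>]]
     continuous_on_compose2[OF Cb2_deriv(4)[OF F]] continuous_on_compose2[OF Cb2_deriv(5)[OF F]]
     continuous_on_compose2[OF Cb2_deriv(3)[OF h]] continuous_on_pairing Cb2_deriv(3)[OF h] Cb2_bounded[OF h]) auto

lemma sigma_finite_subalgebra_filtration: "s \<le> T ==> sigma_finite_subalgebra P (\<F> s)"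
  using canonical_filtration_mono[of s T T A MM] sets_P space_P
  by (intro finite_measure_subalgebra_is_sigma_finite) (auto simp: subalgebra_def finite_measure_subalgebra_def
     finite_measure_subalgebra_axioms_def finite_measure_axioms)

text \<open>The martingale property tested against a weight \<open>Z\<close> known at time
  \<open>s\<close>. The compensator in the martingale starts at \<open>t\<close>; the part up to
  \<open>s\<close> cancels and the half-open interval remains. General weights are needed later for
  frozen derivatives of \<open>W\<close> and for powers of the state at time
  \<open>s\<close>.\<close>

lemma dynkin_Cb2:
  assumes F: "Cb2 F" and h: "Cb2 h" and s: "t \<le> s" "s \<le> s'" "s' \<le> T"
    and Z: "Z \<in> borel_measurable (\<F> s)" "integrable P Z"
    and int: "integrable Q (zcell Z {t..s'} (\<lambda>_. cyl F h))"
  shows "(\<integral>w. Z w * (F (Y h w s') - F (Y h w s)) \<partial>P) =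
    integral\<^sup>L Q (zcell Z {s<..s'} (\<lambda>_. cyl F h))"
proof -
  let ?k = "\<lambda>(w, u, x, a). indicator {t..s'} u * indicator A a * cyl F h x (X w u) a"
  define G where "G = (\<lambda>r w. F (Y h w r) - (\<integral>(u, x, a). indicator {t..r} u * indicator A a * cyl F h x (X w u) a \<partial>m w))"
  have Gdef: "(case w of (\<mu>, q) => F (pairing h (\<mu> r)) - (LINT (u, x, a):{t..r} \<times> UNIV \<times> A|meas q. cyl F h x (\<mu> u) a)) = G r w"
    if "r \<in> {t..T}" for r w
  proof -
    have "(LINT (u, x, a):{t..r} \<times> UNIV \<times> A|m w. cyl F h x (fst w u) a) =
       (\<integral>(u, x, a). indicator {t..r} u * indicator A a * cyl F h x (X w u) a \<partial>m w)"
      unfolding set_lebesgue_integral_def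
      by (intro Bochner_Integration.integral_cong) (use t that in \<open>auto simp: indicator_def X_eq\<close>)
    then show ?thesis using t that by (simp add: G_def m_def X_eq split_beta')
  qed
  have mart: "martingale_on P \<F> {t..T} (\<lambda>s (\<mu>, q). F (pairing h (\<mu> s)) -
             (LINT (u, x, a):{t..s} \<times> UNIV \<times> A|meas q. cyl F h x (\<mu> u) a))"
    using P F h by (simp add: control_rules_def)
  have Gm: "G r \<in> borel_measurable (\<F> r)" if "r \<in> {t..T}" for r
    using mart that unfolding martingale_on_def by (auto simp: Gdef cong: measurable_cong)
  have ce: "AE w in P. real_cond_exp P (\<F> s) (G s') w = G s w"
  proof -
    have g: "(\<lambda>w. case w of (\<mu>, q) => F (pairing h (\<mu> s')) - (LINT (u, x, a):{t..s'} \<times> UNIV \<times> A|meas q. cyl F h x (\<mu> u) a)) = G s'"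
      by (rule ext, rule Gdef) (use s in simp)
    have "AE w in P. real_cond_exp P (\<F> s) (\<lambda>w. case w of (\<mu>, q) => F (pairing h (\<mu> s')) - (LINT (u, x, a):{t..s'} \<times> UNIV \<times> A|meas q. cyl F h x (\<mu> u) a)) w
       = (case w of (\<mu>, q) => F (pairing h (\<mu> s)) - (LINT (u, x, a):{t..s} \<times> UNIV \<times> A|meas q. cyl F h x (\<mu> u) a))"
      using mart[unfolded martingale_on_def, THEN conjunct2, rule_format, of s s'] s by simp
    then show ?thesis unfolding g
    proof eventually_elim
      case (elim w)
      then show ?case using Gdef[of s w] s by simp
    qed
  qed
  obtain C where C: "\<And>x. \<bar>F x\<bar> \<le> C" using Cb2_bound[OF F] by metis
  have Ym: "(\<lambda>w. F (Y h w r)) \<in> borel_measurable P" for r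
    by (rule measurable_compose[OF measurable_Y_P borel_measurable_bcont]) (use F h Cb2_deriv(3) Cb2_bounded in auto)
  have Zm: "Z \<in> borel_measurable P" using Z(2) by auto
  have iF: "integrable P (\<lambda>w. Z w * F (Y h w r))" for r
  proof (rule Bochner_Integration.integrable_bound[where f="\<lambda>w. C * Z w"])
    show "AE w in P. norm (Z w * F (Y h w r)) \<le> norm (C * Z w)"
    proof (rule AE_I2)
      fix w
      have "\<bar>Z w\<bar> * \<bar>F (Y h w r)\<bar> \<le> \<bar>Z w\<bar> * C" by (rule mult_left_mono[OF C]) simp
      moreover have "0 \<le> C" by (rule order_trans[OF abs_ge_zero C])
      ultimately show "norm (Z w * F (Y h w r)) \<le> norm (C * Z w)" by (simp add: abs_mult mult.commute)
    qed
  qed (use Z Zm Ym in auto)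
  have cell: "integrable Q (zcell Z S (\<lambda>_. cyl F h))"
    if S: "S \<in> sets borel" "S \<subseteq> {t..s'}" for S
  proof -
    have "integrable Q (\<lambda>p. indicator S (fst (snd p)) * (zcell Z {t..s'} (\<lambda>_. cyl F h) p))"
    proof (rule Bochner_Integration.integrable_bound[OF int])
      show "(\<lambda>p. indicator S (fst (snd p)) * (zcell Z {t..s'} (\<lambda>_. cyl F h) p)) \<in> borel_measurable Q"
      proof (rule borel_measurable_times)
        show "(\<lambda>x. case x of (w, u, x, a) => Z w * (indicat_real {t..s'} u * indicat_real A a * cyl F h x (X w u) a)) \<in> borel_measurable Q"
          using int by auto
        show "(\<lambda>x. indicat_real S (fst (snd x))) \<in> borel_measurable Q"
          using S by (simp cong: measurable_cong_sets[OF sets_Q refl])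
      qed
    qed (auto simp: indicator_def)
    then show ?thesis
      by (rule back_subst[of "integrable Q"]) (use S in \<open>auto simp: indicator_def fun_eq_iff\<close>)
  qed
  have iI: "integrable P (\<lambda>w. Z w * (\<integral>(u, x, a). indicator {t..r} u * indicator A a * cyl F h x (X w u) a \<partial>m w))"
    "(\<integral>w. Z w * (\<integral>(u, x, a). indicator {t..r} u * indicator A a * cyl F h x (X w u) a \<partial>m w) \<partial>P)
      = integral\<^sup>L Q (zcell Z {t..r} (\<lambda>_. cyl F h))"
    if "r \<le> s'" for r
    using integral_Q(1,2)[OF cell[of "{t..r}"]] that by (simp_all add: split_beta')
  have iG: "integrable P (\<lambda>w. Z w * G r w)" and
    eG: "(\<integral>w. Z w * G r w \<partial>P) = (\<integral>w. Z w * F (Y h w r) \<partial>P) -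
      integral\<^sup>L Q (zcell Z {t..r} (\<lambda>_. cyl F h))" if "r \<le> s'" for r
    using iF[of r] iI[OF that] unfolding G_def by (simp_all add: right_diff_distrib)
  interpret sub: sigma_finite_subalgebra P "\<F> s" using s by (intro sigma_finite_subalgebra_filtration) auto
  have "(\<integral>w. Z w * G s' w \<partial>P) = (\<integral>w. Z w * real_cond_exp P (\<F> s) (G s') w \<partial>P)"
    using iG[of s'] Z(1) Gm[of s'] s by (intro sub.real_cond_exp_intg(2)[symmetric] measurable_filtration_P[OF Gm]) auto
  also have "\<dots> = (\<integral>w. Z w * G s w \<partial>P)"
    by (intro integral_cong_AE) (use ce Zm measurable_filtration_P[OF Gm, of s] s in \<open>auto intro!: borel_measurable_times measurable_from_subalg[OF sub.subalg]\<close>)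
  finally have "(\<integral>w. Z w * F (Y h w s') \<partial>P) - (\<integral>w. Z w * F (Y h w s) \<partial>P) =
     integral\<^sup>L Q (zcell Z {t..s'} (\<lambda>_. cyl F h))
     - integral\<^sup>L Q (zcell Z {t..s} (\<lambda>_. cyl F h))"
    using eG[of s] eG[of s'] s by simp
  also have "\<dots> = (\<integral>p. (zcell Z {t..s'} (\<lambda>_. cyl F h) p)
      - (zcell Z {t..s} (\<lambda>_. cyl F h) p) \<partial>Q)"
    using cell[of "{t..s'}"] cell[of "{t..s}"] s by (intro Bochner_Integration.integral_diff[symmetric]) auto
  also have "\<dots> = integral\<^sup>L Q (zcell Z {s<..s'} (\<lambda>_. cyl F h))"
    by (intro Bochner_Integration.integral_cong) (use s in \<open>auto simp: indicator_def\<close>)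
  finally show ?thesis using iF by (simp add: right_diff_distrib)
qed

lemma X_initial: "AE w in P. X w t = \<xi> t"
proof -
  have "AE (\<mu>, q) in P. \<forall>s\<in>{0..t}. \<mu> s = \<xi> s" using P by (simp add: control_rules_def)
  then show ?thesis by eventually_elim (use t in \<open>auto simp: X_eq\<close>)
qed

text \<open>For the constant test function only the second-order part of the generator survives, and
  the integration over space multiplies it by the mass. For the power \<open>n + 1\<close> this is
  of order \<open>n\<close> in the mass, so the induction closes. Truncation makes the function
  admissible and Fatou removes it; integrability is not yet known, hence
  \<open>ennreal\<close>.\<close>

lemma mass_moments_nn:
  "\<exists>C\<ge>0. \<forall>u\<in>{t..T}. (EN (\<lambda>w. mass w u ^ n)) \<le> ennreal C"
proof (induction n)
  case 0
  then show ?case by (intro exI[of _ 1]) (simp add: emeasure_space_1)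
next
  case (Suc n)
  then obtain C where C: "0 \<le> C" "\<And>u. u \<in> {t..T} ==> (EN (\<lambda>w. mass w u ^ n)) \<le> ennreal C" by auto
  obtain \<Gamma> where \<Gamma>: "0 \<le> \<Gamma>" "\<And>x \<nu> a. a \<in> A ==> \<bar>\<gamma> x \<nu> a\<bar> \<le> \<Gamma>" by (rule admissible_coeff_bound[OF \<gamma>]) blast
  \<comment> \<open>The constant \<open>k * (k - 1) + 3 * k\<close> of \<open>trunc_power\<close>
    for \<open>k = Suc n\<close>.\<close>
  define D where "D = real (Suc n) * n + 3 * real (Suc n)"
  define m0 where "m0 = tmass (\<xi> t)"
  have m0: "0 \<le> m0" by (simp add: m0_def pairing_one)
  define c where "c = 1/2 * \<Gamma> * D * C"
  have c0: "0 \<le> c" using \<Gamma> C by (simp add: c_def D_def)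
  \<comment> \<open>The moment of the deterministic initial state plus the largest growth over an
    interval of length at most \<open>T\<close>.\<close>
  define B where "B = m0 ^ Suc n + c * T"
  have B0: "0 \<le> B" using m0 c0 T by (simp add: B_def)
  have trunc_le: "EN (\<lambda>w. trunc e (mass w s) ^ Suc n) \<le> ennreal B"
    if s: "s \<in> {t..T}" and e: "0 < e" "e \<le> 1" for s e
  proof -
    let ?F = "\<lambda>x. trunc e x ^ Suc n"
    note tp = trunc_power[OF e, of "Suc n", simplified]
    have F: "Cb2 ?F" using trunc_power(1)[OF e, of "Suc n"] by simp
    define G2 where "G2 = deriv (deriv ?F)"
    have G2: "\<bar>x * G2 x\<bar> \<le> D * \<bar>x\<bar> ^ n" for x
    proof -
      have *: "G2 = (\<lambda>x. real (Suc n * (Suc n - 1)) * trunc e x ^ (Suc n - 2) * (trunc1 e x)\<^sup>2 + real (Suc n) * trunc e x ^ (Suc n - 1) * trunc2 e x)"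
        unfolding G2_def by (rule trunc_power(3)[OF e]) simp
      show ?thesis unfolding *
        by (rule order_trans[OF trunc_power(6)[OF e]]) (simp_all add: D_def algebra_simps)
    qed
    have cyl: "cyl ?F (\<lambda>_. 1) x \<nu> a = 1/2 * G2 (tmass \<nu>) * \<gamma> x \<nu> a" for x \<nu> a
      by (simp add: cyl_gen_def gen_def Cb2_const(2) G2_def)
    have G2c: "continuous_on UNIV G2" using Cb2_deriv(5)[OF F] by (simp add: G2_def)
    let ?f = "\<lambda>(w, u, x, a). indicator {t..s} u * indicator A a * cyl ?F (\<lambda>_. 1) x (X w u) a"
    have fm: "?f \<in> borel_measurable PB"
      using s t by (intro measurable_K continuous_on_cyl F Cb2_const) auto
    have km: "(\<lambda>(w, u). 1/2 * \<bar>G2 (mass w u)\<bar> * \<Gamma>) \<in> borel_measurable PR"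
      using measurable_compose[OF measurable_mass(1) borel_measurable_bcont[OF G2c]] by (simp add: split_beta')
    have fb: "\<bar>?f (w, u, x, a)\<bar> \<le> indicator {t..s} u * (case (w, u) of (w, u) => 1/2 * \<bar>G2 (mass w u)\<bar> * \<Gamma>)" for w u x a
      using \<Gamma>(2)[of a x "X w u"] \<Gamma>(1) by (auto simp: cyl indicator_def abs_mult intro!: mult_left_mono simp del: power_Suc)
    have nb: "(\<integral>\<^sup>+w. ennreal (case (w, u) of (w, u) => 1/2 * \<bar>G2 (mass w u)\<bar> * \<Gamma>) * ennreal (mass w u) \<partial>P) \<le> ennreal c"
      if u: "u \<in> {t..s}" for u
    proof -
      have "(\<integral>\<^sup>+w. ennreal (case (w, u) of (w, u) => 1/2 * \<bar>G2 (mass w u)\<bar> * \<Gamma>) * ennreal (mass w u) \<partial>P)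
        \<le> (\<integral>\<^sup>+w. ennreal (1/2 * \<Gamma> * D) * ennreal (mass w u ^ n) \<partial>P)"
      proof (rule nn_integral_mono)
        fix w
        have "\<bar>mass w u * G2 (mass w u)\<bar> \<le> D * mass w u ^ n" using G2[of "mass w u"] by simp
        then have "1/2 * \<Gamma> * (mass w u * \<bar>G2 (mass w u)\<bar>) \<le> 1/2 * \<Gamma> * (D * mass w u ^ n)"
          using \<Gamma>(1) by (intro mult_left_mono) (auto simp: abs_mult)
        then have "(1/2 * \<bar>G2 (mass w u)\<bar> * \<Gamma>) * mass w u \<le> (1/2 * \<Gamma> * D) * mass w u ^ n" by (simp add: mult_ac)
        then show "ennreal (case (w, u) of (w, u) => 1/2 * \<bar>G2 (mass w u)\<bar> * \<Gamma>) * ennreal (mass w u) \<le> ennreal (1/2 * \<Gamma> * D) * ennreal (mass w u ^ n)"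
          using \<Gamma>(1) by (simp only: prod.case) (subst (1 2) ennreal_mult[symmetric]; auto simp: D_def intro!: ennreal_leI)
      qed
      also have "\<dots> = ennreal (1/2 * \<Gamma> * D) * EN (\<lambda>w. mass w u ^ n)"
        by (intro nn_integral_cmult) measurable
      also have "\<dots> \<le> ennreal (1/2 * \<Gamma> * D) * ennreal C"
        using C(2)[of u] u s by (intro mult_left_mono) auto
      also have "\<dots> = ennreal c" using \<Gamma> C(1) by (simp add: c_def ennreal_mult[symmetric] D_def)
      finally show ?thesis .
    qed
    have "integrable Q ?f" "\<bar>\<integral>p. ?f p \<partial>Q\<bar> \<le> c * (s - t)"
      using Q_bound[OF t(1) _ _ fm km fb c0 nb] s by auto
    note Qb = this
    have 1: "(\<integral>w. ?F (mass w s) - ?F (mass w t) \<partial>P) = integral\<^sup>L Q (cell {t<..s} (\<lambda>_. cyl ?F (\<lambda>_. 1)))"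
      by (rule dynkin_Cb2[OF F Cb2_const(1)[of 1], of t s "\<lambda>_. 1", unfolded mult_1]) (use Qb(1) s in auto)
    have "\<bar>integral\<^sup>L Q (cell {t<..s} (\<lambda>_. cyl ?F (\<lambda>_. 1)))\<bar> \<le> c * (s - t)"
    proof (rule Q_bound(2)[OF t(1) _ _ _ km _ c0 nb])
      have "(\<lambda>p. indicator {t<..s} (fst (snd p)) * ?f p) \<in> borel_measurable PB"
        using fm by measurable
      then show "cell {t<..s} (\<lambda>_. cyl ?F (\<lambda>_. 1)) \<in> borel_measurable PB"
        by (rule back_subst[of "\<lambda>f. f \<in> borel_measurable PB"]) (auto simp: fun_eq_iff indicator_def)
      show "\<bar>case (w, u, x, a) of (w, u, x, a) => indicator {t<..s} u * indicator A a * cyl ?F (\<lambda>_. 1) x (X w u) a\<bar>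
         \<le> indicator {t..s} u * (case (w, u) of (w, u) => 1/2 * \<bar>G2 (mass w u)\<bar> * \<Gamma>)" for w u x a
        apply (rule order_trans[OF _ fb[of w u x a]])
        unfolding prod.case abs_mult by (intro mult_right_mono) (auto simp: indicator_def)
    qed (use s in auto)
    also have "c * (s - t) \<le> c * T" using s t c0 by (intro mult_left_mono) auto
    finally have 2: "(\<integral>w. ?F (mass w s) - ?F (mass w t) \<partial>P) \<le> c * T" using 1 by linarith
    have nn: "0 \<le> ?F (mass w r)" for w r using e by (simp add: trunc_def zero_le_mult_iff)
    obtain K where K: "\<And>x. \<bar>?F x\<bar> \<le> K" using Cb2_bound[OF F] by metis
    have mF: "(\<lambda>w. ?F (mass w r)) \<in> borel_measurable P" for r
      by (rule measurable_compose[OF measurable_mass(2) borel_measurable_bcont[OF Cb2_deriv(3)[OF F]]])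
    have iF: "integrable P (\<lambda>w. ?F (mass w r))" for r
      by (rule integrable_const_bound[where B=K]) (use K mF in auto)
    have "(\<integral>w. ?F (mass w t) \<partial>P) = (\<integral>w. ?F m0 \<partial>P)"
      by (intro integral_cong_AE mF) (use X_initial in \<open>auto simp: m0_def elim!: eventually_mono\<close>)
    also have "\<dots> \<le> m0 ^ Suc n"
    proof -
      have "\<bar>trunc e m0\<bar> \<le> \<bar>m0\<bar>" by (rule abs_trunc_le[OF e])
      then have "\<bar>trunc e m0\<bar> ^ Suc n \<le> m0 ^ Suc n" using m0 by (intro power_mono) auto
      then show ?thesis using prob_space by (simp add: power_abs[symmetric] abs_le_iff del: power_Suc)
    qed
    finally have "(\<integral>w. ?F (mass w s) \<partial>P) \<le> B" using 2 iF by (simp add: B_def)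
    then show ?thesis using nn by (subst nn_integral_eq_integral[OF iF]) (auto intro: ennreal_leI)
  qed
  show ?case
  proof (intro exI[of _ B] conjI ballI B0)
    fix u assume u: "u \<in> {t..T}"
    define e where "e = (\<lambda>i. 1 / real (Suc i))"
    have e: "0 < e i" "e i \<le> 1" for i by (auto simp: e_def)
    have e0: "e \<longlonglongrightarrow> 0" unfolding e_def by (rule one_over_Suc_tendsto)
    have "EN (\<lambda>w. mass w u ^ Suc n) = (\<integral>\<^sup>+w. liminf (\<lambda>i. ennreal (trunc (e i) (mass w u) ^ Suc n)) \<partial>P)"
    proof (rule nn_integral_cong)
      fix w
      have "(\<lambda>i. ennreal (trunc (e i) (mass w u) ^ Suc n)) \<longlonglongrightarrow> ennreal (mass w u ^ Suc n)"
        by (intro tendsto_intros trunc_tendsto e0)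
      then show "ennreal (mass w u ^ Suc n) = liminf (\<lambda>i. ennreal (trunc (e i) (mass w u) ^ Suc n))"
        by (rule lim_imp_Liminf[symmetric, rotated]) simp
    qed
    also have "\<dots> \<le> liminf (\<lambda>i. EN (\<lambda>w. trunc (e i) (mass w u) ^ Suc n))"
    proof (rule nn_integral_liminf)
      fix i show "(\<lambda>w. ennreal (trunc (e i) (mass w u) ^ Suc n)) \<in> borel_measurable P"
        unfolding trunc_def by measurable
    qed
    also have "\<dots> \<le> liminf (\<lambda>i::nat. ennreal B)"
      by (intro Liminf_mono always_eventually allI trunc_le u e)
    also have "\<dots> = ennreal B" by (simp add: Liminf_const)
    finally show "EN (\<lambda>w. mass w u ^ Suc n) \<le> ennreal B" .
  qed
qed

text \<open>Bounds uniform over the times in \<open>[t,T]\<close>, fixed once so that later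
  constants can be written down explicitly. Powers of \<open>1 + mass\<close> increase with the
  exponent, which powers of the mass need not do.\<close>

definition moment :: "nat => real" where
  "moment = (SOME M. \<forall>n. 0 \<le> M n \<and> (\<forall>u\<in>{t..T}. (EN (\<lambda>w. (1 + mass w u) ^ n)) \<le> ennreal (M n)))"

lemma moment_nn: "0 \<le> moment n" "u \<in> {t..T} ==> (EN (\<lambda>w. (1 + mass w u) ^ n)) \<le> ennreal (moment n)"
proof -
  have "\<exists>M. 0 \<le> M \<and> (\<forall>u\<in>{t..T}. (EN (\<lambda>w. (1 + mass w u) ^ n)) \<le> ennreal M)" for n
  proof -
    obtain C where C: "0 \<le> C" "\<And>u. u \<in> {t..T} ==> (EN (\<lambda>w. mass w u ^ n)) \<le> ennreal C"
      using mass_moments_nn[of n] by auto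
    have "EN (\<lambda>w. (1 + mass w u) ^ n) \<le> ennreal (2 ^ n * (1 + C))" if u: "u \<in> {t..T}" for u
    proof -
      have le: "(1 + x) ^ n \<le> 2 ^ n * (1 + x ^ n)" if "0 \<le> x" for x :: real
      proof -
        have "(1 + x) ^ n \<le> (2 * max 1 x) ^ n" using that by (intro power_mono) auto
        also have "\<dots> = 2 ^ n * max 1 x ^ n" by (rule power_mult_distrib)
        also have "\<dots> \<le> 2 ^ n * (1 + x ^ n)" using that by (intro mult_left_mono) (auto simp: max_def)
        finally show ?thesis .
      qed
      have "EN (\<lambda>w. (1 + mass w u) ^ n) \<le> (\<integral>\<^sup>+w. ennreal (2 ^ n) * (1 + ennreal (mass w u ^ n)) \<partial>P)"
      proof (rule nn_integral_mono)
        fix w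
        have "ennreal ((1 + mass w u) ^ n) \<le> ennreal (2 ^ n * (1 + mass w u ^ n))" by (intro ennreal_leI le) simp
        also have "\<dots> = ennreal (2 ^ n) * (1 + ennreal (mass w u ^ n))"
          by (subst ennreal_mult) (auto simp: ennreal_plus)
        finally show "ennreal ((1 + mass w u) ^ n) \<le> ennreal (2 ^ n) * (1 + ennreal (mass w u ^ n))" .
      qed
      also have "\<dots> = ennreal (2 ^ n) * (1 + (EN (\<lambda>w. mass w u ^ n)))"
        by (subst nn_integral_cmult) (auto simp: nn_integral_add emeasure_space_1)
      also have "\<dots> \<le> ennreal (2 ^ n) * (1 + ennreal C)" by (intro mult_left_mono add_left_mono C u) simp
      also have "\<dots> = ennreal (2 ^ n * (1 + C))" using C by (subst ennreal_mult) (auto simp: ennreal_plus)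
      finally show ?thesis .
    qed
    then show ?thesis using C by (intro exI[of _ "2 ^ n * (1 + C)"]) auto
  qed
  then have "\<exists>M. \<forall>n. 0 \<le> M n \<and> (\<forall>u\<in>{t..T}. (EN (\<lambda>w. (1 + mass w u) ^ n)) \<le> ennreal (M n))" by metis
  from someI_ex[OF this, folded moment_def] show "0 \<le> moment n"
    "u \<in> {t..T} ==> (EN (\<lambda>w. (1 + mass w u) ^ n)) \<le> ennreal (moment n)" by auto
qed

text \<open>The larger base dominates the product. This separates masses at two different times
  without Hoelder's inequality.\<close>

lemma weight_le:
  fixes a c :: real
  assumes "0 \<le> a" "0 \<le> c"
  shows "(1 + a) ^ p * (1 + c) ^ q \<le> (1 + a) ^ (p + q) + (1 + c) ^ (p + q)"
proof (cases "a \<le> c")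
  case True
  have "(1 + a) ^ p * (1 + c) ^ q \<le> (1 + c) ^ p * (1 + c) ^ q" using assms True by (intro mult_right_mono power_mono) auto
  also have "\<dots> = (1 + c) ^ (p + q)" by (rule power_add[symmetric])
  finally show ?thesis using assms zero_le_power[of "1 + a" "p + q"] by linarith
next
  case False
  have "(1 + a) ^ p * (1 + c) ^ q \<le> (1 + a) ^ p * (1 + a) ^ q" using assms False by (intro mult_left_mono power_mono) auto
  also have "\<dots> = (1 + a) ^ (p + q)" by (rule power_add[symmetric])
  finally show ?thesis using assms zero_le_power[of "1 + c" "p + q"] by linarith
qed

lemma weight_nn:
  assumes "r \<in> {t..T}" "u \<in> {t..T}"
  shows "EN (\<lambda>w. (1 + mass w r) ^ p * (1 + mass w u) ^ q) \<le> ennreal (2 * moment (p + q))"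
proof -
  have "EN (\<lambda>w. (1 + mass w r) ^ p * (1 + mass w u) ^ q) \<le> (\<integral>\<^sup>+w. ennreal ((1 + mass w r) ^ (p + q)) + ennreal ((1 + mass w u) ^ (p + q)) \<partial>P)"
    by (intro nn_integral_mono) (auto simp: ennreal_plus[symmetric] simp del: ennreal_plus intro!: ennreal_leI weight_le)
  also have "\<dots> = EN (\<lambda>w. (1 + mass w r) ^ (p + q)) + EN (\<lambda>w. (1 + mass w u) ^ (p + q))"
    by (intro nn_integral_add) measurable
  also have "\<dots> \<le> ennreal (moment (p + q)) + ennreal (moment (p + q))" by (intro add_mono moment_nn assms)
  also have "\<dots> = ennreal (2 * moment (p + q))" using moment_nn(1)[of "p + q"] by (simp add: ennreal_plus[symmetric] del: ennreal_plus)
  finally show ?thesis .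
qed

lemma P_bound:
  fixes f :: "_ => real"
  assumes "r \<in> {t..T}" "u \<in> {t..T}" "0 \<le> C" "f \<in> borel_measurable P"
    and f: "\<And>w. w \<in> space P ==> \<bar>f w\<bar> \<le> C * ((1 + mass w r) ^ p * (1 + mass w u) ^ q)"
  shows "integrable P f" "\<bar>expectation f\<bar> \<le> C * (2 * moment (p + q))" (is ?g1)
proof -
  note [measurable] = assms(4)
  have "EN (\<lambda>w. norm (f w)) \<le> (\<integral>\<^sup>+w. ennreal C * ennreal ((1 + mass w r) ^ p * (1 + mass w u) ^ q) \<partial>P)"
    using f assms(3) by (intro nn_integral_mono) (auto simp: ennreal_mult[symmetric] intro!: ennreal_leI)
  also have "\<dots> = ennreal C * EN (\<lambda>w. (1 + mass w r) ^ p * (1 + mass w u) ^ q)"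
    by (intro nn_integral_cmult) measurable
  also have "\<dots> \<le> ennreal C * ennreal (2 * moment (p + q))" by (intro mult_left_mono weight_nn assms) simp
  also have "\<dots> = ennreal (C * (2 * moment (p + q)))" using assms(3) moment_nn(1) by (simp add: ennreal_mult[symmetric])
  finally have le: "EN (\<lambda>w. norm (f w)) \<le> ennreal (C * (2 * moment (p + q)))" .
  then have "EN (\<lambda>w. norm (f w)) < \<infinity>" by (simp add: le_less_trans)
  then show i: "integrable P f" by (intro integrableI_bounded) auto
  have "ennreal \<bar>expectation f\<bar> \<le> ennreal (C * (2 * moment (p + q)))"
    using integral_norm_bound_ennreal[OF i] le by (auto intro: order_trans)
  then show ?g1 using assms(3) moment_nn(1) by (subst (asm) ennreal_le_iff) auto
qed

text \<open>Order \<open>p + q + 1\<close> instead of \<open>p + q\<close>, because of the mass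
  factor contributed by the integration over space.\<close>

lemma Q_weight_bound:
  fixes f :: "_ => real"
  assumes r: "r \<in> {t..T}" and s: "t \<le> s" "s \<le> s'" "s' \<le> T" and C: "0 \<le> C" and f: "f \<in> borel_measurable PB"
    and fk: "\<And>w u x a. w \<in> space P ==> \<bar>f (w, u, x, a)\<bar> \<le> indicator {s..s'} u * (C * ((1 + mass w r) ^ p * (1 + mass w u) ^ q))"
  shows "integrable Q f" "\<bar>\<integral>x. f x \<partial>Q\<bar> \<le> C * (2 * moment (p + q + 1)) * (s' - s)" (is ?g1)
proof -
  have k: "(\<lambda>(w, u). C * ((1 + mass w r) ^ p * (1 + mass w u) ^ q)) \<in> borel_measurable PR"
  proof -
    have "(\<lambda>x. mass (fst x) r) \<in> borel_measurable PR"
      by (rule measurable_compose[OF measurable_fst measurable_mass(2)])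
    then show ?thesis using measurable_mass(1) by (simp add: split_beta')
  qed
  have c: "(\<integral>\<^sup>+w. ennreal (case (w, u) of (w, u) => C * ((1 + mass w r) ^ p * (1 + mass w u) ^ q)) * ennreal (mass w u) \<partial>P)
      \<le> ennreal (C * (2 * moment (p + q + 1)))" if "u \<in> {s..s'}" for u
  proof -
    have "(\<integral>\<^sup>+w. ennreal (case (w, u) of (w, u) => C * ((1 + mass w r) ^ p * (1 + mass w u) ^ q)) * ennreal (mass w u) \<partial>P)
       \<le> (\<integral>\<^sup>+w. ennreal C * ennreal ((1 + mass w r) ^ p * (1 + mass w u) ^ (q + 1)) \<partial>P)"
    proof (rule nn_integral_mono)
      fix w
      have "C * ((1 + mass w r) ^ p * (1 + mass w u) ^ q) * mass w u \<le> C * ((1 + mass w r) ^ p * (1 + mass w u) ^ q) * (1 + mass w u)"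
        using C by (intro mult_left_mono) auto
      also have "\<dots> = C * ((1 + mass w r) ^ p * (1 + mass w u) ^ (q + 1))" by (simp add: mult_ac)
      finally show "ennreal (case (w, u) of (w, u) => C * ((1 + mass w r) ^ p * (1 + mass w u) ^ q)) * ennreal (mass w u)
         \<le> ennreal C * ennreal ((1 + mass w r) ^ p * (1 + mass w u) ^ (q + 1))"
        using C by (simp only: prod.case) (subst (1 2) ennreal_mult[symmetric]; auto intro!: ennreal_leI)
    qed
    also have "\<dots> = ennreal C * EN (\<lambda>w. (1 + mass w r) ^ p * (1 + mass w u) ^ (q + 1))"
      by (intro nn_integral_cmult) measurable
    also have "\<dots> \<le> ennreal C * ennreal (2 * moment (p + (q + 1)))"
      using r s that by (intro mult_left_mono weight_nn) auto
    also have "\<dots> = ennreal (C * (2 * moment (p + q + 1)))" using C moment_nn(1) by (simp add: ennreal_mult[symmetric])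
    finally show ?thesis .
  qed
  have "0 \<le> s" using s t by linarith
  have c0: "0 \<le> C * (2 * moment (p + q + 1))" using C moment_nn(1) by simp
  show "integrable Q f" ?g1
    using Q_bound[OF \<open>0 \<le> s\<close> s(2,3) f k _ c0 c] fk by auto
qed

end

section \<open>Moments of the increments\<close>

context ctrl_rule
begin

lemma Y_abs_le:
  assumes "\<And>x. \<bar>h x\<bar> \<le> H"
  shows "\<bar>Y h w u\<bar> \<le> H * (1 + mass w u)"
proof -
  have "0 \<le> H" by (rule order_trans[OF abs_ge_zero assms])
  then show ?thesis using pairing_abs_le[of h H "X w u", OF assms] by (simp add: distrib_left)
qed

lemma gen_bound:
  assumes h: "Cb2 h"
  obtains G where "0 \<le> G" "\<And>x \<nu> a. a \<in> A ==> \<bar>gen b \<sigma> h x \<nu> a\<bar> \<le> G"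
proof -
  obtain B where B: "0 \<le> B" "\<And>x \<nu> a. a \<in> A ==> \<bar>b x \<nu> a\<bar> \<le> B" by (rule admissible_coeff_bound[OF b]) blast
  obtain S where S: "0 \<le> S" "\<And>x \<nu> a. a \<in> A ==> \<bar>\<sigma> x \<nu> a\<bar> \<le> S" by (rule admissible_coeff_bound[OF \<sigma>]) blast
  obtain H where H: "0 \<le> H" "\<And>x. \<bar>deriv h x\<bar> \<le> H" "\<And>x. \<bar>deriv (deriv h) x\<bar> \<le> H" using Cb2_bound[OF h] by metis
  show thesis
  proof (rule that[of "B * H + 1/2 * S\<^sup>2 * H"])
    show "0 \<le> B * H + 1/2 * S\<^sup>2 * H" using B S H by simp
    fix x \<nu> a assume a: "a \<in> A"
    have "(\<sigma> x \<nu> a)\<^sup>2 \<le> S\<^sup>2" using S a by (simp add: abs_le_square_iff[symmetric])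
    then show "\<bar>gen b \<sigma> h x \<nu> a\<bar> \<le> B * H + 1/2 * S\<^sup>2 * H"
      unfolding gen_def
      by (intro order_trans[OF abs_triangle_ineq] add_mono) (auto simp: abs_mult intro!: mult_mono B S H a)
  qed
qed

lemma measurable_lift_P: "Z \<in> borel_measurable P ==> (\<lambda>p. Z (fst p)) \<in> borel_measurable PB"
  by (rule measurable_compose[OF measurable_fst])

lemma measurable_cell:
  fixes K :: "real => coeff"
  assumes "0 \<le> s" "s \<le> s'" "s' \<le> T" "S \<in> sets borel" "S \<subseteq> {s..s'}" "Z \<in> borel_measurable P"
    and K: "continuous_on ({s..s'} \<times> UNIV \<times> UNIV \<times> A) (\<lambda>(u, x, \<nu>, c). K u x \<nu> c)"
  shows "(zcell Z S K) \<in> borel_measurable PB"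
proof -
  have "(\<lambda>p. Z (fst p) * (indicator S (fst (snd p)) * (case p of (w, u, x, a) => indicator {s..s'} u * indicator A a * K u x (X w u) a)))
     \<in> borel_measurable PB"
    using measurable_K[OF assms(1-3) K] measurable_lift_P[OF assms(6)] assms(4) by simp
  then show ?thesis
    by (rule back_subst[of "\<lambda>f. f \<in> borel_measurable PB"])
      (use assms(5) in \<open>auto simp: fun_eq_iff indicator_def\<close>)
qed

text \<open>This is \<open>cyl\<close> for the unbounded function F(y) = y^k with its derivatives
  written out. Truncated subtraction in the exponents is harmless, as the coefficients vanish in
  those cases.\<close>

definition pk :: "(real => real) => nat => coeff" where
  "pk h k x \<nu> a = real k * pairing h \<nu> ^ (k - 1) * gen b \<sigma> h x \<nu> a
     + 1/2 * (real (k * (k - 1)) * pairing h \<nu> ^ (k - 2)) * \<gamma> x \<nu> a * (h x)\<^sup>2"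

lemma continuous_on_pk:
  assumes h: "Cb2 h"
  shows "continuous_on (S \<times> UNIV \<times> UNIV \<times> A) (\<lambda>(u, x, \<nu>, a). pk h k x \<nu> a)"
  unfolding pk_def split_beta'
  by (intro continuous_intros continuous_on_gen[OF admissible_coeff_continuous[OF b] admissible_coeff_continuous[OF \<sigma>] h]
     continuous_on_coeff[OF admissible_coeff_continuous[OF \<gamma>]] continuous_on_compose2[OF Cb2_deriv(3)[OF h]]
     continuous_on_pairing Cb2_deriv(3)[OF h] Cb2_bounded[OF h]) auto

text \<open>Powers are limits of truncated powers, to which \<open>dynkin_Cb2\<close> applies. A
  polynomial in the masses at the times involved dominates everything uniformly in the truncation,
  so both sides converge.\<close>

lemma dynkin_power:
  fixes k :: nat
  assumes h: "Cb2 h" and k: "k \<ge> 1" and s: "t \<le> s" "s \<le> s'" "s' \<le> T"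
    and Z: "Z \<in> borel_measurable (\<F> s)" and C: "0 \<le> C" "\<forall>w\<in>space P. \<bar>Z w\<bar> \<le> C * (1 + mass w s) ^ q"
  shows "integrable Q (zcell Z {s<..s'} (\<lambda>_. pk h k))"
    and "integrable P (\<lambda>w. Z w * (Y h w s' ^ k - Y h w s ^ k))" (is ?g1)
    and "(\<integral>w. Z w * (Y h w s' ^ k - Y h w s ^ k) \<partial>P) =
      integral\<^sup>L Q (zcell Z {s<..s'} (\<lambda>_. pk h k))"
proof -
  have s0: "0 \<le> s" "s \<in> {t..T}" "s' \<in> {t..T}" using s t by auto
  obtain H0 where H0: "\<And>x. \<bar>h x\<bar> \<le> H0" using Cb2_bound[OF h] by metis
  \<comment> \<open>A bound of at least one lets the power \<open>k\<close> dominate all lower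
    powers.\<close>
  define H where "H = max 1 H0"
  have H: "1 \<le> H" "\<And>x. \<bar>h x\<bar> \<le> H" using H0 by (auto simp: H_def le_max_iff_disj)
  obtain G where G: "0 \<le> G" "\<And>x \<nu> a. a \<in> A ==> \<bar>gen b \<sigma> h x \<nu> a\<bar> \<le> G" by (rule gen_bound[OF h]) blast
  obtain \<Gamma> where \<Gamma>: "0 \<le> \<Gamma>" "\<And>x \<nu> a. a \<in> A ==> \<bar>\<gamma> x \<nu> a\<bar> \<le> \<Gamma>" by (rule admissible_coeff_bound[OF \<gamma>]) blast
  have Zm: "Z \<in> borel_measurable P" using measurable_filtration_P[OF Z] s by auto
  have ym: "(\<lambda>w. Y h w u) \<in> borel_measurable P" for u
    by (rule measurable_Y_P) (use Cb2_deriv(3)[OF h] Cb2_bounded[OF h] in auto)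
  have yb: "\<bar>Y h w u\<bar> ^ j \<le> H ^ k * (1 + mass w u) ^ k" if "j \<le> k" for w u j
  proof -
    have "1 * 1 \<le> H * (1 + mass w u)" using H(1) by (intro mult_mono) auto
    then have "(H * (1 + mass w u)) ^ j \<le> (H * (1 + mass w u)) ^ k" using that by (intro power_increasing) auto
    moreover have "\<bar>Y h w u\<bar> ^ j \<le> (H * (1 + mass w u)) ^ j" by (intro power_mono Y_abs_le H) auto
    ultimately show ?thesis by (simp add: power_mult_distrib)
  qed
  \<comment> \<open>One constant for the truncated functions and for their limit; the summand
    \<open>3 * real k\<close> is used by the former only.\<close>
  define D where "D = real k * G + 1/2 * (real (k * (k - 1)) + 3 * real k) * \<Gamma> * H\<^sup>2"
  have D0: "0 \<le> D" using G \<Gamma> by (simp add: D_def)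
  have kb: "\<bar>f1 * gen b \<sigma> h x \<nu> a + 1/2 * f2 * \<gamma> x \<nu> a * (h x)\<^sup>2\<bar> \<le> D * W"
    if "a \<in> A" "\<bar>f1\<bar> \<le> real k * W" "\<bar>f2\<bar> \<le> (real (k * (k - 1)) + 3 * real k) * W" "0 \<le> W" for f1 f2 W x \<nu> a
  proof -
    have h2: "\<bar>(h x)\<^sup>2\<bar> \<le> H\<^sup>2" using H by (simp add: abs_le_square_iff[symmetric])
    have 1: "\<bar>f1 * gen b \<sigma> h x \<nu> a\<bar> \<le> (real k * W) * G"
      unfolding abs_mult by (intro mult_mono) (use that G in auto)
    have f2: "\<bar>1/2 * f2\<bar> \<le> 1/2 * ((real (k * (k - 1)) + 3 * real k) * W)" using that(3) by (simp add: abs_mult)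
    have 2: "\<bar>1/2 * f2 * \<gamma> x \<nu> a * (h x)\<^sup>2\<bar> \<le> 1/2 * ((real (k * (k - 1)) + 3 * real k) * W) * \<Gamma> * H\<^sup>2"
      unfolding abs_mult[of _ "(h x)\<^sup>2"] abs_mult[of _ "\<gamma> x \<nu> a"]
      by (intro mult_mono f2 h2 \<Gamma>) (use that \<Gamma> in auto)
    have "\<bar>f1 * gen b \<sigma> h x \<nu> a + 1/2 * f2 * \<gamma> x \<nu> a * (h x)\<^sup>2\<bar> \<le>
      (real k * W) * G + 1/2 * ((real (k * (k - 1)) + 3 * real k) * W) * \<Gamma> * H\<^sup>2"
      using abs_triangle_ineq[of "f1 * gen b \<sigma> h x \<nu> a" "1/2 * f2 * \<gamma> x \<nu> a * (h x)\<^sup>2"] 1 2 by linarith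
    then show ?thesis by (simp add: D_def algebra_simps)
  qed
  define wt where "wt = (\<lambda>w u. C * D * H ^ k * ((1 + mass w s) ^ q * (1 + mass w u) ^ k))"
  have C': "0 \<le> C * D * H ^ k" using C D0 H by simp
  have Zb: "\<bar>Z w * v\<bar> \<le> wt w u" if "w \<in> space P" "\<bar>v\<bar> \<le> D * (H ^ k * (1 + mass w u) ^ k)" for w v u
  proof -
    have "\<bar>Z w * v\<bar> \<le> (C * (1 + mass w s) ^ q) * (D * (H ^ k * (1 + mass w u) ^ k))"
      unfolding abs_mult using C that by (intro mult_mono) auto
    then show ?thesis by (simp add: wt_def mult_ac)
  qed
  define e where "e = (\<lambda>i. 1 / real (Suc i))"
  have e: "0 < e i" "e i \<le> 1" for i by (auto simp: e_def)
  have e0: "e \<longlonglongrightarrow> 0" unfolding e_def by (rule one_over_Suc_tendsto)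
  define F where "F = (\<lambda>i x. trunc (e i) x ^ k)"
  define F1 where "F1 = (\<lambda>i x. real k * trunc (e i) x ^ (k - 1) * trunc1 (e i) x)"
  define F2 where "F2 = (\<lambda>i x. real (k * (k - 1)) * trunc (e i) x ^ (k - 2) * (trunc1 (e i) x)\<^sup>2 + real k * trunc (e i) x ^ (k - 1) * trunc2 (e i) x)"
  have F: "Cb2 (F i)" "deriv (F i) = F1 i" "deriv (deriv (F i)) = F2 i" for i
    unfolding F_def F1_def F2_def by (rule trunc_power[OF e k])+
  have F1b: "\<bar>F1 i (Y h w u)\<bar> \<le> real k * (H ^ k * (1 + mass w u) ^ k)" for i w u
    unfolding F1_def by (rule order_trans[OF trunc_power(4)[OF e k] mult_left_mono[OF yb]]) auto
  have F2b: "\<bar>F2 i (Y h w u)\<bar> \<le> (real (k * (k - 1)) + 3 * real k) * (H ^ k * (1 + mass w u) ^ k)" for i w u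
    unfolding F2_def distrib_right
    apply (rule order_trans[OF trunc_power(5)[OF e k]])
    apply (rule add_mono)
     apply (rule mult_left_mono[OF yb]; simp)
    apply (simp only: of_nat_mult of_nat_numeral)
    apply (rule mult_left_mono[OF yb]; simp)
    done
  have cylb: "\<bar>cyl (F i) h x (X w u) a\<bar> \<le> D * (H ^ k * (1 + mass w u) ^ k)" if "a \<in> A" for i x w u a
    unfolding cyl_gen_def F(3) unfolding F(2) using H by (intro kb that F1b F2b) auto
  have pkb: "\<bar>pk h k x (X w u) a\<bar> \<le> D * (H ^ k * (1 + mass w u) ^ k)" if "a \<in> A" for x w u a
    unfolding pk_def
  proof (rule kb[OF that])
    have "real k * \<bar>Y h w u\<bar> ^ (k - 1) \<le> real k * (H ^ k * (1 + mass w u) ^ k)"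
      by (rule mult_left_mono[OF yb]) simp_all
    then show "\<bar>real k * Y h w u ^ (k - 1)\<bar> \<le> real k * (H ^ k * (1 + mass w u) ^ k)"
      by (simp only: abs_mult power_abs abs_of_nat)
    have "\<bar>real (k * (k - 1)) * Y h w u ^ (k - 2)\<bar> \<le> real (k * (k - 1)) * (H ^ k * (1 + mass w u) ^ k)"
      unfolding abs_mult power_abs by (simp only: abs_of_nat) (intro mult_left_mono yb; simp)
    moreover have "0 \<le> 3 * real k * (H ^ k * (1 + mass w u) ^ k)" using H by simp
    ultimately show "\<bar>real (k * (k - 1)) * Y h w u ^ (k - 2)\<bar> \<le> (real (k * (k - 1)) + 3 * real k) * (H ^ k * (1 + mass w u) ^ k)"
      by (simp only: distrib_right)
    show "0 \<le> H ^ k * (1 + mass w u) ^ k" using H by simp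
  qed
  have wtm: "(\<lambda>(w, u, x, a). indicator {s..s'} u * wt w u) \<in> borel_measurable PB"
  proof -
    have [measurable]: "(\<lambda>p. mass (fst p) s) \<in> borel_measurable PB" by (rule measurable_lift_P) simp
    have [measurable]: "(\<lambda>p. mass (fst p) (fst (snd p))) \<in> borel_measurable PB"
      using lift_path_measurable[OF measurable_mass(1)] by (simp add: split_beta')
    show ?thesis unfolding wt_def split_beta' by measurable
  qed
  have wtQ: "integrable Q (\<lambda>(w, u, x, a). indicator {s..s'} u * wt w u)"
    by (rule Q_weight_bound(1)[OF s0(2) s C' wtm, of q k]) (use C' in \<open>auto simp: wt_def\<close>)
  have wt0: "0 \<le> wt w u" for w u using C' by (simp add: wt_def)
  have cellb: "\<bar>zcell Z {s<..s'} (\<lambda>_. K) p\<bar> \<le> (case p of (w, u, x, a) => indicator {s..s'} u * wt w u)"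
    if K: "\<And>x w u a. a \<in> A ==> \<bar>K x (X w u) a\<bar> \<le> D * (H ^ k * (1 + mass w u) ^ k)" and p: "p \<in> space Q" for K :: "real => real finmeas => real => real" and p
  proof -
    obtain w u x a where pe: "p = (w, u, x, a)" by (cases p)
    have w: "w \<in> space P" using p sets_eq_imp_space_eq[OF sets_Q] by (simp add: pe space_pair_measure)
    show ?thesis using Zb[OF w, of "K x (X w u) a" u] K[of a x w u] wt0[of w u] by (auto simp: pe indicator_def)
  qed
  show iq: "integrable Q (zcell Z {s<..s'} (\<lambda>_. pk h k))"
  proof (rule Bochner_Integration.integrable_bound[OF wtQ])
    show "(zcell Z {s<..s'} (\<lambda>_. pk h k)) \<in> borel_measurable Q"
      unfolding measurable_cong_sets[OF sets_Q refl]
      by (rule measurable_cell[OF s0(1) s(2,3) _ _ Zm continuous_on_pk[OF h]]) auto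
    show "AE p in Q. norm (zcell Z {s<..s'} (\<lambda>_. pk h k) p) \<le> norm (case p of (w, u, x, a) => indicator {s..s'} u * wt w u)"
      by (rule AE_I2, unfold real_norm_def, rule order_trans[OF cellb[OF pkb] abs_ge_self])
  qed
  have iZ: "integrable P Z"
    by (rule P_bound(1)[OF s0(2) s0(2) C(1) Zm, of q 0]) (use C in simp)
  have dyn: "(\<integral>w. Z w * (F i (Y h w s') - F i (Y h w s)) \<partial>P) =
    integral\<^sup>L Q (zcell Z {s<..s'} (\<lambda>_. cyl (F i) h))" for i
  proof (rule dynkin_Cb2[OF F(1) h s Z iZ])
    show "integrable Q (zcell Z {t..s'} (\<lambda>_. cyl (F i) h))"
    proof (rule Q_weight_bound(1)[OF s0(2) order_refl _ s(3) C', of _ q k])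
      show "(zcell Z {t..s'} (\<lambda>_. cyl (F i) h)) \<in> borel_measurable PB"
        by (rule measurable_cell[OF t(1) _ s(3) _ _ Zm continuous_on_cyl[OF F(1) h]]) (use s in auto)
      fix w u x a assume w: "w \<in> space P"
      show "\<bar>case (w, u, x, a) of (w, u, x, a) => Z w * (indicator {t..s'} u * indicator A a * cyl (F i) h x (X w u) a)\<bar>
         \<le> indicator {t..s'} u * (C * D * H ^ k * ((1 + mass w s) ^ q * (1 + mass w u) ^ k))"
        using Zb[OF w, of "cyl (F i) h x (X w u) a" u] cylb[of a i x w u] wt0[of w u] by (auto simp: indicator_def wt_def)
    qed (use s in auto)
  qed
  have lim1: "(\<lambda>i. F i y) \<longlonglongrightarrow> y ^ k" "(\<lambda>i. F1 i y) \<longlonglongrightarrow> real k * y ^ (k - 1) * 1"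
    "(\<lambda>i. F2 i y) \<longlonglongrightarrow> real (k * (k - 1)) * y ^ (k - 2) * 1\<^sup>2 + real k * y ^ (k - 1) * 0" for y
    unfolding F_def F1_def F2_def by (intro tendsto_intros trunc_tendsto e0)+
  have Fb: "\<bar>F i (Y h w u)\<bar> \<le> H ^ k * (1 + mass w u) ^ k" for i w u
    using power_mono[OF abs_trunc_le[OF e, of i "Y h w u"], of k] yb[of k w u] by (simp add: F_def power_abs)
  have Ykb: "\<bar>Y h w u ^ k\<bar> \<le> H ^ k * (1 + mass w u) ^ k" for w u using yb[of k w u] by (simp add: power_abs)
  define wgt where "wgt = (\<lambda>w. C * H ^ k * ((1 + mass w s) ^ q * (1 + mass w s') ^ k) + C * H ^ k * ((1 + mass w s) ^ q * (1 + mass w s) ^ k))"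
  have CH: "0 \<le> C * H ^ k" using C H by simp
  have wi: "integrable P wgt"
    unfolding wgt_def
    by (intro Bochner_Integration.integrable_add P_bound(1)[OF s0(2) s0(3) CH, of _ q k] P_bound(1)[OF s0(2) s0(2) CH, of _ q k])
      (use CH in auto)
  have wb: "\<bar>Z w * (v' - v)\<bar> \<le> wgt w" if "w \<in> space P" "\<bar>v'\<bar> \<le> H ^ k * (1 + mass w s') ^ k" "\<bar>v\<bar> \<le> H ^ k * (1 + mass w s) ^ k" for w v v'
  proof -
    have "\<bar>v' - v\<bar> \<le> H ^ k * (1 + mass w s') ^ k + H ^ k * (1 + mass w s) ^ k" using that by linarith
    then have "\<bar>Z w * (v' - v)\<bar> \<le> (C * (1 + mass w s) ^ q) * (H ^ k * (1 + mass w s') ^ k + H ^ k * (1 + mass w s) ^ k)"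
      unfolding abs_mult using C that by (intro mult_mono) auto
    then show ?thesis by (simp add: wgt_def algebra_simps)
  qed
  have Fm: "(\<lambda>w. F i (Y h w u)) \<in> borel_measurable P" for i u
    by (rule measurable_compose[OF ym borel_measurable_bcont[OF Cb2_deriv(3)[OF F(1)]]])
  note [measurable] = Zm ym Fm
  show ?g1
  proof (rule Bochner_Integration.integrable_bound[OF wi])
    show "AE w in P. norm (Z w * (Y h w s' ^ k - Y h w s ^ k)) \<le> norm (wgt w)"
      by (rule AE_I2, unfold real_norm_def, rule order_trans[OF wb abs_ge_self]) (auto intro: Ykb)
  qed measurable
  have "(\<lambda>i. \<integral>w. Z w * (F i (Y h w s') - F i (Y h w s)) \<partial>P) \<longlonglongrightarrow> (\<integral>w. Z w * (Y h w s' ^ k - Y h w s ^ k) \<partial>P)"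
  proof (rule integral_dominated_convergence[OF _ _ wi])
    show "AE w in P. (\<lambda>i. Z w * (F i (Y h w s') - F i (Y h w s))) \<longlonglongrightarrow> Z w * (Y h w s' ^ k - Y h w s ^ k)"
      by (intro AE_I2 tendsto_intros lim1)
    show "AE w in P. norm (Z w * (F i (Y h w s') - F i (Y h w s))) \<le> wgt w" for i
      by (rule AE_I2, unfold real_norm_def, rule wb) (auto intro: Fb)
  qed measurable
  moreover have "(\<lambda>i. \<integral>(w, u, x, a). Z w * (indicator {s<..s'} u * indicator A a * cyl (F i) h x (X w u) a) \<partial>Q)
     \<longlonglongrightarrow> integral\<^sup>L Q (zcell Z {s<..s'} (\<lambda>_. pk h k))"
  proof (rule integral_dominated_convergence[OF _ _ wtQ])
    show "(zcell Z {s<..s'} (\<lambda>_. cyl (F i) h)) \<in> borel_measurable Q" for i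
      unfolding measurable_cong_sets[OF sets_Q refl]
      by (rule measurable_cell[OF s0(1) s(2,3) _ _ Zm continuous_on_cyl[OF F(1) h]]) auto
    show "AE p in Q. norm (zcell Z {s<..s'} (\<lambda>_. cyl (F i) h) p)
       \<le> (case p of (w, u, x, a) => indicator {s..s'} u * wt w u)" for i
      by (rule AE_I2, unfold real_norm_def, rule cellb[OF cylb])
    show "AE p in Q. (\<lambda>i. zcell Z {s<..s'} (\<lambda>_. cyl (F i) h) p)
      \<longlonglongrightarrow> (zcell Z {s<..s'} (\<lambda>_. pk h k) p)"
    proof (rule AE_I2)
      fix p :: "outcome \<times> real \<times> real \<times> real"
      obtain w u x a where p: "p = (w, u, x, a)" by (cases p)
      have "(\<lambda>i. cyl (F i) h x (X w u) a) \<longlonglongrightarrow>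
        (real k * Y h w u ^ (k - 1) * 1) * gen b \<sigma> h x (X w u) a +
         1/2 * (real (k * (k - 1)) * Y h w u ^ (k - 2) * 1\<^sup>2 + real k * Y h w u ^ (k - 1) * 0) * \<gamma> x (X w u) a * (h x)\<^sup>2"
        unfolding cyl_gen_def F(3) unfolding F(2) by (intro tendsto_intros lim1)
      then have "(\<lambda>i. cyl (F i) h x (X w u) a) \<longlonglongrightarrow> pk h k x (X w u) a" by (simp add: pk_def)
      then show "(\<lambda>i. zcell Z {s<..s'} (\<lambda>_. cyl (F i) h) p)
        \<longlonglongrightarrow> (zcell Z {s<..s'} (\<lambda>_. pk h k) p)"
        unfolding p prod.case by (intro tendsto_intros)
    qed
  qed (use iq in auto)
  ultimately show "(\<integral>w. Z w * (Y h w s' ^ k - Y h w s ^ k) \<partial>P) =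
      integral\<^sup>L Q (zcell Z {s<..s'} (\<lambda>_. pk h k))"
    unfolding dyn by (rule LIMSEQ_unique)
qed

text \<open>The product of both masses plus one, rather than their sum, is the kind of weight that
  \<open>P_bound\<close> and \<open>Q_weight_bound\<close> accept.\<close>

lemma Y_increment:
  assumes "\<And>x. \<bar>h x\<bar> \<le> H"
  shows "\<bar>Y h w u - Y h w s\<bar> \<le> H * ((1 + mass w s) * (1 + mass w u))"
proof -
  have H: "0 \<le> H" by (rule order_trans[OF abs_ge_zero assms])
  have "\<bar>Y h w u\<bar> \<le> H * mass w u" "\<bar>Y h w s\<bar> \<le> H * mass w s" by (intro pairing_abs_le assms)+
  then have "\<bar>Y h w u - Y h w s\<bar> \<le> H * (mass w u + mass w s)" by (simp add: distrib_left)
  also have "mass w u + mass w s \<le> (1 + mass w s) * (1 + mass w u)"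
    using mult_nonneg_nonneg[OF mass_nonneg[of w s] mass_nonneg[of w u]] by (simp add: algebra_simps)
  then have "H * (mass w u + mass w s) \<le> H * ((1 + mass w s) * (1 + mass w u))" using H by (intro mult_left_mono)
  finally show ?thesis .
qed

lemma measurable_Y_Cb2 [measurable (raw)]:
  assumes "Cb2 h"
  shows "(\<lambda>w. Y h w u) \<in> borel_measurable P"
    and "(\<lambda>p. Y h (fst p) (snd p)) \<in> borel_measurable PR" (is ?g1)
    and "(\<lambda>p. Y h (fst p) u) \<in> borel_measurable PR" (is ?g2)
proof -
  note c = Cb2_deriv(3)[OF assms] Cb2_bounded[OF assms]
  show m: "(\<lambda>w. Y h w u) \<in> borel_measurable P" by (rule measurable_Y_P[OF c])
  show ?g1 using measurable_Y[OF c] by (simp add: split_beta')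
  show ?g2 by (rule measurable_compose[OF measurable_fst m])
qed

lemma measurable_Y_Cb2_filtration:
  assumes "Cb2 h" "0 \<le> s" "s \<le> T"
  shows "(\<lambda>w. Y h w s) \<in> borel_measurable (\<F> s)"
  by (intro measurable_Y_filtration Cb2_deriv(3) Cb2_bounded assms)

text \<open>Expanding (y' - y)^4 and regrouping gives a combination of y^j (y'^k - y^k) with j + k =
  4, and \<open>dynkin_power\<close> applies to each with a multiple of y^j as weight. The
  generators recombine to that of the fourth power of the increment.\<close>

lemma increment_fourth_moment:
  assumes h: "Cb2 h" and s: "t \<le> s" "s \<le> s'" "s' \<le> T"
  shows "integrable Q (\<lambda>(w, u, x, a). indicator {s<..s'} u * indicator A a *
       (4 * (Y h w u - Y h w s) ^ 3 * gen b \<sigma> h x (X w u) a + 6 * (Y h w u - Y h w s)\<^sup>2 * \<gamma> x (X w u) a * (h x)\<^sup>2))"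
    and "(\<integral>w. (Y h w s' - Y h w s) ^ 4 \<partial>P) =
      (\<integral>(w, u, x, a). indicator {s<..s'} u * indicator A a *
       (4 * (Y h w u - Y h w s) ^ 3 * gen b \<sigma> h x (X w u) a + 6 * (Y h w u - Y h w s)\<^sup>2 * \<gamma> x (X w u) a * (h x)\<^sup>2) \<partial>Q)"
proof -
  obtain H where H: "0 \<le> H" "\<And>x. \<bar>h x\<bar> \<le> H" using Cb2_bound[OF h] by metis
  have s0: "0 \<le> s" "s \<le> T" using s t by auto
  note [measurable] = measurable_Y_Cb2_filtration[OF h s0]
  have yb: "\<bar>Y h w s ^ j\<bar> \<le> H ^ j * (1 + mass w s) ^ j" for w j
  proof -
    have "\<bar>Y h w s\<bar> ^ j \<le> (H * (1 + mass w s)) ^ j" by (intro power_mono Y_abs_le H) auto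
    then show ?thesis by (simp add: power_abs power_mult_distrib)
  qed
  have c: "0 \<le> c * H ^ j" if "0 \<le> c" for c j using H that by simp
  have zb: "\<forall>w\<in>space P. \<bar>c * Y h w s ^ j\<bar> \<le> \<bar>c\<bar> * H ^ j * (1 + mass w s) ^ j" for c j
    unfolding abs_mult mult.assoc by (intro ballI mult_left_mono yb) simp
  have Zm: "(\<lambda>w. c * Y h w s ^ j) \<in> borel_measurable (\<F> s)" for c j by measurable
  note d = dynkin_power[OF h _ s Zm c[OF abs_ge_zero] zb]
  note d4 = d[of 4 1 0] and d3 = d[of 3 "-4" 1] and d2 = d[of 2 6 2] and d1 = d[of 1 "-4" 3]
  let ?k = "\<lambda>k (w, u, x, a). indicator {s<..s'} u * indicator A a * pk h k x (X w u) a"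
  let ?q = "\<lambda>c j k (w, u, x, a). c * Y h w s ^ j * (indicator {s<..s'} u * indicator A a * pk h k x (X w u) a)"
  have sum: "(case p of (w, u, x, a) => indicator {s<..s'} u * indicator A a *
       (4 * (Y h w u - Y h w s) ^ 3 * gen b \<sigma> h x (X w u) a + 6 * (Y h w u - Y h w s)\<^sup>2 * \<gamma> x (X w u) a * (h x)\<^sup>2))
     = ?q 1 0 4 p + ?q (-4) 1 3 p + ?q 6 2 2 p + ?q (-4) 3 1 p" for p
    by (cases p) (simp add: pk_def power3_eq_cube power2_eq_square algebra_simps)
  show "integrable Q (\<lambda>(w, u, x, a). indicator {s<..s'} u * indicator A a *
       (4 * (Y h w u - Y h w s) ^ 3 * gen b \<sigma> h x (X w u) a + 6 * (Y h w u - Y h w s)\<^sup>2 * \<gamma> x (X w u) a * (h x)\<^sup>2))"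
    unfolding sum by (intro Bochner_Integration.integrable_add d4(1) d3(1) d2(1) d1(1)) auto
  have "(\<integral>w. (Y h w s' - Y h w s) ^ 4 \<partial>P) =
     (\<integral>w. 1 * Y h w s ^ 0 * (Y h w s' ^ 4 - Y h w s ^ 4) + -4 * Y h w s ^ 1 * (Y h w s' ^ 3 - Y h w s ^ 3)
       + 6 * Y h w s ^ 2 * (Y h w s' ^ 2 - Y h w s ^ 2) + -4 * Y h w s ^ 3 * (Y h w s' ^ 1 - Y h w s ^ 1) \<partial>P)"
    by (intro Bochner_Integration.integral_cong refl) (simp add: power4_eq_xxxx power3_eq_cube power2_eq_square algebra_simps)
  also have "\<dots> = (\<integral>w. 1 * Y h w s ^ 0 * (Y h w s' ^ 4 - Y h w s ^ 4) \<partial>P) + (\<integral>w. -4 * Y h w s ^ 1 * (Y h w s' ^ 3 - Y h w s ^ 3) \<partial>P)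
       + (\<integral>w. 6 * Y h w s ^ 2 * (Y h w s' ^ 2 - Y h w s ^ 2) \<partial>P) + (\<integral>w. -4 * Y h w s ^ 3 * (Y h w s' ^ 1 - Y h w s ^ 1) \<partial>P)"
    using d4(2) d3(2) d2(2) d1(2) by (simp del: power_0 power_one_right)
  also have "\<dots> = (\<integral>p. ?q 1 0 4 p \<partial>Q) + (\<integral>p. ?q (-4) 1 3 p \<partial>Q) + (\<integral>p. ?q 6 2 2 p \<partial>Q) + (\<integral>p. ?q (-4) 3 1 p \<partial>Q)"
    by (subst d4(3) d3(3) d2(3) d1(3), simp)+ (rule refl)
  also have "\<dots> = (\<integral>p. ?q 1 0 4 p + ?q (-4) 1 3 p + ?q 6 2 2 p + ?q (-4) 3 1 p \<partial>Q)"
    using d4(1) d3(1) d2(1) d1(1) by (simp del: power_0 power_one_right)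
  finally show "(\<integral>w. (Y h w s' - Y h w s) ^ 4 \<partial>P) =
      (\<integral>(w, u, x, a). indicator {s<..s'} u * indicator A a *
       (4 * (Y h w u - Y h w s) ^ 3 * gen b \<sigma> h x (X w u) a + 6 * (Y h w u - Y h w s)\<^sup>2 * \<gamma> x (X w u) a * (h x)\<^sup>2) \<partial>Q)"
    unfolding sum .
qed

lemma increment_square:
  assumes h: "Cb2 h" and s: "t \<le> s" "s \<le> s'" "s' \<le> T"
    and Z: "Z \<in> borel_measurable (\<F> s)" "\<And>w. w \<in> space P ==> \<bar>Z w\<bar> \<le> C"
  shows "integrable Q (\<lambda>(w, u, x, a). Z w * (indicator {s<..s'} u * indicator A a *
       (2 * (Y h w u - Y h w s) * gen b \<sigma> h x (X w u) a + \<gamma> x (X w u) a * (h x)\<^sup>2)))"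
    and "integrable P (\<lambda>w. Z w * (Y h w s' - Y h w s)\<^sup>2)" (is ?g1)
    and "(\<integral>w. Z w * (Y h w s' - Y h w s)\<^sup>2 \<partial>P) =
      (\<integral>(w, u, x, a). Z w * (indicator {s<..s'} u * indicator A a *
       (2 * (Y h w u - Y h w s) * gen b \<sigma> h x (X w u) a + \<gamma> x (X w u) a * (h x)\<^sup>2)) \<partial>Q)"
proof -
  obtain H where H: "0 \<le> H" "\<And>x. \<bar>h x\<bar> \<le> H" using Cb2_bound[OF h] by metis
  have s0: "0 \<le> s" "s \<le> T" using s t by auto
  obtain w0 where "w0 \<in> space P" using not_empty by auto
  then have C: "0 \<le> C" using Z(2) abs_ge_zero order_trans by blast
  note [measurable] = measurable_Y_Cb2_filtration[OF h s0] Z(1)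
  have Zm: "(\<lambda>w. -2 * Y h w s * Z w) \<in> borel_measurable (\<F> s)" by measurable
  have zb: "\<forall>w\<in>space P. \<bar>-2 * Y h w s * Z w\<bar> \<le> (2 * H * C) * (1 + mass w s) ^ 1"
  proof
    fix w assume "w \<in> space P"
    note that = this
    have "\<bar>-2 * Y h w s * Z w\<bar> \<le> 2 * (H * (1 + mass w s)) * C"
      unfolding abs_mult by (intro mult_mono Y_abs_le H Z that) (use H in auto)
    then show "\<bar>-2 * Y h w s * Z w\<bar> \<le> (2 * H * C) * (1 + mass w s) ^ 1" by (simp add: mult_ac)
  qed
  have HC: "0 \<le> 2 * H * C" using H C by simp
  have zb2: "\<forall>w\<in>space P. \<bar>Z w\<bar> \<le> C * (1 + mass w s) ^ 0" using Z(2) by simp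
  have k2: "(1::nat) \<le> 2" by simp
  note d2 = dynkin_power[OF h k2 s Z(1) C zb2] and d1 = dynkin_power[OF h order_refl s Zm HC zb]
  let ?q2 = "\<lambda>(w, u, x, a). Z w * (indicator {s<..s'} u * indicator A a * pk h 2 x (X w u) a)"
  let ?q1 = "\<lambda>(w, u, x, a). -2 * Y h w s * Z w * (indicator {s<..s'} u * indicator A a * pk h 1 x (X w u) a)"
  have sum: "(case p of (w, u, x, a) => Z w * (indicator {s<..s'} u * indicator A a *
       (2 * (Y h w u - Y h w s) * gen b \<sigma> h x (X w u) a + \<gamma> x (X w u) a * (h x)\<^sup>2))) = ?q2 p + ?q1 p" for p
    by (cases p) (simp add: pk_def algebra_simps)
  have sum': "Z w * (Y h w s' - Y h w s)\<^sup>2 = Z w * (Y h w s' ^ 2 - Y h w s ^ 2) + -2 * Y h w s * Z w * (Y h w s' ^ 1 - Y h w s ^ 1)" for w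
    by (simp add: power2_eq_square algebra_simps)
  show "integrable Q (\<lambda>(w, u, x, a). Z w * (indicator {s<..s'} u * indicator A a *
       (2 * (Y h w u - Y h w s) * gen b \<sigma> h x (X w u) a + \<gamma> x (X w u) a * (h x)\<^sup>2)))"
    unfolding sum by (intro Bochner_Integration.integrable_add d2(1) d1(1))
  show ?g1
    unfolding sum' by (intro Bochner_Integration.integrable_add d2(2) d1(2))
  have "(\<integral>w. Z w * (Y h w s' - Y h w s)\<^sup>2 \<partial>P) = (\<integral>p. ?q2 p \<partial>Q) + (\<integral>p. ?q1 p \<partial>Q)"
    using Bochner_Integration.integral_add[OF d2(2) d1(2)] unfolding sum' d2(3) d1(3) .
  also have "\<dots> = (\<integral>p. ?q2 p + ?q1 p \<partial>Q)" by (rule Bochner_Integration.integral_add[OF d2(1) d1(1), symmetric])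
  finally show "(\<integral>w. Z w * (Y h w s' - Y h w s)\<^sup>2 \<partial>P) =
      (\<integral>(w, u, x, a). Z w * (indicator {s<..s'} u * indicator A a *
       (2 * (Y h w u - Y h w s) * gen b \<sigma> h x (X w u) a + \<gamma> x (X w u) a * (h x)\<^sup>2)) \<partial>Q)"
    unfolding sum .
qed

lemma fourth_moment_integrable:
  assumes h: "Cb2 h" and s: "s \<in> {t..T}" "u \<in> {t..T}"
  shows "integrable P (\<lambda>w. (Y h w u - Y h w s) ^ 4)"
proof -
  obtain H where H: "0 \<le> H" "\<And>x. \<bar>h x\<bar> \<le> H" using Cb2_bound[OF h] by metis
  show ?thesis
  proof (rule P_bound(1)[OF s, of "H ^ 4" _ 4 4])
    fix w
    have "\<bar>Y h w u - Y h w s\<bar> ^ 4 \<le> (H * ((1 + mass w s) * (1 + mass w u))) ^ 4"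
      by (intro power_mono Y_increment H) auto
    then show "\<bar>(Y h w u - Y h w s) ^ 4\<bar> \<le> H ^ 4 * ((1 + mass w s) ^ 4 * (1 + mass w u) ^ 4)"
      by (simp add: power_abs power_mult_distrib)
  qed (use H measurable_Y_Cb2(1)[OF h] in auto)
qed

lemma young:
  fixes q v \<delta> :: real
  assumes "\<delta> > 0"
  shows "q * v \<le> q\<^sup>2 / (2 * \<delta>) + \<delta> / 2 * v\<^sup>2"
proof -
  have "0 \<le> (q - \<delta> * v)\<^sup>2" by simp
  then have "q * v * (2 * \<delta>) \<le> q\<^sup>2 + \<delta>\<^sup>2 * v\<^sup>2" by (simp add: power2_diff power_mult_distrib algebra_simps)
  then have "q * v \<le> (q\<^sup>2 + \<delta>\<^sup>2 * v\<^sup>2) / (2 * \<delta>)" using assms by (simp only: pos_le_divide_eq)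
  also have "\<dots> = q\<^sup>2 / (2 * \<delta>) + \<delta> / 2 * v\<^sup>2" using assms by (simp add: add_divide_distrib power2_eq_square)
  finally show ?thesis .
qed

text \<open>The bound of the fourth moment by its own supremum over the interval, times a small factor, is
  absorbed on the left-hand side.\<close>

lemma increment_fourth_moment_le:
  assumes h: "Cb2 h"
  obtains C where "0 \<le> C" "\<And>s s'. t \<le> s ==> s \<le> s' ==> s' \<le> T ==> (\<integral>w. (Y h w s' - Y h w s) ^ 4 \<partial>P) \<le> C * (s' - s)\<^sup>2"
proof -
  obtain H where H: "0 \<le> H" "\<And>x. \<bar>h x\<bar> \<le> H" using Cb2_bound[OF h] by metis
  obtain G where G: "0 \<le> G" "\<And>x \<nu> a. a \<in> A ==> \<bar>gen b \<sigma> h x \<nu> a\<bar> \<le> G" by (rule gen_bound[OF h]) blast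
  obtain \<Gamma> where \<Gamma>: "0 \<le> \<Gamma>" "\<And>x \<nu> a. a \<in> A ==> \<bar>\<gamma> x \<nu> a\<bar> \<le> \<Gamma>" by (rule admissible_coeff_bound[OF \<gamma>]) blast
  \<comment> \<open>In the cubic term one factor of the increment is estimated by \<open>H\<close>
    times the masses, so that both terms of the generator carry the square of the increment.\<close>
  define c1 where "c1 = 4 * G * H + 6 * \<Gamma> * H\<^sup>2"
  have c1: "0 \<le> c1" using G H \<Gamma> by (simp add: c1_def)
  define M where "M = c1\<^sup>2 * (2 * moment (2 + 4))"
  have M: "0 \<le> M" using moment_nn(1) by (simp add: M_def)
  have main: "(\<integral>w. (Y h w s' - Y h w s) ^ 4 \<partial>P) \<le> M * (s' - s)\<^sup>2" if s: "t \<le> s" "s < s'" "s' \<le> T" for s s'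
  proof -
    define \<delta> where "\<delta> = s' - s"
    have \<delta>: "\<delta> > 0" using s by (simp add: \<delta>_def)
    let ?D = "\<lambda>w u. Y h w u - Y h w s"
    define e where "e = (SUP u\<in>{s..s'}. \<integral>w. ?D w u ^ 4 \<partial>P)"
    have sT: "s \<in> {t..T}" using s by auto
    \<comment> \<open>Absorbing half of \<open>e\<close> into the left-hand side presupposes that
      \<open>e\<close> is finite; the moment bounds provide this.\<close>
    have bdd: "bdd_above ((\<lambda>u. \<integral>w. ?D w u ^ 4 \<partial>P) ` {s..s'})"
    proof (rule bdd_aboveI2)
      fix u assume u: "u \<in> {s..s'}"
      have "\<bar>\<integral>w. ?D w u ^ 4 \<partial>P\<bar> \<le> H ^ 4 * (2 * moment (4 + 4))"
      proof (rule P_bound(2)[OF sT, of u])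
        fix w
        have "\<bar>?D w u\<bar> ^ 4 \<le> (H * ((1 + mass w s) * (1 + mass w u))) ^ 4"
          by (intro power_mono Y_increment H) auto
        then show "\<bar>?D w u ^ 4\<bar> \<le> H ^ 4 * ((1 + mass w s) ^ 4 * (1 + mass w u) ^ 4)"
          by (simp add: power_abs power_mult_distrib)
      qed (use H u s measurable_Y_Cb2(1)[OF h] in auto)
      then show "(\<integral>w. ?D w u ^ 4 \<partial>P) \<le> H ^ 4 * (2 * moment (4 + 4))" by linarith
    qed
    have e: "(\<integral>w. ?D w u ^ 4 \<partial>P) \<le> e" if "u \<in> {s..s'}" for u
      unfolding e_def by (rule cSUP_upper[OF that bdd])
    have e0: "0 \<le> e" using e[of s] s by simp
    have step: "(\<integral>w. ?D w r ^ 4 \<partial>P) \<le> e / 2 + \<delta>\<^sup>2 * M / 2" if r: "r \<in> {s..s'}" for r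
    proof -
      define k where "k = (\<lambda>(w, u). ?D w u ^ 2 * (c1 * ((1 + mass w s) * (1 + mass w u))))"
      \<comment> \<open>Young's inequality with parameter \<delta> splits square times weight into a
        fourth power over \<open>2 * \<delta>\<close> and \<delta> / 2 times a moment. Integration
        over a length of at most \<delta> turns the first part into \<open>e / 2\<close>.\<close>
      define c where "c = e / (2 * \<delta>) + \<delta> * M / 2"
      have c0: "0 \<le> c" using e0 \<delta> M by (simp add: c_def)
      let ?f = "\<lambda>(w, u, x, a). indicator {s<..r} u * indicator A a *
       (4 * ?D w u ^ 3 * gen b \<sigma> h x (X w u) a + 6 * (?D w u)\<^sup>2 * \<gamma> x (X w u) a * (h x)\<^sup>2)"
      note eq = increment_fourth_moment[OF h s(1), of r]
      have "\<bar>\<integral>p. ?f p \<partial>Q\<bar> \<le> c * (r - s)"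
      proof (rule Q_bound(2)[of s r ?f k])
        show "?f \<in> borel_measurable PB"
          using borel_measurable_integrable[OF eq(1)] r s by (simp cong: measurable_cong_sets[OF sets_Q refl])
        show "k \<in> borel_measurable PR"
        proof -
          have [measurable]: "(\<lambda>p. mass (fst p) (snd p)) \<in> borel_measurable PR" "(\<lambda>p. mass (fst p) s) \<in> borel_measurable PR"
            by (rule measurable_Y_Cb2[OF Cb2_const(1)])+
          show ?thesis unfolding k_def split_beta' using measurable_Y_Cb2(2,3)[OF h] by measurable
        qed
        fix w u x a
        have D: "\<bar>?D w u\<bar> \<le> H * ((1 + mass w s) * (1 + mass w u))" by (intro Y_increment H)
        have w1: "1 \<le> (1 + mass w s) * (1 + mass w u)" using mult_mono[of 1 "1 + mass w s" 1 "1 + mass w u"] by simp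
        have k0: "0 \<le> k (w, u)" using c1 by (simp add: k_def)
        show "\<bar>?f (w, u, x, a)\<bar> \<le> indicator {s..r} u * k (w, u)"
        proof (cases "u \<in> {s<..r} \<and> a \<in> A")
          case True
          have "\<bar>4 * ?D w u ^ 3 * gen b \<sigma> h x (X w u) a\<bar> = ?D w u ^ 2 * (4 * \<bar>?D w u\<bar> * \<bar>gen b \<sigma> h x (X w u) a\<bar>)"
            by (simp add: abs_mult power3_eq_cube power2_eq_square)
          also have "\<dots> \<le> ?D w u ^ 2 * (4 * (H * ((1 + mass w s) * (1 + mass w u))) * G)"
            using True by (intro mult_left_mono mult_mono D G) (use H in auto)
          finally have 1: "\<bar>4 * ?D w u ^ 3 * gen b \<sigma> h x (X w u) a\<bar> \<le> ?D w u ^ 2 * (4 * (H * ((1 + mass w s) * (1 + mass w u))) * G)" .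
          have h2: "(h x)\<^sup>2 \<le> H\<^sup>2" using H by (simp add: abs_le_square_iff[symmetric])
          have "\<bar>6 * (?D w u)\<^sup>2 * \<gamma> x (X w u) a * (h x)\<^sup>2\<bar> = ?D w u ^ 2 * (6 * \<bar>\<gamma> x (X w u) a\<bar> * (h x)\<^sup>2 * 1)"
            by (simp add: abs_mult)
          also have "\<dots> \<le> ?D w u ^ 2 * (6 * \<Gamma> * H\<^sup>2 * ((1 + mass w s) * (1 + mass w u)))"
            using True by (intro mult_left_mono mult_mono w1 h2 \<Gamma>) (use \<Gamma> in auto)
          finally have 2: "\<bar>6 * (?D w u)\<^sup>2 * \<gamma> x (X w u) a * (h x)\<^sup>2\<bar> \<le> ?D w u ^ 2 * (6 * \<Gamma> * H\<^sup>2 * ((1 + mass w s) * (1 + mass w u)))" .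
          have "k (w, u) = ?D w u ^ 2 * (4 * (H * ((1 + mass w s) * (1 + mass w u))) * G) + ?D w u ^ 2 * (6 * \<Gamma> * H\<^sup>2 * ((1 + mass w s) * (1 + mass w u)))"
            by (simp add: k_def c1_def algebra_simps)
          then show ?thesis using 1 2 True abs_triangle_ineq[of "4 * ?D w u ^ 3 * gen b \<sigma> h x (X w u) a" "6 * (?D w u)\<^sup>2 * \<gamma> x (X w u) a * (h x)\<^sup>2"]
            by simp
        qed (use k0 in \<open>auto simp: indicator_def\<close>)
      next
        fix u assume u: "u \<in> {s..r}"
        then have uT: "u \<in> {t..T}" "u \<in> {s..s'}" using r s by auto
        let ?w = "\<lambda>w. (c1\<^sup>2 * ((1 + mass w s) ^ 2 * (1 + mass w u) ^ 4))"
        have wi: "integrable P ?w" "(\<integral>w. ?w w \<partial>P) \<le> M" (is ?g1)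
        proof -
          have "integrable P ?w" "\<bar>\<integral>w. ?w w \<partial>P\<bar> \<le> c1\<^sup>2 * (2 * moment (2 + 4))"
            by (rule P_bound[OF sT uT(1), of "c1\<^sup>2" ?w 2 4]; simp)+
          then show "integrable P ?w" ?g1 by (auto simp: M_def)
        qed
        note iD = fourth_moment_integrable[OF h sT uT(1)]
        let ?g = "\<lambda>w. ?D w u ^ 4 / (2 * \<delta>) + \<delta> / 2 * ?w w"
        have ig: "integrable P ?g" using iD wi by simp
        have "(\<integral>\<^sup>+w. ennreal (k (w, u)) * ennreal (mass w u) \<partial>P) \<le> EN (\<lambda>w. ?g w)"
        proof (rule nn_integral_mono)
          fix w
          define v where "v = c1 * ((1 + mass w s) * (1 + mass w u)^2)"
          have k0: "0 \<le> k (w, u)" using c1 by (simp add: k_def)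
          have "k (w, u) * mass w u \<le> k (w, u) * (1 + mass w u)" using k0 by (intro mult_left_mono) auto
          also have "\<dots> = ?D w u ^ 2 * v" by (simp add: k_def v_def power2_eq_square mult_ac)
          also have "\<dots> \<le> (?D w u ^ 2)\<^sup>2 / (2 * \<delta>) + \<delta> / 2 * v\<^sup>2"
          proof -
            show ?thesis by (rule young[OF \<delta>])
          qed
          also have "\<dots> = ?g w" by (simp add: v_def power_mult_distrib power_mult[symmetric])
          finally show "ennreal (k (w, u)) * ennreal (mass w u) \<le> ennreal (?g w)"
            using k0 by (simp add: ennreal_mult[symmetric] ennreal_leI)
        qed
        also have "\<dots> = ennreal (\<integral>w. ?g w \<partial>P)"
          by (rule nn_integral_eq_integral[OF ig]) (use \<delta> in auto)
        also have "(\<integral>w. ?g w \<partial>P) = (\<integral>w. ?D w u ^ 4 \<partial>P) / (2 * \<delta>) + \<delta> / 2 * (\<integral>w. ?w w \<partial>P)" using iD wi by simp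
        also have "\<dots> \<le> c"
          unfolding c_def using e[OF uT(2)] wi(2) \<delta> by (intro add_mono divide_right_mono) (auto intro!: mult_left_mono)
        finally show "(\<integral>\<^sup>+w. ennreal (k (w, u)) * ennreal (mass w u) \<partial>P) \<le> ennreal c" by (simp add: ennreal_leI)
      qed (use r s t c0 in auto)
      then have "(\<integral>w. ?D w r ^ 4 \<partial>P) \<le> c * (r - s)" using eq(2) r s by simp
      also have "\<dots> \<le> c * \<delta>" using r c0 by (intro mult_left_mono) (auto simp: \<delta>_def)
      also have "\<dots> = e / 2 + \<delta>\<^sup>2 * M / 2" using \<delta> by (simp add: c_def field_simps power2_eq_square)
      finally show ?thesis .
    qed
    have "e \<le> e / 2 + \<delta>\<^sup>2 * M / 2"
      unfolding e_def[of] using step s by (intro cSUP_least) (auto simp: e_def)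
    then have "e \<le> \<delta>\<^sup>2 * M" by linarith
    then have "e \<le> M * \<delta>\<^sup>2" by (simp only: mult.commute)
    then show ?thesis using e[of s'] s by (simp add: \<delta>_def)
  qed
  show thesis
  proof (rule that[OF M])
    fix s s' assume "t \<le> s" "s \<le> s'" "s' \<le> T"
    then show "(\<integral>w. (Y h w s' - Y h w s) ^ 4 \<partial>P) \<le> M * (s' - s)\<^sup>2"
      using main[of s s'] by (cases "s = s'") auto
  qed
qed

end

section \<open>Second-order expansion along atomic measures\<close>

text \<open>The cut-off at zero is continuous, so in this form the dependence on the weights is
  continuous for weights of any sign.\<close>

lemma pairing_atoms_max:
  assumes "finite J" "f \<in> borel_measurable borel"
  shows "pairing f (atoms J x y) = (\<Sum>j\<in>J. max 0 (y j) * f (x j))"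
proof -
  have "atoms J x y = atoms J x (\<lambda>j. max 0 (y j))"
    unfolding atoms_def by (simp add: max_def ennreal_neg cong: if_cong)
       (auto intro!: arg_cong[where f="\<lambda>M. Abs_finmeas (distr (point_measure J M) borel x)"] simp: fun_eq_iff ennreal_neg)
  then show ?thesis using pairing_atoms[of J "\<lambda>j. max 0 (y j)" f x] assms by simp
qed

lemma continuous_on_atoms:
  assumes J: "finite J" and y: "\<And>j. j \<in> J ==> continuous_on S (\<lambda>p. y p j)"
  shows "continuous_on S (\<lambda>p. atoms J x (y p) :: real finmeas)"
  unfolding continuous_on_def
proof
  fix p assume p: "p \<in> S"
  show "((\<lambda>p. atoms J x (y p) :: real finmeas) \<longlongrightarrow> atoms J x (y p)) (at p within S)"
    unfolding tendsto_finmeas_iff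
  proof (intro allI impI)
    fix f :: "real => real" assume f: "continuous_on UNIV f" "bounded (range f)"
    have fm: "f \<in> borel_measurable borel" using f(1) by (rule borel_measurable_bcont)
    have lim: "((\<lambda>q. y q j) \<longlongrightarrow> y p j) (at p within S)" if "j \<in> J" for j
      using y[OF that] p by (simp add: continuous_on_def)
    show "((\<lambda>q. pairing f (atoms J x (y q))) \<longlongrightarrow> pairing f (atoms J x (y p))) (at p within S)"
      unfolding pairing_atoms_max[OF J fm] by (auto intro!: tendsto_intros lim)
  qed
qed

locale smooth_fun =
  fixes T :: real and W Wt :: "real => real finmeas => real" and W1 :: "real => real finmeas => real => real"
    and W2 :: "real => real finmeas => real => real => real"
  assumes T: "0 < T" and W: "Cb_1_22 T W Wt W1 W2" and Wc: "continuous_on ({0..T} \<times> UNIV) (\<lambda>(t, \<nu>). W t \<nu>)"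
begin

lemma Wt_deriv: "u \<in> {0..<T} ==> ((\<lambda>s. W s \<nu>) has_real_derivative Wt u \<nu>) (at u within {0..<T})"
  and Wt_cont: "continuous_on ({0..<T} \<times> UNIV) (\<lambda>(t, \<nu>). Wt t \<nu>)"
  and W_lin: "u \<in> {0..<T} ==> has_linear_derivative (W u) (W1 u)"
  and W1_lin: "u \<in> {0..<T} ==> has_linear_derivative (\<lambda>\<nu>. W1 u \<nu> x) (\<lambda>\<nu> y. W2 u \<nu> x y)"
  and W1_cont: "continuous_on ({0..<T} \<times> UNIV \<times> UNIV) (\<lambda>(t, \<nu>, x). W1 t \<nu> x)"
  and W1x_cont: "continuous_on ({0..<T} \<times> UNIV \<times> UNIV) (\<lambda>(t, \<nu>, x). pd W1 t \<nu> x)"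
  and W1xx_cont: "continuous_on ({0..<T} \<times> UNIV \<times> UNIV) (\<lambda>(t, \<nu>, x). pd (pd W1) t \<nu> x)"
  and W2_cont: "continuous_on ({0..<T} \<times> UNIV \<times> UNIV \<times> UNIV) (\<lambda>(t, \<nu>, x, y). W2 t \<nu> x y)"
  and W1_diff: "u \<in> {0..<T} ==> W1 u \<nu> field_differentiable at x"
  and W1x_diff: "u \<in> {0..<T} ==> pd W1 u \<nu> field_differentiable at x"
  using W by (simp_all add: Cb_1_22_def bcont_on_def)

lemma W1_deriv: "u \<in> {0..<T} ==> (W1 u \<nu> has_real_derivative pd W1 u \<nu> x) (at x)"
  and W1x_deriv: "u \<in> {0..<T} ==> (pd W1 u \<nu> has_real_derivative pd (pd W1) u \<nu> x) (at x)"
  using W1_diff[of u \<nu> x] W1x_diff[of u \<nu> x]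
  unfolding DERIV_deriv_iff_field_differentiable[symmetric] pd_def by auto

lemma derivative_bounds:
  "\<exists>C\<ge>0. \<forall>u\<in>{0..<T}. \<forall>\<nu> x y. \<bar>Wt u \<nu>\<bar> \<le> C \<and> \<bar>W1 u \<nu> x\<bar> \<le> C \<and> \<bar>pd W1 u \<nu> x\<bar> \<le> C \<and> \<bar>pd (pd W1) u \<nu> x\<bar> \<le> C \<and> \<bar>W2 u \<nu> x y\<bar> \<le> C"
proof -
  have bd: "bounded ((\<lambda>(t, \<nu>). Wt t \<nu>) ` ({0..<T} \<times> UNIV))"
    "bounded ((\<lambda>(t, \<nu>, x). W1 t \<nu> x) ` ({0..<T} \<times> UNIV \<times> UNIV))"
    "bounded ((\<lambda>(t, \<nu>, x). pd W1 t \<nu> x) ` ({0..<T} \<times> UNIV \<times> UNIV))"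
    "bounded ((\<lambda>(t, \<nu>, x). pd (pd W1) t \<nu> x) ` ({0..<T} \<times> UNIV \<times> UNIV))"
    "bounded ((\<lambda>(t, \<nu>, x, y). W2 t \<nu> x y) ` ({0..<T} \<times> UNIV \<times> UNIV \<times> UNIV))"
    using W by (auto simp: Cb_1_22_def bcont_on_def)
  obtain c1 where c1: "\<And>u \<nu>. u \<in> {0..<T} ==> \<bar>Wt u \<nu>\<bar> \<le> c1" using bd(1) by (force simp: bounded_iff)
  obtain c2 where c2: "\<And>u \<nu> x. u \<in> {0..<T} ==> \<bar>W1 u \<nu> x\<bar> \<le> c2" using bd(2) by (force simp: bounded_iff)
  obtain c3 where c3: "\<And>u \<nu> x. u \<in> {0..<T} ==> \<bar>pd W1 u \<nu> x\<bar> \<le> c3" using bd(3) by (force simp: bounded_iff)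
  obtain c4 where c4: "\<And>u \<nu> x. u \<in> {0..<T} ==> \<bar>pd (pd W1) u \<nu> x\<bar> \<le> c4" using bd(4) by (force simp: bounded_iff)
  obtain c5 where c5: "\<And>u \<nu> x y. u \<in> {0..<T} ==> \<bar>W2 u \<nu> x y\<bar> \<le> c5" using bd(5) by (force simp: bounded_iff)
  show ?thesis
  proof (intro exI[of _ "\<bar>c1\<bar> + \<bar>c2\<bar> + \<bar>c3\<bar> + \<bar>c4\<bar> + \<bar>c5\<bar>"] conjI ballI allI)
    fix u \<nu> x y assume u: "u \<in> {0..<T}"
    show "\<bar>Wt u \<nu>\<bar> \<le> \<bar>c1\<bar> + \<bar>c2\<bar> + \<bar>c3\<bar> + \<bar>c4\<bar> + \<bar>c5\<bar>" using c1[OF u, of \<nu>] by linarith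
    show "\<bar>W1 u \<nu> x\<bar> \<le> \<bar>c1\<bar> + \<bar>c2\<bar> + \<bar>c3\<bar> + \<bar>c4\<bar> + \<bar>c5\<bar>" using c2[OF u, of \<nu> x] by linarith
    show "\<bar>pd W1 u \<nu> x\<bar> \<le> \<bar>c1\<bar> + \<bar>c2\<bar> + \<bar>c3\<bar> + \<bar>c4\<bar> + \<bar>c5\<bar>" using c3[OF u, of \<nu> x] by linarith
    show "\<bar>pd (pd W1) u \<nu> x\<bar> \<le> \<bar>c1\<bar> + \<bar>c2\<bar> + \<bar>c3\<bar> + \<bar>c4\<bar> + \<bar>c5\<bar>" using c4[OF u, of \<nu> x] by linarith
    show "\<bar>W2 u \<nu> x y\<bar> \<le> \<bar>c1\<bar> + \<bar>c2\<bar> + \<bar>c3\<bar> + \<bar>c4\<bar> + \<bar>c5\<bar>" using c5[OF u, of \<nu> x y] by linarith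
  qed auto
qed

definition KW :: real where
  "KW = (SOME C. 0 \<le> C \<and> (\<forall>u\<in>{0..<T}. \<forall>\<nu> x y. \<bar>Wt u \<nu>\<bar> \<le> C \<and> \<bar>W1 u \<nu> x\<bar> \<le> C \<and> \<bar>pd W1 u \<nu> x\<bar> \<le> C \<and> \<bar>pd (pd W1) u \<nu> x\<bar> \<le> C \<and> \<bar>W2 u \<nu> x y\<bar> \<le> C))"

lemma KW: "0 \<le> KW" "u \<in> {0..<T} ==> \<bar>Wt u \<nu>\<bar> \<le> KW" "u \<in> {0..<T} ==> \<bar>W1 u \<nu> x\<bar> \<le> KW"
  "u \<in> {0..<T} ==> \<bar>pd W1 u \<nu> x\<bar> \<le> KW" "u \<in> {0..<T} ==> \<bar>pd (pd W1) u \<nu> x\<bar> \<le> KW" "u \<in> {0..<T} ==> \<bar>W2 u \<nu> x y\<bar> \<le> KW"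
  using someI_ex[OF derivative_bounds, folded KW_def] by blast+

lemma continuous_on_Wt:
  assumes "continuous_on S f" "continuous_on S g" "\<And>p. p \<in> S ==> f p \<in> {0..<T}"
  shows "continuous_on S (\<lambda>p. Wt (f p) (g p))"
proof -
  have "continuous_on S (\<lambda>p. case (f p, g p) of (t, \<nu>) => Wt t \<nu>)"
    by (rule continuous_on_compose2[OF Wt_cont]) (use assms in \<open>auto intro!: continuous_intros\<close>)
  then show ?thesis by simp
qed

lemma continuous_on_W1:
  assumes "continuous_on S f" "continuous_on S g" "continuous_on S x" "\<And>p. p \<in> S ==> f p \<in> {0..<T}"
  shows "continuous_on S (\<lambda>p. W1 (f p) (g p) (x p))" (is ?g1) "continuous_on S (\<lambda>p. pd W1 (f p) (g p) (x p))" (is ?g2)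
    "continuous_on S (\<lambda>p. pd (pd W1) (f p) (g p) (x p))" (is ?g3)
proof -
  have "continuous_on S (\<lambda>p. case (f p, g p, x p) of (t, \<nu>, x) => W1 t \<nu> x)"
    by (rule continuous_on_compose2[OF W1_cont]) (use assms in \<open>auto intro!: continuous_intros\<close>)
  then show ?g1 by simp
  have "continuous_on S (\<lambda>p. case (f p, g p, x p) of (t, \<nu>, x) => pd W1 t \<nu> x)"
    by (rule continuous_on_compose2[OF W1x_cont]) (use assms in \<open>auto intro!: continuous_intros\<close>)
  then show ?g2 by simp
  have "continuous_on S (\<lambda>p. case (f p, g p, x p) of (t, \<nu>, x) => pd (pd W1) t \<nu> x)"
    by (rule continuous_on_compose2[OF W1xx_cont]) (use assms in \<open>auto intro!: continuous_intros\<close>)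
  then show ?g3 by simp
qed

lemma continuous_on_W2:
  assumes "continuous_on S f" "continuous_on S g" "continuous_on S x" "continuous_on S y" "\<And>p. p \<in> S ==> f p \<in> {0..<T}"
  shows "continuous_on S (\<lambda>p. W2 (f p) (g p) (x p) (y p))"
proof -
  have "continuous_on S (\<lambda>p. case (f p, g p, x p, y p) of (t, \<nu>, x, y) => W2 t \<nu> x y)"
    by (rule continuous_on_compose2[OF W2_cont]) (use assms in \<open>auto intro!: continuous_intros\<close>)
  then show ?thesis by simp
qed

lemma continuous_on_W:
  assumes "continuous_on S f" "continuous_on S g" "\<And>p. p \<in> S ==> f p \<in> {0..T}"
  shows "continuous_on S (\<lambda>p. W (f p) (g p))"
proof -
  have "continuous_on S (\<lambda>p. case (f p, g p) of (t, \<nu>) => W t \<nu>)"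
    by (rule continuous_on_compose2[OF Wc]) (use assms in \<open>auto intro!: continuous_intros\<close>)
  then show ?thesis by simp
qed

text \<open>A non-integrable integrand has integral 0 by convention, so measurability along a
  segment never has to be checked when only a bound is wanted.\<close>

lemma interval_integral_bound:
  fixes f :: "real => real"
  assumes "\<And>r. r \<in> {0..1} ==> \<bar>f r\<bar> \<le> C" "0 \<le> C"
  shows "\<bar>LINT r:{0..1}|lborel. f r\<bar> \<le> C"
proof (cases "set_integrable lborel {0..1} f")
  case True
  have "\<bar>LINT r:{0..1}|lborel. f r\<bar> \<le> (\<integral>r. norm (indicator {0..1} r *\<^sub>R f r) \<partial>lborel)"
    unfolding set_lebesgue_integral_def using integral_norm_bound by fastforce
  also have "\<dots> \<le> (\<integral>r. C * indicator {0..1::real} r \<partial>lborel)"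
  proof (rule integral_mono)
    show "integrable lborel (\<lambda>r. norm (indicator {0..1} r *\<^sub>R f r))"
      using True unfolding set_integrable_def by (rule integrable_norm)
    show "integrable lborel (\<lambda>r. C * indicator {0..1::real} r)"
      by (intro integrable_mult_right integrable_real_indicator) auto
  qed (use assms in \<open>auto simp: indicator_def\<close>)
  also have "\<dots> = C" by simp
  finally show ?thesis .
next
  case False
  then show ?thesis using assms(2) unfolding set_integrable_def set_lebesgue_integral_def
    by (simp add: not_integrable_integral_eq)
qed

text \<open>Before \<open>T\<close>, the linear derivative integrated along the segment from the
  zero measure is bounded by a constant times the mass. At \<open>T\<close> there is no derivative,
  and continuity in time carries the bound over.\<close>

lemma W_growth:
  obtains C where "0 \<le> C" "\<And>u \<nu>. u \<in> {0..T} ==> \<bar>W u \<nu>\<bar> \<le> C * (1 + tmass \<nu>)"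
proof -
  have c0: "continuous_on {0..T} (\<lambda>u. W u 0)" by (rule continuous_on_W) (auto intro!: continuous_intros)
  then have "bounded ((\<lambda>u. W u 0) ` {0..T})" by (intro compact_imp_bounded compact_continuous_image) auto
  then obtain C0 where C0: "\<And>u. u \<in> {0..T} ==> \<bar>W u 0\<bar> \<le> C0" by (force simp: bounded_iff)
  have p0: "pairing f 0 = 0" for f :: "real => real" by (simp add: pairing_def)
  define C where "C = \<bar>C0\<bar> + KW"
  have C: "0 \<le> C" using KW(1) by (simp add: C_def)
  have lt: "\<bar>W u \<nu>\<bar> \<le> C * (1 + tmass \<nu>)" if u: "u \<in> {0..<T}" for u \<nu>
  proof -
    have m: "0 \<le> tmass \<nu>" by (simp add: pairing_one)
    have "W u \<nu> - W u 0 = (LINT r:{0..1}|lborel. pairing (W1 u (segment r 0 \<nu>)) \<nu> - pairing (W1 u (segment r 0 \<nu>)) 0)"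
      using W_lin[OF u] by (simp add: has_linear_derivative_def)
    moreover have "\<bar>LINT r:{0..1}|lborel. pairing (W1 u (segment r 0 \<nu>)) \<nu> - pairing (W1 u (segment r 0 \<nu>)) 0\<bar> \<le> KW * tmass \<nu>"
      by (rule interval_integral_bound) (use m KW(1) in \<open>auto simp: p0 intro!: pairing_abs_le KW(3) u\<close>)
    ultimately have "\<bar>W u \<nu>\<bar> \<le> \<bar>C0\<bar> + KW * tmass \<nu>" using C0[of u] u by auto
    also have "\<dots> \<le> C * (1 + tmass \<nu>)" using m KW(1) by (simp add: C_def algebra_simps)
    finally show ?thesis .
  qed
  show thesis
  proof (rule that[OF C])
    fix u \<nu> assume u: "u \<in> {0..T}"
    show "\<bar>W u \<nu>\<bar> \<le> C * (1 + tmass \<nu>)"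
    proof (cases "u = T")
      case False
      then show ?thesis using lt u by auto
    next
      case True
      have "continuous_on {0..T} (\<lambda>u. W u \<nu>)" by (rule continuous_on_W) (auto intro!: continuous_intros)
      then have "closed ({0..T} \<inter> (\<lambda>u. \<bar>W u \<nu>\<bar>) -` {..C * (1 + tmass \<nu>)})"
        by (intro continuous_closed_preimage continuous_intros) auto
      moreover have "{0..<T} \<subseteq> {0..T} \<inter> (\<lambda>u. \<bar>W u \<nu>\<bar>) -` {..C * (1 + tmass \<nu>)}" using lt by auto
      ultimately have "closure {0..<T} \<subseteq> {0..T} \<inter> (\<lambda>u. \<bar>W u \<nu>\<bar>) -` {..C * (1 + tmass \<nu>)}" by (intro closure_minimal)
      moreover have "T \<in> closure {0..<T}" using T by (simp add: closure_atLeastLessThan)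
      ultimately show ?thesis using True by blast
    qed
  qed
qed

lemma W_time_increment:
  assumes "0 \<le> s" "s < s'" "s' < T"
  obtains r where "s < r" "r < s'" "W s' \<nu> - W s \<nu> = (s' - s) * Wt r \<nu>"
proof -
  have d: "((\<lambda>s. W s \<nu>) has_real_derivative Wt r \<nu>) (at r within {s..s'})" if "s \<le> r" "r \<le> s'" for r
    by (rule DERIV_subset[OF Wt_deriv]) (use that assms in auto)
  have "\<exists>r\<in>{s<..<s'}. W s' \<nu> - W s \<nu> = (\<lambda>h. h * Wt r \<nu>) (s' - s)"
  proof (rule mvt_simple[OF assms(2)])
    fix r assume "s \<le> r" "r \<le> s'"
    from d[OF this] show "((\<lambda>s. W s \<nu>) has_derivative (\<lambda>h. h * Wt r \<nu>)) (at r within {s..s'})"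
      unfolding has_field_derivative_def by (simp add: mult.commute[of _ "Wt r \<nu>"])
  qed
  then show thesis using that by auto
qed

text \<open>The second-order Taylor remainder of \<open>W u\<close> in the weights, at
  \<open>y\<close> in the direction \<open>y' - y\<close>.\<close>

definition rem2 :: "nat set => (nat => real) => real => (nat => real) => (nat => real) => real" where
  "rem2 J z u y y' = W u (atoms J z y') - W u (atoms J z y) - (\<Sum>j\<in>J. (y' j - y j) * W1 u (atoms J z y) (z j))
     - 1/2 * (\<Sum>j\<in>J. \<Sum>k\<in>J. (y' j - y j) * (y' k - y k) * W2 u (atoms J z y) (z j) (z k))"

text \<open>The linear derivative is used twice. It expresses the increment of \<open>W\<close> as
  an integral of the functions \<open>g j\<close> along the segment, and the deviation of each
  \<open>g j\<close> from its affine approximation as an integral of differences of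
  \<open>W2\<close>, each at most \<eta>.\<close>

lemma rem2_bound:
  assumes J: "finite J" and u: "u \<in> {0..<T}" and pos: "\<And>j. j \<in> J ==> 0 \<le> y j" "\<And>j. j \<in> J ==> 0 \<le> y' j"
    and \<eta>: "0 \<le> \<eta>" "\<And>r j k. 0 \<le> r ==> r \<le> 1 ==> j \<in> J ==> k \<in> J ==>
       \<bar>W2 u (atoms J z (\<lambda>j. (1 - r) * y j + r * y' j)) (z j) (z k) - W2 u (atoms J z y) (z j) (z k)\<bar> \<le> \<eta>"
  shows "\<bar>rem2 J z u y y'\<bar> \<le> \<eta> * (\<Sum>j\<in>J. \<bar>y' j - y j\<bar>)\<^sup>2"
proof -
  define D where "D = (\<lambda>j. y' j - y j)"
  define S where "S = (\<Sum>j\<in>J. \<bar>D j\<bar>)"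
  have S0: "0 \<le> S" by (simp add: S_def sum_nonneg)
  define a where "a = (\<lambda>r. atoms J z (\<lambda>j. (1 - r) * y j + r * y' j))"
  have a0: "a 0 = atoms J z y" and a1: "a 1 = atoms J z y'" by (simp_all add: a_def)
  have apos: "0 \<le> (1 - r) * y j + r * y' j" if "0 \<le> r" "r \<le> 1" "j \<in> J" for r j using that pos by simp
  have ac: "continuous_on {0..1} a" unfolding a_def by (intro continuous_on_atoms J continuous_intros)
  have W1m: "W1 u \<nu> \<in> borel_measurable borel" for \<nu>
    by (rule borel_measurable_bcont, rule continuous_on_W1(1)[where f="\<lambda>_. u"]) (use u in \<open>auto intro!: continuous_intros\<close>)
  have W2m: "W2 u \<nu> x \<in> borel_measurable borel" for \<nu> x
    by (rule borel_measurable_bcont, rule continuous_on_W2[where f="\<lambda>_. u"]) (use u in \<open>auto intro!: continuous_intros\<close>)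
  \<comment> \<open>An initial piece of the segment is the segment itself with the parameter
    rescaled.\<close>
  have seg: "segment q (a 0) (a r) = a (q * r)" if "0 \<le> q" "q \<le> 1" "0 \<le> r" "r \<le> 1" for q r
  proof -
    have "a r = segment r (a 0) (a 1)" unfolding a0 a1 a_def using that pos J by (simp add: segment_atoms)
    then have "segment q (a 0) (a r) = segment (q * r) (a 0) (a 1)" using that by (simp add: segment_segment)
    also have "\<dots> = a (q * r)" unfolding a0 a1 a_def using that pos J by (simp add: segment_atoms mult_le_one)
    finally show ?thesis .
  qed
  have pair: "pairing f (a r) - pairing f (a 0) = (\<Sum>k\<in>J. r * D k * f (z k))" if "f \<in> borel_measurable borel" "0 \<le> r" "r \<le> 1" for f r
  proof -
    have "pairing f (a r) - pairing f (a 0) = (\<Sum>k\<in>J. ((1 - r) * y k + r * y' k) * f (z k)) - (\<Sum>k\<in>J. y k * f (z k))"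
      using pairing_atoms[OF J apos[OF that(2,3)] that(1), where x = z] pairing_atoms[OF J pos(1) that(1), where x = z] by (simp add: a_def a0)
    then show ?thesis by (simp add: sum_subtractf[symmetric] D_def algebra_simps)
  qed
  have integ: "set_integrable lborel {0..1} f" if "continuous_on {0..1} f" for f :: "real => real"
    unfolding set_integrable_def using borel_integrable_atLeastAtMost'[OF that] by (simp add: set_integrable_def)
  define g where "g = (\<lambda>j r. W1 u (a r) (z j))"
  have gc: "continuous_on {0..1} (g j)" for j
    unfolding g_def by (rule continuous_on_W1(1)[where f="\<lambda>_. u"]) (use u ac in \<open>auto intro!: continuous_intros\<close>)
  \<comment> \<open>The derivative of \<open>g j\<close> at parameter zero.\<close>
  define L where "L = (\<lambda>j. \<Sum>k\<in>J. D k * W2 u (a 0) (z j) (z k))"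
  have gb: "\<bar>g j r - g j 0 - r * L j\<bar> \<le> \<eta> * S" if j: "j \<in> J" and r: "0 \<le> r" "r \<le> 1" for j r
  proof -
    have "g j r - g j 0 = (LINT q:{0..1}|lborel. pairing (W2 u (segment q (a 0) (a r)) (z j)) (a r) - pairing (W2 u (segment q (a 0) (a r)) (z j)) (a 0))"
      using W1_lin[OF u, of "z j"] by (simp add: has_linear_derivative_def g_def)
    also have "\<dots> = (LINT q:{0..1}|lborel. \<Sum>k\<in>J. r * D k * W2 u (a (q * r)) (z j) (z k))"
      by (intro set_lebesgue_integral_cong) (use r in \<open>auto simp: seg pair[OF W2m]\<close>)
    finally have eq: "g j r - g j 0 = (LINT q:{0..1}|lborel. \<Sum>k\<in>J. r * D k * W2 u (a (q * r)) (z j) (z k))" .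
    have ac': "continuous_on {0..1} (\<lambda>q. a (q * r))"
      by (rule continuous_on_compose2[OF ac]) (use r in \<open>auto intro!: continuous_intros simp: mult_le_one\<close>)
    have i1: "set_integrable lborel {0..1} (\<lambda>q. \<Sum>k\<in>J. r * D k * W2 u (a (q * r)) (z j) (z k))"
      by (rule integ) (use u ac' in \<open>auto intro!: continuous_intros continuous_on_W2[where f="\<lambda>_. u"]\<close>)
    have i2: "set_integrable lborel {0..1} (\<lambda>q::real. r * L j)" by (rule integ) (intro continuous_intros)
    have "r * L j = (LINT q:{0..1::real}|lborel. r * L j)" unfolding set_lebesgue_integral_def by simp
    then have "g j r - g j 0 - r * L j = (LINT q:{0..1}|lborel. (\<Sum>k\<in>J. r * D k * W2 u (a (q * r)) (z j) (z k)) - r * L j)"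
      unfolding eq using set_integral_diff(2)[OF i1 i2] by simp
    also have "\<bar>\<dots>\<bar> \<le> \<eta> * S"
    proof (rule interval_integral_bound)
      fix q :: real assume q: "q \<in> {0..1}"
      have "(\<Sum>k\<in>J. r * D k * W2 u (a (q * r)) (z j) (z k)) - r * L j
         = (\<Sum>k\<in>J. r * D k * (W2 u (a (q * r)) (z j) (z k) - W2 u (a 0) (z j) (z k)))"
        by (simp add: L_def sum_distrib_left sum_subtractf[symmetric] algebra_simps)
      also have "\<bar>\<dots>\<bar> \<le> (\<Sum>k\<in>J. \<bar>D k\<bar> * \<eta>)"
      proof (rule order_trans[OF sum_abs sum_mono])
        fix k assume k: "k \<in> J"
        have "\<bar>W2 u (a (q * r)) (z j) (z k) - W2 u (a 0) (z j) (z k)\<bar> \<le> \<eta>"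
          using \<eta>(2)[of "q * r" j k] q r j k unfolding a0 unfolding a_def by (simp add: mult_le_one)
        moreover have "\<bar>r * D k\<bar> \<le> \<bar>D k\<bar>" using r by (simp add: abs_mult mult_left_le_one_le)
        ultimately show "\<bar>r * D k * (W2 u (a (q * r)) (z j) (z k) - W2 u (a 0) (z j) (z k))\<bar> \<le> \<bar>D k\<bar> * \<eta>"
          unfolding abs_mult[of "r * D k"] by (intro mult_mono) auto
      qed
      also have "\<dots> = \<eta> * S" by (simp add: S_def sum_distrib_left mult.commute)
      finally show "\<bar>(\<Sum>k\<in>J. r * D k * W2 u (a (q * r)) (z j) (z k)) - r * L j\<bar> \<le> \<eta> * S" .
    qed (use \<eta> S0 in auto)
    finally show ?thesis .
  qed
  have "W u (a 1) - W u (a 0) = (LINT r:{0..1}|lborel. pairing (W1 u (segment r (a 0) (a 1))) (a 1) - pairing (W1 u (segment r (a 0) (a 1))) (a 0))"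
    using W_lin[OF u] by (simp add: has_linear_derivative_def)
  also have "\<dots> = (LINT r:{0..1}|lborel. \<Sum>j\<in>J. D j * g j r)"
    by (intro set_lebesgue_integral_cong) (auto simp: seg pair[OF W1m] g_def)
  finally have eq: "W u (a 1) - W u (a 0) = (LINT r:{0..1}|lborel. \<Sum>j\<in>J. D j * g j r)" .
  \<comment> \<open>The Taylor factor one half is the integral of \<open>r\<close> over the unit
    interval.\<close>
  have half: "(LINT r:{0..1}|lborel. (\<Sum>j\<in>J. D j * g j 0) + r * (\<Sum>j\<in>J. D j * L j)) = (\<Sum>j\<in>J. D j * g j 0) + 1/2 * (\<Sum>j\<in>J. D j * L j)"
  proof -
    have e1: "(LINT r:{0..1::real}|lborel. c) = c" for c :: real unfolding set_lebesgue_integral_def by simp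
    have e2: "(LINT r:{0..1}|lborel. r * c) = 1/2 * c" for c :: real
    proof -
      have "(LINT r:{0..1}|lborel. r * c) = (\<integral>r. (r ^ 1 * indicator {0..1} r) * c \<partial>lborel)"
        unfolding set_lebesgue_integral_def by (intro Bochner_Integration.integral_cong) auto
      also have "\<dots> = (\<integral>r. r ^ 1 * indicator {0..1} r \<partial>lborel) * c" by (rule integral_mult_left_zero)
      also have "(\<integral>r. r ^ 1 * indicator {0..1} r \<partial>lborel) = (1/2::real)" by (subst integral_power) auto
      finally show ?thesis .
    qed
    have "(LINT r:{0..1}|lborel. (\<Sum>j\<in>J. D j * g j 0) + r * (\<Sum>j\<in>J. D j * L j)) =
       (LINT r:{0..1::real}|lborel. (\<Sum>j\<in>J. D j * g j 0)) + (LINT r:{0..1}|lborel. r * (\<Sum>j\<in>J. D j * L j))"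
      by (rule set_integral_add(2); rule integ; intro continuous_intros)
    then show ?thesis unfolding e1 e2 .
  qed
  have "rem2 J z u y y' = W u (a 1) - W u (a 0) - ((\<Sum>j\<in>J. D j * g j 0) + 1/2 * (\<Sum>j\<in>J. D j * L j))"
    unfolding rem2_def a0 a1 g_def L_def D_def by (simp add: sum_distrib_left algebra_simps)
  also have "\<dots> = (LINT r:{0..1}|lborel. (\<Sum>j\<in>J. D j * g j r) - ((\<Sum>j\<in>J. D j * g j 0) + r * (\<Sum>j\<in>J. D j * L j)))"
    unfolding eq half[symmetric]
    by (rule set_integral_diff(2)[symmetric]) (auto intro!: integ continuous_intros gc)
  also have "\<bar>\<dots>\<bar> \<le> \<eta> * S\<^sup>2"
  proof (rule interval_integral_bound)
    fix r :: real assume r: "r \<in> {0..1}"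
    have "(\<Sum>j\<in>J. D j * g j r) - ((\<Sum>j\<in>J. D j * g j 0) + r * (\<Sum>j\<in>J. D j * L j)) = (\<Sum>j\<in>J. D j * (g j r - g j 0 - r * L j))"
      by (simp add: sum_distrib_left sum_subtractf[symmetric] sum.distrib[symmetric] algebra_simps)
    also have "\<bar>\<dots>\<bar> \<le> (\<Sum>j\<in>J. \<bar>D j\<bar> * (\<eta> * S))"
      by (rule order_trans[OF sum_abs sum_mono]) (use r in \<open>auto simp: abs_mult intro!: mult_left_mono gb\<close>)
    also have "\<dots> = S * (\<eta> * S)" unfolding sum_distrib_right[symmetric] S_def ..
    also have "\<dots> = \<eta> * S\<^sup>2" by (simp add: power2_eq_square)
    finally show "\<bar>(\<Sum>j\<in>J. D j * g j r) - ((\<Sum>j\<in>J. D j * g j 0) + r * (\<Sum>j\<in>J. D j * L j))\<bar> \<le> \<eta> * S\<^sup>2" .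
  qed (use \<eta> in auto)
  finally show ?thesis by (simp add: S_def D_def)
qed

lemma rem2_bound_crude:
  assumes "finite J" "u \<in> {0..<T}" "\<And>j. j \<in> J ==> 0 \<le> y j" "\<And>j. j \<in> J ==> 0 \<le> y' j"
  shows "\<bar>rem2 J z u y y'\<bar> \<le> 2 * KW * (\<Sum>j\<in>J. \<bar>y' j - y j\<bar>)\<^sup>2"
proof (rule rem2_bound[OF assms])
  fix r j k
  show "\<bar>W2 u (atoms J z (\<lambda>j. (1 - r) * y j + r * y' j)) (z j) (z k) - W2 u (atoms J z y) (z j) (z k)\<bar> \<le> 2 * KW"
    using KW(6)[OF assms(2), of "atoms J z (\<lambda>j. (1 - r) * y j + r * y' j)" "z j" "z k"] KW(6)[OF assms(2), of "atoms J z y" "z j" "z k"] by linarith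
qed (use KW(1) in auto)

text \<open>Were the convergence not uniform in \<open>r\<close>, a sequence of bad \<open>r\<close> would contradict the continuity of
  the second derivative.\<close>

lemma rem2_small:
  fixes y' :: "nat => nat => real"
  assumes J: "finite J" and u: "u \<in> {0..<T}" and pos: "\<And>j. j \<in> J ==> 0 \<le> y j" "\<And>n j. j \<in> J ==> 0 \<le> y' n j"
    and lim: "\<And>j. j \<in> J ==> (\<lambda>n. y' n j) \<longlonglongrightarrow> y j" and e: "e > 0"
  shows "\<forall>\<^sub>F n in sequentially. \<bar>rem2 J z u y (y' n)\<bar> \<le> e * (\<Sum>j\<in>J. \<bar>y' n j - y j\<bar>)\<^sup>2"
proof -
  define a where "a = (\<lambda>n r. atoms J z (\<lambda>j. (1 - r) * y j + r * y' n j))"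
  define bad where "bad = (\<lambda>j k n r. 0 \<le> r \<and> r \<le> 1 \<and> \<not> \<bar>W2 u (a n r) (z j) (z k) - W2 u (atoms J z y) (z j) (z k)\<bar> \<le> e)"
  have "\<forall>\<^sub>F n in sequentially. \<not> (\<exists>r. bad j k n r)" for j k
  proof -
    \<comment> \<open>A bad parameter if there is one, otherwise the default 0, so that the sequence
      always stays in the unit interval.\<close>
    define rn where "rn = (\<lambda>n. if \<exists>r. bad j k n r then SOME r. bad j k n r else 0)"
    have rn: "0 \<le> rn n" "rn n \<le> 1" "(\<exists>r. bad j k n r) ==> bad j k n (rn n)" for n
    proof -
      show b: "(\<exists>r. bad j k n r) ==> bad j k n (rn n)" unfolding rn_def by (simp add: someI_ex)
      show "0 \<le> rn n" "rn n \<le> 1" using b by (cases "\<exists>r. bad j k n r"; auto simp: bad_def rn_def)+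
    qed
    have "(\<lambda>n. a n (rn n)) \<longlonglongrightarrow> atoms J z y"
      unfolding a_def
    proof (rule tendsto_atoms[OF J])
      fix i assume i: "i \<in> J"
      show "0 \<le> y i" using pos i by auto
      show "0 \<le> (1 - rn n) * y i + rn n * y' n i" for n using pos i rn[of n] by simp
      have "(\<lambda>n. y' n i - y i) \<longlonglongrightarrow> 0" using lim[OF i] by (simp add: LIM_zero)
      then have "(\<lambda>n. \<bar>y' n i - y i\<bar>) \<longlonglongrightarrow> 0" by (rule tendsto_rabs_zero)
      then have "(\<lambda>n. rn n * (y' n i - y i)) \<longlonglongrightarrow> 0"
        by (rule Lim_null_comparison[rotated]) (use rn in \<open>auto simp: abs_mult mult_left_le_one_le intro!: always_eventually\<close>)
      then have "(\<lambda>n. y i + rn n * (y' n i - y i)) \<longlonglongrightarrow> y i + 0" by (intro tendsto_intros)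
      then show "(\<lambda>n. (1 - rn n) * y i + rn n * y' n i) \<longlonglongrightarrow> y i" by (simp add: algebra_simps)
    qed
    then have "(\<lambda>n. (u, a n (rn n), z j, z k)) \<longlonglongrightarrow> (u, atoms J z y, z j, z k)" by (intro tendsto_Pair tendsto_const)
    from continuous_on_tendsto_compose[OF W2_cont this] u
    have "(\<lambda>n. W2 u (a n (rn n)) (z j) (z k)) \<longlonglongrightarrow> W2 u (atoms J z y) (z j) (z k)" by auto
    then have "\<forall>\<^sub>F n in sequentially. dist (W2 u (a n (rn n)) (z j) (z k)) (W2 u (atoms J z y) (z j) (z k)) < e"
      using e by (rule tendstoD)
    then show ?thesis
    proof eventually_elim
      case (elim n)
      then have "\<not> bad j k n (rn n)" by (auto simp: bad_def dist_real_def)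
      then show ?case using rn(3) by blast
    qed
  qed
  then have "\<forall>\<^sub>F n in sequentially. \<forall>j\<in>J. \<forall>k\<in>J. \<not> (\<exists>r. bad j k n r)"
    by (intro eventually_ball_finite J ballI)
  then show ?thesis
  proof eventually_elim
    case (elim n)
    show ?case
      by (rule rem2_bound[OF J u]) (use pos elim e in \<open>auto simp: bad_def a_def\<close>)
  qed
qed

end

section \<open>Dynkin's formula for smooth functions of finitely many pairings\<close>

context ctrl_rule
begin

lemma measurable_path_time:
  fixes g :: "real => real finmeas => real"
  assumes g: "continuous_on ({0..<T} \<times> UNIV) (\<lambda>(u, \<nu>). g u \<nu>)"
  shows "(\<lambda>(w, u). indicator {0..<T} u * g u (X w u)) \<in> borel_measurable PR"
proof -
  have 1: "(\<lambda>(w, u, x, d). indicator {0..<T} u * indicator UNIV d * g u (X w u)) \<in> borel_measurable PB"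
  proof (rule measurable_along_path_open[where X = X and K = "\<lambda>u x \<nu> d. g u \<nu>"])
    have "continuous_on ({0..<T} \<times> UNIV \<times> UNIV \<times> UNIV) (\<lambda>p::real \<times> real \<times> real finmeas \<times> real. case (fst p, fst (snd (snd p))) of (u, \<nu>) => g u \<nu>)"
      by (rule continuous_on_compose2[OF g]) (auto intro!: continuous_intros)
    then show "continuous_on ({0..<T} \<times> UNIV \<times> UNIV \<times> UNIV) (\<lambda>(u::real, x::real, \<nu>, d::real). g u \<nu>)"
      by (simp add: split_beta')
  qed (use T in \<open>auto intro: X_measurable X_right_continuous\<close>)
  have "(\<lambda>(w, u). (w, u, 0, 0)) \<in> P \<Otimes>\<^sub>M borel \<rightarrow>\<^sub>M PB"
    unfolding borel_prod[symmetric] by measurable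
  from measurable_compose[OF this 1] show ?thesis by (simp add: split_beta')
qed

lemma path_time_right_continuous:
  fixes g :: "real => real finmeas => real"
  assumes g: "continuous_on ({0..<T} \<times> UNIV) (\<lambda>(u, \<nu>). g u \<nu>)" and s: "s \<in> {0..<T}" and w: "w \<in> space P"
  shows "((\<lambda>u. indicator {0..<T} u * g u (X w u)) \<longlongrightarrow> indicator {0..<T} s * g s (X w s)) (at_right s)"
proof -
  have ev: "\<forall>\<^sub>F u in at_right s. u \<in> {0..<T}"
    using s by (auto simp: eventually_at_right_field intro!: exI[of _ T])
  have "((\<lambda>u. (u, X w u)) \<longlongrightarrow> (s, X w s)) (at_right s)"
    by (intro tendsto_Pair X_right_continuous w s tendsto_ident_at)
  from continuous_on_tendsto_compose[OF g this] s ev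
  have "((\<lambda>u. g u (X w u)) \<longlongrightarrow> g s (X w s)) (at_right s)" by auto
  moreover have "\<forall>\<^sub>F u in at_right s. g u (X w u) = indicator {0..<T} u * g u (X w u)"
    using ev by eventually_elim simp
  ultimately show ?thesis using s by (simp add: tendsto_cong)
qed

lemma measurable_functional_filtration:
  fixes g :: "real finmeas => real"
  assumes "continuous_on UNIV g" "0 \<le> s" "s \<le> T"
  shows "(\<lambda>w. g (X w s)) \<in> borel_measurable (\<F> s)"
  by (rule measurable_compose[OF X_measurable_filtration borel_measurable_bcont[OF assms(1)]]) (use assms in auto)

lemma measurable_functional_P:
  fixes g :: "real finmeas => real"
  assumes "continuous_on UNIV g"
  shows "(\<lambda>w. g (X w s)) \<in> borel_measurable P"
  by (rule measurable_compose[OF X_measurable borel_measurable_bcont[OF assms(1)]])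

text \<open>Smallness in mean square just after time \<open>s\<close>. The square leaves room for
  the unbounded mass factor, against which it is played by Young's inequality.\<close>

definition small_at :: "real => (outcome \<times> real => real) => bool" where
  "small_at s \<kappa> \<longleftrightarrow> \<kappa> \<in> borel_measurable PR \<and>
     (\<forall>e>0. \<exists>d>0. \<forall>u. s \<le> u \<and> u < s + d \<and> u < T \<longrightarrow> (EN (\<lambda>w. (\<kappa> (w, u))\<^sup>2)) \<le> ennreal e)"

text \<open>The relation o(s' - s) as s' decreases to s.\<close>

definition negligible_at :: "real => (real => real) => bool" where
  "negligible_at s f \<longleftrightarrow> ((\<lambda>s'. f s' / (s' - s)) \<longlongrightarrow> 0) (at_right s)"

lemma negligible_atI:
  assumes "s < T" "\<And>e. e > 0 ==> \<exists>d>0. \<forall>s'. s < s' \<and> s' < s + d \<and> s' < T \<longrightarrow> \<bar>f s'\<bar> \<le> e * (s' - s)"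
  shows "negligible_at s f"
  unfolding negligible_at_def
proof (rule tendstoI)
  fix e :: real assume "e > 0"
  then obtain d where d: "d > 0" "\<And>s'. s < s' ==> s' < s + d ==> s' < T ==> \<bar>f s'\<bar> \<le> (e / 2) * (s' - s)"
    using assms(2)[of "e / 2"] by auto
  show "\<forall>\<^sub>F s' in at_right s. dist (f s' / (s' - s)) 0 < e"
    unfolding eventually_at_right_field
  proof (intro exI[of _ "min (s + d) T"] conjI allI impI)
    fix s' assume s': "s < s'" "s' < min (s + d) T"
    then have "\<bar>f s'\<bar> \<le> (e / 2) * (s' - s)" using d(2)[of s'] by auto
    also have "\<dots> < e * (s' - s)" using s' \<open>e > 0\<close> by (intro mult_strict_right_mono) auto
    finally show "dist (f s' / (s' - s)) 0 < e" using s' by (simp add: dist_real_def divide_less_eq)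
  qed (use d assms(1) in auto)
qed

lemma negligible_add: "negligible_at s f ==> negligible_at s g ==> negligible_at s (\<lambda>s'. f s' + g s')"
  using tendsto_add[of "\<lambda>s'. f s' / (s' - s)" 0 "at_right s" "\<lambda>s'. g s' / (s' - s)" 0]
  unfolding negligible_at_def by (simp add: add_divide_distrib)

lemma negligible_cmult: "negligible_at s f ==> negligible_at s (\<lambda>s'. c * f s')"
  using tendsto_mult_right_zero[of "\<lambda>s'. f s' / (s' - s)" "at_right s" c]
  unfolding negligible_at_def by simp

lemma negligible_sum: "finite I ==> (\<And>i. i \<in> I ==> negligible_at s (f i)) ==> negligible_at s (\<lambda>s'. \<Sum>i\<in>I. f i s')"
  unfolding negligible_at_def sum_divide_distrib by (rule tendsto_null_sum)

lemma ennreal_mult_add: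
  "0 \<le> a ==> 0 \<le> b' ==> 0 \<le> c ==> 0 \<le> d ==> ennreal (a * b' + c * d) = ennreal a * ennreal b' + ennreal c * ennreal d"
  by (simp add: ennreal_mult ennreal_plus)

text \<open>Young's inequality separates \<kappa> from the mass. The parameter \<open>l\<close>
  makes the moment of the mass contribute at most \<open>e / 2\<close>; with \<open>l\<close> fixed,
  \<open>e'\<close> is the mean-square level at which the part with \<kappa> does so as
  well.\<close>

lemma small_at_weighted:
  assumes s: "t \<le> s" and \<kappa>: "small_at s \<kappa>" and D: "0 \<le> D" and e: "e > 0"
  shows "\<exists>d>0. \<forall>u. s \<le> u \<and> u < s + d \<and> u < T \<longrightarrow>
    (\<integral>\<^sup>+w. ennreal (D * \<bar>\<kappa> (w, u)\<bar>) * ennreal (1 + mass w u) \<partial>P) \<le> ennreal e"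
proof -
  define M where "M = moment 2"
  have M: "0 \<le> M" using moment_nn(1) by (simp add: M_def)
  define l where "l = e / (D * M + 1)"
  have DM: "0 < D * M + 1" using D M by (simp add: add_nonneg_pos)
  have l: "0 < l" using DM e by (simp add: l_def)
  define e' where "e' = l * e / (D + 1)"
  have e': "0 < e'" using l e D by (simp add: e'_def)
  obtain d where d: "d > 0" "\<And>u. s \<le> u ==> u < s + d ==> u < T ==> (EN (\<lambda>w. (\<kappa> (w, u))\<^sup>2)) \<le> ennreal e'"
    using \<kappa> e' unfolding small_at_def by blast
  have [measurable]: "\<kappa> \<in> borel_measurable PR" using \<kappa> by (simp add: small_at_def)
  show ?thesis
  proof (intro exI[of _ d] conjI allI impI d(1))
    fix u assume u: "s \<le> u \<and> u < s + d \<and> u < T"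
    have "(\<integral>\<^sup>+w. ennreal (D * \<bar>\<kappa> (w, u)\<bar>) * ennreal (1 + mass w u) \<partial>P) \<le>
      (\<integral>\<^sup>+w. ennreal (D / (2 * l)) * ennreal ((\<kappa> (w, u))\<^sup>2) + ennreal (D * l / 2) * ennreal ((1 + mass w u) ^ 2) \<partial>P)"
    proof (rule nn_integral_mono)
      fix w
      have "\<bar>\<kappa> (w, u)\<bar> * (1 + mass w u) \<le> \<bar>\<kappa> (w, u)\<bar>\<^sup>2 / (2 * l) + l / 2 * (1 + mass w u)\<^sup>2" by (rule young[OF l])
      then have "D * (\<bar>\<kappa> (w, u)\<bar> * (1 + mass w u)) \<le> D * (\<bar>\<kappa> (w, u)\<bar>\<^sup>2 / (2 * l) + l / 2 * (1 + mass w u)\<^sup>2)"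
        using D by (rule mult_left_mono)
      then have "D * \<bar>\<kappa> (w, u)\<bar> * (1 + mass w u) \<le> D / (2 * l) * (\<kappa> (w, u))\<^sup>2 + D * l / 2 * (1 + mass w u)\<^sup>2"
        by (simp add: algebra_simps)
      then have "ennreal (D * \<bar>\<kappa> (w, u)\<bar> * (1 + mass w u)) \<le> ennreal (D / (2 * l) * (\<kappa> (w, u))\<^sup>2 + D * l / 2 * (1 + mass w u)\<^sup>2)"
        by (rule ennreal_leI)
      also have "\<dots> = ennreal (D / (2 * l)) * ennreal ((\<kappa> (w, u))\<^sup>2) + ennreal (D * l / 2) * ennreal ((1 + mass w u) ^ 2)"
        using D l by (intro ennreal_mult_add) auto
      finally have "ennreal (D * \<bar>\<kappa> (w, u)\<bar> * (1 + mass w u)) \<le> ennreal (D / (2 * l)) * ennreal ((\<kappa> (w, u))\<^sup>2) + ennreal (D * l / 2) * ennreal ((1 + mass w u) ^ 2)" .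
      moreover have "ennreal (D * \<bar>\<kappa> (w, u)\<bar>) * ennreal (1 + mass w u) = ennreal (D * \<bar>\<kappa> (w, u)\<bar> * (1 + mass w u))"
        by (rule ennreal_mult[symmetric]) (use D in auto)
      ultimately show "ennreal (D * \<bar>\<kappa> (w, u)\<bar>) * ennreal (1 + mass w u) \<le> ennreal (D / (2 * l)) * ennreal ((\<kappa> (w, u))\<^sup>2) + ennreal (D * l / 2) * ennreal ((1 + mass w u) ^ 2)"
        by simp
    qed
    also have "\<dots> = ennreal (D / (2 * l)) * EN (\<lambda>w. (\<kappa> (w, u))\<^sup>2) + ennreal (D * l / 2) * EN (\<lambda>w. (1 + mass w u) ^ 2)"
    proof -
      have [measurable]: "(\<lambda>w. \<kappa> (w, u)) \<in> borel_measurable P" by measurable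
      show ?thesis by (subst nn_integral_add) (auto simp: nn_integral_cmult)
    qed
    also have "\<dots> \<le> ennreal (D / (2 * l)) * ennreal e' + ennreal (D * l / 2) * ennreal M"
      using d(2)[of u] u s unfolding M_def by (intro add_mono mult_left_mono moment_nn(2)) auto
    also have "\<dots> = ennreal (D / (2 * l) * e' + D * l / 2 * M)"
      using D l e' M by (intro ennreal_mult_add[symmetric]) auto
    also have "\<dots> \<le> ennreal e"
    proof (rule ennreal_leI)
      have "D / (2 * l) * e' = e / 2 * (D / (D + 1))" using l by (simp add: e'_def)
      also have "\<dots> \<le> e / 2 * 1" using D e by (intro mult_left_mono) (auto simp: divide_le_eq)
      finally have 1: "D / (2 * l) * e' \<le> e / 2" by simp
      have "D * l / 2 * M = l * (D * M) / 2" by simp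
      also have "\<dots> = e / 2 * (D * M / (D * M + 1))" unfolding l_def by simp
      also have "\<dots> \<le> e / 2 * 1" using DM e by (intro mult_left_mono) (auto simp: divide_le_eq)
      finally show "D / (2 * l) * e' + D * l / 2 * M \<le> e" using 1 by simp
    qed
    finally show "(\<integral>\<^sup>+w. ennreal (D * \<bar>\<kappa> (w, u)\<bar>) * ennreal (1 + mass w u) \<partial>P) \<le> ennreal e" .
  qed
qed

text \<open>The length of the time interval supplies the factor \<open>s' - s\<close>, and the
  weighted smallness of \<kappa> the arbitrarily small constant in front of it.\<close>

lemma negligible_Q:
  assumes s: "t \<le> s" "s < T" and \<kappa>: "small_at s \<kappa>" and D: "0 \<le> D"
    and f: "\<And>s'. s < s' ==> s' < T ==> f s' \<in> borel_measurable PB"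
    and b: "\<And>s' w u x a. s < s' ==> s' < T ==> w \<in> space P ==> \<bar>f s' (w, u, x, a)\<bar> \<le> indicator {s..s'} u * (D * \<bar>\<kappa> (w, u)\<bar>)"
  shows "negligible_at s (\<lambda>s'. \<integral>p. f s' p \<partial>Q)"
proof (rule negligible_atI[OF s(2)])
  fix e :: real assume e: "e > 0"
  obtain d where d: "d > 0" "\<And>u. s \<le> u ==> u < s + d ==> u < T ==>
     (\<integral>\<^sup>+w. ennreal (D * \<bar>\<kappa> (w, u)\<bar>) * ennreal (1 + mass w u) \<partial>P) \<le> ennreal e"
    using small_at_weighted[OF s(1) \<kappa> D e] by blast
  show "\<exists>d>0. \<forall>s'. s < s' \<and> s' < s + d \<and> s' < T \<longrightarrow> \<bar>\<integral>p. f s' p \<partial>Q\<bar> \<le> e * (s' - s)"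
  proof (intro exI[of _ d] conjI allI impI d(1))
    fix s' assume s': "s < s' \<and> s' < s + d \<and> s' < T"
    have k: "(\<lambda>p. D * \<bar>\<kappa> p\<bar>) \<in> borel_measurable PR" using \<kappa> by (auto simp: small_at_def)
    show "\<bar>\<integral>p. f s' p \<partial>Q\<bar> \<le> e * (s' - s)"
    proof (rule Q_bound(2)[OF _ _ _ f k b])
      fix u assume u: "u \<in> {s..s'}"
      have "(\<integral>\<^sup>+w. ennreal (D * \<bar>\<kappa> (w, u)\<bar>) * ennreal (mass w u) \<partial>P) \<le> (\<integral>\<^sup>+w. ennreal (D * \<bar>\<kappa> (w, u)\<bar>) * ennreal (1 + mass w u) \<partial>P)"
        by (intro nn_integral_mono mult_left_mono ennreal_leI) auto
      also have "\<dots> \<le> ennreal e" using d(2)[of u] u s' by auto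
      finally show "(\<integral>\<^sup>+w. ennreal (D * \<bar>\<kappa> (w, u)\<bar>) * ennreal (mass w u) \<partial>P) \<le> ennreal e" .
    qed (use s s' t e in auto)
  qed
qed

text \<open>The counterpart of \<open>Q_bound\<close> for pure time integrals, in which no mass
  factor arises.\<close>

lemma PL_bound:
  fixes f :: "_ => real" and k :: "_ => real"
  assumes s: "0 \<le> s" "s \<le> s'" "s' \<le> T"
    and f: "f \<in> borel_measurable PR" and k: "k \<in> borel_measurable PR"
    and fk: "\<And>w u. w \<in> space P ==> \<bar>f (w, u)\<bar> \<le> indicator {s..s'} u * k (w, u)"
    and c: "0 \<le> c" "\<And>u. u \<in> {s..s'} ==> (EN (\<lambda>w. k (w, u))) \<le> ennreal c"
  shows "integrable (P \<Otimes>\<^sub>M L) f" "\<bar>\<integral>p. f p \<partial>(P \<Otimes>\<^sub>M L)\<bar> \<le> c * (s' - s)" (is ?g1)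
proof -
  have fL: "f \<in> borel_measurable (P \<Otimes>\<^sub>M L)" using f measurable_cong_sets[OF sets_PL refl] by blast
  have "(\<integral>\<^sup>+p. ennreal (norm (f p)) \<partial>(P \<Otimes>\<^sub>M L)) = (\<integral>\<^sup>+u. (EN (\<lambda>w. norm (f (w, u)))) \<partial>L)"
    by (rule PL.nn_integral_snd[symmetric]) (use fL in measurable)
  also have "\<dots> \<le> (\<integral>\<^sup>+u. ennreal c * indicator {s..s'} u \<partial>L)"
  proof (rule nn_integral_mono)
    fix u
    have "EN (\<lambda>w. norm (f (w, u))) \<le> (\<integral>\<^sup>+w. indicator {s..s'} u * ennreal (k (w, u)) \<partial>P)"
    proof (rule nn_integral_mono)
      fix w assume "w \<in> space P"
      then show "ennreal (norm (f (w, u))) \<le> indicator {s..s'} u * ennreal (k (w, u))"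
        using fk[of w u] by (auto simp: indicator_def intro: ennreal_leI)
    qed
    also have "\<dots> \<le> ennreal c * indicator {s..s'} u"
      using c(2)[of u] by (cases "u \<in> {s..s'}") auto
    finally show "EN (\<lambda>w. norm (f (w, u))) \<le> ennreal c * indicator {s..s'} u" .
  qed
  also have "\<dots> = (\<integral>\<^sup>+u. ennreal c * indicator {s..s'} u \<partial>lborel)"
    using s by (subst nn_integral_L) (auto intro!: nn_integral_cong simp: indicator_def)
  also have "\<dots> = ennreal (c * (s' - s))"
    using s c by (simp add: nn_integral_cmult ennreal_mult[symmetric])
  finally have le: "(\<integral>\<^sup>+p. ennreal (norm (f p)) \<partial>(P \<Otimes>\<^sub>M L)) \<le> ennreal (c * (s' - s))" .
  then have "(\<integral>\<^sup>+p. ennreal (norm (f p)) \<partial>(P \<Otimes>\<^sub>M L)) < \<infinity>" by (simp add: le_less_trans)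
  then show i: "integrable (P \<Otimes>\<^sub>M L) f" by (intro integrableI_bounded fL)
  have "ennreal \<bar>\<integral>p. f p \<partial>(P \<Otimes>\<^sub>M L)\<bar> \<le> ennreal (c * (s' - s))"
    using integral_norm_bound_ennreal[OF i] le by (auto intro: order_trans)
  then show ?g1 using s c by (subst (asm) ennreal_le_iff) auto
qed

lemma negligible_PL:
  assumes s: "t \<le> s" "s < T" and \<kappa>: "small_at s \<kappa>"
    and f: "\<And>s'. s < s' ==> s' < T ==> f s' \<in> borel_measurable PR"
    and b: "\<And>s' w u. s < s' ==> s' < T ==> w \<in> space P ==> \<bar>f s' (w, u)\<bar> \<le> indicator {s..s'} u * \<bar>\<kappa> (w, u)\<bar>"
  shows "negligible_at s (\<lambda>s'. \<integral>p. f s' p \<partial>(P \<Otimes>\<^sub>M L))"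
proof (rule negligible_atI[OF s(2)])
  fix e :: real assume e: "e > 0"
  obtain d where d: "d > 0" "\<And>u. s \<le> u ==> u < s + d ==> u < T ==>
     (\<integral>\<^sup>+w. ennreal (1 * \<bar>\<kappa> (w, u)\<bar>) * ennreal (1 + mass w u) \<partial>P) \<le> ennreal e"
    using small_at_weighted[OF s(1) \<kappa> zero_le_one e] by blast
  show "\<exists>d>0. \<forall>s'. s < s' \<and> s' < s + d \<and> s' < T \<longrightarrow> \<bar>\<integral>p. f s' p \<partial>(P \<Otimes>\<^sub>M L)\<bar> \<le> e * (s' - s)"
  proof (intro exI[of _ d] conjI allI impI d(1))
    fix s' assume s': "s < s' \<and> s' < s + d \<and> s' < T"
    have k: "(\<lambda>p. \<bar>\<kappa> p\<bar>) \<in> borel_measurable PR" using \<kappa> by (auto simp: small_at_def)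
    show "\<bar>\<integral>p. f s' p \<partial>(P \<Otimes>\<^sub>M L)\<bar> \<le> e * (s' - s)"
    proof (rule PL_bound(2)[OF _ _ _ f k b])
      fix u assume u: "u \<in> {s..s'}"
      have "(\<integral>\<^sup>+w. ennreal \<bar>\<kappa> (w, u)\<bar> \<partial>P) \<le> (\<integral>\<^sup>+w. ennreal (1 * \<bar>\<kappa> (w, u)\<bar>) * ennreal (1 + mass w u) \<partial>P)"
      proof (rule nn_integral_mono)
        fix w
        have "ennreal \<bar>\<kappa> (w, u)\<bar> * 1 \<le> ennreal (1 * \<bar>\<kappa> (w, u)\<bar>) * ennreal (1 + mass w u)"
          by (intro mult_mono) (auto simp: ennreal_plus)
        then show "ennreal \<bar>\<kappa> (w, u)\<bar> \<le> ennreal (1 * \<bar>\<kappa> (w, u)\<bar>) * ennreal (1 + mass w u)" by simp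
      qed
      also have "\<dots> \<le> ennreal e" using d(2)[of u] u s' by auto
      finally show "(\<integral>\<^sup>+w. ennreal \<bar>\<kappa> (w, u)\<bar> \<partial>P) \<le> ennreal e" .
    qed (use s s' t e in auto)
  qed
qed

text \<open>Pathwise right continuity and a uniform bound give mean-square continuity, by dominated
  convergence along sequences decreasing to \<open>s\<close>.\<close>

lemma small_at_bounded:
  assumes m: "\<kappa> \<in> borel_measurable PR" and C: "\<And>p. \<bar>\<kappa> p\<bar> \<le> C"
    and s: "s < T"
    and lim: "\<And>w. w \<in> space P ==> ((\<lambda>u. \<kappa> (w, u)) \<longlongrightarrow> \<kappa> (w, s)) (at_right s)"
  shows "small_at s (\<lambda>(w, u). \<kappa> (w, u) - \<kappa> (w, s))"
  unfolding small_at_def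
proof (intro conjI allI impI)
  note [measurable] = m
  have ms: "(\<lambda>p. \<kappa> (fst p, s)) \<in> borel_measurable PR" by measurable
  show "(\<lambda>(w, u). \<kappa> (w, u) - \<kappa> (w, s)) \<in> borel_measurable PR"
    using m ms by (simp add: split_beta')
  define F where "F = (\<lambda>u. \<integral>w. (\<kappa> (w, u) - \<kappa> (w, s))\<^sup>2 \<partial>P)"
  have mu[measurable]: "(\<lambda>w. \<kappa> (w, u)) \<in> borel_measurable P" for u by measurable
  have bd: "(\<kappa> (w, u) - \<kappa> (w, s))\<^sup>2 \<le> (2 * C)\<^sup>2" for w u
    using C[of "(w, u)"] C[of "(w, s)"] by (intro power2_le_iff_abs_le[THEN iffD2]) auto
  have int: "integrable P (\<lambda>w. (\<kappa> (w, u) - \<kappa> (w, s))\<^sup>2)" for u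
    by (rule integrable_const_bound[where B="(2 * C)\<^sup>2"]) (use bd in auto)
  have "(F \<longlongrightarrow> 0) (at_right s)"
  proof (rule tendsto_at_right_sequentially[OF s])
    fix S :: "nat => real" assume S: "\<And>n. s < S n" "S \<longlonglongrightarrow> s"
    have "(\<lambda>n. F (S n)) \<longlonglongrightarrow> (\<integral>w. 0 \<partial>P)"
      unfolding F_def
    proof (rule integral_dominated_convergence[where w="\<lambda>_. (2 * C)\<^sup>2"])
      have Sl: "filterlim S (at_right s) sequentially" using S by (auto simp: filterlim_at intro!: always_eventually)
      show "AE w in P. (\<lambda>n. (\<kappa> (w, S n) - \<kappa> (w, s))\<^sup>2) \<longlonglongrightarrow> 0"
      proof (rule AE_I2)
        fix w assume "w \<in> space P"
        from filterlim_compose[OF lim[OF this] Sl] have "(\<lambda>n. (\<kappa> (w, S n) - \<kappa> (w, s))\<^sup>2) \<longlonglongrightarrow> (\<kappa> (w, s) - \<kappa> (w, s))\<^sup>2"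
          by (intro tendsto_intros)
        then show "(\<lambda>n. (\<kappa> (w, S n) - \<kappa> (w, s))\<^sup>2) \<longlonglongrightarrow> 0" by simp
      qed
    qed (use bd in auto)
    then show "(\<lambda>n. F (S n)) \<longlonglongrightarrow> 0" by simp
  qed
  fix e :: real assume e: "e > 0"
  then have "\<forall>\<^sub>F u in at_right s. F u < e" using \<open>(F \<longlongrightarrow> 0) (at_right s)\<close> by (rule order_tendstoD(2)[rotated])
  then obtain b where b: "b > s" "\<And>u. s < u ==> u < b ==> F u < e" by (auto simp: eventually_at_right_field)
  show "\<exists>d>0. \<forall>u. s \<le> u \<and> u < s + d \<and> u < T \<longrightarrow> (EN (\<lambda>w. (case (w, u) of (w, u) => \<kappa> (w, u) - \<kappa> (w, s))\<^sup>2)) \<le> ennreal e"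
  proof (intro exI[of _ "b - s"] conjI allI impI)
    fix u assume u: "s \<le> u \<and> u < s + (b - s) \<and> u < T"
    have "F u \<le> e" using b(2)[of u] u e by (cases "u = s") (auto simp: F_def)
    then show "EN (\<lambda>w. (case (w, u) of (w, u) => \<kappa> (w, u) - \<kappa> (w, s))\<^sup>2) \<le> ennreal e"
      unfolding prod.case F_def by (subst nn_integral_eq_integral[OF int]) (auto intro: ennreal_leI)
  qed (use b in simp)
qed

lemma small_at_path_time:
  fixes g :: "real => real finmeas => real"
  assumes g: "continuous_on ({0..<T} \<times> UNIV) (\<lambda>(u, \<nu>). g u \<nu>)" and C: "\<And>u \<nu>. u \<in> {0..<T} ==> \<bar>g u \<nu>\<bar> \<le> C"
    and s: "s \<in> {0..<T}"
  shows "small_at s (\<lambda>(w, u). indicator {0..<T} u * g u (X w u) - indicator {0..<T} s * g s (X w s))"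
proof -
  have C0: "0 \<le> C" using C[OF s, of 0] by linarith
  have "small_at s (\<lambda>(w, u). (\<lambda>(w, u). indicator {0..<T} u * g u (X w u)) (w, u) - (\<lambda>(w, u). indicator {0..<T} u * g u (X w u)) (w, s))"
  proof (rule small_at_bounded[OF measurable_path_time[OF g], where C = C])
    show "\<bar>case p of (w, u) => indicator {0..<T} u * g u (X w u)\<bar> \<le> C" for p
      using C C0 by (cases p) (auto simp: indicator_def)
  qed (use s path_time_right_continuous[OF g] in auto)
  then show ?thesis by simp
qed

text \<open>Young's inequality between the square and the constant 1, with \<delta> as parameter,
  balances both terms at order \<delta>. Division by \<delta> excludes \<delta> = 0, which is
  therefore a separate hypothesis.\<close>

lemma second_moment_of_fourth:
  assumes f[measurable]: "f \<in> borel_measurable P" and \<delta>: "0 \<le> \<delta>" "\<delta> = 0 ==> f = (\<lambda>_. 0)"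
    and C: "0 \<le> C" "EN (\<lambda>w. f w ^ 4) \<le> ennreal (C * \<delta>\<^sup>2)"
  shows "EN (\<lambda>w. (f w)\<^sup>2) \<le> ennreal ((1 + C) / 2 * \<delta>)"
proof (cases "\<delta> = 0")
  case False
  then have \<delta>0: "\<delta> > 0" using \<delta> by simp
  have "EN (\<lambda>w. (f w)\<^sup>2) \<le> (\<integral>\<^sup>+w. ennreal (1 / (2 * \<delta>)) * ennreal (f w ^ 4) + ennreal (\<delta> / 2) * ennreal 1 \<partial>P)"
  proof (rule nn_integral_mono)
    fix w
    have "(f w)\<^sup>2 * 1 \<le> ((f w)\<^sup>2)\<^sup>2 / (2 * \<delta>) + \<delta> / 2 * 1\<^sup>2" by (rule young[OF \<delta>0])
    then have "(f w)\<^sup>2 \<le> 1 / (2 * \<delta>) * f w ^ 4 + \<delta> / 2 * 1" by (simp add: power_mult[symmetric])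
    from ennreal_leI[OF this] show "ennreal ((f w)\<^sup>2) \<le> ennreal (1 / (2 * \<delta>)) * ennreal (f w ^ 4) + ennreal (\<delta> / 2) * ennreal 1"
      using \<delta> by (subst (asm) ennreal_mult_add) auto
  qed
  also have "\<dots> = ennreal (1 / (2 * \<delta>)) * EN (\<lambda>w. f w ^ 4) + ennreal (\<delta> / 2) * ennreal 1"
    by (subst nn_integral_add) (auto simp: nn_integral_cmult emeasure_space_1)
  also have "\<dots> \<le> ennreal (1 / (2 * \<delta>)) * ennreal (C * \<delta>\<^sup>2) + ennreal (\<delta> / 2) * ennreal 1"
    by (intro add_right_mono mult_left_mono C) auto
  also have "\<dots> = ennreal (1 / (2 * \<delta>) * (C * \<delta>\<^sup>2) + \<delta> / 2 * 1)"
    using \<delta> C by (intro ennreal_mult_add[symmetric]) auto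
  also have "1 / (2 * \<delta>) * (C * \<delta>\<^sup>2) + \<delta> / 2 * 1 = (1 + C) / 2 * \<delta>"
    using \<delta>0 by (simp add: power2_eq_square algebra_simps add_divide_distrib)
  finally show ?thesis .
qed (use \<delta> in simp)

lemma increment_second_moment:
  assumes h: "Cb2 h"
  obtains C where "0 \<le> C" "\<And>s s'. t \<le> s ==> s \<le> s' ==> s' \<le> T ==> (EN (\<lambda>w. (Y h w s' - Y h w s)\<^sup>2)) \<le> ennreal (C * (s' - s))"
proof -
  obtain C where C: "0 \<le> C" "\<And>s s'. t \<le> s ==> s \<le> s' ==> s' \<le> T ==> (\<integral>w. (Y h w s' - Y h w s) ^ 4 \<partial>P) \<le> C * (s' - s)\<^sup>2"
    by (rule increment_fourth_moment_le[OF h]) blast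
  show thesis
  proof (rule that[OF _ second_moment_of_fourth])
    fix s s' assume s: "t \<le> s" "s \<le> s'" "s' \<le> T"
    have i: "integrable P (\<lambda>w. (Y h w s' - Y h w s) ^ 4)" by (rule fourth_moment_integrable[OF h]) (use s in auto)
    show "EN (\<lambda>w. (Y h w s' - Y h w s) ^ 4) \<le> ennreal (C * (s' - s)\<^sup>2)"
      by (subst nn_integral_eq_integral[OF i]) (use C(2)[OF s] in \<open>auto intro: ennreal_leI\<close>)
    show "s' - s = 0 ==> (\<lambda>w. Y h w s' - Y h w s) = (\<lambda>_. 0)" by simp
    show "(\<lambda>w. Y h w s' - Y h w s) \<in> borel_measurable P"
      by (rule borel_measurable_diff[OF measurable_Y_Cb2(1,1)[OF h]])
  qed (use C in auto)
qed

lemma small_at_increment: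
  assumes h: "Cb2 h" and s: "t \<le> s" "s < T"
  shows "small_at s (\<lambda>(w, u). Y h w u - Y h w s)"
  unfolding small_at_def
proof (intro conjI allI impI)
  show "(\<lambda>(w, u). Y h w u - Y h w s) \<in> borel_measurable PR"
    unfolding split_beta' fst_conv snd_conv by (rule borel_measurable_diff[OF measurable_Y_Cb2(2,3)[OF h]])
  fix e :: real assume e: "e > 0"
  obtain C where C: "0 \<le> C" "\<And>s s'. t \<le> s ==> s \<le> s' ==> s' \<le> T ==> (EN (\<lambda>w. (Y h w s' - Y h w s)\<^sup>2)) \<le> ennreal (C * (s' - s))"
    by (rule increment_second_moment[OF h]) blast
  show "\<exists>d>0. \<forall>u. s \<le> u \<and> u < s + d \<and> u < T \<longrightarrow> (EN (\<lambda>w. (case (w, u) of (w, u) => Y h w u - Y h w s)\<^sup>2)) \<le> ennreal e"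
  proof (intro exI[of _ "e / (C + 1)"] conjI allI impI)
    fix u assume u: "s \<le> u \<and> u < s + e / (C + 1) \<and> u < T"
    have "C * (u - s) \<le> (C + 1) * (e / (C + 1))" using u C(1) by (intro mult_mono) auto
    then have "C * (u - s) \<le> e" using C(1) by simp
    then show "EN (\<lambda>w. (case (w, u) of (w, u) => Y h w u - Y h w s)\<^sup>2) \<le> ennreal e"
      using order_trans[OF C(2)[of s u] ennreal_leI] u s by simp
  qed (use e C in simp)
qed

lemma time_integrable:
  fixes g :: "real => real finmeas => real"
  assumes g: "continuous_on ({0..<T} \<times> UNIV) (\<lambda>(u, \<nu>). g u \<nu>)" and C: "\<And>u \<nu>. u \<in> {0..<T} ==> \<bar>g u \<nu>\<bar> \<le> C" "0 \<le> C"
    and S: "S \<in> sets borel" "S \<subseteq> {s..s'}" "S \<subseteq> {0..<T}" and s: "0 \<le> s" "s \<le> s'" "s' \<le> T"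
  shows "integrable (P \<Otimes>\<^sub>M L) (\<lambda>(w, u). indicator S u * g u (X w u))" (is ?g1)
    and "\<bar>\<integral>(w, u). indicator S u * g u (X w u) \<partial>(P \<Otimes>\<^sub>M L)\<bar> \<le> C * (s' - s)" (is ?g2)
proof -
  let ?f = "\<lambda>(w, u). indicator S u * (indicator {0..<T} u * g u (X w u))"
  have eq: "(\<lambda>(w, u). indicator S u * g u (X w u)) = ?f"
    using S by (auto simp: fun_eq_iff indicator_def)
  have fm: "?f \<in> borel_measurable PR"
    using measurable_path_time[OF g] S(1) by (simp add: split_beta')
  have b: "\<bar>?f (w, u)\<bar> \<le> indicator {s..s'} u * C" for w u using C S by (auto simp: indicator_def)
  note c = PL_bound[OF s fm borel_measurable_const b C(2)]
  show ?g1
    unfolding eq by (rule c(1)) (simp add: emeasure_space_1)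
  show ?g2
    unfolding eq by (rule c(2)) (simp add: emeasure_space_1)
qed

end

section \<open>Products of two increments\<close>

context ctrl_rule
begin

lemma cell_bounded:
  fixes K :: "real => coeff"
  assumes s: "t \<le> s" "s \<le> s'" "s' \<le> T" and S: "S \<in> sets borel" "S \<subseteq> {s..s'}"
    and Z: "Z \<in> borel_measurable P" "0 \<le> C" "\<And>w. w \<in> space P ==> \<bar>Z w\<bar> \<le> C"
    and K: "continuous_on ({s..s'} \<times> UNIV \<times> UNIV \<times> A) (\<lambda>(u, x, \<nu>, c). K u x \<nu> c)"
    and D: "0 \<le> D" "\<And>u x \<nu> a. u \<in> {s..s'} ==> a \<in> A ==> \<bar>K u x \<nu> a\<bar> \<le> D"
  shows "integrable Q (zcell Z S K)"
    and "\<bar>\<integral>(w, u, x, a). Z w * (indicator S u * indicator A a * K u x (X w u) a) \<partial>Q\<bar> \<le> C * D * (2 * moment 1) * (s' - s)"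
proof -
  have s0: "0 \<le> s" "t \<in> {t..T}" using s t by auto
  note m = measurable_cell[OF s0(1) s(2,3) S Z(1) K]
  have CD: "0 \<le> C * D" using Z D by simp
  have b: "\<bar>case (w, u, x, a) of (w, u, x, a) => Z w * (indicator S u * indicator A a * K u x (X w u) a)\<bar>
      \<le> indicator {s..s'} u * (C * D * ((1 + mass w t) ^ 0 * (1 + mass w u) ^ 0))" if "w \<in> space P" for w u x a
  proof (cases "u \<in> S \<and> a \<in> A")
    case True
    then have "\<bar>Z w * K u x (X w u) a\<bar> \<le> C * D" unfolding abs_mult using S D Z that by (intro mult_mono) auto
    then show ?thesis using True S by auto
  qed (use CD in \<open>auto simp: indicator_def\<close>)
  show "integrable Q (zcell Z S K)"
    "\<bar>\<integral>(w, u, x, a). Z w * (indicator S u * indicator A a * K u x (X w u) a) \<partial>Q\<bar> \<le> C * D * (2 * moment 1) * (s' - s)"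
    using Q_weight_bound[OF s0(2) s CD m b] by auto
qed

lemma Y_add:
  assumes "Cb2 h" "Cb2 g"
  shows "Y (\<lambda>x. h x + g x) w u = Y h w u + Y g w u"
proof -
  have "integrable (meas (X w u)) f" if f: "Cb2 f" for f
  proof -
    obtain C where "\<And>x. \<bar>f x\<bar> \<le> C" using Cb2_bound[OF f] by metis
    then show ?thesis by (intro integrable_meas_bounded borel_measurable_bcont Cb2_deriv(3)[OF f])
  qed
  then show ?thesis using assms by (simp add: pairing_def)
qed

lemma gen_add:
  assumes "Cb2 h" "Cb2 g"
  shows "gen b \<sigma> (\<lambda>x. h x + g x) x \<nu> a = gen b \<sigma> h x \<nu> a + gen b \<sigma> g x \<nu> a"
  unfolding gen_def unfolding Cb2_add(3)[OF assms] unfolding Cb2_add(2)[OF assms] by (simp add: algebra_simps)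

text \<open>The weight \<open>Z\<close> will be a second derivative of \<open>W\<close> frozen at
  time \<open>s\<close>, hence bounded. Polarisation needs the sum of the two test functions, which
  is again admissible.\<close>

lemma increment_product:
  assumes h: "Cb2 h" and g: "Cb2 g" and s: "t \<le> s" "s \<le> s'" "s' \<le> T"
    and Z: "Z \<in> borel_measurable (\<F> s)" "\<And>w. w \<in> space P ==> \<bar>Z w\<bar> \<le> C"
  defines "f \<equiv> (\<lambda>(w, u, x, a). Z w * (indicator {s<..s'} u * indicator A a *
       ((Y h w u - Y h w s) * gen b \<sigma> g x (X w u) a + (Y g w u - Y g w s) * gen b \<sigma> h x (X w u) a + \<gamma> x (X w u) a * (h x * g x))))"
  shows "integrable Q f"
    and "integrable P (\<lambda>w. Z w * ((Y h w s' - Y h w s) * (Y g w s' - Y g w s)))" (is ?g1)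
    and "(\<integral>w. Z w * ((Y h w s' - Y h w s) * (Y g w s' - Y g w s)) \<partial>P) = (\<integral>p. f p \<partial>Q)" (is ?g2)
proof -
  note hg = Cb2_add(1)[OF h g]
  note 1 = increment_square[OF hg s Z] and 2 = increment_square[OF h s Z] and 3 = increment_square[OF g s Z]
  define q where "q = (\<lambda>k (w, u, x, a). Z w * (indicator {s<..s'} u * indicator A a *
       (2 * (Y k w u - Y k w s) * gen b \<sigma> k x (X w u) a + \<gamma> x (X w u) a * (k x)\<^sup>2)))"
  have f: "f p = 1/2 * (q (\<lambda>x. h x + g x) p - q h p - q g p)" for p
    unfolding f_def q_def Y_add[OF h g] gen_add[OF h g]
    by (cases p) (simp add: power2_eq_square field_simps)
  have Zf: "Z w * ((Y h w s' - Y h w s) * (Y g w s' - Y g w s)) =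
     1/2 * (Z w * (Y (\<lambda>x. h x + g x) w s' - Y (\<lambda>x. h x + g x) w s)\<^sup>2 - Z w * (Y h w s' - Y h w s)\<^sup>2 - Z w * (Y g w s' - Y g w s)\<^sup>2)" for w
    unfolding Y_add[OF h g] by (simp add: power2_eq_square field_simps)
  have i: "integrable Q (q (\<lambda>x. h x + g x))" "integrable Q (q h)" "integrable Q (q g)"
    unfolding q_def using 1(1) 2(1) 3(1) by auto
  have j: "integrable P (\<lambda>w. Z w * (Y (\<lambda>x. h x + g x) w s' - Y (\<lambda>x. h x + g x) w s)\<^sup>2)"
    "integrable P (\<lambda>w. Z w * (Y h w s' - Y h w s)\<^sup>2)" "integrable P (\<lambda>w. Z w * (Y g w s' - Y g w s)\<^sup>2)"
    using 1(2) 2(2) 3(2) by auto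
  have e: "(\<integral>w. Z w * (Y (\<lambda>x. h x + g x) w s' - Y (\<lambda>x. h x + g x) w s)\<^sup>2 \<partial>P) = (\<integral>p. q (\<lambda>x. h x + g x) p \<partial>Q)"
    "(\<integral>w. Z w * (Y h w s' - Y h w s)\<^sup>2 \<partial>P) = (\<integral>p. q h p \<partial>Q)" "(\<integral>w. Z w * (Y g w s' - Y g w s)\<^sup>2 \<partial>P) = (\<integral>p. q g p \<partial>Q)"
    unfolding q_def using 1(3) 2(3) 3(3) by auto
  show "integrable Q f" unfolding f[abs_def] using i by simp
  show ?g1 unfolding Zf using j by simp
  show ?g2
    unfolding Zf f using i j e by simp
qed

end

section \<open>Second-order expansion along finitely many pairings\<close>

locale ctrl_smooth = ctrl_rule T A \<phi> b \<sigma> \<gamma> MM t \<xi> P + Wf: smooth_fun T W Wt W1 W2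
  for T A \<phi> b \<sigma> \<gamma> MM t \<xi> P and W Wt W1 W2

text \<open>The functions and points are left general here; the Bernstein bumps and nodes are
  inserted afterwards. Nonnegativity makes the vector of pairings an admissible vector of
  weights.\<close>

locale cyl_smooth = ctrl_smooth T A \<phi> b \<sigma> \<gamma> MM t \<xi> P W Wt W1 W2
  for T A \<phi> b \<sigma> \<gamma> MM t \<xi> P W Wt W1 W2 +
  fixes J :: "nat set" and h :: "nat => real => real" and z :: "nat => real"
  assumes J: "finite J" and h: "\<And>j. Cb2 (h j)" and h0: "\<And>j x. 0 \<le> h j x"
begin

abbreviation Pi :: "real finmeas => real finmeas" where "Pi \<nu> \<equiv> atoms J z (\<lambda>j. pairing (h j) \<nu>)"

lemma continuous_on_Pi: "continuous_on S g ==> continuous_on S (\<lambda>p. Pi (g p))"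
  by (intro continuous_on_atoms J continuous_on_pairing Cb2_deriv(3) Cb2_bounded h)

lemma Yh_nonneg: "0 \<le> Y (h j) w u"
  by (rule pairing_nonneg[OF h0])

lemma Pi_continuities:
  "continuous_on UNIV (\<lambda>\<nu>. Pi \<nu>)"
  "u \<in> {0..T} ==> continuous_on UNIV (\<lambda>\<nu>. W u (Pi \<nu>))"
  "continuous_on ({0..<T} \<times> UNIV) (\<lambda>(u, \<nu>). Wt u (Pi \<nu>))"
  "continuous_on ({0..<T} \<times> UNIV) (\<lambda>(u, \<nu>). W1 u (Pi \<nu>) x)"
  "continuous_on ({0..<T} \<times> UNIV) (\<lambda>(u, \<nu>). W2 u (Pi \<nu>) x y)"
  "u \<in> {0..<T} ==> continuous_on UNIV (\<lambda>\<nu>. Wt u (Pi \<nu>))"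
  "u \<in> {0..<T} ==> continuous_on UNIV (\<lambda>\<nu>. W1 u (Pi \<nu>) x)"
  "u \<in> {0..<T} ==> continuous_on UNIV (\<lambda>\<nu>. W2 u (Pi \<nu>) x y)"
  unfolding split_beta'
  by (intro continuous_on_Pi Wf.continuous_on_W Wf.continuous_on_Wt Wf.continuous_on_W1(1) Wf.continuous_on_W2 continuous_intros; auto)+

lemma WPi_growth:
  obtains C where "0 \<le> C" "\<And>u \<nu>. u \<in> {0..T} ==> \<bar>W u (Pi \<nu>)\<bar> \<le> C * (1 + tmass \<nu>)"
proof -
  obtain C where C: "0 \<le> C" "\<And>u \<nu>. u \<in> {0..T} ==> \<bar>W u \<nu>\<bar> \<le> C * (1 + tmass \<nu>)" by (rule Wf.W_growth) blast
  have "\<exists>H. 0 \<le> H \<and> (\<forall>x. \<bar>h j x\<bar> \<le> H)" for j using Cb2_bound[OF h[of j]] by metis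
  then obtain H where H: "\<And>j. 0 \<le> H j" "\<And>j x. \<bar>h j x\<bar> \<le> H j" by metis
  show thesis
  proof (rule that[of "C * (1 + (\<Sum>j\<in>J. H j))"])
    show "0 \<le> C * (1 + (\<Sum>j\<in>J. H j))" using C H by (simp add: sum_nonneg)
    fix u :: real and \<nu> :: "real finmeas" assume u: "u \<in> {0..T}"
    have m: "0 \<le> tmass \<nu>" by (simp add: pairing_one)
    have "tmass (Pi \<nu>) = (\<Sum>j\<in>J. pairing (h j) \<nu> * 1)"
      by (rule pairing_atoms[OF J]) (auto intro: pairing_nonneg h0)
    also have "\<dots> \<le> (\<Sum>j\<in>J. H j * tmass \<nu>)"
    proof (rule sum_mono)
      fix j
      show "pairing (h j) \<nu> * 1 \<le> H j * tmass \<nu>"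
        using pairing_abs_le[of "h j" "H j" \<nu>, OF H(2)] by simp
    qed
    finally have p: "tmass (Pi \<nu>) \<le> (\<Sum>j\<in>J. H j) * tmass \<nu>" by (simp add: sum_distrib_right)
    have "\<bar>W u (Pi \<nu>)\<bar> \<le> C * (1 + tmass (Pi \<nu>))" by (rule C(2)[OF u])
    also have "\<dots> \<le> C * ((1 + (\<Sum>j\<in>J. H j)) * (1 + tmass \<nu>))"
    proof (rule mult_left_mono[OF _ C(1)])
      have "0 \<le> (\<Sum>j\<in>J. H j)" using H by (simp add: sum_nonneg)
      then show "1 + tmass (Pi \<nu>) \<le> (1 + (\<Sum>j\<in>J. H j)) * (1 + tmass \<nu>)"
        using p m by (simp add: algebra_simps)
    qed
    finally show "\<bar>W u (Pi \<nu>)\<bar> \<le> C * (1 + (\<Sum>j\<in>J. H j)) * (1 + tmass \<nu>)" by (simp add: mult.assoc)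
  qed
qed

lemma integrable_WPi:
  assumes "u \<in> {0..T}" "v \<in> {t..T}"
  shows "integrable P (\<lambda>w. W u (Pi (X w v)))"
proof -
  obtain C where C: "0 \<le> C" "\<And>u \<nu>. u \<in> {0..T} ==> \<bar>W u (Pi \<nu>)\<bar> \<le> C * (1 + tmass \<nu>)" by (rule WPi_growth) blast
  have "\<bar>W u (Pi (X w v))\<bar> \<le> C * ((1 + mass w v) ^ 1 * (1 + mass w v) ^ 0)" for w
    using C(2)[OF assms(1), of "X w v"] by simp
  then show ?thesis
    by (intro P_bound(1)[OF assms(2) assms(2) C(1) measurable_functional_P[OF Pi_continuities(2)[OF assms(1)]]])
qed

abbreviation inc :: "nat => outcome => real => real => real" where
  "inc j w s s' \<equiv> Y (h j) w s' - Y (h j) w s"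

abbreviation V1 :: "nat => outcome => real => real" where
  "V1 j w s \<equiv> W1 s (Pi (X w s)) (z j)"

abbreviation V2 :: "nat => nat => outcome => real => real" where
  "V2 j k w s \<equiv> W2 s (Pi (X w s)) (z j) (z k)"

definition Sinc :: "outcome => real => real => real" where
  "Sinc w s s' = (\<Sum>j\<in>J. \<bar>inc j w s s'\<bar>)"

lemma Sinc_nonneg: "0 \<le> Sinc w s s'" by (simp add: Sinc_def sum_nonneg)

lemma Sinc_measurable [measurable]: "(\<lambda>w. Sinc w s s') \<in> borel_measurable P"
  unfolding Sinc_def using measurable_Y_Cb2(1)[OF h] by measurable

lemma Sinc_fourth:
  obtains C where "0 \<le> C" "\<And>s s'. t \<le> s ==> s \<le> s' ==> s' \<le> T ==> (EN (\<lambda>w. Sinc w s s' ^ 4)) \<le> ennreal (C * (s' - s)\<^sup>2)"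
proof -
  have "\<exists>C\<ge>0. \<forall>s s'. t \<le> s \<longrightarrow> s \<le> s' \<longrightarrow> s' \<le> T \<longrightarrow> (\<integral>w. (inc j w s s') ^ 4 \<partial>P) \<le> C * (s' - s)\<^sup>2" for j
    by (rule increment_fourth_moment_le[OF h[of j]]) blast
  then have "\<exists>C. \<forall>j. 0 \<le> C j \<and> (\<forall>s s'. t \<le> s \<longrightarrow> s \<le> s' \<longrightarrow> s' \<le> T \<longrightarrow> (\<integral>w. (inc j w s s') ^ 4 \<partial>P) \<le> C j * (s' - s)\<^sup>2)"
    by (intro choice allI)
  then obtain C where C: "\<And>j. 0 \<le> C j" "\<And>j s s'. t \<le> s ==> s \<le> s' ==> s' \<le> T ==> (\<integral>w. (inc j w s s') ^ 4 \<partial>P) \<le> C j * (s' - s)\<^sup>2"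
    by blast
  \<comment> \<open>The Cauchy-Schwarz inequality is applied twice, to the sum and to the sum of
    squares, which yields the factor \<open>N ^ 3\<close>.\<close>
  define N where "N = real (card J)"
  show thesis
  proof (rule that[of "N ^ 3 * (\<Sum>j\<in>J. C j)"])
    show "0 \<le> N ^ 3 * (\<Sum>j\<in>J. C j)" using C by (simp add: N_def sum_nonneg)
    fix s s' assume s: "t \<le> s" "s \<le> s'" "s' \<le> T"
    let ?g = "\<lambda>w. N ^ 3 * (\<Sum>j\<in>J. (inc j w s s') ^ 4)"
    have i: "integrable P (\<lambda>w. (inc j w s s') ^ 4)" for j
      by (rule fourth_moment_integrable[OF h]) (use s in auto)
    have "EN (\<lambda>w. Sinc w s s' ^ 4) \<le> EN (\<lambda>w. ?g w)"
    proof (intro nn_integral_mono ennreal_leI)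
      fix w
      let ?D = "\<lambda>j. inc j w s s'"
      have "Sinc w s s' ^ 2 \<le> (\<Sum>j\<in>J. \<bar>?D j\<bar>\<^sup>2) * N"
        unfolding Sinc_def N_def by (rule sum_squared_le_sum_of_squares)
      then have "(Sinc w s s' ^ 2)\<^sup>2 \<le> ((\<Sum>j\<in>J. (?D j)\<^sup>2) * N)\<^sup>2" by (intro power_mono) auto
      also have "\<dots> = (\<Sum>j\<in>J. (?D j)\<^sup>2)\<^sup>2 * N\<^sup>2" by (rule power_mult_distrib)
      also have "\<dots> \<le> ((\<Sum>j\<in>J. ((?D j)\<^sup>2)\<^sup>2) * N) * N\<^sup>2"
        unfolding N_def by (intro mult_right_mono sum_squared_le_sum_of_squares) auto
      finally show "Sinc w s s' ^ 4 \<le> ?g w" by (simp add: power_mult[symmetric] power3_eq_cube power2_eq_square[of N] mult_ac)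
    qed
    also have "\<dots> = ennreal (\<integral>w. ?g w \<partial>P)"
      using i by (intro nn_integral_eq_integral) (auto simp: N_def sum_nonneg)
    also have "(\<integral>w. ?g w \<partial>P) = N ^ 3 * (\<Sum>j\<in>J. (\<integral>w. (inc j w s s') ^ 4 \<partial>P))" using i by simp
    also have "\<dots> \<le> N ^ 3 * (\<Sum>j\<in>J. C j * (s' - s)\<^sup>2)" using C(2)[OF s] by (intro mult_left_mono sum_mono) (auto simp: N_def)
    also have "\<dots> = N ^ 3 * (\<Sum>j\<in>J. C j) * (s' - s)\<^sup>2" by (simp add: sum_distrib_right)
    finally show "EN (\<lambda>w. Sinc w s s' ^ 4) \<le> ennreal (N ^ 3 * (\<Sum>j\<in>J. C j) * (s' - s)\<^sup>2)" by (simp add: ennreal_leI)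
  qed
qed

lemma Sinc_second:
  obtains C where "0 \<le> C" "\<And>s s'. t \<le> s ==> s \<le> s' ==> s' \<le> T ==>
    integrable P (\<lambda>w. (Sinc w s s')\<^sup>2) \<and> (\<integral>w. (Sinc w s s')\<^sup>2 \<partial>P) \<le> C * (s' - s)"
proof -
  obtain C where C: "0 \<le> C" "\<And>s s'. t \<le> s ==> s \<le> s' ==> s' \<le> T ==> (EN (\<lambda>w. Sinc w s s' ^ 4)) \<le> ennreal (C * (s' - s)\<^sup>2)"
    by (rule Sinc_fourth) blast
  show thesis
  proof (rule that[of "(1 + C) / 2"])
    fix s s' assume s: "t \<le> s" "s \<le> s'" "s' \<le> T"
    have nn: "EN (\<lambda>w. (Sinc w s s')\<^sup>2) \<le> ennreal ((1 + C) / 2 * (s' - s))"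
      by (rule second_moment_of_fourth[OF Sinc_measurable _ _ C(1) C(2)[OF s]]) (use s in \<open>auto simp: Sinc_def\<close>)
    then have "EN (\<lambda>w. (Sinc w s s')\<^sup>2) < \<infinity>" by (simp add: le_less_trans)
    then have i: "integrable P (\<lambda>w. (Sinc w s s')\<^sup>2)" by (intro integrableI_nonneg) auto
    moreover have "(\<integral>w. (Sinc w s s')\<^sup>2 \<partial>P) \<le> (1 + C) / 2 * (s' - s)"
      using nn C s by (subst (asm) nn_integral_eq_integral[OF i]) (auto simp: ennreal_le_iff)
    ultimately show "integrable P (\<lambda>w. (Sinc w s s')\<^sup>2) \<and> (\<integral>w. (Sinc w s s')\<^sup>2 \<partial>P) \<le> (1 + C) / 2 * (s' - s)" by simp
  qed (use C in simp)
qed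

definition R2 :: "outcome => real => real => real" where
  "R2 w s s' = Wf.rem2 J z s (\<lambda>j. Y (h j) w s) (\<lambda>j. Y (h j) w s')"

lemma R2_bound: "s \<in> {0..<T} ==> \<bar>R2 w s s'\<bar> \<le> 2 * Wf.KW * (Sinc w s s')\<^sup>2"
  unfolding R2_def Sinc_def by (rule Wf.rem2_bound_crude[OF J]) (auto intro: Yh_nonneg)

lemma first_order:
  assumes s: "t \<le> s" "s \<le> s'" "s' < T"
  shows "integrable P (\<lambda>w. V1 j w s * inc j w s s')" (is ?g1)
    and "(\<integral>w. V1 j w s * inc j w s s' \<partial>P) =
      (\<integral>(w, u, x, a). V1 j w s * (indicator {s<..s'} u * indicator A a * gen b \<sigma> (h j) x (X w u) a) \<partial>Q)"
proof -
  have s0: "s \<in> {0..<T}" "0 \<le> s" "s \<le> T" "s' \<le> T" using s t by auto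
  have Zm: "(\<lambda>w. V1 j w s) \<in> borel_measurable (\<F> s)"
    by (rule measurable_functional_filtration[OF Pi_continuities(7)[OF s0(1)] s0(2,3)])
  have Zb: "\<forall>w\<in>space P. \<bar>V1 j w s\<bar> \<le> Wf.KW * (1 + mass w s) ^ 0" using Wf.KW(3)[OF s0(1)] by simp
  note d = dynkin_power[OF h order_refl s(1,2) s0(4) Zm Wf.KW(1) Zb]
  have pk1: "pk (h j) 1 x \<nu> a = gen b \<sigma> (h j) x \<nu> a" for x \<nu> a by (simp add: pk_def)
  show ?g1 using d(2)[of j] by simp
  show "(\<integral>w. V1 j w s * inc j w s s' \<partial>P) =
      (\<integral>(w, u, x, a). V1 j w s * (indicator {s<..s'} u * indicator A a * gen b \<sigma> (h j) x (X w u) a) \<partial>Q)"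
    using d(3)[of j] unfolding pk1 by simp
qed

lemma second_order:
  assumes s: "t \<le> s" "s \<le> s'" "s' < T"
  shows "integrable P (\<lambda>w. V2 j k w s * (inc j w s s' * inc k w s s'))" (is ?g1)
    and "integrable Q (\<lambda>(w, u, x, a). V2 j k w s * (indicator {s<..s'} u * indicator A a *
       (inc j w s u * gen b \<sigma> (h k) x (X w u) a + inc k w s u * gen b \<sigma> (h j) x (X w u) a + \<gamma> x (X w u) a * (h j x * h k x))))"
    and "(\<integral>w. V2 j k w s * (inc j w s s' * inc k w s s') \<partial>P) =
      (\<integral>(w, u, x, a). V2 j k w s * (indicator {s<..s'} u * indicator A a *
       (inc j w s u * gen b \<sigma> (h k) x (X w u) a + inc k w s u * gen b \<sigma> (h j) x (X w u) a + \<gamma> x (X w u) a * (h j x * h k x))) \<partial>Q)"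
proof -
  have s0: "s \<in> {0..<T}" "0 \<le> s" "s \<le> T" "s' \<le> T" using s t by auto
  have Zm: "(\<lambda>w. V2 j k w s) \<in> borel_measurable (\<F> s)"
    by (rule measurable_functional_filtration[OF Pi_continuities(8)[OF s0(1)] s0(2,3)])
  note p = increment_product[OF h h s(1,2) s0(4) Zm Wf.KW(6)[OF s0(1)]]
  show ?g1
    by (rule p(2))
  show "integrable Q (\<lambda>(w, u, x, a). V2 j k w s * (indicator {s<..s'} u * indicator A a *
       (inc j w s u * gen b \<sigma> (h k) x (X w u) a + inc k w s u * gen b \<sigma> (h j) x (X w u) a + \<gamma> x (X w u) a * (h j x * h k x))))"
    by (rule p(1))
  show "(\<integral>w. V2 j k w s * (inc j w s s' * inc k w s s') \<partial>P) =
      (\<integral>(w, u, x, a). V2 j k w s * (indicator {s<..s'} u * indicator A a *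
       (inc j w s u * gen b \<sigma> (h k) x (X w u) a + inc k w s u * gen b \<sigma> (h j) x (X w u) a + \<gamma> x (X w u) a * (h j x * h k x))) \<partial>Q)"
    by (rule p(3))
qed

lemma R2_eq:
  "R2 w s s' = W s (Pi (X w s')) - W s (Pi (X w s))
     - (\<Sum>j\<in>J. V1 j w s * inc j w s s')
     - 1/2 * (\<Sum>j\<in>J. \<Sum>k\<in>J. V2 j k w s * (inc j w s s' * inc k w s s'))"
  unfolding R2_def Wf.rem2_def by (simp add: mult_ac)

lemma integrable_R2:
  assumes s: "t \<le> s" "s \<le> s'" "s' < T"
  shows "integrable P (\<lambda>w. R2 w s s')"
  unfolding R2_eq
  by (intro Bochner_Integration.integrable_diff Bochner_Integration.integrable_sum integrable_mult_right integrable_WPi first_order(1) second_order(1))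
    (use s t in auto)

text \<open>Time moves first, at the final state; the state is then expanded with the time frozen at
  \<open>s\<close>. All derivatives in the measure are thus known at time \<open>s\<close> and can
  serve as weights.\<close>

lemma expansion:
  assumes s: "t \<le> s" "s \<le> s'" "s' < T"
  shows "(\<integral>w. W s' (Pi (X w s')) \<partial>P) - (\<integral>w. W s (Pi (X w s)) \<partial>P) =
    (\<integral>w. W s' (Pi (X w s')) - W s (Pi (X w s')) \<partial>P)
    + (\<Sum>j\<in>J. \<integral>w. V1 j w s * inc j w s s' \<partial>P)
    + 1/2 * (\<Sum>j\<in>J. \<Sum>k\<in>J. \<integral>w. V2 j k w s * (inc j w s s' * inc k w s s') \<partial>P)
    + (\<integral>w. R2 w s s' \<partial>P)"
proof -
  have w: "integrable P (\<lambda>w. W s' (Pi (X w s')))" "integrable P (\<lambda>w. W s (Pi (X w s)))" "integrable P (\<lambda>w. W s (Pi (X w s')))"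
    using s t by (intro integrable_WPi; simp)+
  have "(\<integral>w. R2 w s s' \<partial>P) = (\<integral>w. W s (Pi (X w s')) \<partial>P) - (\<integral>w. W s (Pi (X w s)) \<partial>P)
     - (\<Sum>j\<in>J. \<integral>w. V1 j w s * inc j w s s' \<partial>P)
     - 1/2 * (\<Sum>j\<in>J. \<Sum>k\<in>J. \<integral>w. V2 j k w s * (inc j w s s' * inc k w s s') \<partial>P)"
    unfolding R2_eq using w first_order(1)[OF s] second_order(1)[OF s] by simp
  then show ?thesis using w by simp
qed

end

section \<open>Rules for negligible and small terms\<close>

context ctrl_rule
begin

lemma negligible_cong:
  assumes "s < T" "\<And>s'. s < s' ==> s' < T ==> f s' = g s'" "negligible_at s f"
  shows "negligible_at s g"
proof -
  have "\<forall>\<^sub>F s' in at_right s. f s' / (s' - s) = g s' / (s' - s)"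
    unfolding eventually_at_right_field by (rule exI[of _ T]) (use assms in auto)
  from tendsto_cong[OF this, of 0] show ?thesis using assms(3) unfolding negligible_at_def by blast
qed

lemma negligible_sequentially:
  assumes "s < T" "\<And>S. (\<And>n. s < S n) ==> (\<And>n. S n < T) ==> S \<longlonglongrightarrow> s ==> (\<lambda>n. f (S n) / (S n - s)) \<longlonglongrightarrow> 0"
  shows "negligible_at s f"
  unfolding negligible_at_def
  by (rule tendsto_at_right_sequentially[OF assms(1)]) (rule assms(2), auto)

lemma small_at_abs_add:
  assumes "small_at s \<kappa>" "small_at s \<kappa>'"
  shows "small_at s (\<lambda>p. \<bar>\<kappa> p\<bar> + \<bar>\<kappa>' p\<bar>)"
  unfolding small_at_def
proof (intro conjI allI impI)
  have [measurable]: "\<kappa> \<in> borel_measurable PR" "\<kappa>' \<in> borel_measurable PR"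
    using assms by (auto simp: small_at_def)
  show "(\<lambda>p. \<bar>\<kappa> p\<bar> + \<bar>\<kappa>' p\<bar>) \<in> borel_measurable PR" by measurable
  fix e :: real assume e: "e > 0"
  then have e4: "e / 4 > 0" by simp
  obtain d where d: "d > 0" "\<And>u. s \<le> u ==> u < s + d ==> u < T ==> (EN (\<lambda>w. (\<kappa> (w, u))\<^sup>2)) \<le> ennreal (e / 4)"
    using assms(1) e4 unfolding small_at_def by blast
  obtain d' where d': "d' > 0" "\<And>u. s \<le> u ==> u < s + d' ==> u < T ==> (EN (\<lambda>w. (\<kappa>' (w, u))\<^sup>2)) \<le> ennreal (e / 4)"
    using assms(2) e4 unfolding small_at_def by blast
  show "\<exists>d>0. \<forall>u. s \<le> u \<and> u < s + d \<and> u < T \<longrightarrow> (EN (\<lambda>w. (\<bar>\<kappa> (w, u)\<bar> + \<bar>\<kappa>' (w, u)\<bar>)\<^sup>2)) \<le> ennreal e"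
  proof (intro exI[of _ "min d d'"] conjI allI impI)
    fix u assume u: "s \<le> u \<and> u < s + min d d' \<and> u < T"
    have [measurable]: "(\<lambda>w. \<kappa> (w, u)) \<in> borel_measurable P" "(\<lambda>w. \<kappa>' (w, u)) \<in> borel_measurable P" by measurable
    have "EN (\<lambda>w. (\<bar>\<kappa> (w, u)\<bar> + \<bar>\<kappa>' (w, u)\<bar>)\<^sup>2) \<le> (\<integral>\<^sup>+w. ennreal 2 * ennreal ((\<kappa> (w, u))\<^sup>2) + ennreal 2 * ennreal ((\<kappa>' (w, u))\<^sup>2) \<partial>P)"
    proof (rule nn_integral_mono)
      fix w
      have "0 \<le> (\<bar>\<kappa> (w, u)\<bar> - \<bar>\<kappa>' (w, u)\<bar>)\<^sup>2" by simp
      then have "(\<bar>\<kappa> (w, u)\<bar> + \<bar>\<kappa>' (w, u)\<bar>)\<^sup>2 \<le> 2 * (\<kappa> (w, u))\<^sup>2 + 2 * (\<kappa>' (w, u))\<^sup>2"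
        by (simp add: power2_sum power2_diff)
      then have "ennreal ((\<bar>\<kappa> (w, u)\<bar> + \<bar>\<kappa>' (w, u)\<bar>)\<^sup>2) \<le> ennreal (2 * (\<kappa> (w, u))\<^sup>2 + 2 * (\<kappa>' (w, u))\<^sup>2)"
        by (rule ennreal_leI)
      also have "\<dots> = ennreal 2 * ennreal ((\<kappa> (w, u))\<^sup>2) + ennreal 2 * ennreal ((\<kappa>' (w, u))\<^sup>2)"
        by (intro ennreal_mult_add) auto
      finally show "ennreal ((\<bar>\<kappa> (w, u)\<bar> + \<bar>\<kappa>' (w, u)\<bar>)\<^sup>2) \<le> ennreal 2 * ennreal ((\<kappa> (w, u))\<^sup>2) + ennreal 2 * ennreal ((\<kappa>' (w, u))\<^sup>2)" .
    qed
    also have "\<dots> = ennreal 2 * EN (\<lambda>w. (\<kappa> (w, u))\<^sup>2) + ennreal 2 * EN (\<lambda>w. (\<kappa>' (w, u))\<^sup>2)"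
      by (subst nn_integral_add) (auto simp: nn_integral_cmult)
    also have "\<dots> \<le> ennreal 2 * ennreal (e / 4) + ennreal 2 * ennreal (e / 4)"
      using u by (intro add_mono mult_left_mono d d') auto
    also have "\<dots> = ennreal (2 * (e / 4) + 2 * (e / 4))" using e by (intro ennreal_mult_add[symmetric]) auto
    also have "2 * (e / 4) + 2 * (e / 4) = e" by simp
    finally show "EN (\<lambda>w. (\<bar>\<kappa> (w, u)\<bar> + \<bar>\<kappa>' (w, u)\<bar>)\<^sup>2) \<le> ennreal e" .
  qed (use d d' in auto)
qed

lemma time_cell:
  fixes K :: "real => coeff"
  assumes s: "t \<le> s" "s \<le> s'" "s' < T"
    and K: "continuous_on ({0..<T} \<times> UNIV \<times> UNIV \<times> A) (\<lambda>(u, x, \<nu>, c). K u x \<nu> c)"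
    and D: "0 \<le> D" "\<And>u x \<nu> a. u \<in> {0..<T} ==> a \<in> A ==> \<bar>K u x \<nu> a\<bar> \<le> D"
  shows "integrable Q (cell {s<..s'} K)" (is ?g1)
    and "\<bar>integral\<^sup>L Q (cell {s<..s'} K)\<bar> \<le> D * (2 * moment 1) * (s' - s)" (is ?g2)
proof -
  have Kc: "continuous_on ({s..s'} \<times> UNIV \<times> UNIV \<times> A) (\<lambda>(u, x, \<nu>, c). K u x \<nu> c)"
    by (rule continuous_on_subset[OF K]) (use s t in auto)
  have sT: "s' \<le> T" using s by simp
  have D': "\<bar>K u x \<nu> a\<bar> \<le> D" if "u \<in> {s..s'}" "a \<in> A" for u x \<nu> a using D(2)[of u a] s t that by auto
  have S: "{s<..s'} \<in> sets borel" "{s<..s'} \<subseteq> {s..s'}" by auto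
  note c = cell_bounded[OF s(1,2) sT S borel_measurable_const[of "1 :: real"] zero_le_one _ Kc D(1) D']
  show ?g1
    using c(1) by simp
  show ?g2
    using c(2) by simp
qed

lemma measurable_Q_eq: "borel_measurable Q = borel_measurable PB"
  using sets_Q by (rule measurable_cong_sets) simp

end

section \<open>Comparison of each term of the expansion with its compensator\<close>

context cyl_smooth
begin

text \<open>The weighted martingale formulas leave the derivative of \<open>W\<close> frozen at the
  left end point. Here it is taken at the running time, which makes the compensator additive over
  adjacent intervals.\<close>

definition K1 :: "nat => real => coeff" where
  "K1 j u x \<nu> a = W1 u (Pi \<nu>) (z j) * gen b \<sigma> (h j) x \<nu> a"

definition K2 :: "nat => nat => real => coeff" where
  "K2 j k u x \<nu> a = W2 u (Pi \<nu>) (z j) (z k) * (\<gamma> x \<nu> a * (h j x * h k x))"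

lemma gen_continuous:
  "continuous_on (S \<times> UNIV \<times> UNIV \<times> A) (\<lambda>(u, x, \<nu>, a). gen b \<sigma> (h j) x \<nu> a)"
  unfolding split_beta'
  by (intro continuous_on_gen[OF admissible_coeff_continuous[OF b] admissible_coeff_continuous[OF \<sigma>] h] continuous_intros) auto

lemma K1_continuous: "continuous_on ({0..<T} \<times> UNIV \<times> UNIV \<times> A) (\<lambda>(u, x, \<nu>, a). K1 j u x \<nu> a)"
  unfolding K1_def split_beta'
  by (intro continuous_on_mult continuous_on_gen[OF admissible_coeff_continuous[OF b] admissible_coeff_continuous[OF \<sigma>] h]
       Wf.continuous_on_W1(1) continuous_on_Pi continuous_intros) auto

lemma K2_continuous: "continuous_on ({0..<T} \<times> UNIV \<times> UNIV \<times> A) (\<lambda>(u, x, \<nu>, a). K2 j k u x \<nu> a)"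
  unfolding K2_def split_beta'
  by (intro continuous_on_mult continuous_on_coeff[OF admissible_coeff_continuous[OF \<gamma>]] continuous_on_compose2[OF Cb2_deriv(3)[OF h]]
       Wf.continuous_on_W2 continuous_on_Pi continuous_intros) auto

lemma gamma_bound:
  obtains G where "0 \<le> G" "\<And>x \<nu> a. a \<in> A ==> \<bar>\<gamma> x \<nu> a * (h j x * h k x)\<bar> \<le> G"
proof -
  obtain C where C: "0 \<le> C" "\<And>x \<nu> a. a \<in> A ==> \<bar>\<gamma> x \<nu> a\<bar> \<le> C" by (rule admissible_coeff_bound[OF \<gamma>]) blast
  obtain H where H: "0 \<le> H" "\<And>x. \<bar>h j x\<bar> \<le> H" using Cb2_bound[OF h[of j]] by metis
  obtain H' where H': "0 \<le> H'" "\<And>x. \<bar>h k x\<bar> \<le> H'" using Cb2_bound[OF h[of k]] by metis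
  show thesis
  proof (rule that[of "C * (H * H')"])
    fix x \<nu> a assume "a \<in> A"
    then show "\<bar>\<gamma> x \<nu> a * (h j x * h k x)\<bar> \<le> C * (H * H')"
      unfolding abs_mult using C H H' by (intro mult_mono) auto
  qed (use C H H' in auto)
qed

lemma K1_bound:
  obtains D where "0 \<le> D" "\<And>u x \<nu> a. u \<in> {0..<T} ==> a \<in> A ==> \<bar>K1 j u x \<nu> a\<bar> \<le> D"
proof -
  obtain G where G: "0 \<le> G" "\<And>x \<nu> a. a \<in> A ==> \<bar>gen b \<sigma> (h j) x \<nu> a\<bar> \<le> G" by (rule gen_bound[OF h[of j]]) blast
  show thesis
  proof (rule that[of "Wf.KW * G"])
    fix u x a and \<nu> :: "real finmeas" assume "u \<in> {0..<T}" "a \<in> A"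
    then show "\<bar>K1 j u x \<nu> a\<bar> \<le> Wf.KW * G"
      unfolding K1_def abs_mult by (intro mult_mono Wf.KW G) auto
  qed (use G Wf.KW(1) in simp)
qed

lemma K2_bound:
  obtains D where "0 \<le> D" "\<And>u x \<nu> a. u \<in> {0..<T} ==> a \<in> A ==> \<bar>K2 j k u x \<nu> a\<bar> \<le> D"
proof -
  obtain G where G: "0 \<le> G" "\<And>x \<nu> a. a \<in> A ==> \<bar>\<gamma> x \<nu> a * (h j x * h k x)\<bar> \<le> G" by (rule gamma_bound[of j k]) blast
  show thesis
  proof (rule that[of "Wf.KW * G"])
    fix u x a and \<nu> :: "real finmeas" assume "u \<in> {0..<T}" "a \<in> A"
    then show "\<bar>K2 j k u x \<nu> a\<bar> \<le> Wf.KW * G"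
      unfolding K2_def abs_mult[of "W2 u (Pi \<nu>) (z j) (z k)"] by (intro mult_mono Wf.KW G) auto
  qed (use G Wf.KW(1) in simp)
qed

lemma W1_cell:
  assumes s: "t \<le> s" "s \<le> s'" "s' < T" and G: "0 \<le> G" "\<And>x \<nu> a. a \<in> A ==> \<bar>gen b \<sigma> (h j) x \<nu> a\<bar> \<le> G"
  shows "integrable Q (\<lambda>(w, u, x, a). V1 j w s * (indicator {s<..s'} u * indicator A a * gen b \<sigma> (h j) x (X w u) a))" (is ?g1)
    and "\<bar>\<integral>(w, u, x, a). V1 j w s * (indicator {s<..s'} u * indicator A a * gen b \<sigma> (h j) x (X w u) a) \<partial>Q\<bar>
      \<le> Wf.KW * G * (2 * moment 1) * (s' - s)"
proof -
  have s0: "s \<in> {0..<T}" "s' \<le> T" using s t by auto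
  have S: "{s<..s'} \<in> sets borel" "{s<..s'} \<subseteq> {s..s'}" by auto
  note c = cell_bounded[OF s(1,2) s0(2) S measurable_functional_P[OF Pi_continuities(7)[OF s0(1)]] Wf.KW(1) Wf.KW(3)[OF s0(1)]
      gen_continuous G(1) G(2)]
  show ?g1
    by (rule c(1))
  show "\<bar>\<integral>(w, u, x, a). V1 j w s * (indicator {s<..s'} u * indicator A a * gen b \<sigma> (h j) x (X w u) a) \<partial>Q\<bar>
      \<le> Wf.KW * G * (2 * moment 1) * (s' - s)"
    by (rule c(2))
qed

lemma negligible_first_order:
  assumes s: "t \<le> s" "s < T"
  shows "negligible_at s (\<lambda>s'. (\<integral>w. V1 j w s * inc j w s s' \<partial>P)
     - integral\<^sup>L Q (cell {s<..s'} (K1 j)))"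
proof -
  have s0: "s \<in> {0..<T}" using s t by auto
  obtain G where G: "0 \<le> G" "\<And>x \<nu> a. a \<in> A ==> \<bar>gen b \<sigma> (h j) x \<nu> a\<bar> \<le> G" by (rule gen_bound[OF h[of j]]) blast
  obtain D where D: "0 \<le> D" "\<And>u x \<nu> a. u \<in> {0..<T} ==> a \<in> A ==> \<bar>K1 j u x \<nu> a\<bar> \<le> D" by (rule K1_bound[of j]) blast
  define \<kappa> where "\<kappa> = (\<lambda>(w, u). indicator {0..<T} u * W1 u (Pi (X w u)) (z j) - indicator {0..<T} s * V1 j w s)"
  have \<kappa>: "small_at s \<kappa>"
    unfolding \<kappa>_def by (rule small_at_path_time[OF Pi_continuities(4) Wf.KW(3) s0])
  define f where "f = (\<lambda>s' (w, u, x, a). V1 j w s * (indicator {s<..s'} u * indicator A a * gen b \<sigma> (h j) x (X w u) a)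
     - indicator {s<..s'} u * indicator A a * K1 j u x (X w u) a)"
  have i: "integrable Q (f s')" if "s < s'" "s' < T" for s'
    unfolding f_def split_beta'
    using W1_cell(1)[OF s(1) less_imp_le[OF that(1)] that(2) G] time_cell(1)[OF s(1) less_imp_le[OF that(1)] that(2) K1_continuous D]
    by (simp add: split_beta')
  have "negligible_at s (\<lambda>s'. \<integral>p. f s' p \<partial>Q)"
  proof (rule negligible_Q[OF s \<kappa> G(1)])
    fix s' assume s': "s < s'" "s' < T"
    show "f s' \<in> borel_measurable PB" using i[OF s'] measurable_Q_eq by blast
    fix w u x a
    show "\<bar>f s' (w, u, x, a)\<bar> \<le> indicator {s..s'} u * (G * \<bar>\<kappa> (w, u)\<bar>)"
    proof (cases "u \<in> {s<..s'} \<and> a \<in> A")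
      case True
      then have u: "u \<in> {0..<T}" using s s' t by auto
      have "f s' (w, u, x, a) = - (gen b \<sigma> (h j) x (X w u) a * \<kappa> (w, u))"
        using True u s0 by (simp add: f_def K1_def \<kappa>_def algebra_simps)
      then have "\<bar>f s' (w, u, x, a)\<bar> = \<bar>gen b \<sigma> (h j) x (X w u) a\<bar> * \<bar>\<kappa> (w, u)\<bar>" by (simp add: abs_mult)
      also have "\<dots> \<le> G * \<bar>\<kappa> (w, u)\<bar>" using True by (intro mult_right_mono G) auto
      finally show ?thesis using True by simp
    qed (use G in \<open>auto simp: f_def indicator_def\<close>)
  qed
  then show ?thesis
  proof (rule negligible_cong[OF s(2), rotated])
    fix s' assume s': "s < s'" "s' < T"
    show "(\<integral>p. f s' p \<partial>Q) = (\<integral>w. V1 j w s * inc j w s s' \<partial>P)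
     - integral\<^sup>L Q (cell {s<..s'} (K1 j))"
      unfolding first_order(2)[OF s(1) less_imp_le[OF s'(1)] s'(2)] f_def split_beta'
      using W1_cell(1)[OF s(1) less_imp_le[OF s'(1)] s'(2) G] time_cell(1)[OF s(1) less_imp_le[OF s'(1)] s'(2) K1_continuous D]
      by (simp add: split_beta')
  qed
qed

text \<open>Besides the freezing error \<kappa>1 there are two cross terms, an increment times the
  generator of the other test function. Increments are small in mean square, so to first order only
  the term with \<gamma> survives.\<close>

lemma negligible_second_order:
  assumes s: "t \<le> s" "s < T"
  shows "negligible_at s (\<lambda>s'. (\<integral>w. V2 j k w s * (inc j w s s' * inc k w s s') \<partial>P)
     - integral\<^sup>L Q (cell {s<..s'} (K2 j k)))"
proof -
  have s0: "s \<in> {0..<T}" using s t by auto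
  obtain G where G: "0 \<le> G" "\<And>x \<nu> a. a \<in> A ==> \<bar>gen b \<sigma> (h j) x \<nu> a\<bar> \<le> G" by (rule gen_bound[OF h[of j]]) blast
  obtain G' where G': "0 \<le> G'" "\<And>x \<nu> a. a \<in> A ==> \<bar>gen b \<sigma> (h k) x \<nu> a\<bar> \<le> G'" by (rule gen_bound[OF h[of k]]) blast
  obtain H where H: "0 \<le> H" "\<And>x \<nu> a. a \<in> A ==> \<bar>\<gamma> x \<nu> a * (h j x * h k x)\<bar> \<le> H" by (rule gamma_bound[of j k]) blast
  obtain D where D: "0 \<le> D" "\<And>u x \<nu> a. u \<in> {0..<T} ==> a \<in> A ==> \<bar>K2 j k u x \<nu> a\<bar> \<le> D" by (rule K2_bound[of j k]) blast
  define \<kappa>1 where "\<kappa>1 = (\<lambda>(w, u). indicator {0..<T} u * W2 u (Pi (X w u)) (z j) (z k) - indicator {0..<T} s * V2 j k w s)"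
  define \<kappa>2 where "\<kappa>2 = (\<lambda>(w, u). inc j w s u)"
  define \<kappa>3 where "\<kappa>3 = (\<lambda>(w, u). inc k w s u)"
  define \<kappa> where "\<kappa> = (\<lambda>p. \<bar>\<kappa>1 p\<bar> + \<bar>\<bar>\<kappa>2 p\<bar> + \<bar>\<kappa>3 p\<bar>\<bar>)"
  have \<kappa>: "small_at s \<kappa>"
    unfolding \<kappa>_def \<kappa>1_def \<kappa>2_def \<kappa>3_def
    by (intro small_at_abs_add small_at_path_time[OF Pi_continuities(5) Wf.KW(6) s0] small_at_increment h s)
  define C where "C = H + Wf.KW * G' + Wf.KW * G"
  have C: "0 \<le> C" "H \<le> C" "Wf.KW * G' \<le> C" "Wf.KW * G \<le> C" using H G G' Wf.KW(1) by (auto simp: C_def)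
  define g where "g = (\<lambda>s' (w, u, x, a). V2 j k w s * (indicator {s<..s'} u * indicator A a *
       (inc j w s u * gen b \<sigma> (h k) x (X w u) a + inc k w s u * gen b \<sigma> (h j) x (X w u) a + \<gamma> x (X w u) a * (h j x * h k x))))"
  define g' where "g' = (\<lambda>s' (w, u, x, a). indicator {s<..s'} u * indicator A a * K2 j k u x (X w u) a)"
  define f where "f = (\<lambda>s' p. g s' p - g' s' p)"
  have ig: "integrable Q (g s')" "integrable Q (g' s')" if "s < s'" "s' < T" for s'
    using second_order(2)[OF s(1) less_imp_le[OF that(1)] that(2)] time_cell(1)[OF s(1) less_imp_le[OF that(1)] that(2) K2_continuous D]
    unfolding g_def g'_def by auto
  have "negligible_at s (\<lambda>s'. \<integral>p. f s' p \<partial>Q)"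
  proof (rule negligible_Q[OF s \<kappa> C(1)])
    fix s' assume s': "s < s'" "s' < T"
    show "f s' \<in> borel_measurable PB" using ig[OF s'] unfolding f_def measurable_Q_eq[symmetric] by measurable
    fix w u x a
    show "\<bar>f s' (w, u, x, a)\<bar> \<le> indicator {s..s'} u * (C * \<bar>\<kappa> (w, u)\<bar>)"
    proof (cases "u \<in> {s<..s'} \<and> a \<in> A")
      case True
      then have u: "u \<in> {0..<T}" using s s' t by auto
      let ?W = "V2 j k w s"
      have "f s' (w, u, x, a) = - (\<gamma> x (X w u) a * (h j x * h k x) * \<kappa>1 (w, u)) + ?W * gen b \<sigma> (h k) x (X w u) a * \<kappa>2 (w, u) + ?W * gen b \<sigma> (h j) x (X w u) a * \<kappa>3 (w, u)"
        using True u s0 by (simp add: f_def g_def g'_def K2_def \<kappa>1_def \<kappa>2_def \<kappa>3_def algebra_simps)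
      then have "\<bar>f s' (w, u, x, a)\<bar> \<le> \<bar>\<gamma> x (X w u) a * (h j x * h k x) * \<kappa>1 (w, u)\<bar> + \<bar>?W * gen b \<sigma> (h k) x (X w u) a * \<kappa>2 (w, u)\<bar> + \<bar>?W * gen b \<sigma> (h j) x (X w u) a * \<kappa>3 (w, u)\<bar>"
        by linarith
      also have "\<dots> = \<bar>\<gamma> x (X w u) a * (h j x * h k x)\<bar> * \<bar>\<kappa>1 (w, u)\<bar> + \<bar>?W\<bar> * \<bar>gen b \<sigma> (h k) x (X w u) a\<bar> * \<bar>\<kappa>2 (w, u)\<bar> + \<bar>?W\<bar> * \<bar>gen b \<sigma> (h j) x (X w u) a\<bar> * \<bar>\<kappa>3 (w, u)\<bar>"
        by (simp only: abs_mult)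
      also have "\<dots> \<le> H * \<bar>\<kappa>1 (w, u)\<bar> + Wf.KW * G' * \<bar>\<kappa>2 (w, u)\<bar> + Wf.KW * G * \<bar>\<kappa>3 (w, u)\<bar>"
        using True G H G' Wf.KW(1) Wf.KW(6)[OF s0] by (intro add_mono mult_right_mono mult_mono) auto
      also have "\<dots> \<le> C * \<bar>\<kappa>1 (w, u)\<bar> + C * \<bar>\<kappa>2 (w, u)\<bar> + C * \<bar>\<kappa>3 (w, u)\<bar>"
        using C by (intro add_mono mult_right_mono) auto
      also have "\<dots> = C * \<bar>\<kappa> (w, u)\<bar>" by (simp add: \<kappa>_def algebra_simps)
      finally show ?thesis using True by simp
    qed (use C in \<open>auto simp: f_def g_def g'_def indicator_def\<close>)
  qed
  then show ?thesis
  proof (rule negligible_cong[OF s(2), rotated])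
    fix s' assume s': "s < s'" "s' < T"
    show "(\<integral>p. f s' p \<partial>Q) = (\<integral>w. V2 j k w s * (inc j w s s' * inc k w s s') \<partial>P)
     - integral\<^sup>L Q (cell {s<..s'} (K2 j k))"
      using Bochner_Integration.integral_diff[OF ig[OF s']]
      unfolding second_order(3)[OF s(1) less_imp_le[OF s'(1)] s'(2)] f_def g_def g'_def .
  qed
qed

text \<open>The remainder is \<rho> times the squared increment with \<rho> bounded and tending to
  zero on every path. Young's inequality with parameter \<eta> / \<delta> leaves, after division by
  \<delta>, the mean of \<rho> squared over \<open>2 * \<eta>\<close> and a term of order \<eta>
  from the fourth moment. First the time step and then \<eta> tends to zero.\<close>

lemma negligible_R2:
  assumes s: "t \<le> s" "s < T"
  shows "negligible_at s (\<lambda>s'. \<integral>w. R2 w s s' \<partial>P)"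
proof (rule negligible_sequentially[OF s(2)])
  fix S :: "nat => real" assume S: "\<And>n. s < S n" "\<And>n. S n < T" "S \<longlonglongrightarrow> s"
  have s0: "s \<in> {0..<T}" using s t by auto
  \<comment> \<open>Where the increment vanishes the remainder vanishes too, so the value 0 of the
    division by zero is the right one.\<close>
  define \<rho> where "\<rho> = (\<lambda>n w. \<bar>R2 w s (S n)\<bar> / (Sinc w s (S n))\<^sup>2)"
  have iR: "integrable P (\<lambda>w. R2 w s (S n))" for n by (rule integrable_R2) (use s S less_imp_le in auto)
  have [measurable]: "(\<lambda>w. R2 w s (S n)) \<in> borel_measurable P" for n using iR[of n] by simp
  have \<rho>m[measurable]: "\<rho> n \<in> borel_measurable P" for n unfolding \<rho>_def by measurable
  have \<rho>R: "\<bar>R2 w s (S n)\<bar> = \<rho> n w * (Sinc w s (S n))\<^sup>2" for n w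
    using R2_bound[OF s0, of w "S n"] by (cases "Sinc w s (S n) = 0") (auto simp: \<rho>_def)
  have \<rho>b: "0 \<le> \<rho> n w" "\<rho> n w \<le> 2 * Wf.KW" for n w
    using R2_bound[OF s0, of w "S n"] Wf.KW(1) by (auto simp: \<rho>_def divide_le_eq)
  have Sl: "filterlim S (at_right s) sequentially" using S by (auto simp: filterlim_at intro!: always_eventually)
  have \<rho>0: "(\<lambda>n. \<rho> n w) \<longlonglongrightarrow> 0" if w: "w \<in> space P" for w
  proof (rule tendstoI)
    fix e :: real assume e: "e > 0"
    have XS: "(\<lambda>n. X w (S n)) \<longlonglongrightarrow> X w s"
      by (rule filterlim_compose[OF X_right_continuous[OF w s0] Sl])
    have YS: "(\<lambda>n. Y (h j) w (S n)) \<longlonglongrightarrow> Y (h j) w s" for j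
      using XS Cb2_deriv(3)[OF h[of j]] Cb2_bounded[OF h[of j]] unfolding tendsto_finmeas_iff by blast
    have "\<forall>\<^sub>F n in sequentially. \<bar>Wf.rem2 J z s (\<lambda>j. Y (h j) w s) (\<lambda>j. Y (h j) w (S n))\<bar> \<le> (e / 2) * (\<Sum>j\<in>J. \<bar>inc j w s (S n)\<bar>)\<^sup>2"
      by (rule Wf.rem2_small[OF J s0]) (use YS e in \<open>auto intro: Yh_nonneg\<close>)
    then show "\<forall>\<^sub>F n in sequentially. dist (\<rho> n w) 0 < e"
    proof eventually_elim
      case (elim n)
      then have "\<bar>R2 w s (S n)\<bar> \<le> (e / 2) * (Sinc w s (S n))\<^sup>2" unfolding R2_def Sinc_def .
      then have "\<rho> n w \<le> e / 2" using e by (auto simp: \<rho>_def divide_le_eq)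
      then show ?case using \<rho>b(1)[of n w] e by (simp add: dist_real_def)
    qed
  qed
  define B where "B = (2 * Wf.KW)\<^sup>2"
  have \<rho>2: "(\<rho> n w)\<^sup>2 \<le> B" for n w unfolding B_def by (rule power_mono[OF \<rho>b(2,1)])
  have i\<rho>: "integrable P (\<lambda>w. (\<rho> n w)\<^sup>2)" for n
    by (rule integrable_const_bound[where B=B]) (use \<rho>2 in auto)
  have lim: "(\<lambda>n. \<integral>w. (\<rho> n w)\<^sup>2 \<partial>P) \<longlonglongrightarrow> 0"
  proof -
    have "(\<lambda>n. \<integral>w. (\<rho> n w)\<^sup>2 \<partial>P) \<longlonglongrightarrow> (\<integral>w. 0 \<partial>P)"
    proof (rule integral_dominated_convergence[where w="\<lambda>_. B"])
      show "AE w in P. (\<lambda>n. (\<rho> n w)\<^sup>2) \<longlonglongrightarrow> 0"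
        by (rule AE_I2) (use tendsto_power[OF \<rho>0, of _ 2] in simp)
      show "AE w in P. norm ((\<rho> n w)\<^sup>2) \<le> B" for n
        by (rule AE_I2) (use \<rho>2 in simp)
    qed auto
    then show ?thesis by simp
  qed
  obtain C where C: "0 \<le> C" "\<And>s s'. t \<le> s ==> s \<le> s' ==> s' \<le> T ==> (EN (\<lambda>w. Sinc w s s' ^ 4)) \<le> ennreal (C * (s' - s)\<^sup>2)"
    by (rule Sinc_fourth) blast
  have bound: "\<bar>\<integral>w. R2 w s (S n) \<partial>P\<bar> / (S n - s) \<le> (\<integral>w. (\<rho> n w)\<^sup>2 \<partial>P) / (2 * \<eta>) + \<eta> / 2 * C" if \<eta>: "\<eta> > 0" for n \<eta>
  proof -
    define \<delta> where "\<delta> = S n - s"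
    have \<delta>: "\<delta> > 0" using S(1)[of n] by (simp add: \<delta>_def)
    have i4: "integrable P (\<lambda>w. Sinc w s (S n) ^ 4)" and e4: "(\<integral>w. Sinc w s (S n) ^ 4 \<partial>P) \<le> C * \<delta>\<^sup>2" (is ?g1)
    proof -
      have le: "EN (\<lambda>w. Sinc w s (S n) ^ 4) \<le> ennreal (C * \<delta>\<^sup>2)"
        unfolding \<delta>_def using C(2)[of s "S n"] S(1,2)[of n] s by simp
      then have "EN (\<lambda>w. Sinc w s (S n) ^ 4) < \<infinity>" by (simp add: le_less_trans)
      then show i: "integrable P (\<lambda>w. Sinc w s (S n) ^ 4)" by (intro integrableI_nonneg) auto
      show ?g1
        using le C by (subst (asm) nn_integral_eq_integral[OF i]) (auto simp: ennreal_le_iff)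
    qed
    have "\<bar>\<integral>w. R2 w s (S n) \<partial>P\<bar> \<le> (\<integral>w. \<bar>R2 w s (S n)\<bar> \<partial>P)" using integral_norm_bound[of P "\<lambda>w. R2 w s (S n)"] by simp
    also have "\<dots> \<le> (\<integral>w. \<delta> / (2 * \<eta>) * (\<rho> n w)\<^sup>2 + \<eta> / (2 * \<delta>) * Sinc w s (S n) ^ 4 \<partial>P)"
    proof (rule integral_mono)
      fix w
      have "\<rho> n w * (Sinc w s (S n))\<^sup>2 \<le> (\<rho> n w)\<^sup>2 / (2 * (\<eta> / \<delta>)) + (\<eta> / \<delta>) / 2 * ((Sinc w s (S n))\<^sup>2)\<^sup>2"
        by (rule young) (use \<eta> \<delta> in simp)
      then show "\<bar>R2 w s (S n)\<bar> \<le> \<delta> / (2 * \<eta>) * (\<rho> n w)\<^sup>2 + \<eta> / (2 * \<delta>) * Sinc w s (S n) ^ 4"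
        unfolding \<rho>R by (simp add: power_mult[symmetric] mult.commute)
    qed (use iR i\<rho> i4 in auto)
    also have "\<dots> = \<delta> / (2 * \<eta>) * (\<integral>w. (\<rho> n w)\<^sup>2 \<partial>P) + \<eta> / (2 * \<delta>) * (\<integral>w. Sinc w s (S n) ^ 4 \<partial>P)"
      using i\<rho> i4 by simp
    also have "\<dots> \<le> \<delta> / (2 * \<eta>) * (\<integral>w. (\<rho> n w)\<^sup>2 \<partial>P) + \<eta> / (2 * \<delta>) * (C * \<delta>\<^sup>2)"
      using e4 \<eta> \<delta> by (intro add_left_mono mult_left_mono) auto
    also have "\<dots> = ((\<integral>w. (\<rho> n w)\<^sup>2 \<partial>P) / (2 * \<eta>) + \<eta> / 2 * C) * \<delta>"
      using \<delta> \<eta> by (simp add: field_simps power2_eq_square)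
    finally show ?thesis using \<delta> unfolding \<delta>_def[symmetric] by (simp add: divide_le_eq)
  qed
  show "(\<lambda>n. (\<integral>w. R2 w s (S n) \<partial>P) / (S n - s)) \<longlonglongrightarrow> 0"
  proof (rule tendstoI)
    fix e :: real assume e: "e > 0"
    define \<eta> where "\<eta> = e / (C + 1)"
    have \<eta>: "\<eta> > 0" using e C by (simp add: \<eta>_def)
    have "\<eta> / 2 * C = e / 2 * (C / (C + 1))" by (simp add: \<eta>_def)
    also have "\<dots> \<le> e / 2 * 1" using C e by (intro mult_left_mono) auto
    finally have \<eta>C: "\<eta> / 2 * C \<le> e / 2" by simp
    have "\<forall>\<^sub>F n in sequentially. (\<integral>w. (\<rho> n w)\<^sup>2 \<partial>P) < e * \<eta>"
      using order_tendstoD(2)[OF lim, of "e * \<eta>"] e \<eta> by simp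
    then show "\<forall>\<^sub>F n in sequentially. dist ((\<integral>w. R2 w s (S n) \<partial>P) / (S n - s)) 0 < e"
    proof eventually_elim
      case (elim n)
      then have "(\<integral>w. (\<rho> n w)\<^sup>2 \<partial>P) / (2 * \<eta>) < e / 2" using \<eta> by (simp add: divide_less_eq)
      with bound[OF \<eta>, of n] \<eta>C have "\<bar>\<integral>w. R2 w s (S n) \<partial>P\<bar> / (S n - s) < e" by linarith
      then show ?case using S(1)[of n] by (simp add: dist_real_def)
    qed
  qed
qed

end

section \<open>Lipschitz bounds in time\<close>

context ctrl_rule
begin

lemma measure_L: "0 \<le> s ==> s \<le> s' ==> s' \<le> T ==> measure L {s<..s'} = s' - s"
proof -
  assume s: "0 \<le> s" "s \<le> s'" "s' \<le> T"
  have "emeasure L {s<..s'} = (\<integral>\<^sup>+u. indicator {s<..s'} u \<partial>L)" by simp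
  also have "\<dots> = (\<integral>\<^sup>+u. indicator {s<..s'} u * indicator {0..T} u \<partial>lborel)"
    by (rule nn_integral_L) simp
  also have "\<dots> = (\<integral>\<^sup>+u. indicator {s<..s'} u \<partial>lborel)"
    by (rule nn_integral_cong) (use s in \<open>simp add: indicator_def\<close>)
  also have "\<dots> = ennreal (s' - s)" using s by simp
  finally show "measure L {s<..s'} = s' - s" using s by (simp add: measure_def)
qed

lemma abs_expectation_le:
  fixes f :: "outcome => real"
  assumes "integrable P f" "\<And>w. w \<in> space P ==> \<bar>f w\<bar> \<le> c"
  shows "\<bar>expectation f\<bar> \<le> c"
proof -
  have "\<bar>expectation f\<bar> \<le> expectation (\<lambda>w. \<bar>f w\<bar>)" using integral_norm_bound[of P f] by simp
  also have "\<dots> \<le> expectation (\<lambda>_. c)" using assms by (intro integral_mono) auto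
  also have "\<dots> = c" using prob_space by simp
  finally show ?thesis .
qed

definition Lip :: "(real => real => real) => bool" where
  "Lip F \<longleftrightarrow> (\<exists>C\<ge>0. \<forall>s s'. t \<le> s \<longrightarrow> s \<le> s' \<longrightarrow> s' < T \<longrightarrow> \<bar>F s s'\<bar> \<le> C * (s' - s))"

lemma LipI: "0 \<le> C ==> (\<And>s s'. t \<le> s ==> s \<le> s' ==> s' < T ==> \<bar>F s s'\<bar> \<le> C * (s' - s)) ==> Lip F"
  unfolding Lip_def by blast

lemma Lip_add:
  assumes "Lip F" "Lip G" shows "Lip (\<lambda>s s'. F s s' + G s s')"
proof -
  obtain C where C: "0 \<le> C" "\<And>s s'. t \<le> s ==> s \<le> s' ==> s' < T ==> \<bar>F s s'\<bar> \<le> C * (s' - s)" using assms(1) by (auto simp: Lip_def)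
  obtain D where D: "0 \<le> D" "\<And>s s'. t \<le> s ==> s \<le> s' ==> s' < T ==> \<bar>G s s'\<bar> \<le> D * (s' - s)" using assms(2) by (auto simp: Lip_def)
  show ?thesis
  proof (rule LipI[of "C + D"])
    fix s s' assume s: "t \<le> s" "s \<le> s'" "s' < T"
    show "\<bar>F s s' + G s s'\<bar> \<le> (C + D) * (s' - s)" using C(2)[OF s] D(2)[OF s] by (simp add: algebra_simps)
  qed (use C D in simp)
qed

lemma Lip_cmult: assumes "Lip F" shows "Lip (\<lambda>s s'. c * F s s')"
proof -
  obtain C where C: "0 \<le> C" "\<And>s s'. t \<le> s ==> s \<le> s' ==> s' < T ==> \<bar>F s s'\<bar> \<le> C * (s' - s)" using assms by (auto simp: Lip_def)
  show ?thesis
  proof (rule LipI[of "\<bar>c\<bar> * C"])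
    fix s s' assume "t \<le> s" "s \<le> s'" "s' < T"
    from mult_left_mono[OF C(2)[OF this] abs_ge_zero[of c]]
    show "\<bar>c * F s s'\<bar> \<le> \<bar>c\<bar> * C * (s' - s)" by (simp add: abs_mult mult_ac)
  qed (use C in simp)
qed

lemma Lip_sum: "finite I ==> (\<And>i. i \<in> I ==> Lip (F i)) ==> Lip (\<lambda>s s'. \<Sum>i\<in>I. F i s s')"
proof (induction I rule: finite_induct)
  case empty
  show ?case by (rule LipI[of 0]) auto
qed (simp add: Lip_add)

lemma Lip_cong: "(\<And>s s'. t \<le> s ==> s \<le> s' ==> s' < T ==> F s s' = G s s') ==> Lip F ==> Lip G"
  unfolding Lip_def by simp

end

section \<open>Dynkin's formula along finitely many pairings\<close>

context cyl_smooth
begin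

lemma time_increment_bound:
  assumes "0 \<le> s" "s \<le> s'" "s' < T"
  shows "\<bar>W s' \<nu> - W s \<nu>\<bar> \<le> Wf.KW * (s' - s)"
proof (cases "s = s'")
  case False
  then have "s < s'" using assms by simp
  then obtain r where r: "s < r" "r < s'" "W s' \<nu> - W s \<nu> = (s' - s) * Wt r \<nu>"
    using Wf.W_time_increment[of s s' \<nu>] assms by blast
  have "\<bar>Wt r \<nu>\<bar> \<le> Wf.KW" using r assms by (intro Wf.KW(2)) auto
  from mult_left_mono[OF this, of "s' - s"] show ?thesis using r assms by (simp add: abs_mult mult.commute)
qed simp

definition drift :: "real => coeff" where
  "drift u x \<nu> a = (\<Sum>j\<in>J. K1 j u x \<nu> a) + 1/2 * (\<Sum>j\<in>J. \<Sum>k\<in>J. K2 j k u x \<nu> a)"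

definition drift_int :: "real => real => real" where
  "drift_int s s' = integral\<^sup>L Q (cell {s<..s'} drift)"

definition time_int :: "real => real => real" where
  "time_int s s' = (\<integral>(w, u). indicator {s<..s'} u * Wt u (Pi (X w u)) \<partial>(P \<Otimes>\<^sub>M L))"

lemma time_int_integrable:
  assumes s: "t \<le> s" "s \<le> s'" "s' < T"
  shows "integrable (P \<Otimes>\<^sub>M L) (\<lambda>(w, u). indicator {s<..s'} u * Wt u (Pi (X w u)))"
    and "\<bar>time_int s s'\<bar> \<le> Wf.KW * (s' - s)"
  unfolding time_int_def
  by (rule time_integrable[OF Pi_continuities(3) Wf.KW(2,1), of _ s s']; use s t in auto)+

text \<open>Both terms are compared with \<open>(s' - s) * v\<close>, where \<open>v\<close> is the
  expected time derivative at \<open>s\<close>. For the first, the mean value theorem gives an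
  intermediate time that also tends to \<open>s\<close>, and dominated convergence applies; for the
  second, the time derivative along the path is continuous from the right in mean square.\<close>

lemma negligible_time:
  assumes s: "t \<le> s" "s < T"
  shows "negligible_at s (\<lambda>s'. (\<integral>w. W s' (Pi (X w s')) - W s (Pi (X w s')) \<partial>P) - time_int s s')"
proof -
  have s0: "s \<in> {0..<T}" using s t by auto
  define v where "v = (\<integral>w. Wt s (Pi (X w s)) \<partial>P)"
  have vi: "integrable P (\<lambda>w. Wt s (Pi (X w s)))"
    by (rule integrable_const_bound[where B=Wf.KW])
      (use Wf.KW(2)[OF s0] measurable_functional_P[OF Pi_continuities(6)[OF s0]] in auto)
  have 1: "negligible_at s (\<lambda>s'. (\<integral>w. W s' (Pi (X w s')) - W s (Pi (X w s')) \<partial>P) - (s' - s) * v)"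
  proof (rule negligible_sequentially[OF s(2)])
    fix S :: "nat => real" assume S: "\<And>n. s < S n" "\<And>n. S n < T" "S \<longlonglongrightarrow> s"
    have Sl: "filterlim S (at_right s) sequentially" using S by (auto simp: filterlim_at intro!: always_eventually)
    define q where "q = (\<lambda>n w. (W (S n) (Pi (X w (S n))) - W s (Pi (X w (S n)))) / (S n - s))"
    have S0: "S n \<in> {0..T}" "S n \<in> {t..T}" "s \<in> {0..T}" "0 \<le> s" "s \<le> S n" for n using S(1,2)[of n] s t by auto
    have qi: "integrable P (\<lambda>w. W (S n) (Pi (X w (S n))) - W s (Pi (X w (S n))))" for n
      using S0 by (intro Bochner_Integration.integrable_diff integrable_WPi)
    have qb: "\<bar>q n w\<bar> \<le> Wf.KW" for n w
      using time_increment_bound[OF S0(4,5) S(2), of n "Pi (X w (S n))"] S(1)[of n] by (simp add: q_def divide_le_eq)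
    have qlim: "(\<lambda>n. q n w) \<longlonglongrightarrow> Wt s (Pi (X w s))" if w: "w \<in> space P" for w
    proof -
      have "\<exists>r. s < r \<and> r < S n \<and> q n w = Wt r (Pi (X w (S n)))" for n
      proof -
        obtain r where r: "s < r" "r < S n" "W (S n) (Pi (X w (S n))) - W s (Pi (X w (S n))) = (S n - s) * Wt r (Pi (X w (S n)))"
          by (rule Wf.W_time_increment[OF S0(4) S(1,2), of n "Pi (X w (S n))"])
        then show ?thesis using S(1)[of n] unfolding q_def r(3) by (intro exI[of _ r]) auto
      qed
      then obtain r where r: "\<And>n. s < r n" "\<And>n. r n < S n" "\<And>n. q n w = Wt (r n) (Pi (X w (S n)))" by metis
      have rl: "r \<longlonglongrightarrow> s"
        by (rule tendsto_sandwich[OF _ _ tendsto_const S(3)]) (use r(1,2)[THEN less_imp_le] in \<open>auto intro!: always_eventually\<close>)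
      have Xl: "(\<lambda>n. X w (S n)) \<longlonglongrightarrow> X w s" by (rule filterlim_compose[OF X_right_continuous[OF w s0] Sl])
      have rT: "r n \<in> {0..<T}" for n using r(1,2)[of n] S(2)[of n] s0 by auto
      have "(\<lambda>n. (\<lambda>(u, \<nu>). Wt u (Pi \<nu>)) (r n, X w (S n))) \<longlonglongrightarrow> (\<lambda>(u, \<nu>). Wt u (Pi \<nu>)) (s, X w s)"
        by (rule continuous_on_tendsto_compose[OF Pi_continuities(3) tendsto_Pair[OF rl Xl]]) (use s0 rT in auto)
      then show ?thesis using r(3) by simp
    qed
    have "(\<lambda>n. \<integral>w. q n w \<partial>P) \<longlonglongrightarrow> v"
      unfolding v_def
    proof (rule integral_dominated_convergence[where w="\<lambda>_. Wf.KW"])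
      show "q n \<in> borel_measurable P" for n using qi[of n] unfolding q_def by measurable
      show "AE w in P. (\<lambda>n. q n w) \<longlonglongrightarrow> Wt s (Pi (X w s))" by (rule AE_I2) (rule qlim)
    qed (use vi qb in auto)
    then have "(\<lambda>n. (\<integral>w. q n w \<partial>P) - v) \<longlonglongrightarrow> v - v" by (intro tendsto_intros)
    moreover have "((\<integral>w. W (S n) (Pi (X w (S n))) - W s (Pi (X w (S n))) \<partial>P) - (S n - s) * v) / (S n - s) = (\<integral>w. q n w \<partial>P) - v" for n
      using S(1)[of n] unfolding q_def integral_divide_zero by (simp add: field_simps)
    ultimately show "(\<lambda>n. ((\<integral>w. W (S n) (Pi (X w (S n))) - W s (Pi (X w (S n))) \<partial>P) - (S n - s) * v) / (S n - s)) \<longlonglongrightarrow> 0"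
      by simp
  qed
  define \<kappa> where "\<kappa> = (\<lambda>(w, u). indicator {0..<T} u * Wt u (Pi (X w u)) - indicator {0..<T} s * Wt s (Pi (X w s)))"
  have \<kappa>: "small_at s \<kappa>" unfolding \<kappa>_def by (rule small_at_path_time[OF Pi_continuities(3) Wf.KW(2) s0])
  have 2: "negligible_at s (\<lambda>s'. \<integral>p. indicator {s<..s'} (snd p) * \<kappa> p \<partial>(P \<Otimes>\<^sub>M L))"
  proof (rule negligible_PL[OF s \<kappa>])
    fix s'
    have [measurable]: "\<kappa> \<in> borel_measurable PR" using \<kappa> by (simp add: small_at_def)
    show "(\<lambda>p. indicator {s<..s'} (snd p) * \<kappa> p) \<in> borel_measurable PR" by measurable
  qed (auto simp: indicator_def)
  have e: "(\<integral>p. indicator {s<..s'} (snd p) * \<kappa> p \<partial>(P \<Otimes>\<^sub>M L)) = time_int s s' - (s' - s) * v" if s': "s < s'" "s' < T" for s'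
  proof -
    let ?g = "\<lambda>(w, u). indicator {s<..s'} u * Wt s (Pi (X w s))"
    have gm: "?g \<in> borel_measurable PR"
    proof -
      have [measurable]: "(\<lambda>p. Wt s (Pi (X (fst p) s))) \<in> borel_measurable PR"
        by (rule measurable_compose[OF measurable_fst measurable_functional_P[OF Pi_continuities(6)[OF s0]]])
      show ?thesis unfolding split_beta' by measurable
    qed
    have s1: "s \<le> s'" "s' \<le> T" "0 \<le> s" using s' s0 by auto
    have b: "\<bar>?g (w, u)\<bar> \<le> indicator {s..s'} u * Wf.KW" for w u
      using Wf.KW(2)[OF s0] Wf.KW(1) by (auto simp: indicator_def)
    have gi: "integrable (P \<Otimes>\<^sub>M L) ?g"
      by (rule PL_bound(1)[OF s1(3,1,2) gm borel_measurable_const b Wf.KW(1)]) (simp add: emeasure_space_1)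
    have "(\<integral>p. ?g p \<partial>(P \<Otimes>\<^sub>M L)) = (\<integral>w. (\<integral>u. ?g (w, u) \<partial>L) \<partial>P)" by (rule PL.integral_fst'[OF gi, symmetric])
    also have "\<dots> = (s' - s) * v"
      using measure_L[OF s1(3,1,2)] by (simp add: v_def)
    finally have g: "(\<integral>p. ?g p \<partial>(P \<Otimes>\<^sub>M L)) = (s' - s) * v" .
    have "(\<integral>p. indicator {s<..s'} (snd p) * \<kappa> p \<partial>(P \<Otimes>\<^sub>M L)) =
      (\<integral>p. (\<lambda>(w, u). indicator {s<..s'} u * Wt u (Pi (X w u))) p - ?g p \<partial>(P \<Otimes>\<^sub>M L))"
      using s0 s' by (intro Bochner_Integration.integral_cong refl) (auto simp: \<kappa>_def indicator_def)
    also have "\<dots> = time_int s s' - (s' - s) * v"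
      unfolding time_int_def g[symmetric] by (rule Bochner_Integration.integral_diff[OF time_int_integrable(1)[OF s(1) s1(1) s'(2)] gi])
    finally show ?thesis .
  qed
  from negligible_add[OF 1 negligible_cmult[OF 2, of "-1"]]
  show ?thesis by (rule negligible_cong[OF s(2), rotated]) (simp add: e)
qed

lemma K_integrable:
  assumes s: "t \<le> s" "s \<le> s'" "s' < T"
  shows "integrable Q (cell {s<..s'} (K1 j))" (is ?g1)
    and "integrable Q (cell {s<..s'} (K2 j k))" (is ?g2)
proof -
  obtain D where D: "0 \<le> D" "\<And>u x \<nu> a. u \<in> {0..<T} ==> a \<in> A ==> \<bar>K1 j u x \<nu> a\<bar> \<le> D" by (rule K1_bound[of j]) blast
  show ?g1
    by (rule time_cell(1)[OF s K1_continuous D])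
  obtain D where D: "0 \<le> D" "\<And>u x \<nu> a. u \<in> {0..<T} ==> a \<in> A ==> \<bar>K2 j k u x \<nu> a\<bar> \<le> D" by (rule K2_bound[of j k]) blast
  show ?g2
    by (rule time_cell(1)[OF s K2_continuous D])
qed

lemma Lip_K:
  "Lip (\<lambda>s s'. integral\<^sup>L Q (cell {s<..s'} (K1 j)))" (is ?g1)
  "Lip (\<lambda>s s'. integral\<^sup>L Q (cell {s<..s'} (K2 j k)))" (is ?g2)
proof -
  obtain D where D: "0 \<le> D" "\<And>u x \<nu> a. u \<in> {0..<T} ==> a \<in> A ==> \<bar>K1 j u x \<nu> a\<bar> \<le> D" by (rule K1_bound[of j]) blast
  show ?g1
    by (rule LipI[OF _ time_cell(2)[OF _ _ _ K1_continuous D]]) (use D moment_nn(1) in auto)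
  obtain D where D: "0 \<le> D" "\<And>u x \<nu> a. u \<in> {0..<T} ==> a \<in> A ==> \<bar>K2 j k u x \<nu> a\<bar> \<le> D" by (rule K2_bound[of j k]) blast
  show ?g2
    by (rule LipI[OF _ time_cell(2)[OF _ _ _ K2_continuous D]]) (use D moment_nn(1) in auto)
qed

lemma drift_integrable:
  assumes s: "t \<le> s" "s \<le> s'" "s' < T"
  shows "integrable Q (cell {s<..s'} drift)" (is ?g1)
    and "drift_int s s' = (\<Sum>j\<in>J. integral\<^sup>L Q (cell {s<..s'} (K1 j)))
      + 1/2 * (\<Sum>j\<in>J. \<Sum>k\<in>J. integral\<^sup>L Q (cell {s<..s'} (K2 j k)))"
proof -
  have e: "cell {s<..s'} drift =
    (\<lambda>p. (\<Sum>j\<in>J. (cell {s<..s'} (K1 j)) p)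
      + 1/2 * (\<Sum>j\<in>J. \<Sum>k\<in>J. (cell {s<..s'} (K2 j k)) p))"
    by (simp add: fun_eq_iff drift_def sum_distrib_left distrib_left mult_ac)
  have i1: "integrable Q (\<lambda>p. \<Sum>j\<in>J. (cell {s<..s'} (K1 j)) p)"
    by (intro Bochner_Integration.integrable_sum K_integrable(1)[OF s])
  have i2: "integrable Q (\<lambda>p. \<Sum>j\<in>J. \<Sum>k\<in>J. (cell {s<..s'} (K2 j k)) p)"
    by (intro Bochner_Integration.integrable_sum K_integrable(2)[OF s])
  show ?g1
    unfolding e by (intro Bochner_Integration.integrable_add integrable_mult_right i1 i2)
  show "drift_int s s' = (\<Sum>j\<in>J. integral\<^sup>L Q (cell {s<..s'} (K1 j)))
      + 1/2 * (\<Sum>j\<in>J. \<Sum>k\<in>J. integral\<^sup>L Q (cell {s<..s'} (K2 j k)))"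
    unfolding drift_int_def e Bochner_Integration.integral_add[OF i1 integrable_mult_right[OF i2]] integral_mult_right_zero
    using K_integrable[OF s] by (simp only: Bochner_Integration.integral_sum Bochner_Integration.integrable_sum)
qed

text \<open>The defect of Dynkin's formula is Lipschitz in time with vanishing right derivative, hence zero.\<close>

definition defect :: "real => real => real" where
  "defect s s' = (\<integral>w. W s' (Pi (X w s')) \<partial>P) - (\<integral>w. W s (Pi (X w s)) \<partial>P) - drift_int s s' - time_int s s'"

lemma defect_eq:
  assumes s: "t \<le> s" "s \<le> s'" "s' < T"
  shows "defect s s' = ((\<integral>w. W s' (Pi (X w s')) - W s (Pi (X w s')) \<partial>P) - time_int s s')
    + (\<Sum>j\<in>J. (\<integral>w. V1 j w s * inc j w s s' \<partial>P)
     - integral\<^sup>L Q (cell {s<..s'} (K1 j)))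
    + 1/2 * (\<Sum>j\<in>J. \<Sum>k\<in>J. (\<integral>w. V2 j k w s * (inc j w s s' * inc k w s s') \<partial>P)
     - integral\<^sup>L Q (cell {s<..s'} (K2 j k)))
    + (\<integral>w. R2 w s s' \<partial>P)"
  unfolding defect_def expansion[OF s] drift_integrable(2)[OF s] by (simp add: sum_subtractf algebra_simps)

lemma negligible_defect:
  assumes s: "t \<le> s" "s < T"
  shows "negligible_at s (defect s)"
proof (rule negligible_cong[OF s(2)])
  show "negligible_at s (\<lambda>s'. ((\<integral>w. W s' (Pi (X w s')) - W s (Pi (X w s')) \<partial>P) - time_int s s')
    + (\<Sum>j\<in>J. (\<integral>w. V1 j w s * inc j w s s' \<partial>P)
     - integral\<^sup>L Q (cell {s<..s'} (K1 j)))
    + 1/2 * (\<Sum>j\<in>J. \<Sum>k\<in>J. (\<integral>w. V2 j k w s * (inc j w s s' * inc k w s s') \<partial>P)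
     - integral\<^sup>L Q (cell {s<..s'} (K2 j k)))
    + (\<integral>w. R2 w s s' \<partial>P))"
    by (intro negligible_add negligible_cmult negligible_sum J negligible_time negligible_first_order negligible_second_order negligible_R2 s)
qed (simp add: defect_eq s)

lemma Sinc_ge: "j \<in> J ==> \<bar>inc j w s s'\<bar> \<le> Sinc w s s'"
  unfolding Sinc_def by (rule member_le_sum[OF _ _ J]) auto

lemma Lip_Sinc:
  assumes f: "\<And>s s'. t \<le> s ==> s \<le> s' ==> s' < T ==> integrable P (f s s')" and c: "0 \<le> c"
    and fb: "\<And>s s' w. t \<le> s ==> s \<le> s' ==> s' < T ==> \<bar>f s s' w\<bar> \<le> c * (Sinc w s s')\<^sup>2"
  shows "Lip (\<lambda>s s'. \<integral>w. f s s' w \<partial>P)"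
proof -
  obtain C where C: "0 \<le> C" "\<And>s s'. t \<le> s ==> s \<le> s' ==> s' \<le> T ==>
    integrable P (\<lambda>w. (Sinc w s s')\<^sup>2) \<and> (\<integral>w. (Sinc w s s')\<^sup>2 \<partial>P) \<le> C * (s' - s)"
    by (rule Sinc_second) blast
  show ?thesis
  proof (rule LipI[of "c * C"])
    fix s s' assume s: "t \<le> s" "s \<le> s'" "s' < T"
    have i: "integrable P (\<lambda>w. (Sinc w s s')\<^sup>2)" "(\<integral>w. (Sinc w s s')\<^sup>2 \<partial>P) \<le> C * (s' - s)" using C(2)[of s s'] s by auto
    have "\<bar>\<integral>w. f s s' w \<partial>P\<bar> \<le> (\<integral>w. \<bar>f s s' w\<bar> \<partial>P)" using integral_norm_bound[of P "f s s'"] by simp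
    also have "\<dots> \<le> (\<integral>w. c * (Sinc w s s')\<^sup>2 \<partial>P)" using f[OF s] i fb[OF s] by (intro integral_mono) auto
    also have "\<dots> \<le> c * (C * (s' - s))" using i c by (simp add: mult_left_mono)
    finally show "\<bar>\<integral>w. f s s' w \<partial>P\<bar> \<le> c * C * (s' - s)" by simp
  qed (use c C in simp)
qed

lemma Lip_defect: "Lip defect"
proof (rule Lip_cong)
  have 1: "Lip (\<lambda>s s'. \<integral>w. W s' (Pi (X w s')) - W s (Pi (X w s')) \<partial>P)"
  proof (rule LipI[OF Wf.KW(1)])
    fix s s' assume s: "t \<le> s" "s \<le> s'" "s' < T"
    then have "integrable P (\<lambda>w. W s' (Pi (X w s')) - W s (Pi (X w s')))"
      using t by (intro Bochner_Integration.integrable_diff integrable_WPi) auto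
    then show "\<bar>\<integral>w. W s' (Pi (X w s')) - W s (Pi (X w s')) \<partial>P\<bar> \<le> Wf.KW * (s' - s)"
      using t s by (intro abs_expectation_le time_increment_bound) auto
  qed
  have 2: "Lip time_int" by (rule LipI[OF Wf.KW(1) time_int_integrable(2)])
  have 3: "Lip (\<lambda>s s'. \<integral>w. V1 j w s * inc j w s s' \<partial>P)" for j
  proof -
    obtain G where G: "0 \<le> G" "\<And>x \<nu> a. a \<in> A ==> \<bar>gen b \<sigma> (h j) x \<nu> a\<bar> \<le> G" by (rule gen_bound[OF h[of j]]) blast
    show ?thesis
    proof (rule LipI[of "Wf.KW * G * (2 * moment 1)"])
      fix s s' assume s: "t \<le> s" "s \<le> s'" "s' < T"
      show "\<bar>\<integral>w. V1 j w s * inc j w s s' \<partial>P\<bar> \<le> Wf.KW * G * (2 * moment 1) * (s' - s)"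
        unfolding first_order(2)[OF s] by (rule W1_cell(2)[OF s G])
    qed (use G Wf.KW(1) moment_nn(1) in auto)
  qed
  have 4: "Lip (\<lambda>s s'. \<integral>w. V2 j k w s * (inc j w s s' * inc k w s s') \<partial>P)"
    if jk: "j \<in> J" "k \<in> J" for j k
  proof (rule Lip_Sinc[OF second_order(1) Wf.KW(1)])
    fix s s' w assume s: "t \<le> s" "s \<le> s'" "s' < T"
    then have s0: "s \<in> {0..<T}" using t by auto
    show "\<bar>V2 j k w s * (inc j w s s' * inc k w s s')\<bar> \<le> Wf.KW * (Sinc w s s')\<^sup>2"
      unfolding abs_mult power2_eq_square using Wf.KW(1) Sinc_nonneg
      by (intro mult_mono Wf.KW(6)[OF s0] Sinc_ge jk) auto
  qed
  have 5: "Lip (\<lambda>s s'. \<integral>w. R2 w s s' \<partial>P)"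
    by (rule Lip_Sinc[OF integrable_R2 _ R2_bound]) (use Wf.KW(1) t in auto)
  have m: "Lip F ==> Lip G ==> Lip (\<lambda>s s'. F s s' - G s s')" for F G
    using Lip_add[OF _ Lip_cmult[of G "-1"], of F] by simp
  show "Lip (\<lambda>s s'. ((\<integral>w. W s' (Pi (X w s')) - W s (Pi (X w s')) \<partial>P) - time_int s s')
    + (\<Sum>j\<in>J. (\<integral>w. V1 j w s * inc j w s s' \<partial>P)
     - integral\<^sup>L Q (cell {s<..s'} (K1 j)))
    + 1/2 * (\<Sum>j\<in>J. \<Sum>k\<in>J. (\<integral>w. V2 j k w s * (inc j w s s' * inc k w s s') \<partial>P)
     - integral\<^sup>L Q (cell {s<..s'} (K2 j k)))
    + (\<integral>w. R2 w s s' \<partial>P))"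
    by (intro Lip_add Lip_cmult Lip_sum J m 1 2 3 4 5 Lip_K)
qed (simp add: defect_eq)

lemma defect_additive:
  assumes s: "t \<le> s" "s \<le> s'" "s' \<le> s''" "s'' < T"
  shows "defect s s'' = defect s s' + defect s' s''"
proof -
  have ind: "indicator {s<..s''} u = (indicator {s<..s'} u + indicator {s'<..s''} u :: real)" for u
    using s by (auto simp: indicator_def)
  have s1: "t \<le> s'" "s' < T" using s by auto
  note i = drift_integrable(1)[OF s(1,2) s1(2)] drift_integrable(1)[OF s1(1) s(3,4)]
  note j = time_int_integrable(1)[OF s(1,2) s1(2)] time_int_integrable(1)[OF s1(1) s(3,4)]
  have "drift_int s s'' = drift_int s s' + drift_int s' s''"
    unfolding drift_int_def Bochner_Integration.integral_add[OF i, symmetric] ind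
    by (simp add: split_beta' algebra_simps)
  moreover have "time_int s s'' = time_int s s' + time_int s' s''"
    unfolding time_int_def Bochner_Integration.integral_add[OF j, symmetric] ind
    by (simp add: split_beta' algebra_simps)
  ultimately show ?thesis by (simp add: defect_def)
qed

text \<open>Additivity of the defect over adjacent intervals turns its negligibility at each time
  into a vanishing right derivative of \<open>defect t\<close>; the Lipschitz bound provides the
  continuity.\<close>

lemma cylinder_dynkin:
  assumes s: "t \<le> s" "s < T"
  shows "(\<integral>w. W s (Pi (X w s)) \<partial>P) - (\<integral>w. W t (Pi (X w t)) \<partial>P) = drift_int t s + time_int t s"
proof -
  have add: "defect t r = defect t r' + defect r' r" if "t \<le> r'" "r' \<le> r" "r < T" for r r'
    by (rule defect_additive) (use that in auto)
  have "defect t s = defect t t"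
  proof (rule right_derivative_zero_imp_const[OF s(1)])
    obtain C where C: "0 \<le> C" "\<And>s s'. t \<le> s ==> s \<le> s' ==> s' < T ==> \<bar>defect s s'\<bar> \<le> C * (s' - s)"
      using Lip_defect by (auto simp: Lip_def)
    have l: "\<bar>defect t r - defect t r'\<bar> \<le> C * \<bar>r - r'\<bar>" if "r \<in> {t..s}" "r' \<in> {t..s}" for r r'
      using add[of r' r] add[of r r'] C(2)[of r' r] C(2)[of r r'] that s by (cases "r' \<le> r") auto
    show "continuous_on {t..s} (defect t)"
      by (rule lipschitz_on_continuous_on[of C], rule lipschitz_onI) (use l C(1) in \<open>auto simp: dist_real_def\<close>)
    fix r e :: real assume r: "r \<in> {t..<s}" and e: "e > 0"
    have rT: "t \<le> r" "r < T" using r s by auto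
    have "\<forall>\<^sub>F s' in at_right r. dist (defect r s' / (s' - r)) 0 < e"
      using negligible_defect[OF rT] e unfolding negligible_at_def by (rule tendstoD)
    then obtain d where d: "d > r" "\<And>s'. r < s' ==> s' < d ==> \<bar>defect r s' / (s' - r)\<bar> < e"
      by (auto simp: eventually_at_right_field dist_real_def)
    show "\<exists>d>0. \<forall>s'. r < s' \<and> s' < r + d \<and> s' \<le> s \<longrightarrow> \<bar>defect t s' - defect t r\<bar> \<le> e * (s' - r)"
    proof (intro exI[of _ "d - r"] conjI allI impI)
      fix s' assume s': "r < s' \<and> s' < r + (d - r) \<and> s' \<le> s"
      then have "\<bar>defect r s'\<bar> < e * (s' - r)" using d(2)[of s'] by (simp add: divide_less_eq)
      then show "\<bar>defect t s' - defect t r\<bar> \<le> e * (s' - r)" using add[of r s'] s' s rT by simp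
    qed (use d in simp)
  qed
  also have "\<dots> = 0" by (simp add: defect_def drift_int_def time_int_def split_beta')
  finally show ?thesis by (simp add: defect_def)
qed

end

section \<open>Dynkin's formula for smooth functions of the measure\<close>

text \<open>A product neighbourhood of the limit point separates the two arguments: the measures
  eventually lie in one factor, and the other contains an interval around \<open>x\<close>
  independent of \<open>n\<close>.\<close>

lemma ucontI:
  fixes K :: "real finmeas => real => real"
  assumes K: "continuous_on UNIV (\<lambda>(\<nu>, \<xi>). K \<nu> \<xi>)" and \<nu>: "\<nu>s \<longlonglongrightarrow> \<nu>"
  shows "ucont (\<lambda>n. K (\<nu>s n)) x (K \<nu> x)"
  unfolding ucont_def
proof (intro allI impI)
  fix e :: real assume e: "e > 0"
  let ?U = "{p. \<bar>(case p of (\<nu>, \<xi>) => K \<nu> \<xi>) - K \<nu> x\<bar> < e}"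
  have "open ?U" by (intro open_Collect_less continuous_intros K)
  moreover have "(\<nu>, x) \<in> ?U" using e by simp
  ultimately obtain M B where M: "open M" "open B" "(\<nu>, x) \<in> M \<times> B" "M \<times> B \<subseteq> ?U" by (rule open_prod_elim)
  obtain d where d: "d > 0" "ball x d \<subseteq> B" using M by (meson open_contains_ball mem_Sigma_iff)
  have "\<forall>\<^sub>F n in sequentially. \<nu>s n \<in> M" using topological_tendstoD[OF \<nu> M(1)] M(3) by simp
  then have "\<forall>\<^sub>F n in sequentially. \<forall>\<xi>. \<bar>\<xi> - x\<bar> < d \<longrightarrow> \<bar>K (\<nu>s n) \<xi> - K \<nu> x\<bar> \<le> e"
  proof eventually_elim
    case (elim n)
    have "\<xi> \<in> B" if "\<bar>\<xi> - x\<bar> < d" for \<xi> using d that by (auto simp: dist_real_def abs_minus_commute)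
    then show ?case using elim M(4) by (force intro: less_imp_le)
  qed
  then show "\<exists>d>0. \<forall>\<^sub>F n in sequentially. \<forall>\<xi>. \<bar>\<xi> - x\<bar> < d \<longrightarrow> \<bar>K (\<nu>s n) \<xi> - K \<nu> x\<bar> \<le> e" using d(1) by blast
qed

lemma ucont2I:
  fixes K :: "real finmeas => real => real => real"
  assumes K: "continuous_on UNIV (\<lambda>(\<nu>, \<xi>, \<eta>). K \<nu> \<xi> \<eta>)" and \<nu>: "\<nu>s \<longlonglongrightarrow> \<nu>"
  shows "ucont2 (\<lambda>n. K (\<nu>s n)) x (K \<nu> x x)"
  unfolding ucont2_def
proof (intro allI impI)
  fix e :: real assume e: "e > 0"
  let ?U = "{p. \<bar>(case p of (\<nu>, \<xi>, \<eta>) => K \<nu> \<xi> \<eta>) - K \<nu> x x\<bar> < e}"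
  have "open ?U" by (intro open_Collect_less continuous_intros K)
  moreover have "(\<nu>, x, x) \<in> ?U" using e by simp
  ultimately obtain M B where M: "open M" "open B" "(\<nu>, x, x) \<in> M \<times> B" "M \<times> B \<subseteq> ?U" by (rule open_prod_elim)
  then have "(x, x) \<in> B" by simp
  with M(2) obtain C D where C: "open C" "open D" "(x, x) \<in> C \<times> D" "C \<times> D \<subseteq> B" by (rule open_prod_elim)
  have "open (C \<inter> D)" "x \<in> C \<inter> D" using C by auto
  then obtain d where d: "d > 0" "ball x d \<subseteq> C \<inter> D" by (meson open_contains_ball)
  have "\<forall>\<^sub>F n in sequentially. \<nu>s n \<in> M" using topological_tendstoD[OF \<nu> M(1)] M(3) by simp
  then have "\<forall>\<^sub>F n in sequentially. \<forall>\<xi> \<eta>. \<bar>\<xi> - x\<bar> < d \<longrightarrow> \<bar>\<eta> - x\<bar> < d \<longrightarrow> \<bar>K (\<nu>s n) \<xi> \<eta> - K \<nu> x x\<bar> \<le> e"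
  proof eventually_elim
    case (elim n)
    have "\<xi> \<in> C \<inter> D" if "\<bar>\<xi> - x\<bar> < d" for \<xi>
    proof -
      have "\<xi> \<in> ball x d" using that by (simp add: dist_real_def abs_minus_commute)
      then show ?thesis using d by blast
    qed
    then have "(\<nu>s n, \<xi>, \<eta>) \<in> ?U" if "\<bar>\<xi> - x\<bar> < d" "\<bar>\<eta> - x\<bar> < d" for \<xi> \<eta>
      using elim M(4) C(4) that by blast
    then show ?case by (auto intro: less_imp_le)
  qed
  then show "\<exists>d>0. \<forall>\<^sub>F n in sequentially. \<forall>\<xi> \<eta>. \<bar>\<xi> - x\<bar> < d \<longrightarrow> \<bar>\<eta> - x\<bar> < d \<longrightarrow> \<bar>K (\<nu>s n) \<xi> \<eta> - K \<nu> x x\<bar> \<le> e"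
    using d(1) by blast
qed

section \<open>Passage to the limit in the projection\<close>

context ctrl_smooth
begin

text \<open>The drift of \<open>W\<close> composed with \<open>proj n\<close>, once the sums over
  the atoms are collected: derivatives of the bumps, weighted by derivatives of \<open>W\<close> at
  the nodes, combine to derivatives of Bernstein approximants.\<close>

definition gen_proj :: "nat => real => coeff" where
  "gen_proj n u x \<nu> a = b x \<nu> a * appr1 n (\<lambda>j. W1 u (proj n \<nu>) (node n j)) x
     + 1/2 * (\<sigma> x \<nu> a)\<^sup>2 * appr2 n (\<lambda>j. W1 u (proj n \<nu>) (node n j)) x
     + 1/2 * \<gamma> x \<nu> a * appr n (\<lambda>i. appr n (\<lambda>j. W2 u (proj n \<nu>) (node n i) (node n j)) x) x"

definition gen_W :: "real => coeff" where
  "gen_W u x \<nu> a = b x \<nu> a * pd W1 u \<nu> x + 1/2 * (\<sigma> x \<nu> a)\<^sup>2 * pd (pd W1) u \<nu> x + 1/2 * \<gamma> x \<nu> a * W2 u \<nu> x x"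

lemma gen_bounds:
  obtains C where "0 \<le> C" "\<And>n u x \<nu> a. u \<in> {0..<T} ==> a \<in> A ==> \<bar>gen_proj n u x \<nu> a\<bar> \<le> C"
    "\<And>u x \<nu> a. u \<in> {0..<T} ==> a \<in> A ==> \<bar>gen_W u x \<nu> a\<bar> \<le> C"
proof -
  obtain B where B: "0 \<le> B" "\<And>x \<nu> a. a \<in> A ==> \<bar>b x \<nu> a\<bar> \<le> B" by (rule admissible_coeff_bound[OF b]) blast
  obtain S where S: "0 \<le> S" "\<And>x \<nu> a. a \<in> A ==> \<bar>\<sigma> x \<nu> a\<bar> \<le> S" by (rule admissible_coeff_bound[OF \<sigma>]) blast
  obtain G where G: "0 \<le> G" "\<And>x \<nu> a. a \<in> A ==> \<bar>\<gamma> x \<nu> a\<bar> \<le> G" by (rule admissible_coeff_bound[OF \<gamma>]) blast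
  let ?K = "Wf.KW"
  define C where "C = B * (4 * ?K) + 1/2 * S\<^sup>2 * (4 * ?K) + 1/2 * G * (4 * ?K)"
  have K: "0 \<le> ?K" by (rule Wf.KW(1))
  have main: "\<bar>b x \<nu> a * p + 1/2 * (\<sigma> x \<nu> a)\<^sup>2 * q + 1/2 * \<gamma> x \<nu> a * r\<bar> \<le> C"
    if "a \<in> A" "\<bar>p\<bar> \<le> 4 * ?K" "\<bar>q\<bar> \<le> 4 * ?K" "\<bar>r\<bar> \<le> 4 * ?K" for x \<nu> a p q r
  proof -
    have "\<bar>b x \<nu> a * p + 1/2 * (\<sigma> x \<nu> a)\<^sup>2 * q + 1/2 * \<gamma> x \<nu> a * r\<bar> \<le> \<bar>b x \<nu> a * p\<bar> + \<bar>1/2 * (\<sigma> x \<nu> a)\<^sup>2 * q\<bar> + \<bar>1/2 * \<gamma> x \<nu> a * r\<bar>"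
      by linarith
    also have "\<dots> = \<bar>b x \<nu> a\<bar> * \<bar>p\<bar> + 1/2 * \<bar>\<sigma> x \<nu> a\<bar>\<^sup>2 * \<bar>q\<bar> + 1/2 * \<bar>\<gamma> x \<nu> a\<bar> * \<bar>r\<bar>"
      by (simp add: abs_mult)
    also have "\<dots> \<le> C" unfolding C_def
      using that B S G K by (intro add_mono mult_mono power_mono) auto
    finally show ?thesis .
  qed
  show thesis
  proof (rule that[of C])
    show "0 \<le> C" using B S G K by (auto simp: C_def)
    fix u x a and \<nu> :: "real finmeas" assume u: "u \<in> {0..<T}" and a: "a \<in> A"
    show "\<bar>gen_W u x \<nu> a\<bar> \<le> C"
    proof -
      have K4: "?K \<le> 4 * ?K" using K by simp
      show ?thesis unfolding gen_W_def by (intro main a order_trans[OF _ K4] Wf.KW u)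
    qed
    fix n
    have "\<bar>appr n (\<lambda>i. appr n (\<lambda>j. W2 u (proj n \<nu>) (node n i) (node n j)) x) x\<bar> \<le> ?K"
      unfolding appr_def by (intro bern_abs_le coord_bounds Wf.KW(6)[OF u])
    moreover have "\<bar>appr1 n (\<lambda>j. W1 u (proj n \<nu>) (node n j)) x\<bar> \<le> ?K" "\<bar>appr2 n (\<lambda>j. W1 u (proj n \<nu>) (node n j)) x\<bar> \<le> 4 * ?K"
      by (rule appr_bounds[OF Wf.W1_deriv[OF u] Wf.W1x_deriv[OF u] Wf.KW(4)[OF u] Wf.KW(5)[OF u]])+
    ultimately show "\<bar>gen_proj n u x \<nu> a\<bar> \<le> C"
      unfolding gen_proj_def using K by (intro main a) auto
  qed
qed

lemma gen_proj_tendsto: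
  assumes u: "u \<in> {0..<T}"
  shows "(\<lambda>n. gen_proj n u x \<nu> a) \<longlonglongrightarrow> gen_W u x \<nu> a"
proof -
  have c1: "continuous_on UNIV (\<lambda>(\<nu>, \<xi>). pd W1 u \<nu> \<xi>)" "continuous_on UNIV (\<lambda>(\<nu>, \<xi>). pd (pd W1) u \<nu> \<xi>)"
    unfolding split_beta' by (intro Wf.continuous_on_W1(2,3) continuous_intros; use u in simp)+
  have c2: "continuous_on UNIV (\<lambda>(\<nu>, \<xi>, \<eta>). W2 u \<nu> \<xi> \<eta>)"
    unfolding split_beta' by (intro Wf.continuous_on_W2 continuous_intros; use u in simp)
  note l1 = appr_tendsto[OF Wf.W1_deriv[OF u] Wf.W1x_deriv[OF u] Wf.KW(4)[OF u] Wf.KW(5)[OF u]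
      ucontI[OF c1(1) proj_tendsto] ucontI[OF c1(2) proj_tendsto]]
  note l2 = bern_tendsto_ucont2[OF Wf.KW(6)[OF u] ucont2I[OF c2 proj_tendsto]]
  show ?thesis
    unfolding gen_proj_def gen_W_def
    by (intro tendsto_intros l1 l2[folded appr_def])
qed

lemma gen_W_continuous: "continuous_on ({0..<T} \<times> UNIV \<times> UNIV \<times> A) (\<lambda>(u, x, \<nu>, a). gen_W u x \<nu> a)"
  unfolding gen_W_def split_beta'
  by (intro continuous_on_add continuous_on_mult continuous_on_power continuous_on_coeff[OF admissible_coeff_continuous[OF b]]
       continuous_on_coeff[OF admissible_coeff_continuous[OF \<sigma>]] continuous_on_coeff[OF admissible_coeff_continuous[OF \<gamma>]]
       Wf.continuous_on_W1(2,3) Wf.continuous_on_W2 continuous_intros) auto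

lemma proj_dynkin:
  assumes s: "t \<le> s" "s < T"
  shows "integrable Q (cell {t<..s} (gen_proj n))" (is ?g1)
    and "integrable (P \<Otimes>\<^sub>M L) (\<lambda>(w, u). indicator {t<..s} u * Wt u (proj n (X w u)))" (is ?g2)
    and "v \<in> {0..T} ==> r \<in> {t..T} ==> integrable P (\<lambda>w. W v (proj n (X w r)))"
    and "(\<integral>w. W s (proj n (X w s)) \<partial>P) - (\<integral>w. W t (proj n (X w t)) \<partial>P) =
     integral\<^sup>L Q (cell {t<..s} (gen_proj n))
     + (\<integral>(w, u). indicator {t<..s} u * Wt u (proj n (X w u)) \<partial>(P \<Otimes>\<^sub>M L))"
proof -
  interpret C: cyl_smooth T A \<phi> b \<sigma> \<gamma> MM t \<xi> P W Wt W1 W2 "{..dg n}" "bump n" "node n"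
    by unfold_locales (auto intro: Cb2_bump bump_nonneg)
  have d: "C.drift u x \<nu> a = gen_proj n u x \<nu> a" for u x \<nu> a
  proof -
    have "(\<Sum>j\<in>J. w j * (c * h1 j + 1/2 * e * h2 j)) = c * (\<Sum>j\<in>J. w j * h1 j) + 1/2 * e * (\<Sum>j\<in>J. w j * h2 j)" for w h1 h2 :: "nat => real" and c e :: real and J
      by (simp add: sum_distrib_left sum.distrib algebra_simps)
    moreover have "(\<Sum>i\<in>J. \<Sum>j\<in>J. w i j * (c * (h i * h j))) = c * (\<Sum>i\<in>J. (\<Sum>j\<in>J. w i j * h j) * h i)" for w and h :: "nat => real" and c :: real and J
      by (simp add: sum_distrib_left sum_distrib_right mult_ac)
    ultimately show ?thesis
      unfolding C.drift_def C.K1_def C.K2_def gen_def gen_proj_def proj_def[symmetric]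
      by (simp only: sum_bump_deriv sum_bump)
  qed
  show ?g1
    using C.drift_integrable(1)[OF order_refl s] unfolding d .
  show ?g2
    using C.time_int_integrable(1)[OF order_refl s] unfolding proj_def .
  show "v \<in> {0..T} ==> r \<in> {t..T} ==> integrable P (\<lambda>w. W v (proj n (X w r)))"
    unfolding proj_def by (rule C.integrable_WPi)
  show "(\<integral>w. W s (proj n (X w s)) \<partial>P) - (\<integral>w. W t (proj n (X w t)) \<partial>P) =
     integral\<^sup>L Q (cell {t<..s} (gen_proj n))
     + (\<integral>(w, u). indicator {t<..s} u * Wt u (proj n (X w u)) \<partial>(P \<Otimes>\<^sub>M L))"
    using C.cylinder_dynkin[OF s] unfolding C.drift_int_def C.time_int_def d proj_def .
qed

lemma W_X_growth:
  obtains C where "0 \<le> C" "\<And>u v w. u \<in> {0..T} ==> \<bar>W u (X w v)\<bar> \<le> C * (1 + mass w v)"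
    "\<And>u v w n. u \<in> {0..T} ==> \<bar>W u (proj n (X w v))\<bar> \<le> C * (1 + mass w v)"
proof -
  obtain C where C: "0 \<le> C" "\<And>u \<nu>. u \<in> {0..T} ==> \<bar>W u \<nu>\<bar> \<le> C * (1 + tmass \<nu>)" by (rule Wf.W_growth) blast
  show thesis using that[OF C(1) C(2)] C(2)[of _ "proj n (X w v)" for n w v] unfolding pairing_proj_one by blast
qed

lemma integrable_mass_weight:
  assumes "v \<in> {t..T}"
  shows "integrable P (\<lambda>w. C * (1 + mass w v))"
proof -
  have [measurable]: "(\<lambda>w. mass w v) \<in> borel_measurable P" by (rule measurable_functional_P) (intro continuous_pairing, auto)
  have "integrable P (\<lambda>w. 1 + mass w v)"
    by (rule P_bound(1)[OF assms assms zero_le_one, of _ 1 0]) (auto simp: pairing_nonneg)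
  then show ?thesis by simp
qed

lemma E_W_proj_tendsto:
  assumes "u \<in> {0..T}" "v \<in> {t..T}"
  shows "(\<lambda>n. \<integral>w. W u (proj n (X w v)) \<partial>P) \<longlonglongrightarrow> (\<integral>w. W u (X w v) \<partial>P)"
proof -
  obtain C where C: "0 \<le> C" "\<And>u v w. u \<in> {0..T} ==> \<bar>W u (X w v)\<bar> \<le> C * (1 + mass w v)"
    "\<And>u v w n. u \<in> {0..T} ==> \<bar>W u (proj n (X w v))\<bar> \<le> C * (1 + mass w v)"
    by (rule W_X_growth) blast
  have c: "continuous_on UNIV (W u)" using Wf.continuous_on_W[of UNIV "\<lambda>_. u" "\<lambda>\<nu>. \<nu>"] assms by (simp add: continuous_on_id)
  show ?thesis
  proof (rule integral_dominated_convergence[where w="\<lambda>w. C * (1 + mass w v)"])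
    show "(\<lambda>w. W u (X w v)) \<in> borel_measurable P" by (rule measurable_functional_P[OF c])
    show "(\<lambda>w. W u (proj n (X w v))) \<in> borel_measurable P" for n
    proof -
      have "t < T \<or> t = T" using t by auto
      interpret C: cyl_smooth T A \<phi> b \<sigma> \<gamma> MM t \<xi> P W Wt W1 W2 "{..dg n}" "bump n" "node n"
        by unfold_locales (auto intro: Cb2_bump bump_nonneg)
      show ?thesis using C.integrable_WPi[OF assms] unfolding proj_def by simp
    qed
    show "integrable P (\<lambda>w. C * (1 + mass w v))" by (rule integrable_mass_weight[OF assms(2)])
    show "AE w in P. (\<lambda>n. W u (proj n (X w v))) \<longlonglongrightarrow> W u (X w v)"
      by (rule AE_I2, rule continuous_on_tendsto_compose[OF c proj_tendsto]) auto
    show "AE w in P. norm (W u (proj n (X w v))) \<le> C * (1 + mass w v)" for n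
      using C(3)[OF assms(1)] by simp
  qed
qed

lemma Wt_integrable:
  assumes "S \<in> sets borel" "S \<subseteq> {t..<T}"
  shows "integrable (P \<Otimes>\<^sub>M L) (\<lambda>(w, u). indicator S u * Wt u (X w u))"
  by (rule time_integrable(1)[OF Wf.Wt_cont Wf.KW(2,1), of _ t T]) (use assms t in auto)

lemma dynkin_before_T:
  assumes s: "t \<le> s" "s < T"
  shows "(\<integral>w. W s (X w s) \<partial>P) - (\<integral>w. W t (X w t) \<partial>P) =
     integral\<^sup>L Q (cell {t<..s} gen_W)
     + (\<integral>(w, u). indicator {t<..s} u * Wt u (X w u) \<partial>(P \<Otimes>\<^sub>M L))"
proof -
  obtain C where C: "0 \<le> C" "\<And>n u x \<nu> a. u \<in> {0..<T} ==> a \<in> A ==> \<bar>gen_proj n u x \<nu> a\<bar> \<le> C"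
    "\<And>u x \<nu> a. u \<in> {0..<T} ==> a \<in> A ==> \<bar>gen_W u x \<nu> a\<bar> \<le> C" by (rule gen_bounds) blast
  have sub: "u \<in> {0..<T}" if "u \<in> {t<..s}" for u using that s t by auto
  have 1: "(\<lambda>n. \<integral>p. (cell {t<..s} (gen_proj n)) p \<partial>Q) \<longlonglongrightarrow>
    (\<integral>p. (cell {t<..s} gen_W) p \<partial>Q)"
  proof (rule integral_dominated_convergence[where w="\<lambda>(w, u, x, a). indicator {t<..s} u * indicator A a * C"])
    show "cell {t<..s} gen_W \<in> borel_measurable Q"
      using time_cell(1)[OF order_refl s gen_W_continuous C(1,3)] by simp
    show "cell {t<..s} (gen_proj n) \<in> borel_measurable Q" for n
      using proj_dynkin(1)[OF s] by simp
    show "integrable Q (\<lambda>(w, u, x, a). indicator {t<..s} u * indicator A a * C)"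
      using time_cell(1)[OF order_refl s, of "\<lambda>_ _ _ _. C" C] C(1) by (simp add: split_beta')
    show "AE p in Q. (\<lambda>n. (cell {t<..s} (gen_proj n)) p)
       \<longlonglongrightarrow> (cell {t<..s} gen_W) p"
    proof (rule AE_I2)
      fix p :: "outcome \<times> real \<times> real \<times> real"
      obtain w u x a where p: "p = (w, u, x, a)" by (cases p)
      show "(\<lambda>n. (cell {t<..s} (gen_proj n)) p)
       \<longlonglongrightarrow> (cell {t<..s} gen_W) p"
        unfolding p prod.case
        using tendsto_mult_left[OF gen_proj_tendsto[OF sub], of u "indicator {t<..s} u * indicator A a" x "X w u" a]
        by (cases "u \<in> {t<..s}") auto
    qed
    show "AE p in Q. norm ((cell {t<..s} (gen_proj n)) p)
       \<le> (\<lambda>(w, u, x, a). indicator {t<..s} u * indicator A a * C) p" for n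
      using C(2)[OF sub] by (intro AE_I2) (auto simp: indicator_def)
  qed
  have 2: "(\<lambda>n. \<integral>p. (\<lambda>(w, u). indicator {t<..s} u * Wt u (proj n (X w u))) p \<partial>(P \<Otimes>\<^sub>M L)) \<longlonglongrightarrow>
    (\<integral>p. (\<lambda>(w, u). indicator {t<..s} u * Wt u (X w u)) p \<partial>(P \<Otimes>\<^sub>M L))"
  proof (rule integral_dominated_convergence[where w="\<lambda>_. Wf.KW"])
    show "(\<lambda>(w, u). indicator {t<..s} u * Wt u (X w u)) \<in> borel_measurable (P \<Otimes>\<^sub>M L)"
      using Wt_integrable[of "{t<..s}"] s by (simp add: subset_eq)
    show "(\<lambda>(w, u). indicator {t<..s} u * Wt u (proj n (X w u))) \<in> borel_measurable (P \<Otimes>\<^sub>M L)" for n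
      using proj_dynkin(2)[OF s] by simp
    interpret fL: finite_measure L by (rule finite_L)
    interpret fPL: finite_measure "P \<Otimes>\<^sub>M L" by (rule finite_measure_pair_measure) (rule finite_measure_axioms finite_L)+
    show "integrable (P \<Otimes>\<^sub>M L) (\<lambda>_. Wf.KW)" by simp
    show "AE p in P \<Otimes>\<^sub>M L. (\<lambda>n. (\<lambda>(w, u). indicator {t<..s} u * Wt u (proj n (X w u))) p)
       \<longlonglongrightarrow> (\<lambda>(w, u). indicator {t<..s} u * Wt u (X w u)) p"
    proof (rule AE_I2)
      fix p :: "outcome \<times> real"
      obtain w u where p: "p = (w, u)" by (cases p)
      show "(\<lambda>n. (\<lambda>(w, u). indicator {t<..s} u * Wt u (proj n (X w u))) p)
       \<longlonglongrightarrow> (\<lambda>(w, u). indicator {t<..s} u * Wt u (X w u)) p"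
      proof (cases "u \<in> {t<..s}")
        case True
        have c: "continuous_on UNIV (Wt u)"
          using Wf.continuous_on_Wt[of UNIV "\<lambda>_. u" "\<lambda>\<nu>. \<nu>"] sub[OF True] by (simp add: continuous_on_id)
        show ?thesis using True continuous_on_tendsto_compose[OF c proj_tendsto[of "X w u"]] by (simp add: p)
      qed (simp add: p)
    qed
    show "AE p in P \<Otimes>\<^sub>M L. norm ((\<lambda>(w, u). indicator {t<..s} u * Wt u (proj n (X w u))) p) \<le> Wf.KW" for n
      using Wf.KW(2)[OF sub] Wf.KW(1) by (intro AE_I2) (auto simp: indicator_def)
  qed
  have st: "s \<in> {0..T}" "s \<in> {t..T}" "t \<in> {0..T}" "t \<in> {t..T}" using s t by auto
  have "(\<lambda>n. (\<integral>w. W s (proj n (X w s)) \<partial>P) - (\<integral>w. W t (proj n (X w t)) \<partial>P)) \<longlonglongrightarrow> (\<integral>w. W s (X w s) \<partial>P) - (\<integral>w. W t (X w t) \<partial>P)"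
    by (intro tendsto_diff E_W_proj_tendsto st)
  then show ?thesis
    unfolding proj_dynkin(4)[OF s] by (rule LIMSEQ_unique[OF _ tendsto_add[OF 1 2]])
qed

end

text \<open>Points at distance zero have the same neighbourhoods, because the distance determines the topology.\<close>

lemma tendsto_of_weak_dist_0:
  assumes \<phi>: "test_sequence \<phi>" and l: "(X \<longlongrightarrow> l) F" and 0: "weak_dist \<phi> \<mu> l = 0"
  shows "(X \<longlongrightarrow> \<mu>) F"
proof (rule topological_tendstoI)
  fix U assume U: "open U" "\<mu> \<in> U"
  have "\<forall>\<mu>\<in>U. \<exists>e>0. \<forall>\<nu>. weak_dist \<phi> \<mu> \<nu> < e \<longrightarrow> \<nu> \<in> U" using \<phi> U(1) unfolding test_sequence_def by blast
  then have "l \<in> U" using U(2) 0 by force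
  then show "\<forall>\<^sub>F x in F. X x \<in> U" by (rule topological_tendstoD[OF l U(1)])
qed

section \<open>Continuity of the state at the terminal time\<close>

context ctrl_rule
begin

lemma Cb2_test: "Cb2 (\<phi> k)" "\<And>x. \<bar>\<phi> k x\<bar> \<le> 1" "\<phi> 0 = (\<lambda>_. 1)"
  using \<phi> by (auto simp: test_sequence_def)

lemma left_limit:
  assumes "w \<in> space P"
  shows "\<exists>l. (X w \<longlongrightarrow> l) (at_left T)"
proof -
  have "\<forall>t\<in>{0<..T}. \<exists>l. (fst w \<longlongrightarrow> l) (at_left t)"
    using assms by (auto simp: space_P canonical_space_def cadlag_paths_def)
  then obtain l where l: "(fst w \<longlongrightarrow> l) (at_left T)" using T by force
  have "\<forall>\<^sub>F v in at_left T. fst w v = X w v"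
    unfolding eventually_at_left_field by (rule exI[of _ 0]) (use T in \<open>auto simp: X_eq\<close>)
  then show ?thesis using l by (auto simp: tendsto_cong)
qed

text \<open>Fatou yields only that a lower limit vanishes, but the left limit of the path exists, so
  the lower limit is a limit. The test sequence is countable, so one null set serves all its
  members; the pairings of left limit and terminal value then agree, and their distance is
  zero.\<close>

lemma left_limit_terminal:
  assumes tT: "t < T" and S: "\<And>n. t \<le> S n" "\<And>n. S n < T" "S \<longlonglongrightarrow> T"
  shows "AE w in P. (\<lambda>n. X w (S n)) \<longlonglongrightarrow> X w T"
proof -
  have Sl: "filterlim S (at_left T) sequentially" using S by (auto simp: filterlim_at intro!: always_eventually)
  have k: "AE w in P. liminf (\<lambda>n. ennreal ((Y (\<phi> k) w T - Y (\<phi> k) w (S n))\<^sup>2)) = 0" for k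
  proof -
    obtain C where C: "0 \<le> C" "\<And>s s'. t \<le> s ==> s \<le> s' ==> s' \<le> T ==> (EN (\<lambda>w. (Y (\<phi> k) w s' - Y (\<phi> k) w s)\<^sup>2)) \<le> ennreal (C * (s' - s))"
      by (rule increment_second_moment[OF Cb2_test(1)]) blast
    note [measurable] = measurable_Y_Cb2(1)[OF Cb2_test(1)]
    have "(\<integral>\<^sup>+w. liminf (\<lambda>n. ennreal ((Y (\<phi> k) w T - Y (\<phi> k) w (S n))\<^sup>2)) \<partial>P)
      \<le> liminf (\<lambda>n. EN (\<lambda>w. (Y (\<phi> k) w T - Y (\<phi> k) w (S n))\<^sup>2))"
      by (rule nn_integral_liminf) measurable
    also have "\<dots> \<le> liminf (\<lambda>n. ennreal (C * (T - S n)))"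
      by (intro Liminf_mono always_eventually allI C S less_imp_le order_refl)
    also have "\<dots> = 0"
    proof (rule lim_imp_Liminf)
      have "(\<lambda>n. C * (T - S n)) \<longlonglongrightarrow> C * (T - T)" by (intro tendsto_intros S)
      then show "(\<lambda>n. ennreal (C * (T - S n))) \<longlonglongrightarrow> 0" using tendsto_ennrealI by fastforce
    qed simp
    finally have "(\<integral>\<^sup>+w. liminf (\<lambda>n. ennreal ((Y (\<phi> k) w T - Y (\<phi> k) w (S n))\<^sup>2)) \<partial>P) = 0" by simp
    then show ?thesis by (subst (asm) nn_integral_0_iff_AE) auto
  qed
  have "AE w in P. \<forall>k. liminf (\<lambda>n. ennreal ((Y (\<phi> k) w T - Y (\<phi> k) w (S n))\<^sup>2)) = 0"
    using k by (simp add: AE_all_countable)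
  with AE_space show ?thesis
  proof eventually_elim
    case (elim w)
    obtain l where l: "(X w \<longlongrightarrow> l) (at_left T)" using left_limit elim(1) by blast
    have lS: "(\<lambda>n. X w (S n)) \<longlonglongrightarrow> l" by (rule filterlim_compose[OF l Sl])
    have "pairing (\<phi> k) (X w T) = pairing (\<phi> k) l" for k
    proof -
      have "(\<lambda>n. Y (\<phi> k) w (S n)) \<longlonglongrightarrow> pairing (\<phi> k) l"
        using lS Cb2_deriv(3)[OF Cb2_test(1)] Cb2_bounded[OF Cb2_test(1)] unfolding tendsto_finmeas_iff by blast
      then have "(\<lambda>n. ennreal ((Y (\<phi> k) w T - Y (\<phi> k) w (S n))\<^sup>2)) \<longlonglongrightarrow> ennreal ((Y (\<phi> k) w T - pairing (\<phi> k) l)\<^sup>2)"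
        by (intro tendsto_ennrealI tendsto_intros)
      from lim_imp_Liminf[OF _ this] have "ennreal ((Y (\<phi> k) w T - pairing (\<phi> k) l)\<^sup>2) = 0" using elim(2) by simp
      then show ?thesis by (simp add: ennreal_eq_0_iff)
    qed
    then have "weak_dist \<phi> (X w T) l = 0" by (simp add: weak_dist_def)
    from tendsto_of_weak_dist_0[OF \<phi> lS this] show ?case .
  qed
qed

lemma measurable_interior:
  fixes K :: "real => coeff"
  assumes K: "continuous_on ({0..<T} \<times> UNIV \<times> UNIV \<times> A) (\<lambda>(u, x, \<nu>, c). K u x \<nu> c)"
  shows "cell {t<..<T} K \<in> borel_measurable PB"
proof -
  have "(\<lambda>p. indicator {t<..<T} (fst (snd p)) * (case p of (w, u, x, d) => indicator {0..<T} u * indicator A d * K u x (X w u) d)) \<in> borel_measurable PB"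
    using measurable_K_open[OF order_refl T order_refl K] by measurable
  also have "(\<lambda>p. indicator {t<..<T} (fst (snd p)) * (case p of (w, u, x, d) => indicator {0..<T} u * indicator A d * K u x (X w u) d)) =
    (cell {t<..<T} K)"
    using t by (auto simp: fun_eq_iff indicator_def)
  finally show ?thesis .
qed

lemma integrable_interior:
  fixes f :: "outcome \<times> real \<times> real \<times> real => real"
  assumes f: "f \<in> borel_measurable PB" and C: "0 \<le> C"
    and b: "\<And>w u x a. \<bar>f (w, u, x, a)\<bar> \<le> indicator {t..T} u * (C * (1 + mass w u) ^ q)"
  shows "integrable Q f"
  by (rule Q_weight_bound(1)[OF _ order_refl t(2) order_refl C f, of t 0 q]) (use b t in auto)

end

context ctrl_smooth
begin

text \<open>\<open>W\<close> grows linearly in the mass, whose value changes with the time, so no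
  common dominating function is at hand; bounded second moments take its place.\<close>

lemma E_W_tendsto:
  assumes tT: "t < T" and S: "\<And>n. t \<le> S n" "\<And>n. S n < T" "S \<longlonglongrightarrow> T"
  shows "(\<lambda>n. \<integral>w. W (S n) (X w (S n)) \<partial>P) \<longlonglongrightarrow> (\<integral>w. W T (X w T) \<partial>P)"
proof -
  obtain C where C: "0 \<le> C" "\<And>u v w. u \<in> {0..T} ==> \<bar>W u (X w v)\<bar> \<le> C * (1 + mass w v)" by (rule W_X_growth) blast
  have Wm: "(\<lambda>w. W u (X w v)) \<in> borel_measurable P" if "u \<in> {0..T}" for u v
    by (rule measurable_functional_P) (use Wf.continuous_on_W[of UNIV "\<lambda>_. u" "\<lambda>\<nu>. \<nu>"] that in \<open>simp add: continuous_on_id\<close>)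
  have S0: "S n \<in> {0..T}" "S n \<in> {t..T}" for n using S(1,2)[of n] t by auto
  have b: "\<bar>(W (S n) (X w (S n)))\<^sup>2\<bar> \<le> C\<^sup>2 * ((1 + mass w (S n)) ^ 2 * (1 + mass w (S n)) ^ 0)" for n w
    using power_mono[OF C(2)[OF S0(1), of n w "S n"] abs_ge_zero, of 2] by (simp add: power_mult_distrib)
  have C2: "0 \<le> C\<^sup>2" by simp
  have i: "integrable P (\<lambda>w. (W (S n) (X w (S n)))\<^sup>2)" "\<bar>\<integral>w. (W (S n) (X w (S n)))\<^sup>2 \<partial>P\<bar> \<le> C\<^sup>2 * (2 * moment (2 + 0))" for n
    using P_bound[OF S0(2) S0(2) C2 borel_measurable_power[OF Wm[OF S0(1)]] b] by auto
  show ?thesis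
  proof (rule expectation_tendsto_of_second_moment(4)[OF i(1)])
    show "(\<integral>w. (W (S n) (X w (S n)))\<^sup>2 \<partial>P) \<le> C\<^sup>2 * (2 * moment (2 + 0))" for n using i(2)[of n] by linarith
    show "(\<lambda>w. W T (X w T)) \<in> borel_measurable P" by (rule Wm) (use T in simp)
    show "AE w in P. (\<lambda>n. W (S n) (X w (S n))) \<longlonglongrightarrow> W T (X w T)"
      using left_limit_terminal[OF tT S]
    proof eventually_elim
      case (elim w)
      have "(\<lambda>n. (\<lambda>(u, \<nu>). W u \<nu>) (S n, X w (S n))) \<longlonglongrightarrow> (\<lambda>(u, \<nu>). W u \<nu>) (T, X w T)"
        by (rule continuous_on_tendsto_compose[OF Wf.Wc tendsto_Pair[OF S(3) elim]]) (use T S0 in auto)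
      then show ?case by simp
    qed
  qed (rule Wm[OF S0(1)])
qed

lemma gen_W_integrable: "integrable Q (cell {t<..<T} gen_W)"
proof -
  obtain C where C: "0 \<le> C" "\<And>u x \<nu> a. u \<in> {0..<T} ==> a \<in> A ==> \<bar>gen_W u x \<nu> a\<bar> \<le> C" by (rule gen_bounds) blast
  show ?thesis
    by (rule integrable_interior[OF measurable_interior[OF gen_W_continuous] C(1), of 0]) (use C t in \<open>auto simp: indicator_def\<close>)
qed

theorem dynkin_W:
  assumes tT: "t < T"
  shows "(\<integral>w. W T (X w T) \<partial>P) = W t (\<xi> t) +
     integral\<^sup>L Q (cell {t<..<T} gen_W)
     + (\<integral>(w, u). indicator {t<..<T} u * Wt u (X w u) \<partial>(P \<Otimes>\<^sub>M L))"
proof -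
  obtain C where C: "0 \<le> C" "\<And>u x \<nu> a. u \<in> {0..<T} ==> a \<in> A ==> \<bar>gen_W u x \<nu> a\<bar> \<le> C" by (rule gen_bounds) blast
  define S where "S = (\<lambda>n. T - (T - t) * (1 / real (Suc n)))"
  have S: "t \<le> S n" "S n < T" "S \<longlonglongrightarrow> T" (is ?g1) for n
  proof -
    have "(T - t) * (1 / real (Suc n)) \<le> (T - t) * 1" using tT by (intro mult_left_mono) auto
    then show "t \<le> S n" by (simp add: S_def)
    show "S n < T" using tT by (simp add: S_def)
    have "S \<longlonglongrightarrow> T - (T - t) * 0" unfolding S_def by (intro tendsto_intros one_over_Suc_tendsto)
    then show ?g1 by simp
  qed
  have ind: "\<forall>\<^sub>F n in sequentially. indicator {t<..S n} u = (indicator {t<..<T} u :: real)" for u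
  proof (cases "u < T")
    case True
    then have "\<forall>\<^sub>F n in sequentially. u < S n" using order_tendstoD(1)[OF S(3)] by simp
    then show ?thesis by eventually_elim (use True in \<open>auto simp: indicator_def\<close>)
  next
    case False
    have "\<not> u \<le> S n" for n using False S(2)[of n] by linarith
    then show ?thesis using False by (intro always_eventually allI) (auto simp: indicator_def)
  qed
  have lim: "(\<lambda>n. indicator {t<..S n} u * c) \<longlonglongrightarrow> indicator {t<..<T} u * (c :: real)" for u c
    by (rule tendsto_eventually) (use ind[of u] in \<open>eventually_elim, simp\<close>)
  have sub: "u \<in> {0..<T}" if "u \<in> {t<..S n}" for u n using that S(2)[of n] t by auto
  have 1: "(\<lambda>n. \<integral>p. (cell {t<..S n} gen_W) p \<partial>Q) \<longlonglongrightarrow>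
    (\<integral>p. (cell {t<..<T} gen_W) p \<partial>Q)"
  proof (rule integral_dominated_convergence[where w="\<lambda>(w, u, x, a). indicator {t..T} u * C"])
    show "cell {t<..<T} gen_W \<in> borel_measurable Q"
      using gen_W_integrable by simp
    show "cell {t<..S n} gen_W \<in> borel_measurable Q" for n
      using time_cell(1)[OF order_refl S(1,2) gen_W_continuous C] by simp
    have wm: "(\<lambda>(w, u, x, a). indicator {t..T} u * C) \<in> borel_measurable PB"
      unfolding split_beta' by measurable
    show "integrable Q (\<lambda>(w, u, x, a). indicator {t..T} u * C)"
      by (rule Q_weight_bound(1)[OF _ order_refl t(2) order_refl C(1) wm, of t 0 0]) (use t C in \<open>auto simp: indicator_def\<close>)
    show "AE p in Q. (\<lambda>n. (cell {t<..S n} gen_W) p)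
       \<longlonglongrightarrow> (cell {t<..<T} gen_W) p"
    proof (rule AE_I2)
      fix p :: "outcome \<times> real \<times> real \<times> real"
      obtain w u x a where p: "p = (w, u, x, a)" by (cases p)
      show "(\<lambda>n. (cell {t<..S n} gen_W) p)
       \<longlonglongrightarrow> (cell {t<..<T} gen_W) p"
        using lim[of u "indicator A a * gen_W u x (X w u) a"] by (simp add: p mult.assoc)
    qed
    show "AE p in Q. norm ((cell {t<..S n} gen_W) p)
       \<le> (\<lambda>(w, u, x, a). indicator {t..T} u * C) p" for n
      using C(1) C(2)[OF sub] S(2)[of n] by (intro AE_I2) (auto simp: indicator_def)
  qed
  have 2: "(\<lambda>n. \<integral>p. (\<lambda>(w, u). indicator {t<..S n} u * Wt u (X w u)) p \<partial>(P \<Otimes>\<^sub>M L)) \<longlonglongrightarrow>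
    (\<integral>p. (\<lambda>(w, u). indicator {t<..<T} u * Wt u (X w u)) p \<partial>(P \<Otimes>\<^sub>M L))"
  proof (rule integral_dominated_convergence[where w="\<lambda>_. Wf.KW"])
    show "(\<lambda>(w, u). indicator {t<..<T} u * Wt u (X w u)) \<in> borel_measurable (P \<Otimes>\<^sub>M L)"
      using Wt_integrable[of "{t<..<T}"] by (simp add: subset_eq)
    show "(\<lambda>(w, u). indicator {t<..S n} u * Wt u (X w u)) \<in> borel_measurable (P \<Otimes>\<^sub>M L)" for n
      using Wt_integrable[of "{t<..S n}"] S(2)[of n] by (simp add: subset_eq)
    interpret fPL: finite_measure "P \<Otimes>\<^sub>M L" by (rule finite_measure_pair_measure) (rule finite_measure_axioms finite_L)+
    show "integrable (P \<Otimes>\<^sub>M L) (\<lambda>_. Wf.KW)" by simp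
    show "AE p in P \<Otimes>\<^sub>M L. (\<lambda>n. (\<lambda>(w, u). indicator {t<..S n} u * Wt u (X w u)) p)
       \<longlonglongrightarrow> (\<lambda>(w, u). indicator {t<..<T} u * Wt u (X w u)) p"
      unfolding split_beta' by (intro AE_I2 lim)
    show "AE p in P \<Otimes>\<^sub>M L. norm ((\<lambda>(w, u). indicator {t<..S n} u * Wt u (X w u)) p) \<le> Wf.KW" for n
      using Wf.KW(2)[OF sub] Wf.KW(1) by (intro AE_I2) (auto simp: indicator_def)
  qed
  have "AE w in P. W t (X w t) = W t (\<xi> t)" using X_initial by eventually_elim simp
  then have "(\<integral>w. W t (X w t) \<partial>P) = (\<integral>w. W t (\<xi> t) \<partial>P)"
    by (intro integral_cong_AE measurable_functional_P) (use Wf.continuous_on_W[of UNIV "\<lambda>_. t" "\<lambda>\<nu>. \<nu>"] t in \<open>auto simp: continuous_on_id\<close>)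
  then have W0: "(\<integral>w. W t (X w t) \<partial>P) = W t (\<xi> t)" using prob_space by simp
  have "(\<lambda>n. (\<integral>w. W (S n) (X w (S n)) \<partial>P) - W t (\<xi> t)) \<longlonglongrightarrow> (\<integral>w. W T (X w T) \<partial>P) - W t (\<xi> t)"
    by (intro tendsto_diff tendsto_const E_W_tendsto[OF tT S])
  then have "(\<integral>w. W T (X w T) \<partial>P) - W t (\<xi> t) =
    (\<integral>p. (cell {t<..<T} gen_W) p \<partial>Q)
    + (\<integral>p. (\<lambda>(w, u). indicator {t<..<T} u * Wt u (X w u)) p \<partial>(P \<Otimes>\<^sub>M L))"
    unfolding W0[symmetric] dynkin_before_T[OF S(1,2)] by (rule LIMSEQ_unique[OF _ tendsto_add[OF 1 2]])
  then show ?thesis by simp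
qed

end

section \<open>Verification\<close>

text \<open>Each squared pairing is at most the squared mass, and the geometric weights sum to 2.
  Growth conditions in the distance from zero become polynomial growth in the mass, for which
  moments are available.\<close>

lemma weak_dist_zero_bounds:
  assumes \<phi>: "test_sequence \<phi>"
  shows "0 \<le> weak_dist \<phi> \<nu> 0" (is ?g1) "weak_dist \<phi> \<nu> 0 \<le> 2 * tmass \<nu>" (is ?g2)
proof -
  define M where "M = tmass \<nu>"
  have M: "0 \<le> M" by (simp add: M_def pairing_nonneg)
  define a where "a = (\<lambda>k. 1 / (2 ^ k * dist_weight (\<phi> k)) * (pairing (\<phi> k) \<nu> - pairing (\<phi> k) 0)\<^sup>2)"
  have bound: "0 \<le> a k" "a k \<le> (1/2) ^ k * M\<^sup>2" (is ?g3) for k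
  proof -
    have q: "1 \<le> dist_weight (\<phi> k)" by (simp add: dist_weight_def)
    show "0 \<le> a k" using q by (simp add: a_def)
    have "\<bar>pairing (\<phi> k) \<nu>\<bar> \<le> 1 * tmass \<nu>"
      by (rule pairing_abs_le) (use \<phi> in \<open>simp add: test_sequence_def\<close>)
    then have p: "(pairing (\<phi> k) \<nu> - pairing (\<phi> k) 0)\<^sup>2 \<le> M\<^sup>2"
      using power_mono[of "\<bar>pairing (\<phi> k) \<nu>\<bar>" M 2] by (simp add: M_def pairing_def[of _ 0])
    have "1 / (2 ^ k * dist_weight (\<phi> k)) \<le> 1 / (2 ^ k * 1)"
      using q by (intro divide_left_mono mult_left_mono) auto
    then show ?g3 unfolding a_def using p q by (intro mult_mono) (auto simp: power_one_over)
  qed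
  have s: "summable (\<lambda>k. (1/2) ^ k * M\<^sup>2)" by (intro summable_mult2 summable_geometric) simp
  have sa: "summable a" by (rule summable_comparison_test'[OF s, of 0]) (use bound in auto)
  have "suminf a \<le> (\<Sum>k. (1/2) ^ k * M\<^sup>2)" by (rule suminf_le[OF bound(2) sa s])
  also have "\<dots> = 2 * M\<^sup>2" by (subst suminf_mult2[symmetric]) (auto intro: summable_geometric simp: suminf_geometric)
  also have "\<dots> \<le> (2 * M)\<^sup>2" by (simp add: power_mult_distrib)
  finally have "suminf a \<le> (2 * M)\<^sup>2" .
  then have "sqrt (suminf a) \<le> 2 * M" using M by (intro real_le_lsqrt) auto
  then show ?g2 by (simp add: weak_dist_def a_def M_def)
  show ?g1 using suminf_nonneg[OF sa bound(1)] by (simp add: weak_dist_def a_def)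
qed

text \<open>The base is enlarged to at least one before the exponent is rounded up to an integer,
  since only then is the power increasing in the exponent.\<close>

lemma powr_growth_le:
  fixes d p M :: real
  assumes "0 \<le> d" "d \<le> 2 * M" "0 < p" "0 \<le> M"
  shows "1 + d powr p \<le> (1 + 2 ^ nat \<lceil>p\<rceil>) * (1 + M) ^ nat \<lceil>p\<rceil>"
proof -
  define q where "q = nat \<lceil>p\<rceil>"
  have q: "p \<le> real q" unfolding q_def by (rule real_nat_ceiling_ge)
  have "d powr p \<le> (2 * (1 + M)) powr p" using assms by (intro powr_mono2) auto
  also have "\<dots> \<le> (2 * (1 + M)) powr real q" using assms q by (intro powr_mono) auto
  also have "\<dots> = 2 ^ q * (1 + M) ^ q" unfolding power_mult_distrib[symmetric] by (rule powr_realpow) (use assms in simp)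
  finally have "d powr p \<le> 2 ^ q * (1 + M) ^ q" .
  moreover have "1 \<le> (1 + M) ^ q" using assms by (intro one_le_power) auto
  ultimately show ?thesis unfolding q_def[symmetric] by (simp add: algebra_simps)
qed

text \<open>Continuity lets a dense subset reach the infimum. Taken over a countable dense set, the
  infimum over controls is measurable.\<close>

lemma INF_dense:
  fixes H :: "real => real"
  assumes A: "A \<noteq> {}" and D: "D \<subseteq> A" "A \<subseteq> closure D" and H: "continuous_on A H" and bd: "bdd_below (H ` A)"
  shows "(INF a\<in>A. H a) = (INF a\<in>D. H a)"
proof (rule antisym)
  have D0: "D \<noteq> {}" using A D by auto
  show "(INF a\<in>A. H a) \<le> (INF a\<in>D. H a)" by (rule cINF_superset_mono[OF D0 bd D(1)]) simp
  have bD: "bdd_below (H ` D)" by (rule bdd_below_mono[OF bd]) (use D in auto)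
  show "(INF a\<in>D. H a) \<le> (INF a\<in>A. H a)"
  proof (rule cINF_greatest[OF A])
    fix a assume a: "a \<in> A"
    then obtain s where s: "\<And>n. s n \<in> D" "s \<longlonglongrightarrow> a" using D(2) closure_sequential by blast
    have "(\<lambda>n. H (s n)) \<longlonglongrightarrow> H a" by (rule continuous_on_tendsto_compose[OF H s(2) a]) (use s D in \<open>auto intro!: always_eventually\<close>)
    then show "(INF a\<in>D. H a) \<le> H a"
      by (rule LIMSEQ_le_const) (use cINF_lower[OF bD] s(1) in auto)
  qed
qed

section \<open>Infimum over controls and null times\<close>

context ctrl_rule
begin

text \<open>Almost every outcome has a control on the nonempty set
  \<open>[0,T] \<times> \<real>\<close> with values in \<open>A\<close>.\<close>

lemma A_nonempty: "A \<noteq> {}"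
proof
  assume "A = {}"
  then have "restrict_space borel ({0..T} \<times> UNIV) \<rightarrow>\<^sub>M restrict_space borel A = ({} :: (real \<times> real => real) set)"
    using T by (auto simp: measurable_def space_restrict_space Pi_iff)
  moreover have "AE (\<mu>, m) in P. \<exists>\<alpha>. (\<lambda>(s, x). \<alpha> s x) \<in> restrict_space borel ({0..T} \<times> UNIV) \<rightarrow>\<^sub>M restrict_space borel A \<and> controlled_by T \<mu> m \<alpha>"
    using P by (simp add: control_rules_def)
  ultimately have "AE w in P. False" by (auto simp: split_beta')
  then show False using AE_False by simp
qed

lemma measurable_INF:
  fixes K :: "real => coeff"
  assumes K: "continuous_on ({0..<T} \<times> UNIV \<times> UNIV \<times> A) (\<lambda>(u, x, \<nu>, c). K u x \<nu> c)"
    and bd: "\<And>u x \<nu>. u \<in> {0..<T} ==> bdd_below (K u x \<nu> ` A)"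
  shows "(\<lambda>(w, u, x, a). indicator {t<..<T} u * (INF c\<in>A. K u x (X w u) c)) \<in> borel_measurable PB"
proof -
  obtain D where D: "countable D" "D \<subseteq> A" "A \<subseteq> closure D" by (rule separable)
  have D0: "D \<noteq> {}" using D A_nonempty by auto
  have "(\<lambda>(w, u, x, a). indicator {t<..<T} u * K u x (X w u) d) \<in> borel_measurable PB" if d: "d \<in> D" for d
  proof -
    have 1: "(\<lambda>p. (fst p, fst (snd p), fst (snd (snd p)), d)) \<in> PB \<rightarrow>\<^sub>M PB"
      unfolding borel_prod[symmetric] by measurable
    show ?thesis
      using measurable_compose[OF 1 measurable_interior[OF K]] d D by (simp add: split_beta' subset_iff)
  qed
  then have "(\<lambda>p. INF d\<in>D. (\<lambda>(w, u, x, a). indicator {t<..<T} u * K u x (X w u) d) p) \<in> borel_measurable PB"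
    by (intro borel_measurable_cINF_real D)
  also have "(\<lambda>p :: outcome \<times> real \<times> real \<times> real. INF d\<in>D. (\<lambda>(w, u, x, a). indicator {t<..<T} u * K u x (X w u) d) p) =
    (\<lambda>(w, u, x, a). indicator {t<..<T} u * (INF c\<in>A. K u x (X w u) c))"
  proof
    fix p :: "outcome \<times> real \<times> real \<times> real"
    obtain w u x a where p: "p = (w, u, x, a)" by (cases p)
    show "(INF d\<in>D. (\<lambda>(w, u, x, a). indicator {t<..<T} u * K u x (X w u) d) p) = (\<lambda>(w, u, x, a). indicator {t<..<T} u * (INF c\<in>A. K u x (X w u) c)) p"
    proof (cases "u \<in> {t<..<T}")
      case True
      then have u: "u \<in> {0..<T}" using t by auto
      have "continuous_on A (\<lambda>c. (\<lambda>(u, x, \<nu>, c). K u x \<nu> c) (u, x, X w u, c))"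
        by (rule continuous_on_compose2[OF K]) (use u in \<open>auto intro!: continuous_intros\<close>)
      then have "continuous_on A (K u x (X w u))" by simp
      from INF_dense[OF A_nonempty D(2,3) this bd[OF u]] show ?thesis using True by (simp add: p)
    qed (use D0 in \<open>simp add: p\<close>)
  qed
  finally show ?thesis .
qed

text \<open>The time marginal of the control measure has a density with respect to Lebesgue measure.
  This reconciles the closed interval in the cost with the open one, on which the derivatives of
  \<open>W\<close> are available.\<close>

lemma AE_Q_interior: "AE p in Q. fst (snd p) \<noteq> t \<and> fst (snd p) \<noteq> T"
proof (rule AE_Q)
  show "{p \<in> space PB. \<not> (fst (snd p) \<noteq> t \<and> fst (snd p) \<noteq> T)} \<in> sets PB" by measurable
  show "AE w in P. AE p in m w. fst (snd (w, p)) \<noteq> t \<and> fst (snd (w, p)) \<noteq> T"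
    using AE_good
  proof eventually_elim
    case (elim w)
    let ?k = "\<lambda>p. indicator ({t, T} \<times> UNIV) p :: ennreal"
    have k: "?k \<in> borel_measurable (borel :: (real \<times> real) measure)" unfolding borel_prod[symmetric] by measurable
    have "(\<integral>\<^sup>+(u, x, a). ?k (u, x) \<partial>m w) = (\<integral>\<^sup>+u. (\<integral>\<^sup>+x. ?k (u, x) \<partial>meas (X w u)) \<partial>L)"
      by (rule good_nn_integral[OF elim k])
    also have "\<dots> = (\<integral>\<^sup>+u. 0 \<partial>L)"
    proof (rule nn_integral_cong_AE)
      have "AE u in lborel. u \<notin> {t, T}" using AE_lborel_singleton[of t] AE_lborel_singleton[of T] by eventually_elim simp
      then have "AE u in L. u \<notin> {t, T}" unfolding L_def by (subst AE_density) auto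
      then show "AE u in L. (\<integral>\<^sup>+x. ?k (u, x) \<partial>meas (X w u)) = 0" by eventually_elim simp
    qed
    finally have z: "(\<integral>\<^sup>+(u, x, a). ?k (u, x) \<partial>m w) = 0" by simp
    have "(\<lambda>(u, x, a). ?k (u, x)) \<in> borel_measurable (m w)"
      using measurable_compose[OF uxa_measurable k] by (simp add: split_beta' cong: measurable_cong_sets)
    from nn_integral_0_iff_AE[OF this] z have "AE p in m w. (\<lambda>(u, x, a). ?k (u, x)) p = 0" by simp
    then show ?case by eventually_elim (auto simp: split_beta' indicator_def split: if_splits)
  qed
qed

end

section \<open>Comparison of \<open>W\<close> with the cost\<close>

locale verification = ctrl_smooth T A \<phi> b \<sigma> \<gamma> MM t \<xi> P W Wt W1 W2
  for T A \<phi> b \<sigma> \<gamma> MM t \<xi> P W Wt W1 W2 +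
  fixes f :: coeff and g :: "real finmeas => real"
  assumes f: "continuous_on (UNIV \<times> UNIV \<times> A) (\<lambda>(x, \<nu>, a). f x \<nu> a)" and g: "continuous_on UNIV g"
    and growth: "\<exists>C>0. \<exists>p>0. (\<forall>x \<nu>. \<forall>a\<in>A. \<bar>f x \<nu> a\<bar> \<le> C * (1 + weak_dist \<phi> \<nu> 0 powr p)) \<and>
                              (\<forall>\<nu>. \<bar>g \<nu>\<bar> \<le> C * (1 + weak_dist \<phi> \<nu> 0 powr p))"
begin

lemma cost_growth:
  obtains C q where "0 \<le> C" "\<And>x \<nu> a. a \<in> A ==> \<bar>f x \<nu> a\<bar> \<le> C * (1 + tmass \<nu>) ^ q"
    "\<And>\<nu>. \<bar>g \<nu>\<bar> \<le> C * (1 + tmass \<nu>) ^ q"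
proof -
  obtain C p where C: "C > 0" "p > 0" "\<And>x \<nu> a. a \<in> A ==> \<bar>f x \<nu> a\<bar> \<le> C * (1 + weak_dist \<phi> \<nu> 0 powr p)"
    "\<And>\<nu>. \<bar>g \<nu>\<bar> \<le> C * (1 + weak_dist \<phi> \<nu> 0 powr p)" using growth by blast
  let ?q = "nat \<lceil>p\<rceil>"
  have le: "C * (1 + weak_dist \<phi> \<nu> 0 powr p) \<le> C * (1 + 2 ^ ?q) * (1 + tmass \<nu>) ^ ?q" for \<nu>
  proof -
    from powr_growth_le[OF weak_dist_zero_bounds[OF \<phi>] C(2) pairing_nonneg] C(1)
    have "C * (1 + weak_dist \<phi> \<nu> 0 powr p) \<le> C * ((1 + 2 ^ ?q) * (1 + tmass \<nu>) ^ ?q)" by simp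
    then show ?thesis by (simp add: mult.assoc)
  qed
  show thesis
  proof (rule that[of "C * (1 + 2 ^ ?q)" ?q])
    show "\<And>x \<nu> a. a \<in> A ==> \<bar>f x \<nu> a\<bar> \<le> C * (1 + 2 ^ ?q) * (1 + tmass \<nu>) ^ ?q"
      using order_trans[OF C(3) le] by blast
    show "\<And>\<nu>. \<bar>g \<nu>\<bar> \<le> C * (1 + 2 ^ ?q) * (1 + tmass \<nu>) ^ ?q" using order_trans[OF C(4) le] by blast
  qed (use C in auto)
qed

lemma f_continuous: "continuous_on (S \<times> UNIV \<times> UNIV \<times> A) (\<lambda>(u, x, \<nu>, a). f x \<nu> a)"
  unfolding split_beta' by (intro continuous_on_coeff[OF f] continuous_intros) auto

lemma f_integrable: "integrable Q (cell {t<..<T} (\<lambda>_. f))"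
proof -
  obtain C q where C: "0 \<le> C" "\<And>x \<nu> a. a \<in> A ==> \<bar>f x \<nu> a\<bar> \<le> C * (1 + tmass \<nu>) ^ q" by (rule cost_growth) blast
  show ?thesis
    by (rule integrable_interior[OF measurable_interior[OF f_continuous] C(1), of q])
      (use C in \<open>auto simp: indicator_def pairing_nonneg\<close>)
qed

lemma g_integrable: "integrable P (\<lambda>w. g (X w T))"
proof -
  obtain C q where C: "0 \<le> C" "\<And>\<nu>. \<bar>g \<nu>\<bar> \<le> C * (1 + tmass \<nu>) ^ q" by (rule cost_growth) blast
  have b: "\<bar>g (X w T)\<bar> \<le> C * ((1 + mass w T) ^ q * (1 + mass w T) ^ 0)" for w using C(2) by simp
  have uT: "T \<in> {t..T}" using t by simp
  show ?thesis by (rule P_bound(1)[OF uT uT C(1) measurable_functional_P[OF g] b])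
qed

lemma cost_eq:
  "cost T A f g t P = integral\<^sup>L Q (cell {t<..<T} (\<lambda>_. f)) + (\<integral>w. g (X w T) \<partial>P)"
proof -
  obtain C q where C: "0 \<le> C" "\<And>x \<nu> a. a \<in> A ==> \<bar>f x \<nu> a\<bar> \<le> C * (1 + tmass \<nu>) ^ q" by (rule cost_growth) blast
  let ?F = "\<lambda>(w, u, x, a). indicator {t..T} u * indicator A a * f x (X w u) a"
  have F: "?F \<in> borel_measurable PB" by (rule measurable_K[OF t(1,2) order_refl f_continuous])
  have i: "integrable Q ?F"
    by (rule integrable_interior[OF F C(1), of q]) (use C in \<open>auto simp: indicator_def pairing_nonneg\<close>)
  have "cost T A f g t P = (\<integral>w. (\<integral>z. ?F (w, z) \<partial>m w) + g (X w T) \<partial>P)"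
    unfolding cost_def set_lebesgue_integral_def
  proof (rule Bochner_Integration.integral_cong[OF refl])
    fix w
    have "(\<integral>p. indicator ({t..T} \<times> UNIV \<times> A) p *\<^sub>R (case p of (u, x, a) => f x (fst w u) a) \<partial>meas (snd w)) = (\<integral>z. ?F (w, z) \<partial>m w)"
      unfolding m_def by (rule Bochner_Integration.integral_cong) (use t in \<open>auto simp: indicator_def X_eq\<close>)
    then show "(case w of (\<mu>, q) => (\<integral>p. indicator ({t..T} \<times> UNIV \<times> A) p *\<^sub>R (case p of (u, x, a) => f x (\<mu> u) a) \<partial>meas q) + g (\<mu> T)) =
      (\<integral>z. ?F (w, z) \<partial>m w) + g (X w T)"
      using T by (simp add: split_beta' X_eq)
  qed
  also have "\<dots> = (\<integral>w. (\<integral>z. ?F (w, z) \<partial>m w) \<partial>P) + (\<integral>w. g (X w T) \<partial>P)"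
    by (intro Bochner_Integration.integral_add integral_Q(1)[OF i] g_integrable)
  also have "(\<integral>w. (\<integral>z. ?F (w, z) \<partial>m w) \<partial>P) = (\<integral>p. ?F p \<partial>Q)" by (rule integral_Q(2)[OF i, symmetric])
  also have "\<dots> = integral\<^sup>L Q (cell {t<..<T} (\<lambda>_. f))"
  proof (rule integral_cong_AE[OF borel_measurable_integrable[OF i] borel_measurable_integrable[OF f_integrable]])
    show "AE p in Q. ?F p = cell {t<..<T} (\<lambda>_. f) p"
      using AE_Q_interior by eventually_elim (auto simp: split_beta' indicator_def)
  qed
  finally show ?thesis .
qed

definition H :: "real => coeff" where
  "H u x \<nu> a = gen_W u x \<nu> a + f x \<nu> a"

lemma H_eq: "hjb_term b \<sigma> \<gamma> f W1 W2 = H"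
proof -
  have e: "pd W1 u \<nu> = deriv (W1 u \<nu>)" for u \<nu> by (simp add: fun_eq_iff pd_def)
  show ?thesis by (intro ext) (simp add: hjb_term_def H_def gen_def gen_W_def pd_def[of "pd W1"] e)
qed

lemma H_continuous: "continuous_on ({0..<T} \<times> UNIV \<times> UNIV \<times> A) (\<lambda>(u, x, \<nu>, a). H u x \<nu> a)"
  using continuous_on_add[OF gen_W_continuous f_continuous[of "{0..<T}"]] by (simp add: H_def split_beta')

lemma H_growth:
  obtains C q where "0 \<le> C" "\<And>u x \<nu> a. u \<in> {0..<T} ==> a \<in> A ==> \<bar>H u x \<nu> a\<bar> \<le> C * (1 + tmass \<nu>) ^ q"
proof -
  obtain C q where C: "0 \<le> C" "\<And>x \<nu> a. a \<in> A ==> \<bar>f x \<nu> a\<bar> \<le> C * (1 + tmass \<nu>) ^ q" by (rule cost_growth) blast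
  obtain D where D: "0 \<le> D" "\<And>u x \<nu> a. u \<in> {0..<T} ==> a \<in> A ==> \<bar>gen_W u x \<nu> a\<bar> \<le> D" by (rule gen_bounds) blast
  show thesis
  proof (rule that[of "D + C" q])
    fix u x a and \<nu> :: "real finmeas" assume u: "u \<in> {0..<T}" and a: "a \<in> A"
    have "1 \<le> (1 + tmass \<nu>) ^ q" by (intro one_le_power) (simp add: pairing_nonneg)
    from mult_left_mono[OF this D(1)] D(2)[OF u a, of x \<nu>] C(2)[OF a, of x \<nu>]
    show "\<bar>H u x \<nu> a\<bar> \<le> (D + C) * (1 + tmass \<nu>) ^ q"
      unfolding H_def by (simp add: algebra_simps)
  qed (use C D in simp)
qed

lemma H_bdd_below: "u \<in> {0..<T} ==> bdd_below (H u x \<nu> ` A)"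
proof -
  assume u: "u \<in> {0..<T}"
  obtain C q where C: "0 \<le> C" "\<And>u x \<nu> a. u \<in> {0..<T} ==> a \<in> A ==> \<bar>H u x \<nu> a\<bar> \<le> C * (1 + tmass \<nu>) ^ q" by (rule H_growth) blast
  show ?thesis by (rule bdd_belowI2[of _ "- (C * (1 + tmass \<nu>) ^ q)"]) (use C(2)[OF u] in \<open>auto simp: abs_le_iff minus_le_iff\<close>)
qed

definition I :: "real => real => real finmeas => real" where "I u x \<nu> = (INF a\<in>A. H u x \<nu> a)"

abbreviation IX :: "outcome \<times> real \<times> real \<times> real => real" where
  "IX \<equiv> \<lambda>(w, u, x, a). indicator {t<..<T} u * I u x (X w u)"

abbreviation HX :: "outcome \<times> real \<times> real \<times> real => real" where
  "HX \<equiv> \<lambda>(w, u, x, a). indicator {t<..<T} u * indicator A a * H u x (X w u) a"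

lemma I_le: "u \<in> {0..<T} ==> a \<in> A ==> I u x \<nu> \<le> H u x \<nu> a"
  unfolding I_def by (rule cINF_lower[OF H_bdd_below])

lemma IX_measurable: "IX \<in> borel_measurable PB"
  unfolding I_def by (rule measurable_INF[OF H_continuous H_bdd_below])

lemma HX_measurable: "HX \<in> borel_measurable PB"
  by (rule measurable_interior[OF H_continuous])

lemma HX_integrable: "integrable Q HX" and IX_integrable: "integrable Q IX"
proof -
  obtain C q where C: "0 \<le> C" "\<And>u x \<nu> a. u \<in> {0..<T} ==> a \<in> A ==> \<bar>H u x \<nu> a\<bar> \<le> C * (1 + tmass \<nu>) ^ q" by (rule H_growth) blast
  show "integrable Q HX"
    by (rule integrable_interior[OF HX_measurable C(1), of q]) (use C t in \<open>auto simp: indicator_def pairing_nonneg\<close>)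
  have I: "\<bar>I u x \<nu>\<bar> \<le> C * (1 + tmass \<nu>) ^ q" if u: "u \<in> {0..<T}" for u x \<nu>
  proof -
    obtain a where a: "a \<in> A" using A_nonempty by auto
    have "- (C * (1 + tmass \<nu>) ^ q) \<le> I u x \<nu>"
      unfolding I_def using C(2)[OF u] by (intro cINF_greatest A_nonempty) (auto simp: abs_le_iff minus_le_iff)
    moreover have "I u x \<nu> \<le> C * (1 + tmass \<nu>) ^ q" using I_le[OF u a, of x \<nu>] C(2)[OF u a, of x \<nu>] by linarith
    ultimately show ?thesis by linarith
  qed
  show "integrable Q IX"
    by (rule integrable_interior[OF IX_measurable C(1), of q]) (use C(1) I t in \<open>auto simp: indicator_def pairing_nonneg\<close>)
qed

text \<open>The infimum does not depend on the control coordinate, so its integral against the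
  control measure only sees the time and space marginal. That leaves the integral against the
  current state, as in the Hamilton-Jacobi-Bellman relation.\<close>

lemma IX_path:
  "AE w in P. (\<integral>z. IX (w, z) \<partial>m w) = (\<integral>u. indicator {t<..<T} u * (\<integral>x. I u x (X w u) \<partial>meas (X w u)) \<partial>L)
     \<and> integrable L (\<lambda>u. indicator {t<..<T} u * (\<integral>x. I u x (X w u) \<partial>meas (X w u)))"
  using AE_good integral_Q(3)[OF IX_integrable]
proof eventually_elim
  case (elim w)
  then have w: "w \<in> space P" by (simp add: good_def)
  let ?k = "\<lambda>(u, x). indicator {t<..<T} u * I u x (X w u)"
  have km: "?k \<in> borel_measurable borel"
  proof -
    \<comment> \<open>The control coordinate can be frozen at any value, since the infimum ignores
      it.\<close>
    have "(\<lambda>(u, x). (w, u, x, 0)) \<in> borel \<rightarrow>\<^sub>M PB"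
      unfolding borel_prod[symmetric] using w by measurable
    from measurable_compose[OF this IX_measurable] show ?thesis by (simp add: split_beta')
  qed
  have ki: "integrable (m w) (\<lambda>(u, x, a). ?k (u, x))" using elim(2) by (simp add: split_beta')
  from good_integral[OF elim(1) ki km] show ?case by (simp add: split_beta')
qed

lemma Wt_path:
  shows "AE w in P. integrable L (\<lambda>u. indicator {t<..<T} u * Wt u (X w u))" (is ?g1)
    and "integrable P (\<lambda>w. \<integral>u. indicator {t<..<T} u * Wt u (X w u) \<partial>L)"
    and "(\<integral>(w, u). indicator {t<..<T} u * Wt u (X w u) \<partial>(P \<Otimes>\<^sub>M L)) = (\<integral>w. (\<integral>u. indicator {t<..<T} u * Wt u (X w u) \<partial>L) \<partial>P)"
proof -
  have Wt_int: "integrable (P \<Otimes>\<^sub>M L) (\<lambda>(w, u). indicator {t<..<T} u * Wt u (X w u))" by (rule Wt_integrable) auto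
  show ?g1
    "integrable P (\<lambda>w. \<integral>u. indicator {t<..<T} u * Wt u (X w u) \<partial>L)"
    "(\<integral>(w, u). indicator {t<..<T} u * Wt u (X w u) \<partial>(P \<Otimes>\<^sub>M L)) = (\<integral>w. (\<integral>u. indicator {t<..<T} u * Wt u (X w u) \<partial>L) \<partial>P)"
  using PL.AE_integrable_fst'[OF Wt_int] PL.integrable_fst'[OF Wt_int]
    PL.integral_fst'[OF Wt_int, symmetric] by auto
qed

text \<open>The gap between cost and \<open>W\<close> as a sum of three terms: the excess of the
  bracket over its infimum, the Hamilton-Jacobi-Bellman expression along the path, and the
  difference of terminal values. Each is nonnegative under the hypotheses of the first claim and
  zero under those of the second.\<close>

lemma cost_dynkin:
  assumes tT: "t < T"
  shows "cost T A f g t P - W t (\<xi> t) = (\<integral>p. HX p \<partial>Q) - (\<integral>p. IX p \<partial>Q)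
     + (\<integral>w. (\<integral>z. IX (w, z) \<partial>m w) + (\<integral>u. indicator {t<..<T} u * Wt u (X w u) \<partial>L) \<partial>P)
     + ((\<integral>w. g (X w T) \<partial>P) - (\<integral>w. W T (X w T) \<partial>P))"
proof -
  have "(\<integral>p. HX p \<partial>Q) = integral\<^sup>L Q (cell {t<..<T} gen_W)
    + integral\<^sup>L Q (cell {t<..<T} (\<lambda>_. f))"
    unfolding Bochner_Integration.integral_add[OF gen_W_integrable f_integrable, symmetric]
    by (rule Bochner_Integration.integral_cong) (auto simp: H_def algebra_simps)
  moreover have "(\<integral>w. (\<integral>z. IX (w, z) \<partial>m w) + (\<integral>u. indicator {t<..<T} u * Wt u (X w u) \<partial>L) \<partial>P) =
    (\<integral>p. IX p \<partial>Q) + (\<integral>(w, u). indicator {t<..<T} u * Wt u (X w u) \<partial>(P \<Otimes>\<^sub>M L))"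
    unfolding Wt_path(3) integral_Q(2)[OF IX_integrable]
    by (rule Bochner_Integration.integral_add[OF integral_Q(1)[OF IX_integrable] Wt_path(2)])
  ultimately show ?thesis unfolding cost_eq dynkin_W[OF tT] by simp
qed

lemma W_T_integrable: "integrable P (\<lambda>w. W T (X w T))"
proof -
  obtain C where C: "0 \<le> C" "\<And>u v w. u \<in> {0..T} ==> \<bar>W u (X w v)\<bar> \<le> C * (1 + mass w v)" by (rule W_X_growth) blast
  have c: "continuous_on UNIV (W T)" using Wf.continuous_on_W[of UNIV "\<lambda>_. T" "\<lambda>\<nu>. \<nu>"] T by (simp add: continuous_on_id)
  have b: "\<bar>W T (X w T)\<bar> \<le> C * ((1 + mass w T) ^ 1 * (1 + mass w T) ^ 0)" for w using C(2) T by simp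
  have uT: "T \<in> {t..T}" using t by simp
  show ?thesis by (rule P_bound(1)[OF uT uT C(1) measurable_functional_P[OF c] b])
qed

lemma HJB_path:
  assumes HJB: "\<And>u \<nu>. u \<in> {0..<T} ==> Wt u \<nu> + (\<integral>x. I u x \<nu> \<partial>meas \<nu>) \<ge> 0" and tT: "t < T"
  shows "AE w in P. 0 \<le> (\<integral>z. IX (w, z) \<partial>m w) + (\<integral>u. indicator {t<..<T} u * Wt u (X w u) \<partial>L)"
  using IX_path Wt_path(1)
proof eventually_elim
  case (elim w)
  then have "(\<integral>z. IX (w, z) \<partial>m w) + (\<integral>u. indicator {t<..<T} u * Wt u (X w u) \<partial>L)
    = (\<integral>u. indicator {t<..<T} u * (\<integral>x. I u x (X w u) \<partial>meas (X w u)) + indicator {t<..<T} u * Wt u (X w u) \<partial>L)"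
    by simp
  also have "0 \<le> \<dots>"
    using HJB t by (intro Bochner_Integration.integral_nonneg) (auto simp: indicator_def add.commute)
  finally show ?case .
qed

theorem W_le_cost:
  assumes HJB: "\<And>u \<nu>. u \<in> {0..<T} ==> Wt u \<nu> + (\<integral>x. I u x \<nu> \<partial>meas \<nu>) \<ge> 0"
    and terminal: "\<And>\<nu>. W T \<nu> \<le> g \<nu>"
  shows "W t (\<xi> t) \<le> cost T A f g t P"
proof -
  have gW: "(\<integral>w. W T (X w T) \<partial>P) \<le> (\<integral>w. g (X w T) \<partial>P)"
    by (intro integral_mono W_T_integrable g_integrable terminal)
  show ?thesis
  proof (cases "t < T")
    case True
    have "(\<integral>p. IX p \<partial>Q) \<le> (\<integral>p. HX p \<partial>Q)"
    proof (rule integral_mono_AE[OF IX_integrable HX_integrable])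
      have "AE p in Q. snd (snd (snd p)) \<in> A"
      proof (rule AE_Q)
        show "{p \<in> space PB. snd (snd (snd p)) \<notin> A} \<in> sets PB" by measurable
        show "AE w in P. AE p in m w. snd (snd (snd (w, p))) \<in> A"
        proof (rule AE_I2)
          fix w assume "w \<in> space P"
          from m_AE_carrier[OF this] show "AE p in m w. snd (snd (snd (w, p))) \<in> A" by eventually_elim auto
        qed
      qed
      then show "AE p in Q. IX p \<le> HX p"
        by eventually_elim (use I_le t in \<open>auto simp: indicator_def\<close>)
    qed
    moreover have "0 \<le> (\<integral>w. (\<integral>z. IX (w, z) \<partial>m w) + (\<integral>u. indicator {t<..<T} u * Wt u (X w u) \<partial>L) \<partial>P)"
      by (rule integral_nonneg_AE[OF HJB_path[OF HJB True]])
    ultimately show ?thesis using cost_dynkin[OF True] gW by linarith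
  next
    case False
    \<comment> \<open>\<open>dynkin_W\<close> requires \<open>t < T\<close>. At \<open>t = T\<close>
      no running cost is left and the initial condition fixes the terminal state.\<close>
    then have tT: "t = T" using t by simp
    have "AE w in P. W T (X w T) = W T (\<xi> T)" using X_initial unfolding tT by eventually_elim simp
    then have "(\<integral>w. W T (X w T) \<partial>P) = (\<integral>w. W T (\<xi> T) \<partial>P)"
      using W_T_integrable by (intro integral_cong_AE) auto
    then have "W T (\<xi> T) = (\<integral>w. W T (X w T) \<partial>P)" using prob_space by simp
    moreover have "cost T A f g t P = (\<integral>w. g (X w T) \<partial>P)" unfolding cost_eq using tT by (simp add: split_beta')
    ultimately show ?thesis using gW tT by simp
  qed
qed

text \<open>All three terms of \<open>cost_dynkin\<close> vanish: the control measure is carried by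
  the graph of the minimising control, the relation holds with equality, and the terminal values
  agree.\<close>

theorem W_eq_cost:
  assumes HJB: "\<And>u \<nu>. u \<in> {0..<T} ==> Wt u \<nu> + (\<integral>x. I u x \<nu> \<partial>meas \<nu>) = 0"
    and terminal: "\<And>\<nu>. W T \<nu> = g \<nu>"
    and \<alpha>A: "\<And>u \<nu> x. u \<in> {0..T} ==> \<alpha> u \<nu> x \<in> A"
    and \<alpha>: "\<And>u \<nu> x. u \<in> {0..<T} ==> H u x \<nu> (\<alpha> u \<nu> x) = I u x \<nu>"
    and c: "AE w in P. controlled_by T (fst w) (snd w) (\<lambda>u x. \<alpha> u (fst w u) x)"
  shows "cost T A f g t P = W t (\<xi> t)"
proof (cases "t < T")
  case True
  have "(\<integral>p. HX p \<partial>Q) = (\<integral>p. IX p \<partial>Q)"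
  proof (rule integral_cong_AE)
    show "AE p in Q. HX p = IX p"
    proof (rule AE_Q)
      show B: "{p \<in> space PB. HX p \<noteq> IX p} \<in> sets PB"
        by (rule borel_measurable_neq[OF HX_measurable IX_measurable])
      show "AE w in P. AE z in m w. HX (w, z) = IX (w, z)"
        using AE_space c
      proof eventually_elim
        case (elim w)
        \<comment> \<open>The measure of \<open>B\<close> is computed on the graph of the control,
          where bracket and infimum coincide before \<open>T\<close>; off the open time interval
          both sides are zero.\<close>
        define B where "B = {z. HX (w, z) \<noteq> IX (w, z)}"
        have "B = Pair w -` {p \<in> space PB. HX p \<noteq> IX p}" using elim(1) by (auto simp: B_def space_pair_measure)
        then have Bs: "B \<in> sets borel" using sets_Pair1[OF B] by simp
        have "emeasure (m w) B = (\<integral>\<^sup>+s\<in>{0..T}. (\<integral>\<^sup>+x. indicator B (s, x, \<alpha> s (fst w s) x) \<partial>meas (fst w s)) \<partial>lborel)"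
          using elim(2) Bs unfolding controlled_by_def m_def by blast
        also have "\<dots> = (\<integral>\<^sup>+s. 0 \<partial>(lborel :: real measure))"
        proof (rule nn_integral_cong)
          fix s :: real
          have "(s, x, \<alpha> s (fst w s) x) \<notin> B" if s: "s \<in> {0..T}" for x
          proof (cases "s \<in> {t<..<T}")
            case True
            then have "s \<in> {0..<T}" using t by auto
            then show ?thesis using \<alpha>[of s x "fst w s"] \<alpha>A[OF s] X_eq[OF s, of w] by (simp add: B_def)
          qed (simp add: B_def)
          then show "(\<integral>\<^sup>+x. indicator B (s, x, \<alpha> s (fst w s) x) \<partial>meas (fst w s)) * indicator {0..T} s = 0"
            by (cases "s \<in> {0..T}") auto
        qed
        finally have "emeasure (m w) B = 0" by simp
        with Bs have "AE z in m w. z \<notin> B" by (intro AE_not_in) (simp add: null_sets_def)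
        then show ?case
        proof eventually_elim
          case (elim z)
          then show ?case unfolding B_def by blast
        qed
      qed
    qed
  qed (use HX_integrable IX_integrable in auto)
  moreover have "(\<integral>w. (\<integral>z. IX (w, z) \<partial>m w) + (\<integral>u. indicator {t<..<T} u * Wt u (X w u) \<partial>L) \<partial>P) = (\<integral>w. 0 \<partial>P)"
  proof (rule integral_cong_AE)
    show "(\<lambda>w. (\<integral>z. IX (w, z) \<partial>m w) + (\<integral>u. indicator {t<..<T} u * Wt u (X w u) \<partial>L)) \<in> borel_measurable P"
      using integral_Q(1)[OF IX_integrable] Wt_path(2) by simp
    show "AE w in P. (\<integral>z. IX (w, z) \<partial>m w) + (\<integral>u. indicator {t<..<T} u * Wt u (X w u) \<partial>L) = 0"
      using IX_path Wt_path(1)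
    proof eventually_elim
      case (elim w)
      then have "(\<integral>z. IX (w, z) \<partial>m w) + (\<integral>u. indicator {t<..<T} u * Wt u (X w u) \<partial>L)
        = (\<integral>u. indicator {t<..<T} u * (\<integral>x. I u x (X w u) \<partial>meas (X w u)) + indicator {t<..<T} u * Wt u (X w u) \<partial>L)"
        by simp
      also have "\<dots> = (\<integral>u. 0 \<partial>L)"
        by (rule Bochner_Integration.integral_cong[OF refl]) (use HJB t in \<open>auto simp: indicator_def add.commute\<close>)
      finally show ?case by simp
    qed
  qed simp
  ultimately show ?thesis using cost_dynkin[OF True] by (simp add: terminal)
next
  case False
  then have tT: "t = T" using t by simp
  have "AE w in P. W T (X w T) = W T (\<xi> T)" using X_initial unfolding tT by eventually_elim simp
  then have "(\<integral>w. W T (X w T) \<partial>P) = (\<integral>w. W T (\<xi> T) \<partial>P)"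
    using W_T_integrable by (intro integral_cong_AE) auto
  then have "W T (\<xi> T) = (\<integral>w. g (X w T) \<partial>P)" using prob_space by (simp add: terminal)
  moreover have "cost T A f g t P = (\<integral>w. g (X w T) \<partial>P)" unfolding cost_eq using tT by (simp add: split_beta')
  ultimately show ?thesis using tT by simp
qed

end

text \<open>If the projection on the time axis is Lebesgue measure, the mass is one at almost every time. So in this
  case not every finite measure is the initial state of a control rule.\<close>

lemma (in ctrl_rule) leb_initial_mass:
  assumes MM': "MM = leb_control_measures T A" and t0: "t = 0"
  shows "tmass (\<xi> 0) \<le> 1"
proof (rule ccontr)
  assume big: "\<not> tmass (\<xi> 0) \<le> 1"
  \<comment> \<open>The midpoint between 1 and the initial mass. By right continuity the mass
    exceeds it for some time, and then the time marginal exceeds Lebesgue measure there.\<close>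
  define c where "c = (1 + tmass (\<xi> 0)) / 2"
  have c: "1 < c" "c < tmass (\<xi> 0)" using big by (auto simp: c_def)
  have "AE w in P. good w \<and> X w 0 = \<xi> 0" using AE_good X_initial unfolding t0 by eventually_elim simp
  then obtain w where w: "good w" "X w 0 = \<xi> 0" using AE_False eventually_mono by blast
  then have sp: "w \<in> space P" by (simp add: good_def)
  have "(X w \<longlongrightarrow> X w 0) (at_right 0)" by (rule X_right_continuous[OF sp]) (use T in simp)
  then have "((\<lambda>u. mass w u) \<longlongrightarrow> mass w 0) (at_right 0)" unfolding tendsto_finmeas_iff by simp
  then have "\<forall>\<^sub>F u in at_right 0. c < mass w u" using c w(2) by (intro order_tendstoD) auto
  then obtain d' where d': "d' > 0" "\<And>u. 0 < u ==> u < d' ==> c < mass w u" by (auto simp: eventually_at_right_field)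
  define d where "d = min d' T"
  have d: "0 < d" "d \<le> T" "\<And>u. 0 < u ==> u < d ==> c < mass w u" using d' T by (auto simp: d_def)
  let ?k = "\<lambda>p. indicator ({0<..<d} \<times> UNIV) p :: ennreal"
  have k: "?k \<in> borel_measurable (borel :: (real \<times> real) measure)" unfolding borel_prod[symmetric] by measurable
  have L: "emeasure L {0<..<d} = ennreal d"
  proof -
    have "emeasure L {0<..<d} = (\<integral>\<^sup>+u. indicator {0<..<d} u \<partial>L)" by simp
    also have "\<dots> = (\<integral>\<^sup>+u. indicator {0<..<d} u * indicator {0..T} u \<partial>lborel)" by (rule nn_integral_L) simp
    also have "\<dots> = (\<integral>\<^sup>+u. indicator {0<..<d} u \<partial>lborel)" by (rule nn_integral_cong) (use d in \<open>simp add: indicator_def\<close>)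
    finally show ?thesis using d by simp
  qed
  have "snd w \<in> leb_control_measures T A" using sp MM' by (auto simp: space_P canonical_space_def)
  then have proj: "distr (m w) borel fst = L" by (simp add: leb_control_measures_def m_def L_def)
  have "fst \<in> borel_measurable (borel :: (real \<times> real \<times> real) measure)" unfolding borel_prod[symmetric] by measurable
  then have fm: "fst \<in> borel_measurable (m w)" by (simp cong: measurable_cong_sets)
  have "ennreal d = (\<integral>\<^sup>+u. indicator {0<..<d} u \<partial>distr (m w) borel fst)" unfolding proj using L by simp
  also have "\<dots> = (\<integral>\<^sup>+p. indicator {0<..<d} (fst p) \<partial>m w)" by (rule nn_integral_distr[OF fm]) simp
  also have "\<dots> = (\<integral>\<^sup>+(u, x, a). ?k (u, x) \<partial>m w)" by (rule nn_integral_cong) (auto simp: indicator_def)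
  also have "\<dots> = (\<integral>\<^sup>+u. (\<integral>\<^sup>+x. ?k (u, x) \<partial>meas (X w u)) \<partial>L)" by (rule good_nn_integral[OF w(1) k])
  also have "\<dots> \<ge> (\<integral>\<^sup>+u. ennreal c * indicator {0<..<d} u \<partial>L)"
  proof (rule nn_integral_mono)
    fix u
    show "ennreal c * indicator {0<..<d} u \<le> (\<integral>\<^sup>+x. ?k (u, x) \<partial>meas (X w u))"
    proof (cases "u \<in> {0<..<d}")
      case True
      interpret finite_measure "meas (X w u)" by (rule finite_measure_meas)
      have "(\<integral>\<^sup>+x. ?k (u, x) \<partial>meas (X w u)) = (\<integral>\<^sup>+x. 1 \<partial>meas (X w u))" using True by (intro nn_integral_cong) simp
      also have "\<dots> = ennreal (mass w u)" by (simp add: pairing_one emeasure_eq_measure)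
      finally show ?thesis using True d(3)[of u] by (auto intro!: ennreal_leI)
    qed simp
  qed
  also have "(\<integral>\<^sup>+u. ennreal c * indicator {0<..<d} u \<partial>L) = ennreal (c * d)"
    using L c d by (simp add: nn_integral_cmult ennreal_mult)
  finally show False using c d by (simp add: ennreal_le_iff)
qed

theorem theorem4p4:
  fixes T :: real and A :: "real set" and \<phi> :: "nat \<Rightarrow> real \<Rightarrow> real"
    and b \<sigma> \<gamma> f :: coeff and g :: "real finmeas \<Rightarrow> real"
    and MM :: "(real \<times> real \<times> real) finmeas set"
    and rep :: "real \<Rightarrow> real finmeas \<Rightarrow> real \<Rightarrow> real finmeas"
    and W W\<^sub>t :: "real \<Rightarrow> real finmeas \<Rightarrow> real"
    and W\<^sub>1 :: "real \<Rightarrow> real finmeas \<Rightarrow> real \<Rightarrow> real"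
    and W\<^sub>2 :: "real \<Rightarrow> real finmeas \<Rightarrow> real \<Rightarrow> real \<Rightarrow> real"
  defines "H \<equiv> hjb_term b \<sigma> \<gamma> f W\<^sub>1 W\<^sub>2"
    and "\<P> \<equiv> control_rules T A MM b \<sigma> \<gamma>"
    and "J \<equiv> cost T A f g"
    and "V \<equiv> value_fun T A MM b \<sigma> \<gamma> f g"
  assumes T: "0 < T" and A: "compact A"
    and \<phi>: "test_sequence \<phi>"
    and b: "admissible_coeff A \<phi> b" and \<sigma>: "admissible_coeff A \<phi> \<sigma>"
    and \<gamma>: "admissible_coeff A \<phi> \<gamma>" and \<gamma>_nonneg: "\<forall>x \<nu>. \<forall>a\<in>A. 0 \<le> \<gamma> x \<nu> a"
    and f: "continuous_on (UNIV \<times> UNIV \<times> A) (\<lambda>(x, \<nu>, a). f x \<nu> a)"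
    and g: "continuous_on UNIV g"
    and growth: "\<exists>C>0. \<exists>p>0. (\<forall>x \<nu>. \<forall>a\<in>A. \<bar>f x \<nu> a\<bar> \<le> C * (1 + weak_dist \<phi> \<nu> 0 powr p)) \<and>
                              (\<forall>\<nu>. \<bar>g \<nu>\<bar> \<le> C * (1 + weak_dist \<phi> \<nu> 0 powr p))"
    and MM: "MM = leb_control_measures T A \<or> MM = control_measures T A"
    \<comment> \<open>\<open>V t (rep t \<nu>)\<close> is the value at the measure \<open>\<nu>\<close>, for an arbitrary choice of paths through \<open>\<nu>\<close> at time \<open>t\<close>\<close>
    and rep: "\<forall>t\<in>{0..T}. \<forall>\<nu>. rep t \<nu> \<in> cadlag_paths T \<and> rep t \<nu> t = \<nu>"
    and W: "Cb_1_22 T W W\<^sub>t W\<^sub>1 W\<^sub>2" "continuous_on ({0..T} \<times> UNIV) (\<lambda>(t, \<nu>). W t \<nu>)"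
    and HJB: "\<forall>u\<in>{0..<T}. \<forall>\<nu>. W\<^sub>t u \<nu> + (\<integral>x. (INF a\<in>A. H u x \<nu> a) \<partial>meas \<nu>) \<ge> 0"
    and terminal: "\<forall>\<nu>. W T \<nu> \<le> g \<nu>"
  shows
    "(\<forall>t\<in>{0..T}. \<forall>\<nu>. ereal (W t \<nu>) \<le> V t (rep t \<nu>)) \<and>
     (\<forall>\<alpha> :: real \<Rightarrow> real finmeas \<Rightarrow> real \<Rightarrow> real.
        (\<forall>\<nu>. W T \<nu> = g \<nu>) \<and>
        (\<lambda>(u, \<nu>, x). \<alpha> u \<nu> x)
          \<in> restrict_space borel {0..T} \<Otimes>\<^sub>M borel \<Otimes>\<^sub>M borel \<rightarrow>\<^sub>M restrict_space borel A \<and>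
        (\<forall>u\<in>{0..<T}. \<forall>\<nu> x. H u x \<nu> (\<alpha> u \<nu> x) = (INF a\<in>A. H u x \<nu> a)) \<and>
        (MM = leb_control_measures T A \<or>
         (\<forall>u\<in>{0..<T}. \<forall>\<nu>. W\<^sub>t u \<nu> + (\<integral>x. (INF a\<in>A. H u x \<nu> a) \<partial>meas \<nu>) = 0)) \<and>
        (\<forall>t\<in>{0..T}. \<forall>\<nu>. \<exists>P\<in>\<P> t (rep t \<nu>).
           AE (\<mu>, m) in P. controlled_by T \<mu> m (\<lambda>u x. \<alpha> u (\<mu> u) x)) \<longrightarrow>
        (\<forall>t\<in>{0..T}. \<forall>\<nu>. ereal (W t \<nu>) = V t (rep t \<nu>)) \<and>
        (\<forall>t\<in>{0..T}. \<forall>\<nu>. \<forall>P\<in>\<P> t (rep t \<nu>).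
           (AE (\<mu>, m) in P. controlled_by T \<mu> m (\<lambda>u x. \<alpha> u (\<mu> u) x)) \<longrightarrow>
           ereal (J t P) = V t (rep t \<nu>)))"
proof -
  have verif: "verification T A \<phi> b \<sigma> \<gamma> MM t (rep t \<nu>) P W W\<^sub>t W\<^sub>1 W\<^sub>2 f g" if "t \<in> {0..T}" "P \<in> \<P> t (rep t \<nu>)" for t \<nu> P
    by unfold_locales (use that T A \<phi> b \<sigma> \<gamma> MM W f g growth in \<open>auto simp: \<P>_def\<close>)
  have le: "W t \<nu> \<le> J t P" if tP: "t \<in> {0..T}" "P \<in> \<P> t (rep t \<nu>)" for t \<nu> P
  proof -
    interpret v: verification T A \<phi> b \<sigma> \<gamma> MM t "rep t \<nu>" P W W\<^sub>t W\<^sub>1 W\<^sub>2 f g by (rule verif[OF tP])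
    have "0 \<le> W\<^sub>t u \<nu> + (\<integral>x. v.I u x \<nu> \<partial>meas \<nu>)" if "u \<in> {0..<T}" for u \<nu>
      using HJB that unfolding H_def v.H_eq v.I_def by blast
    from v.W_le_cost[OF this] terminal have "W t (rep t \<nu> t) \<le> J t P" by (simp add: J_def)
    then show ?thesis using rep tP(1) by simp
  qed
  \<comment> \<open>The value lies in \<open>ereal\<close>, so where no control rule starts the
    infimum is infinite and the inequality is trivial.\<close>
  have W_le_V: "ereal (W t \<nu>) \<le> V t (rep t \<nu>)" if t: "t \<in> {0..T}" for t \<nu>
    unfolding V_def value_fun_def using le[OF t] by (intro INF_greatest) (auto simp: \<P>_def J_def)
  have eq: "ereal (W t \<nu>) = V t (rep t \<nu>)" "ereal (J t P) = V t (rep t \<nu>)"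
    if \<alpha>: "\<forall>\<nu>. W T \<nu> = g \<nu>"
      "(\<lambda>(u, \<nu>, x). \<alpha> u \<nu> x) \<in> restrict_space borel {0..T} \<Otimes>\<^sub>M borel \<Otimes>\<^sub>M borel \<rightarrow>\<^sub>M restrict_space borel A"
      "\<forall>u\<in>{0..<T}. \<forall>\<nu> x. H u x \<nu> (\<alpha> u \<nu> x) = (INF a\<in>A. H u x \<nu> a)"
      "MM = leb_control_measures T A \<or> (\<forall>u\<in>{0..<T}. \<forall>\<nu>. W\<^sub>t u \<nu> + (\<integral>x. (INF a\<in>A. H u x \<nu> a) \<partial>meas \<nu>) = 0)"
      "\<forall>t\<in>{0..T}. \<forall>\<nu>. \<exists>P\<in>\<P> t (rep t \<nu>). AE (\<mu>, m) in P. controlled_by T \<mu> m (\<lambda>u x. \<alpha> u (\<mu> u) x)"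
    and tP: "t \<in> {0..T}" "P \<in> \<P> t (rep t \<nu>)"
    and c: "AE (\<mu>, m) in P. controlled_by T \<mu> m (\<lambda>u x. \<alpha> u (\<mu> u) x)" for \<alpha> t \<nu> P
  proof -
    \<comment> \<open>Under Lebesgue projections an initial measure of mass two admits no control
      rule at time zero, which contradicts the assumed existence for every measure. So the
      alternative with equality is the one that holds.\<close>
    have MM': "MM \<noteq> leb_control_measures T A"
    proof
      assume leb: "MM = leb_control_measures T A"
      define \<nu>' :: "real finmeas" where "\<nu>' = atoms {0 :: nat} (\<lambda>_. 0) (\<lambda>_. 2)"
      have m2: "pairing (\<lambda>_. 1) \<nu>' = 2" unfolding \<nu>'_def by (subst pairing_atoms) auto
      have 0: "(0 :: real) \<in> {0..T}" using T by simp
      obtain P' where P': "P' \<in> \<P> 0 (rep 0 \<nu>')" using \<alpha>(5) 0 by blast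
      interpret v: verification T A \<phi> b \<sigma> \<gamma> MM 0 "rep 0 \<nu>'" P' W W\<^sub>t W\<^sub>1 W\<^sub>2 f g by (rule verif[OF 0 P'])
      have "pairing (\<lambda>_. 1) (rep 0 \<nu>' 0) \<le> 1" by (rule v.leb_initial_mass[OF leb refl])
      then show False using rep 0 m2 by simp
    qed
    interpret v: verification T A \<phi> b \<sigma> \<gamma> MM t "rep t \<nu>" P W W\<^sub>t W\<^sub>1 W\<^sub>2 f g by (rule verif[OF tP])
    have "cost T A f g t P = W t (rep t \<nu> t)"
    proof (rule v.W_eq_cost)
      show "W\<^sub>t u \<nu> + (\<integral>x. v.I u x \<nu> \<partial>meas \<nu>) = 0" if "u \<in> {0..<T}" for u \<nu>
        using \<alpha>(4) MM' that unfolding H_def v.H_eq v.I_def by blast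
      show "\<alpha> u \<nu> x \<in> A" if "u \<in> {0..T}" for u \<nu> x
        using measurable_space[OF \<alpha>(2), of "(u, \<nu>, x)"] that by (simp add: space_pair_measure space_restrict_space)
      show "v.H u x \<nu> (\<alpha> u \<nu> x) = v.I u x \<nu>" if "u \<in> {0..<T}" for u \<nu> x
        using \<alpha>(3) that unfolding H_def v.H_eq v.I_def by blast
      show "AE \<omega> in P. controlled_by T (fst \<omega>) (snd \<omega>) (\<lambda>u x. \<alpha> u (fst \<omega> u) x)" using c by (simp add: split_beta')
    qed (use \<alpha>(1) in simp)
    then have JW: "J t P = W t \<nu>" using rep tP(1) by (simp add: J_def)
    have "V t (rep t \<nu>) \<le> ereal (J t P)"
      unfolding V_def value_fun_def J_def using tP(2) by (intro INF_lower) (simp add: \<P>_def)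
    then show "ereal (W t \<nu>) = V t (rep t \<nu>)" "ereal (J t P) = V t (rep t \<nu>)"
      using W_le_V[OF tP(1), of \<nu>] JW by auto
  qed
  show ?thesis
  proof (intro conjI allI impI ballI)
    show "ereal (W t \<nu>) \<le> V t (rep t \<nu>)" if "t \<in> {0..T}" for t \<nu> by (rule W_le_V[OF that])
  qed (use eq in blast)+
qed

end
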